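(* Let $\mathcal T_1,\dots,\mathcal T_m$ be small triangulated categories and $\mathcal P$ a Picard groupoid. The notions of multi-determinant functor $\mathcal T_1\times\dots\times\mathcal T_m\to\mathcal P$ and of cubical multi-determinant functor $C^{\le2}(\mathrm{isom}(\mathcal T_1),\dots,\mathrm{isom}(\mathcal T_m))\to C^{\le2}(\mathcal P)$ are equivalent: every multi-determinant functor $d$ (as the level $0$ part, with its additivity data giving the level $1$ part) induces a cubical multi-determinant functor, and conversely, for every cubical multi-determinant functor $D$, the level $0$ part $D^0$, with additivity data given by the level $1$ part of $D$, is a multi-determinant functor.
   Context: **Picard groupoids.** A Picard groupoid is a groupoid $\mathcal P$ with a symmetric monoidal structure $(+,0)$ (not assumed strict) such that $x+(-)$ is an equivalence for every object $x$; $\mathrm{coas}\colon(a+b)+(c+d)\to(a+c)+(b+d)$ is the canonical isomorphism. **Multi-determinant functors.** $\mathrm{isom}(\mathcal T)$ is the category of isomorphisms of $\mathcal T$, $\Sigma$ the translation. A *determinant functor* $[-]\colon\mathcal T\to\mathcal P$ is a functor $\mathrm{isom}(\mathcal T)\to\mathcal P$ with, for each distinguished triangle $\Delta\colon x\to y\to z\to\Sigma x$, a morphism (additivity datum) $[\Delta]\colon[z]+[x]\to[y]$, natural for isomorphisms of distinguished triangles, such that: for the split triangles $\Delta_1\colon x\to x\oplus y\to y\to\Sigma x$, $\Delta_2\colon y\to x\oplus y\to x\to\Sigma y$, $[\Delta_2]$ equals $[\Delta_1]$ precomposed with the symmetry $[x]+[y]\to[y]+[x]$; and for every octahedron with triangles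 $\Delta_1\colon x\to y\to z'\to\Sigma x$, $\Delta_2\colon x\to z\to y'\to\Sigma x$, $\Delta_3\colon y\to z\to x'\to\Sigma y$, $\Delta_4\colon z'\to y'\to x'\to\Sigma z'$, $[\Delta_2]\circ([\Delta_4]+\mathrm{id})=[\Delta_3]\circ(\mathrm{id}+[\Delta_1])\circ\mathrm{assoc}$ on $([x']+[z'])+[x]$. A *multi-determinant functor* $D\colon\mathcal T_1\times\dots\times\mathcal T_m\to\mathcal P$ is an $m$-functor $\mathrm{isom}(\mathcal T_1)\times\dots\times\mathrm{isom}(\mathcal T_m)\to\mathcal P$ that is a determinant functor in each variable and satisfies, for distinct $i,j$ (other variables suppressed): (Two Triangles, $i<j$) for distinguished triangles $\Delta_k\colon x_k\to y_k\to z_k\to\Sigma x_k$ in $\mathcal T_k$, $k=i,j$, $D(y_i,\Delta_j)\circ(D(\Delta_i,z_j)+D(\Delta_i,x_j))=D(\Delta_i,y_j)\circ(D(z_i,\Delta_j)+D(x_i,\Delta_j))\circ\mathrm{coas}$; (Triangle-Function) for $f_i\colon a_i\to b_i$ in $\mathrm{isom}(\mathcal T_i)$, $D(f_i,y_j)\circ D(a_i,\Delta_j)=D(b_i,\Delta_j)\circ(D(f_i,z_j)+D(f_i,x_j))$. **Cubes in $\mathcal P$.** An $n$-cube $S$ in $\mathcal P$ consists of objects $S(a_1,\dots,a_n)$, $a_k\in\{-1,0,1\}$, and isomorphisms $f_i\colon S(\dots,1,\dots)+S(\dots,-1,\dots)\to S(\dots,0,\dots)$ (entries in position $i$), $i=1,\dots,n$,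 for all values of the other coordinates, such that for $i<j$ (displaying coordinates $i,j$) $f_j(0)\circ(f_i(1)+f_i(-1))=f_i(0)\circ(f_j(1)+f_j(-1))\circ\mathrm{coas}$ on $(S(1,1)+S(-1,1))+(S(1,-1)+S(-1,-1))$, where $f_i(b)$ is $f_i$ at $a_j=b$ and $f_j(b)$ is $f_j$ at $a_i=b$. Morphisms are families of morphisms of $\mathcal P$ compatible with the structure isomorphisms; this gives a groupoid $C^n(\mathcal P)$, with $C^0(\mathcal P)=\mathcal P$. **Cubes in a triangulated category.** $C^0(\mathrm{isom}\,\mathcal T)=\mathrm{isom}(\mathcal T)$; a 1-cube is a distinguished triangle $x\to y\to z\to\Sigma x$ ($x,y,z$ in positions $-1,0,1$); a 2-cube is a $3\times3$ diagram with rows the distinguished triangles $x'\xrightarrow{f'}y'\xrightarrow{g'}z'\xrightarrow{h'}\Sigma x'$, $x\xrightarrow{f}y\xrightarrow{g}z\xrightarrow{h}\Sigma x$, $x''\xrightarrow{f''}y''\xrightarrow{g''}z''\xrightarrow{h''}\Sigma x''$ and columns the distinguished triangles $x'\xrightarrow{p'}x\xrightarrow{p}x''\xrightarrow{p''}\Sigma x'$, $y'\xrightarrow{q'}y\xrightarrow{q}y''\xrightarrow{q''}\Sigma y'$, $z'\xrightarrow{r'}z\xrightarrow{r}z''\xrightarrow{r''}\Sigma z'$ (all squares commuting, except the square $z''\to\Sigma^2x'$, which anticommutes), equipped with a *Verdier structure*: an object $A$ and octahedra (1) on $x'\xrightarrow{p'}x\xrightarrow{f}y$ with triangles $(p',p,p'')$,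 $(f,g,h)$, $x'\xrightarrow{fp'}y\xrightarrow{\alpha}A\xrightarrow{v}\Sigma x'$, $x''\xrightarrow{\epsilon}A\xrightarrow{\eta}z\xrightarrow{\zeta}\Sigma x''$; (2) on $x'\xrightarrow{f'}y'\xrightarrow{q'}y$ with triangles $(f',g',h')$, $(q',q,q'')$, $x'\xrightarrow{q'f'}y\xrightarrow{\alpha}A\xrightarrow{u}\Sigma x'$, $z'\xrightarrow{\beta}A\xrightarrow{\gamma}y''\xrightarrow{\delta}\Sigma z'$; (3) on $x''\xrightarrow{\epsilon}A\xrightarrow{\gamma}y''$, $\gamma\epsilon=f''$, with triangles $(\epsilon,\eta,\zeta)$, $(f'',g'',h'')$, $A\xrightarrow{\gamma}y''\xrightarrow{\delta}\Sigma z'\xrightarrow{-\Sigma\beta}\Sigma A$, $z\xrightarrow{r}z''\xrightarrow{r''}\Sigma z'\xrightarrow{-\Sigma r'}\Sigma z$. Morphisms of cubes are object-wise isomorphisms. **Cubical complexes.** Face functors $\partial^\alpha_j\colon C^n\to C^{n-1}$ ($\alpha\in\{-1,0,1\}$, $1\le j\le n$) restrict a cube to the part with $j$-th coordinate $\alpha$ (for triangulated cubes: the vertices of a triangle; the rows and columns of a $3\times 3$ diagram). Degeneracy functors $s^j_\alpha\colon C^n\to C^{n+1}$ ($\alpha=\pm1$) send $S$ to the cube equal to $S$ (with the $j$-th coordinate deleted) where $a_j\ne\alpha$ and to $0$ where $a_j=\alpha$, with unit isomorphisms (resp. identity maps) in direction $j$; e.g. $x\mapsto(0\to x=x\to 0)$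 or $(x=x\to0\to\Sigma x)$. Define $C^n(\mathrm{isom}\,\mathcal T_1,\dots,\mathrm{isom}\,\mathcal T_m)=\coprod_{n_1+\dots+n_m=n,\ n_i\ge0}C^{n_1}(\mathrm{isom}\,\mathcal T_1)\times\dots\times C^{n_m}(\mathrm{isom}\,\mathcal T_m)$ for $n\le2$, with induced faces and degeneracies. A *cubical multi-determinant functor* is a family $D$ of functors $D^n\colon C^n(\mathrm{isom}\,\mathcal T_1,\dots,\mathrm{isom}\,\mathcal T_m)\to C^n(\mathcal P)$, $n=0,1,2$, mapping $n$-cubes to $n$-cubes and respecting the face and degeneracy maps (degeneracies up to the canonical isomorphisms $D(\dots,0,\dots)\cong0$).
   Formalization: In a Verdier structure the third maps v and u of the triangle x'→y→A→Σx' in octahedra (1) and (2) are taken to be equal; with u and v independent, a multi-determinant functor need not induce a cubical one (e.g. for determinants of vector spaces). *)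

theory Defs
  imports "HOL-Algebra.Group"
begin

section \<open>Small categories\<close>

record ('o, 'a) cat =
  Ob :: "'o set"
  Ar :: "'a set"
  Dom :: "'a \<Rightarrow> 'o"
  Cod :: "'a \<Rightarrow> 'o"
  Idt :: "'o \<Rightarrow> 'a"
  Cmp :: "'a \<Rightarrow> 'a \<Rightarrow> 'a" (infixr "\<cdot>\<index>" 75)

definition Hom :: "('o, 'a, 'z) cat_scheme \<Rightarrow> 'o \<Rightarrow> 'o \<Rightarrow> 'a set" where
  "Hom C x y = {f \<in> Ar C. Dom C f = x \<and> Cod C f = y}"

definition category :: "('o, 'a, 'z) cat_scheme \<Rightarrow> bool" where
  "category C \<longleftrightarrow>
     (\<forall>f\<in>Ar C. Dom C f \<in> Ob C \<and> Cod C f \<in> Ob C) \<and>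
     (\<forall>x\<in>Ob C. Idt C x \<in> Hom C x x) \<and>
     (\<forall>x y z. \<forall>f\<in>Hom C x y. \<forall>g\<in>Hom C y z. g \<cdot>\<^bsub>C\<^esub> f \<in> Hom C x z) \<and>
     (\<forall>x y. \<forall>f\<in>Hom C x y. f \<cdot>\<^bsub>C\<^esub> Idt C x = f \<and> Idt C y \<cdot>\<^bsub>C\<^esub> f = f) \<and>
     (\<forall>w x y z. \<forall>f\<in>Hom C w x. \<forall>g\<in>Hom C x y. \<forall>h\<in>Hom C y z.
        (h \<cdot>\<^bsub>C\<^esub> g) \<cdot>\<^bsub>C\<^esub> f = h \<cdot>\<^bsub>C\<^esub> (g \<cdot>\<^bsub>C\<^esub> f))"

definition isos :: "('o, 'a, 'z) cat_scheme \<Rightarrow> 'a set" where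
  "isos C = {f \<in> Ar C. \<exists>g\<in>Hom C (Cod C f) (Dom C f).
     g \<cdot>\<^bsub>C\<^esub> f = Idt C (Dom C f) \<and> f \<cdot>\<^bsub>C\<^esub> g = Idt C (Cod C f)}"

definition groupoid :: "('o, 'a, 'z) cat_scheme \<Rightarrow> bool" where
  "groupoid C \<longleftrightarrow> category C \<and> isos C = Ar C"

definition isom :: "('o, 'a, 'z) cat_scheme \<Rightarrow> ('o, 'a) cat" where
  "isom C = \<lparr>Ob = Ob C, Ar = isos C, Dom = Dom C, Cod = Cod C, Idt = Idt C, Cmp = Cmp C\<rparr>"

definition prod_cat :: "'i set \<Rightarrow> ('i \<Rightarrow> ('o, 'a, 'z) cat_scheme) \<Rightarrow> ('i \<Rightarrow> 'o, 'i \<Rightarrow> 'a) cat" where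
  "prod_cat I C = \<lparr>Ob = (\<Pi>\<^sub>E k\<in>I. Ob (C k)), Ar = (\<Pi>\<^sub>E k\<in>I. Ar (C k)),
     Dom = (\<lambda>f. \<lambda>k\<in>I. Dom (C k) (f k)), Cod = (\<lambda>f. \<lambda>k\<in>I. Cod (C k) (f k)),
     Idt = (\<lambda>x. \<lambda>k\<in>I. Idt (C k) (x k)), Cmp = (\<lambda>g f. \<lambda>k\<in>I. g k \<cdot>\<^bsub>C k\<^esub> f k)\<rparr>"

record ('o, 'a, 'p, 'q) func =
  on_ob :: "'o \<Rightarrow> 'p"
  on_ar :: "'a \<Rightarrow> 'q"

definition is_functor ::
  "('o, 'a, 'y) cat_scheme \<Rightarrow> ('p, 'q, 'z) cat_scheme \<Rightarrow> ('o, 'a, 'p, 'q, 'w) func_scheme \<Rightarrow> bool" where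
  "is_functor C D F \<longleftrightarrow>
     on_ob F \<in> Ob C \<rightarrow> Ob D \<and>
     (\<forall>f\<in>Ar C. on_ar F f \<in> Hom D (on_ob F (Dom C f)) (on_ob F (Cod C f))) \<and>
     (\<forall>x\<in>Ob C. on_ar F (Idt C x) = Idt D (on_ob F x)) \<and>
     (\<forall>f\<in>Ar C. \<forall>g\<in>Ar C. Cod C f = Dom C g \<longrightarrow>
        on_ar F (g \<cdot>\<^bsub>C\<^esub> f) = on_ar F g \<cdot>\<^bsub>D\<^esub> on_ar F f)"

definition extensional_functor ::
  "('o, 'a, 'y) cat_scheme \<Rightarrow> ('o, 'a, 'p, 'q, 'w) func_scheme \<Rightarrow> bool" where
  "extensional_functor C F \<longleftrightarrow> on_ob F \<in> extensional (Ob C) \<and> on_ar F \<in> extensional (Ar C)"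

definition natural_iso ::
  "('o, 'a, 'y) cat_scheme \<Rightarrow> ('p, 'q, 'z) cat_scheme \<Rightarrow>
   ('o, 'a, 'p, 'q) func \<Rightarrow> ('o, 'a, 'p, 'q) func \<Rightarrow> ('o \<Rightarrow> 'q) \<Rightarrow> bool" where
  "natural_iso C D F G \<eta> \<longleftrightarrow>
     (\<forall>x\<in>Ob C. \<eta> x \<in> Hom D (on_ob F x) (on_ob G x) \<inter> isos D) \<and>
     (\<forall>f\<in>Ar C. \<eta> (Cod C f) \<cdot>\<^bsub>D\<^esub> on_ar F f = on_ar G f \<cdot>\<^bsub>D\<^esub> \<eta> (Dom C f))"

definition id_func :: "('o, 'a, 'o, 'a) func" where
  "id_func = \<lparr>on_ob = (\<lambda>x. x), on_ar = (\<lambda>f. f)\<rparr>"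

definition comp_func ::
  "('p, 'q, 'r, 's) func \<Rightarrow> ('o, 'a, 'p, 'q) func \<Rightarrow> ('o, 'a, 'r, 's) func" where
  "comp_func G F = \<lparr>on_ob = on_ob G \<circ> on_ob F, on_ar = on_ar G \<circ> on_ar F\<rparr>"

definition equivalence ::
  "('o, 'a, 'y) cat_scheme \<Rightarrow> ('p, 'q, 'z) cat_scheme \<Rightarrow> ('o, 'a, 'p, 'q) func \<Rightarrow> bool" where
  "equivalence C D F \<longleftrightarrow> is_functor C D F \<and>
     (\<exists>G \<eta> \<epsilon>. is_functor D C G \<and> natural_iso C C id_func (comp_func G F) \<eta> \<and>
        natural_iso D D (comp_func F G) id_func \<epsilon>)"


section \<open>Picard groupoids\<close>

record ('o, 'a) symcat = "('o, 'a) cat" +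
  padd :: "'o \<Rightarrow> 'o \<Rightarrow> 'o" (infixl "\<boxplus>\<index>" 65)
  padda :: "'a \<Rightarrow> 'a \<Rightarrow> 'a" (infixl "\<oplus>\<index>" 65)
  punit :: 'o
  assoc :: "'o \<Rightarrow> 'o \<Rightarrow> 'o \<Rightarrow> 'a"
  lunit :: "'o \<Rightarrow> 'a"
  runit :: "'o \<Rightarrow> 'a"
  symm :: "'o \<Rightarrow> 'o \<Rightarrow> 'a"

definition symmetric_monoidal :: "('o, 'a, 'z) symcat_scheme \<Rightarrow> bool" where
  "symmetric_monoidal P \<longleftrightarrow> category P \<and>
     \<comment> \<open>the sum is a bifunctor\<close>
     (\<forall>a\<in>Ob P. \<forall>b\<in>Ob P. a \<boxplus>\<^bsub>P\<^esub> b \<in> Ob P) \<and> punit P \<in> Ob P \<and>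
     (\<forall>f\<in>Ar P. \<forall>g\<in>Ar P. f \<oplus>\<^bsub>P\<^esub> g \<in> Hom P (Dom P f \<boxplus>\<^bsub>P\<^esub> Dom P g) (Cod P f \<boxplus>\<^bsub>P\<^esub> Cod P g)) \<and>
     (\<forall>a\<in>Ob P. \<forall>b\<in>Ob P. Idt P a \<oplus>\<^bsub>P\<^esub> Idt P b = Idt P (a \<boxplus>\<^bsub>P\<^esub> b)) \<and>
     (\<forall>f\<in>Ar P. \<forall>f'\<in>Ar P. \<forall>g\<in>Ar P. \<forall>g'\<in>Ar P. Cod P f = Dom P f' \<and> Cod P g = Dom P g' \<longrightarrow>
        (f' \<cdot>\<^bsub>P\<^esub> f) \<oplus>\<^bsub>P\<^esub> (g' \<cdot>\<^bsub>P\<^esub> g) = (f' \<oplus>\<^bsub>P\<^esub> g') \<cdot>\<^bsub>P\<^esub> (f \<oplus>\<^bsub>P\<^esub> g)) \<and>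
     \<comment> \<open>natural isomorphisms\<close>
     (\<forall>a\<in>Ob P. \<forall>b\<in>Ob P. \<forall>c\<in>Ob P.
        assoc P a b c \<in> Hom P ((a \<boxplus>\<^bsub>P\<^esub> b) \<boxplus>\<^bsub>P\<^esub> c) (a \<boxplus>\<^bsub>P\<^esub> (b \<boxplus>\<^bsub>P\<^esub> c)) \<inter> isos P) \<and>
     (\<forall>a\<in>Ob P. lunit P a \<in> Hom P (punit P \<boxplus>\<^bsub>P\<^esub> a) a \<inter> isos P) \<and>
     (\<forall>a\<in>Ob P. runit P a \<in> Hom P (a \<boxplus>\<^bsub>P\<^esub> punit P) a \<inter> isos P) \<and>
     (\<forall>a\<in>Ob P. \<forall>b\<in>Ob P. symm P a b \<in> Hom P (a \<boxplus>\<^bsub>P\<^esub> b) (b \<boxplus>\<^bsub>P\<^esub> a) \<inter> isos P) \<and>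
     (\<forall>f\<in>Ar P. \<forall>g\<in>Ar P. \<forall>h\<in>Ar P.
        assoc P (Cod P f) (Cod P g) (Cod P h) \<cdot>\<^bsub>P\<^esub> ((f \<oplus>\<^bsub>P\<^esub> g) \<oplus>\<^bsub>P\<^esub> h) =
        (f \<oplus>\<^bsub>P\<^esub> (g \<oplus>\<^bsub>P\<^esub> h)) \<cdot>\<^bsub>P\<^esub> assoc P (Dom P f) (Dom P g) (Dom P h)) \<and>
     (\<forall>f\<in>Ar P. lunit P (Cod P f) \<cdot>\<^bsub>P\<^esub> (Idt P (punit P) \<oplus>\<^bsub>P\<^esub> f) = f \<cdot>\<^bsub>P\<^esub> lunit P (Dom P f)) \<and>
     (\<forall>f\<in>Ar P. runit P (Cod P f) \<cdot>\<^bsub>P\<^esub> (f \<oplus>\<^bsub>P\<^esub> Idt P (punit P)) = f \<cdot>\<^bsub>P\<^esub> runit P (Dom P f)) \<and>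
     (\<forall>f\<in>Ar P. \<forall>g\<in>Ar P. symm P (Cod P f) (Cod P g) \<cdot>\<^bsub>P\<^esub> (f \<oplus>\<^bsub>P\<^esub> g) =
        (g \<oplus>\<^bsub>P\<^esub> f) \<cdot>\<^bsub>P\<^esub> symm P (Dom P f) (Dom P g)) \<and>
     \<comment> \<open>pentagon, triangle, hexagon, symmetry\<close>
     (\<forall>a\<in>Ob P. \<forall>b\<in>Ob P. \<forall>c\<in>Ob P. \<forall>d\<in>Ob P.
        assoc P a b (c \<boxplus>\<^bsub>P\<^esub> d) \<cdot>\<^bsub>P\<^esub> assoc P (a \<boxplus>\<^bsub>P\<^esub> b) c d =
        (Idt P a \<oplus>\<^bsub>P\<^esub> assoc P b c d) \<cdot>\<^bsub>P\<^esub> assoc P a (b \<boxplus>\<^bsub>P\<^esub> c) d \<cdot>\<^bsub>P\<^esub>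
          (assoc P a b c \<oplus>\<^bsub>P\<^esub> Idt P d)) \<and>
     (\<forall>a\<in>Ob P. \<forall>b\<in>Ob P.
        (Idt P a \<oplus>\<^bsub>P\<^esub> lunit P b) \<cdot>\<^bsub>P\<^esub> assoc P a (punit P) b = runit P a \<oplus>\<^bsub>P\<^esub> Idt P b) \<and>
     (\<forall>a\<in>Ob P. \<forall>b\<in>Ob P. \<forall>c\<in>Ob P.
        assoc P b c a \<cdot>\<^bsub>P\<^esub> symm P a (b \<boxplus>\<^bsub>P\<^esub> c) \<cdot>\<^bsub>P\<^esub> assoc P a b c =
        (Idt P b \<oplus>\<^bsub>P\<^esub> symm P a c) \<cdot>\<^bsub>P\<^esub> assoc P b a c \<cdot>\<^bsub>P\<^esub> (symm P a b \<oplus>\<^bsub>P\<^esub> Idt P c)) \<and>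
     (\<forall>a\<in>Ob P. \<forall>b\<in>Ob P. symm P b a \<cdot>\<^bsub>P\<^esub> symm P a b = Idt P (a \<boxplus>\<^bsub>P\<^esub> b))"

definition picard_groupoid :: "('o, 'a, 'z) symcat_scheme \<Rightarrow> bool" where
  "picard_groupoid P \<longleftrightarrow> groupoid P \<and> symmetric_monoidal P \<and>
     (\<forall>x\<in>Ob P. equivalence P P
        \<lparr>on_ob = (\<lambda>y. x \<boxplus>\<^bsub>P\<^esub> y), on_ar = (\<lambda>f. Idt P x \<oplus>\<^bsub>P\<^esub> f)\<rparr>)"

definition inv_assoc :: "('o, 'a, 'z) symcat_scheme \<Rightarrow> 'o \<Rightarrow> 'o \<Rightarrow> 'o \<Rightarrow> 'a" where
  "inv_assoc P a b c = (THE f. f \<in> Hom P (a \<boxplus>\<^bsub>P\<^esub> (b \<boxplus>\<^bsub>P\<^esub> c)) ((a \<boxplus>\<^bsub>P\<^esub> b) \<boxplus>\<^bsub>P\<^esub> c) \<and>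
     f \<cdot>\<^bsub>P\<^esub> assoc P a b c = Idt P ((a \<boxplus>\<^bsub>P\<^esub> b) \<boxplus>\<^bsub>P\<^esub> c))"

text \<open>The canonical isomorphism \<open>(a + b) + (c + d) \<rightarrow> (a + c) + (b + d)\<close>; by coherence any
  composite of associativities and the symmetry of \<open>b\<close> and \<open>c\<close> gives the same morphism.\<close>

definition coas :: "('o, 'a, 'z) symcat_scheme \<Rightarrow> 'o \<Rightarrow> 'o \<Rightarrow> 'o \<Rightarrow> 'o \<Rightarrow> 'a" where
  "coas P a b c d =
     inv_assoc P a c (b \<boxplus>\<^bsub>P\<^esub> d) \<cdot>\<^bsub>P\<^esub>
     (Idt P a \<oplus>\<^bsub>P\<^esub> (assoc P c b d \<cdot>\<^bsub>P\<^esub> (symm P b c \<oplus>\<^bsub>P\<^esub> Idt P d) \<cdot>\<^bsub>P\<^esub> inv_assoc P b c d)) \<cdot>\<^bsub>P\<^esub>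
     assoc P a b (c \<boxplus>\<^bsub>P\<^esub> d)"


section \<open>Triangulated categories\<close>

text \<open>A triangle \<open>x \<rightarrow> y \<rightarrow> z \<rightarrow> \<Sigma>x\<close> is the triple of its three morphisms.\<close>

type_synonym 'a tri = "'a \<times> 'a \<times> 'a"

text \<open>\<open>zob\<close> is the chosen zero object, \<open>mzero x y\<close> the zero morphism from \<open>x\<close> to \<open>y\<close>,
  \<open>(sho, sha)\<close> the translation and \<open>distg\<close> the class of distinguished triangles.\<close>

record ('o, 'a) tricat = "('o, 'a) cat" +
  zob :: 'o
  madd :: "'a \<Rightarrow> 'a \<Rightarrow> 'a"
  mzero :: "'o \<Rightarrow> 'o \<Rightarrow> 'a"
  sho :: "'o \<Rightarrow> 'o"
  sha :: "'a \<Rightarrow> 'a"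
  distg :: "'a tri set"

definition hom_group :: "('o, 'a, 'z) tricat_scheme \<Rightarrow> 'o \<Rightarrow> 'o \<Rightarrow> 'a monoid" where
  "hom_group T x y = \<lparr>carrier = Hom T x y, monoid.mult = madd T, one = mzero T x y\<rparr>"

definition mneg :: "('o, 'a, 'z) tricat_scheme \<Rightarrow> 'a \<Rightarrow> 'a" where
  "mneg T f = inv\<^bsub>hom_group T (Dom T f) (Cod T f)\<^esub> f"

definition zero_object :: "('o, 'a, 'z) cat_scheme \<Rightarrow> 'o \<Rightarrow> bool" where
  "zero_object C z \<longleftrightarrow> z \<in> Ob C \<and>
     (\<forall>x\<in>Ob C. (\<exists>!f. f \<in> Hom C x z) \<and> (\<exists>!f. f \<in> Hom C z x))"

definition biproduct ::
  "('o, 'a, 'z) tricat_scheme \<Rightarrow> 'o \<Rightarrow> 'o \<Rightarrow> 'o \<Rightarrow> 'a \<Rightarrow> 'a \<Rightarrow> 'a \<Rightarrow> 'a \<Rightarrow> bool" where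
  "biproduct T x y b i1 i2 p1 p2 \<longleftrightarrow> b \<in> Ob T \<and>
     i1 \<in> Hom T x b \<and> i2 \<in> Hom T y b \<and> p1 \<in> Hom T b x \<and> p2 \<in> Hom T b y \<and>
     p1 \<cdot>\<^bsub>T\<^esub> i1 = Idt T x \<and> p2 \<cdot>\<^bsub>T\<^esub> i2 = Idt T y \<and>
     p1 \<cdot>\<^bsub>T\<^esub> i2 = mzero T y x \<and> p2 \<cdot>\<^bsub>T\<^esub> i1 = mzero T x y \<and>
     madd T (i1 \<cdot>\<^bsub>T\<^esub> p1) (i2 \<cdot>\<^bsub>T\<^esub> p2) = Idt T b"

definition additive_category :: "('o, 'a, 'z) tricat_scheme \<Rightarrow> bool" where
  "additive_category T \<longleftrightarrow> category T \<and> zero_object T (zob T) \<and>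
     (\<forall>x\<in>Ob T. \<forall>y\<in>Ob T. comm_group (hom_group T x y)) \<and>
     (\<forall>x y z. \<forall>f\<in>Hom T x y. \<forall>f'\<in>Hom T x y. \<forall>g\<in>Hom T y z. \<forall>g'\<in>Hom T y z.
        g \<cdot>\<^bsub>T\<^esub> madd T f f' = madd T (g \<cdot>\<^bsub>T\<^esub> f) (g \<cdot>\<^bsub>T\<^esub> f') \<and>
        madd T g g' \<cdot>\<^bsub>T\<^esub> f = madd T (g \<cdot>\<^bsub>T\<^esub> f) (g' \<cdot>\<^bsub>T\<^esub> f)) \<and>
     (\<forall>x\<in>Ob T. \<forall>y\<in>Ob T. \<exists>b i1 i2 p1 p2. biproduct T x y b i1 i2 p1 p2)"

fun triangle :: "('o, 'a, 'z) tricat_scheme \<Rightarrow> 'a tri \<Rightarrow> bool" where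
  "triangle T (f, g, h) \<longleftrightarrow> f \<in> Ar T \<and> g \<in> Hom T (Cod T f) (Dom T h) \<and>
     h \<in> Hom T (Cod T g) (sho T (Dom T f))"

fun tri_mor :: "('o, 'a, 'z) tricat_scheme \<Rightarrow> 'a tri \<Rightarrow> 'a tri \<Rightarrow> 'a \<Rightarrow> 'a \<Rightarrow> 'a \<Rightarrow> bool" where
  "tri_mor T (f, g, h) (f', g', h') u v w \<longleftrightarrow>
     u \<in> Hom T (Dom T f) (Dom T f') \<and> v \<in> Hom T (Cod T f) (Cod T f') \<and>
     w \<in> Hom T (Cod T g) (Cod T g') \<and>
     v \<cdot>\<^bsub>T\<^esub> f = f' \<cdot>\<^bsub>T\<^esub> u \<and> w \<cdot>\<^bsub>T\<^esub> g = g' \<cdot>\<^bsub>T\<^esub> v \<and> sha T u \<cdot>\<^bsub>T\<^esub> h = h' \<cdot>\<^bsub>T\<^esub> w"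

text \<open>An octahedron on \<open>x \<rightarrow>\<^sub>f y \<rightarrow>\<^sub>g z\<close> with distinguished triangles
  \<open>x \<rightarrow> y \<rightarrow> z' \<rightarrow> \<Sigma>x\<close>, \<open>x \<rightarrow> z \<rightarrow> y' \<rightarrow> \<Sigma>x\<close>, \<open>y \<rightarrow> z \<rightarrow> x' \<rightarrow> \<Sigma>y\<close> and \<open>z' \<rightarrow> y' \<rightarrow> x' \<rightarrow> \<Sigma>z'\<close>.\<close>

fun octahedron ::
  "('o, 'a, 'z) tricat_scheme \<Rightarrow> 'a tri \<Rightarrow> 'a tri \<Rightarrow> 'a tri \<Rightarrow> 'a tri \<Rightarrow> bool" where
  "octahedron T (f, a, a') (gf, b, b') (g, c, c') (d, e, e') \<longleftrightarrow>
     {(f, a, a'), (gf, b, b'), (g, c, c'), (d, e, e')} \<subseteq> distg T \<and>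
     Cod T f = Dom T g \<and> Dom T d = Cod T a \<and> Cod T d = Cod T b \<and> Cod T e = Cod T c \<and>
     gf = g \<cdot>\<^bsub>T\<^esub> f \<and>
     d \<cdot>\<^bsub>T\<^esub> a = b \<cdot>\<^bsub>T\<^esub> g \<and> b' \<cdot>\<^bsub>T\<^esub> d = a' \<and> e \<cdot>\<^bsub>T\<^esub> b = c \<and>
     c' \<cdot>\<^bsub>T\<^esub> e = sha T f \<cdot>\<^bsub>T\<^esub> b' \<and> e' = sha T a \<cdot>\<^bsub>T\<^esub> c'"

definition triangulated :: "('o, 'a, 'z) tricat_scheme \<Rightarrow> bool" where
  "triangulated T \<longleftrightarrow> additive_category T \<and>
     \<comment> \<open>the translation is an additive autoequivalence\<close>
     equivalence T T \<lparr>on_ob = sho T, on_ar = sha T\<rparr> \<and>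
     (\<forall>x y. \<forall>f\<in>Hom T x y. \<forall>g\<in>Hom T x y. sha T (madd T f g) = madd T (sha T f) (sha T g)) \<and>
     (\<forall>t\<in>distg T. triangle T t) \<and>
     \<comment> \<open>TR1\<close>
     (\<forall>t\<in>distg T. \<forall>t' u v w. triangle T t' \<and> tri_mor T t t' u v w \<and> {u, v, w} \<subseteq> isos T \<longrightarrow>
        t' \<in> distg T) \<and>
     (\<forall>x\<in>Ob T. (Idt T x, mzero T x (zob T), mzero T (zob T) (sho T x)) \<in> distg T) \<and>
     (\<forall>f\<in>Ar T. \<exists>g h. (f, g, h) \<in> distg T) \<and>
     \<comment> \<open>TR2\<close>
     (\<forall>f g h. triangle T (f, g, h) \<longrightarrow>
        ((f, g, h) \<in> distg T \<longleftrightarrow> (g, h, mneg T (sha T f)) \<in> distg T)) \<and>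
     \<comment> \<open>TR3\<close>
     (\<forall>f g h f' g' h' u v. (f, g, h) \<in> distg T \<and> (f', g', h') \<in> distg T \<and>
        u \<in> Hom T (Dom T f) (Dom T f') \<and> v \<in> Hom T (Cod T f) (Cod T f') \<and>
        v \<cdot>\<^bsub>T\<^esub> f = f' \<cdot>\<^bsub>T\<^esub> u \<longrightarrow>
        (\<exists>w. tri_mor T (f, g, h) (f', g', h') u v w)) \<and>
     \<comment> \<open>TR4\<close>
     (\<forall>f a a' g c c' b b'. (f, a, a') \<in> distg T \<and> (g, c, c') \<in> distg T \<and> Cod T f = Dom T g \<and>
        (g \<cdot>\<^bsub>T\<^esub> f, b, b') \<in> distg T \<longrightarrow>
        (\<exists>d e e'. octahedron T (f, a, a') (g \<cdot>\<^bsub>T\<^esub> f, b, b') (g, c, c') (d, e, e')))"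


section \<open>Multi-determinant functors\<close>

definition determinant_functor ::
  "('o, 'a, 'y) tricat_scheme \<Rightarrow> ('p, 'q, 'z) symcat_scheme \<Rightarrow> ('o, 'a, 'p, 'q) func \<Rightarrow>
   ('a tri \<Rightarrow> 'q) \<Rightarrow> bool" where
  "determinant_functor T P F ad \<longleftrightarrow>
     is_functor (isom T) P F \<and>
     (\<forall>f g h. (f, g, h) \<in> distg T \<longrightarrow>
        ad (f, g, h) \<in> Hom P (on_ob F (Cod T g) \<boxplus>\<^bsub>P\<^esub> on_ob F (Dom T f)) (on_ob F (Cod T f))) \<and>
     (\<forall>t\<in>distg T. \<forall>t'\<in>distg T. \<forall>u v w. tri_mor T t t' u v w \<and> {u, v, w} \<subseteq> isos T \<longrightarrow>
        on_ar F v \<cdot>\<^bsub>P\<^esub> ad t = ad t' \<cdot>\<^bsub>P\<^esub> (on_ar F w \<oplus>\<^bsub>P\<^esub> on_ar F u)) \<and>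
     (\<forall>x\<in>Ob T. \<forall>y\<in>Ob T. \<forall>b i1 i2 p1 p2. biproduct T x y b i1 i2 p1 p2 \<longrightarrow>
        ad (i2, p1, mzero T x (sho T y)) =
        ad (i1, p2, mzero T y (sho T x)) \<cdot>\<^bsub>P\<^esub> symm P (on_ob F x) (on_ob F y)) \<and>
     (\<forall>f a a' gf b b' g c c' d e e'.
        octahedron T (f, a, a') (gf, b, b') (g, c, c') (d, e, e') \<longrightarrow>
        ad (gf, b, b') \<cdot>\<^bsub>P\<^esub> (ad (d, e, e') \<oplus>\<^bsub>P\<^esub> Idt P (on_ob F (Dom T f))) =
        ad (g, c, c') \<cdot>\<^bsub>P\<^esub> (Idt P (on_ob F (Cod T c)) \<oplus>\<^bsub>P\<^esub> ad (f, a, a')) \<cdot>\<^bsub>P\<^esub>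
          assoc P (on_ob F (Cod T c)) (on_ob F (Cod T a)) (on_ob F (Dom T f)))"

text \<open>The variables are numbered \<open>0, \<dots>, m - 1\<close>. \<open>m_add D (i, x, \<Delta>)\<close> is the additivity datum
  for the triangle \<open>\<Delta>\<close> in variable \<open>i\<close>, the objects in the other variables being given by
  \<open>x\<close>, a family indexed by the variables distinct from \<open>i\<close>.\<close>

record ('o, 'a, 'p, 'q) mdf = "(nat \<Rightarrow> 'o, nat \<Rightarrow> 'a, 'p, 'q) func" +
  m_add :: "nat \<times> (nat \<Rightarrow> 'o) \<times> 'a tri \<Rightarrow> 'q"

definition isom_prod :: "(nat \<Rightarrow> ('o, 'a) tricat) \<Rightarrow> nat \<Rightarrow> (nat \<Rightarrow> 'o, nat \<Rightarrow> 'a) cat" where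
  "isom_prod T m = prod_cat {..<m} (\<lambda>k. isom (T k))"

definition others :: "(nat \<Rightarrow> ('o, 'a) tricat) \<Rightarrow> nat \<Rightarrow> nat set \<Rightarrow> (nat \<Rightarrow> 'o) set" where
  "others T m J = (\<Pi>\<^sub>E k\<in>{..<m} - J. Ob (T k))"

definition others_id ::
  "(nat \<Rightarrow> ('o, 'a) tricat) \<Rightarrow> nat \<Rightarrow> nat set \<Rightarrow> (nat \<Rightarrow> 'o) \<Rightarrow> nat \<Rightarrow> 'a" where
  "others_id T m J x = (\<lambda>k\<in>{..<m} - J. Idt (T k) (x k))"

definition add_dom :: "(nat \<Rightarrow> ('o, 'a) tricat) \<Rightarrow> nat \<Rightarrow> (nat \<times> (nat \<Rightarrow> 'o) \<times> 'a tri) set" where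
  "add_dom T m = {(i, x, t). i < m \<and> x \<in> others T m {i} \<and> t \<in> distg (T i)}"

definition multi_determinant ::
  "(nat \<Rightarrow> ('o, 'a) tricat) \<Rightarrow> nat \<Rightarrow> ('p, 'q) symcat \<Rightarrow> ('o, 'a, 'p, 'q) mdf \<Rightarrow> bool" where
  "multi_determinant T m P D \<longleftrightarrow>
     extensional_functor (isom_prod T m) D \<and> m_add D \<in> extensional (add_dom T m) \<and>
     is_functor (isom_prod T m) P D \<and>
     (\<forall>i<m. \<forall>x\<in>others T m {i}.
        determinant_functor (T i) P
          \<lparr>on_ob = (\<lambda>a. on_ob D (x(i := a))), on_ar = (\<lambda>f. on_ar D ((others_id T m {i} x)(i := f)))\<rparr>
          (\<lambda>t. m_add D (i, x, t))) \<and>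
     \<comment> \<open>Two Triangles\<close>
     (\<forall>i j. i < j \<and> j < m \<longrightarrow> (\<forall>x\<in>others T m {i, j}.
        \<forall>f g h f' g' h'. (f, g, h) \<in> distg (T i) \<and> (f', g', h') \<in> distg (T j) \<longrightarrow>
        (let xi = Dom (T i) f; yi = Cod (T i) f; zi = Cod (T i) g;
             xj = Dom (T j) f'; yj = Cod (T j) f'; zj = Cod (T j) g';
             ob = (\<lambda>a b. on_ob D (x(i := a, j := b)));
             di = (\<lambda>b. m_add D (i, x(j := b), (f, g, h)));
             dj = (\<lambda>a. m_add D (j, x(i := a), (f', g', h')))
         in dj yi \<cdot>\<^bsub>P\<^esub> (di zj \<oplus>\<^bsub>P\<^esub> di xj) =
            di yj \<cdot>\<^bsub>P\<^esub> (dj zi \<oplus>\<^bsub>P\<^esub> dj xi) \<cdot>\<^bsub>P\<^esub>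
              coas P (ob zi zj) (ob xi zj) (ob zi xj) (ob xi xj)))) \<and>
     \<comment> \<open>Triangle-Function\<close>
     (\<forall>i<m. \<forall>j<m. i \<noteq> j \<longrightarrow> (\<forall>x\<in>others T m {i, j}.
        \<forall>f g h. \<forall>\<phi>\<in>isos (T i). (f, g, h) \<in> distg (T j) \<longrightarrow>
        (let ar = (\<lambda>b. on_ar D ((others_id T m {i, j} x)(i := \<phi>, j := Idt (T j) b)));
             dj = (\<lambda>a. m_add D (j, x(i := a), (f, g, h)))
         in ar (Cod (T j) f) \<cdot>\<^bsub>P\<^esub> dj (Dom (T i) \<phi>) =
            dj (Cod (T i) \<phi>) \<cdot>\<^bsub>P\<^esub> (ar (Cod (T j) g) \<oplus>\<^bsub>P\<^esub> ar (Dom (T j) f)))))"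


section \<open>Coordinates\<close>

text \<open>The directions of an \<open>n\<close>-cube are numbered \<open>0, \<dots>, n - 1\<close>; a position is a list of \<open>n\<close>
  coordinates in \<open>{-1, 0, 1}\<close>.\<close>

definition coords :: "nat \<Rightarrow> int list set" where
  "coords n = {a. length a = n \<and> set a \<subseteq> {-1, 0, 1}}"

definition ins :: "nat \<Rightarrow> int \<Rightarrow> int list \<Rightarrow> int list" where
  "ins j \<alpha> a = take j a @ \<alpha> # drop j a"

definition del :: "nat \<Rightarrow> int list \<Rightarrow> int list" where
  "del j a = take j a @ drop (Suc j) a"

text \<open>A morphism of cubes: source, target and a component at each position.\<close>

datatype ('c, 'a) cmor = CMor (csrc: 'c) (ctgt: 'c) (cat_at: "int list \<Rightarrow> 'a")


section \<open>Cubes in a Picard groupoid\<close>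

text \<open>\<open>pe S (i, c)\<close> is the structure isomorphism in direction \<open>i\<close> where the coordinates other
  than the \<open>i\<close>-th one are given by \<open>c\<close>.\<close>

record ('p, 'q) pcube =
  pv :: "int list \<Rightarrow> 'p"
  pe :: "nat \<times> int list \<Rightarrow> 'q"

definition is_pcube :: "('p, 'q, 'z) symcat_scheme \<Rightarrow> nat \<Rightarrow> ('p, 'q) pcube \<Rightarrow> bool" where
  "is_pcube P n S \<longleftrightarrow>
     pv S \<in> coords n \<rightarrow>\<^sub>E Ob P \<and> pe S \<in> extensional ({..<n} \<times> coords (n - 1)) \<and>
     (\<forall>i<n. \<forall>c\<in>coords (n - 1).
        pe S (i, c) \<in> Hom P (pv S (ins i 1 c) \<boxplus>\<^bsub>P\<^esub> pv S (ins i (-1) c)) (pv S (ins i 0 c))) \<and>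
     (\<forall>i j. i < j \<and> j < n \<longrightarrow> (\<forall>c\<in>coords (n - 2).
        let s = (\<lambda>\<alpha> \<beta>. pv S (ins j \<beta> (ins i \<alpha> c)));
            fi = (\<lambda>\<beta>. pe S (i, ins (j - 1) \<beta> c));
            fj = (\<lambda>\<alpha>. pe S (j, ins i \<alpha> c))
        in fj 0 \<cdot>\<^bsub>P\<^esub> (fi 1 \<oplus>\<^bsub>P\<^esub> fi (-1)) =
           fi 0 \<cdot>\<^bsub>P\<^esub> (fj 1 \<oplus>\<^bsub>P\<^esub> fj (-1)) \<cdot>\<^bsub>P\<^esub>
             coas P (s 1 1) (s (-1) 1) (s 1 (-1)) (s (-1) (-1))))"

definition is_pcube_mor ::
  "('p, 'q, 'z) symcat_scheme \<Rightarrow> nat \<Rightarrow> (('p, 'q) pcube, 'q) cmor \<Rightarrow> bool" where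
  "is_pcube_mor P n F \<longleftrightarrow> is_pcube P n (csrc F) \<and> is_pcube P n (ctgt F) \<and>
     cat_at F \<in> extensional (coords n) \<and>
     (\<forall>a\<in>coords n. cat_at F a \<in> Hom P (pv (csrc F) a) (pv (ctgt F) a)) \<and>
     (\<forall>i<n. \<forall>c\<in>coords (n - 1).
        cat_at F (ins i 0 c) \<cdot>\<^bsub>P\<^esub> pe (csrc F) (i, c) =
        pe (ctgt F) (i, c) \<cdot>\<^bsub>P\<^esub> (cat_at F (ins i 1 c) \<oplus>\<^bsub>P\<^esub> cat_at F (ins i (-1) c)))"

definition pcubes ::
  "('p, 'q, 'z) symcat_scheme \<Rightarrow> nat \<Rightarrow> (('p, 'q) pcube, (('p, 'q) pcube, 'q) cmor) cat" where
  "pcubes P n = \<lparr>Ob = {S. is_pcube P n S}, Ar = {F. is_pcube_mor P n F}, Dom = csrc, Cod = ctgt,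
     Idt = (\<lambda>S. CMor S S (\<lambda>a\<in>coords n. Idt P (pv S a))),
     Cmp = (\<lambda>G F. CMor (csrc F) (ctgt G) (\<lambda>a\<in>coords n. cat_at G a \<cdot>\<^bsub>P\<^esub> cat_at F a))\<rparr>"

text \<open>The faces of an \<open>n\<close>-cube and its degeneracies, which are \<open>(n + 1)\<close>-cubes. In the complement
  of a direction \<open>i < j\<close> the coordinate number \<open>j\<close> has index \<open>j - 1\<close>.\<close>

definition pface :: "nat \<Rightarrow> int \<Rightarrow> nat \<Rightarrow> ('p, 'q) pcube \<Rightarrow> ('p, 'q) pcube" where
  "pface n \<alpha> j S = \<lparr>pv = (\<lambda>a\<in>coords (n - 1). pv S (ins j \<alpha> a)),
     pe = (\<lambda>(i, c)\<in>{..<n - 1} \<times> coords (n - 2).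
       if i < j then pe S (i, ins (j - 1) \<alpha> c) else pe S (Suc i, ins j \<alpha> c))\<rparr>"

definition pface_mor ::
  "nat \<Rightarrow> int \<Rightarrow> nat \<Rightarrow> (('p, 'q) pcube, 'q) cmor \<Rightarrow> (('p, 'q) pcube, 'q) cmor" where
  "pface_mor n \<alpha> j F = CMor (pface n \<alpha> j (csrc F)) (pface n \<alpha> j (ctgt F))
     (\<lambda>a\<in>coords (n - 1). cat_at F (ins j \<alpha> a))"

definition pdeg ::
  "('p, 'q, 'z) symcat_scheme \<Rightarrow> nat \<Rightarrow> int \<Rightarrow> nat \<Rightarrow> ('p, 'q) pcube \<Rightarrow> ('p, 'q) pcube" where
  "pdeg P n \<alpha> j S = \<lparr>pv = (\<lambda>a\<in>coords (n + 1). if a ! j = \<alpha> then punit P else pv S (del j a)),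
     pe = (\<lambda>(i, c)\<in>{..<n + 1} \<times> coords n.
       if i = j then (if \<alpha> = 1 then lunit P (pv S c) else runit P (pv S c))
       else if i < j then
         (if c ! (j - 1) = \<alpha> then lunit P (punit P) else pe S (i, del (j - 1) c))
       else (if c ! j = \<alpha> then lunit P (punit P) else pe S (i - 1, del j c)))\<rparr>"

definition pdeg_mor ::
  "('p, 'q, 'z) symcat_scheme \<Rightarrow> nat \<Rightarrow> int \<Rightarrow> nat \<Rightarrow>
   (('p, 'q) pcube, 'q) cmor \<Rightarrow> (('p, 'q) pcube, 'q) cmor" where
  "pdeg_mor P n \<alpha> j F = CMor (pdeg P n \<alpha> j (csrc F)) (pdeg P n \<alpha> j (ctgt F))
     (\<lambda>a\<in>coords (n + 1). if a ! j = \<alpha> then Idt P (punit P) else cat_at F (del j a))"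


section \<open>Cubes in a triangulated category\<close>

text \<open>A Verdier structure \<open>((\<alpha>, v), (\<epsilon>, \<eta>, \<zeta>), (\<beta>, \<gamma>, \<delta>))\<close>; the object \<open>A\<close> is the codomain of \<open>\<alpha>\<close>.\<close>

type_synonym 'a verdier = "('a \<times> 'a) \<times> 'a tri \<times> 'a tri"

text \<open>A square is given by its three rows and its three columns. The first coordinate of a
  position is the index of the row, the second one that of the column.\<close>

datatype ('o, 'a) tcube =
    Point 'o
  | Triangle "'a tri"
  | Square (rows: "'a tri \<times> 'a tri \<times> 'a tri") (columns: "'a tri \<times> 'a tri \<times> 'a tri") "'a verdier"

fun at :: "int \<Rightarrow> 'b \<times> 'b \<times> 'b \<Rightarrow> 'b" where
  "at \<alpha> (r, s, t) = (if \<alpha> = -1 then r else if \<alpha> = 0 then s else t)"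

fun vertex :: "('o, 'a, 'z) tricat_scheme \<Rightarrow> 'a tri \<Rightarrow> int \<Rightarrow> 'o" where
  "vertex T (f, g, h) \<alpha> = at \<alpha> (Dom T f, Cod T f, Cod T g)"

fun tdim :: "('o, 'a) tcube \<Rightarrow> nat" where
  "tdim (Point x) = 0"
| "tdim (Triangle t) = 1"
| "tdim (Square R K V) = 2"

fun diagram33 ::
  "('o, 'a, 'z) tricat_scheme \<Rightarrow> 'a tri \<times> 'a tri \<times> 'a tri \<Rightarrow> 'a tri \<times> 'a tri \<times> 'a tri \<Rightarrow> bool" where
  "diagram33 T ((f', g', h'), (f, g, h), (f'', g'', h'')) ((p', p, p''), (q', q, q''), (r', r, r'')) \<longleftrightarrow>
     {(f', g', h'), (f, g, h), (f'', g'', h''), (p', p, p''), (q', q, q''), (r', r, r'')} \<subseteq> distg T \<and>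
     Dom T p' = Dom T f' \<and> Cod T p' = Dom T f \<and> Cod T p = Dom T f'' \<and>
     Dom T q' = Cod T f' \<and> Cod T q' = Cod T f \<and> Cod T q = Cod T f'' \<and>
     Dom T r' = Cod T g' \<and> Cod T r' = Cod T g \<and> Cod T r = Cod T g'' \<and>
     q' \<cdot>\<^bsub>T\<^esub> f' = f \<cdot>\<^bsub>T\<^esub> p' \<and> r' \<cdot>\<^bsub>T\<^esub> g' = g \<cdot>\<^bsub>T\<^esub> q' \<and> sha T p' \<cdot>\<^bsub>T\<^esub> h' = h \<cdot>\<^bsub>T\<^esub> r' \<and>
     q \<cdot>\<^bsub>T\<^esub> f = f'' \<cdot>\<^bsub>T\<^esub> p \<and> r \<cdot>\<^bsub>T\<^esub> g = g'' \<cdot>\<^bsub>T\<^esub> q \<and> sha T p \<cdot>\<^bsub>T\<^esub> h = h'' \<cdot>\<^bsub>T\<^esub> r \<and>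
     q'' \<cdot>\<^bsub>T\<^esub> f'' = sha T f' \<cdot>\<^bsub>T\<^esub> p'' \<and> r'' \<cdot>\<^bsub>T\<^esub> g'' = sha T g' \<cdot>\<^bsub>T\<^esub> q'' \<and>
     sha T p'' \<cdot>\<^bsub>T\<^esub> h'' = mneg T (sha T h' \<cdot>\<^bsub>T\<^esub> r'')"

text \<open>The first two octahedra are both built on the composite \<open>x' \<rightarrow> y\<close> and share its
  distinguished triangle \<open>x' \<rightarrow> y \<rightarrow> A \<rightarrow> \<Sigma>x'\<close>, including the third morphism \<open>v\<close>. If that
  morphism could differ between the two octahedra, a square would not determine a cube in \<open>P\<close>:
  for every automorphism \<open>s\<close> of \<open>\<Sigma>X\<close>, the rows \<open>X = X \<rightarrow> 0\<close>, \<open>X \<rightarrow> 0 \<rightarrow> \<Sigma>X\<close>,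
  \<open>0 \<rightarrow> \<Sigma>X = \<Sigma>X\<close> and the columns \<open>X = X \<rightarrow> 0\<close>, \<open>X \<rightarrow> 0 \<rightarrow> \<Sigma>X\<close> (with third morphism \<open>s\<close>),
  \<open>0 \<rightarrow> \<Sigma>X = \<Sigma>X\<close> would form a square.\<close>

fun verdier_structure ::
  "('o, 'a, 'z) tricat_scheme \<Rightarrow> 'a tri \<times> 'a tri \<times> 'a tri \<Rightarrow> 'a tri \<times> 'a tri \<times> 'a tri \<Rightarrow>
   'a verdier \<Rightarrow> bool" where
  "verdier_structure T
     ((f', g', h'), (f, g, h), (f'', g'', h'')) ((p', p, p''), (q', q, q''), (r', r, r''))
     ((\<alpha>, v), (\<epsilon>, \<eta>, \<zeta>), (\<beta>, \<gamma>, \<delta>)) \<longleftrightarrow>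
     octahedron T (p', p, p'') (f \<cdot>\<^bsub>T\<^esub> p', \<alpha>, v) (f, g, h) (\<epsilon>, \<eta>, \<zeta>) \<and>
     octahedron T (f', g', h') (q' \<cdot>\<^bsub>T\<^esub> f', \<alpha>, v) (q', q, q'') (\<beta>, \<gamma>, \<delta>) \<and>
     \<gamma> \<cdot>\<^bsub>T\<^esub> \<epsilon> = f'' \<and>
     octahedron T (\<epsilon>, \<eta>, \<zeta>) (f'', g'', h'') (\<gamma>, \<delta>, mneg T (sha T \<beta>))
       (r, r'', mneg T (sha T r'))"

fun is_tcube :: "('o, 'a, 'z) tricat_scheme \<Rightarrow> ('o, 'a) tcube \<Rightarrow> bool" where
  "is_tcube T (Point x) \<longleftrightarrow> x \<in> Ob T"
| "is_tcube T (Triangle t) \<longleftrightarrow> t \<in> distg T"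
| "is_tcube T (Square R K V) \<longleftrightarrow> diagram33 T R K \<and> verdier_structure T R K V"

text \<open>\<open>tv T Q a\<close> is the object at position \<open>a\<close> and \<open>tedge Q j c\<close> the triangle in direction \<open>j\<close>
  where the remaining coordinates are given by \<open>c\<close>.\<close>

fun tv :: "('o, 'a, 'z) tricat_scheme \<Rightarrow> ('o, 'a) tcube \<Rightarrow> int list \<Rightarrow> 'o" where
  "tv T (Point x) a = x"
| "tv T (Triangle t) a = vertex T t (a ! 0)"
| "tv T (Square R K V) a = vertex T (at (a ! 0) R) (a ! 1)"

fun tedge :: "('o, 'a) tcube \<Rightarrow> nat \<Rightarrow> int list \<Rightarrow> 'a tri" where
  "tedge (Point x) j c = undefined"
| "tedge (Triangle t) j c = t"
| "tedge (Square R K V) j c = (if j = 0 then at (c ! 0) K else at (c ! 0) R)"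

text \<open>Morphisms are not required to preserve the Verdier structure.\<close>

definition is_tcube_mor ::
  "('o, 'a, 'z) tricat_scheme \<Rightarrow> nat \<Rightarrow> (('o, 'a) tcube, 'a) cmor \<Rightarrow> bool" where
  "is_tcube_mor T n F \<longleftrightarrow> is_tcube T (csrc F) \<and> is_tcube T (ctgt F) \<and>
     tdim (csrc F) = n \<and> tdim (ctgt F) = n \<and> cat_at F \<in> extensional (coords n) \<and>
     (\<forall>a\<in>coords n. cat_at F a \<in> Hom T (tv T (csrc F) a) (tv T (ctgt F) a) \<inter> isos T) \<and>
     (\<forall>j<n. \<forall>c\<in>coords (n - 1).
        tri_mor T (tedge (csrc F) j c) (tedge (ctgt F) j c)
          (cat_at F (ins j (-1) c)) (cat_at F (ins j 0 c)) (cat_at F (ins j 1 c)))"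

definition tcubes ::
  "('o, 'a, 'z) tricat_scheme \<Rightarrow> nat \<Rightarrow> (('o, 'a) tcube, (('o, 'a) tcube, 'a) cmor) cat" where
  "tcubes T n = \<lparr>Ob = {Q. is_tcube T Q \<and> tdim Q = n}, Ar = {F. is_tcube_mor T n F},
     Dom = csrc, Cod = ctgt,
     Idt = (\<lambda>Q. CMor Q Q (\<lambda>a\<in>coords (tdim Q). Idt T (tv T Q a))),
     Cmp = (\<lambda>G F. CMor (csrc F) (ctgt G)
       (\<lambda>a\<in>coords (tdim (csrc F)). cat_at G a \<cdot>\<^bsub>T\<^esub> cat_at F a))\<rparr>"

fun tface :: "int \<Rightarrow> nat \<Rightarrow> ('o, 'a, 'z) tricat_scheme \<Rightarrow> ('o, 'a) tcube \<Rightarrow> ('o, 'a) tcube" where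
  "tface \<alpha> j T (Point x) = undefined"
| "tface \<alpha> j T (Triangle t) = Point (vertex T t \<alpha>)"
| "tface \<alpha> j T (Square R K V) = Triangle (if j = 0 then at \<alpha> R else at \<alpha> K)"

definition tface_mor ::
  "int \<Rightarrow> nat \<Rightarrow> ('o, 'a, 'z) tricat_scheme \<Rightarrow>
   (('o, 'a) tcube, 'a) cmor \<Rightarrow> (('o, 'a) tcube, 'a) cmor" where
  "tface_mor \<alpha> j T F = CMor (tface \<alpha> j T (csrc F)) (tface \<alpha> j T (ctgt F))
     (\<lambda>a\<in>coords (tdim (csrc F) - 1). cat_at F (ins j \<alpha> a))"

text \<open>\<open>x = x \<rightarrow> 0 \<rightarrow> \<Sigma>x\<close> for \<open>\<alpha> = 1\<close> and \<open>0 \<rightarrow> x = x \<rightarrow> \<Sigma>0\<close> for \<open>\<alpha> = -1\<close>.\<close>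

definition deg_tri :: "int \<Rightarrow> ('o, 'a, 'z) tricat_scheme \<Rightarrow> 'o \<Rightarrow> 'a tri" where
  "deg_tri \<alpha> T x =
     (if \<alpha> = 1 then (Idt T x, mzero T x (zob T), mzero T (zob T) (sho T x))
      else (mzero T (zob T) x, Idt T x, mzero T x (sho T (zob T))))"

text \<open>A degenerate square carries the evident Verdier structure, in which \<open>A\<close> is \<open>z\<close> for
  \<open>\<alpha> = 1\<close> and \<open>y\<close> for \<open>\<alpha> = -1\<close>.\<close>

fun tdeg :: "int \<Rightarrow> nat \<Rightarrow> ('o, 'a, 'z) tricat_scheme \<Rightarrow> ('o, 'a) tcube \<Rightarrow> ('o, 'a) tcube" where
  "tdeg \<alpha> j T (Point x) = Triangle (deg_tri \<alpha> T x)"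
| "tdeg \<alpha> j T (Triangle (f, g, h)) =
    (let t = (f, g, h); x = Dom T f; y = Cod T f; z = Cod T g;
         null = deg_tri 1 T (zob T);
         parallel = (if \<alpha> = 1 then (t, t, null) else (null, t, t));
         transversal = (deg_tri \<alpha> T x, deg_tri \<alpha> T y, deg_tri \<alpha> T z);
         diagonal = (if \<alpha> = 1 then (g, h) else (Idt T y, mzero T y (sho T (zob T))))
     in if j = 0
        then Square parallel transversal
          (diagonal, if \<alpha> = 1 then deg_tri (-1) T z else t, deg_tri \<alpha> T (if \<alpha> = 1 then z else y))
        else Square transversal parallel
          (diagonal, deg_tri \<alpha> T (if \<alpha> = 1 then z else y), if \<alpha> = 1 then deg_tri (-1) T z else t))"
| "tdeg \<alpha> j T (Square R K V) = undefined"

definition tdeg_mor ::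
  "int \<Rightarrow> nat \<Rightarrow> ('o, 'a, 'z) tricat_scheme \<Rightarrow>
   (('o, 'a) tcube, 'a) cmor \<Rightarrow> (('o, 'a) tcube, 'a) cmor" where
  "tdeg_mor \<alpha> j T F = CMor (tdeg \<alpha> j T (csrc F)) (tdeg \<alpha> j T (ctgt F))
     (\<lambda>a\<in>coords (tdim (csrc F) + 1). if a ! j = \<alpha> then Idt T (zob T) else cat_at F (del j a))"


section \<open>Cubical multi-determinant functors\<close>

definition multi_cubes ::
  "(nat \<Rightarrow> ('o, 'a) tricat) \<Rightarrow> nat \<Rightarrow> nat \<Rightarrow>
   (nat \<Rightarrow> ('o, 'a) tcube, nat \<Rightarrow> (('o, 'a) tcube, 'a) cmor) cat" where
  "multi_cubes T m n =
     (let ds = {d \<in> {..<m} \<rightarrow>\<^sub>E {..n}. sum d {..<m} = n};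
          C = (\<lambda>d. prod_cat {..<m} (\<lambda>k. tcubes (T k) (d k)))
      in \<lparr>Ob = (\<Union>d\<in>ds. Ob (C d)), Ar = (\<Union>d\<in>ds. Ar (C d)),
          Dom = (\<lambda>F. \<lambda>k\<in>{..<m}. csrc (F k)), Cod = (\<lambda>F. \<lambda>k\<in>{..<m}. ctgt (F k)),
          Idt = (\<lambda>Q. \<lambda>k\<in>{..<m}. Idt (tcubes (T k) (tdim (Q k))) (Q k)),
          Cmp = (\<lambda>G F. \<lambda>k\<in>{..<m}. G k \<cdot>\<^bsub>tcubes (T k) (tdim (csrc (F k)))\<^esub> F k)\<rparr>)"

text \<open>Direction \<open>j\<close> of the \<open>k\<close>-th factor is direction \<open>offset Q k + j\<close> of \<open>Q\<close>.\<close>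

definition offset :: "(nat \<Rightarrow> ('o, 'a) tcube) \<Rightarrow> nat \<Rightarrow> nat" where
  "offset Q k = (\<Sum>l<k. tdim (Q l))"

definition multi_vertex ::
  "(nat \<Rightarrow> ('o, 'a) tricat) \<Rightarrow> nat \<Rightarrow> (nat \<Rightarrow> ('o, 'a) tcube) \<Rightarrow> int list \<Rightarrow> nat \<Rightarrow> 'o" where
  "multi_vertex T m Q a =
     (\<lambda>k\<in>{..<m}. tv (T k) (Q k) (take (tdim (Q k)) (drop (offset Q k) a)))"

type_synonym ('o, 'a, 'p, 'q) cmdf =
  "nat \<Rightarrow> (nat \<Rightarrow> ('o, 'a) tcube, nat \<Rightarrow> (('o, 'a) tcube, 'a) cmor,
     ('p, 'q) pcube, (('p, 'q) pcube, 'q) cmor) func"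

text \<open>The level 0 part of \<open>D\<close>, with additivity data given by the level 1 part.\<close>

definition level01 ::
  "(nat \<Rightarrow> ('o, 'a) tricat) \<Rightarrow> nat \<Rightarrow> ('o, 'a, 'p, 'q) cmdf \<Rightarrow> ('o, 'a, 'p, 'q) mdf" where
  "level01 T m D =
     \<lparr>on_ob = (\<lambda>x\<in>Ob (isom_prod T m). pv (on_ob (D 0) (\<lambda>k\<in>{..<m}. Point (x k))) []),
      on_ar = (\<lambda>f\<in>Ar (isom_prod T m). cat_at (on_ar (D 0)
        (\<lambda>k\<in>{..<m}. CMor (Point (Dom (T k) (f k))) (Point (Cod (T k) (f k))) (\<lambda>a\<in>coords 0. f k))) []),
      m_add = (\<lambda>(i, x, t)\<in>add_dom T m.
        pe (on_ob (D 1) ((\<lambda>k\<in>{..<m} - {i}. Point (x k))(i := Triangle t))) (0, []))\<rparr>"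

text \<open>The canonical isomorphism \<open>u : D(\<dots>, 0, \<dots>) \<rightarrow> 0\<close>, where \<open>0\<close> is in variable \<open>k\<close>: the
  unique morphism transforming the additivity datum
  \<open>D(\<dots>, 0, \<dots>) + D(\<dots>, 0, \<dots>) \<rightarrow> D(\<dots>, 0, \<dots>)\<close> of the triangle \<open>0 \<rightarrow> 0 \<rightarrow> 0 \<rightarrow> \<Sigma>0\<close> into the unit
  isomorphism \<open>0 + 0 \<rightarrow> 0\<close>.\<close>

definition zero_iso ::
  "(nat \<Rightarrow> ('o, 'a) tricat) \<Rightarrow> nat \<Rightarrow> ('p, 'q) symcat \<Rightarrow> ('o, 'a, 'p, 'q) mdf \<Rightarrow>
   nat \<Rightarrow> (nat \<Rightarrow> 'o) \<Rightarrow> 'q" where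
  "zero_iso T m P D k x = (THE u. u \<in> Hom P (on_ob D x) (punit P) \<and>
     u \<cdot>\<^bsub>P\<^esub> m_add D (k, restrict x ({..<m} - {k}), deg_tri 1 (T k) (zob (T k))) =
     lunit P (punit P) \<cdot>\<^bsub>P\<^esub> (u \<oplus>\<^bsub>P\<^esub> u))"

text \<open>The comparison \<open>D(s Q) \<rightarrow> s(D Q)\<close> for the degeneracy \<open>s\<close> in direction \<open>j\<close> of the
  \<open>k\<close>-th factor.\<close>

definition deg_iso ::
  "(nat \<Rightarrow> ('o, 'a) tricat) \<Rightarrow> nat \<Rightarrow> ('p, 'q) symcat \<Rightarrow> ('o, 'a, 'p, 'q) cmdf \<Rightarrow> nat \<Rightarrow> int \<Rightarrow>
   nat \<Rightarrow> nat \<Rightarrow> (nat \<Rightarrow> ('o, 'a) tcube) \<Rightarrow> (('p, 'q) pcube, 'q) cmor" where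
  "deg_iso T m P D n \<alpha> k j Q =
     (let R = Q(k := tdeg \<alpha> j (T k) (Q k)); J = offset Q k + j
      in CMor (on_ob (D (n + 1)) R) (pdeg P n \<alpha> J (on_ob (D n) Q))
           (\<lambda>a\<in>coords (n + 1). if a ! J = \<alpha> then zero_iso T m P (level01 T m D) k (multi_vertex T m R a)
              else Idt P (pv (on_ob (D n) Q) (del J a))))"

definition cubical_multi_determinant ::
  "(nat \<Rightarrow> ('o, 'a) tricat) \<Rightarrow> nat \<Rightarrow> ('p, 'q) symcat \<Rightarrow> ('o, 'a, 'p, 'q) cmdf \<Rightarrow> bool" where
  "cubical_multi_determinant T m P D \<longleftrightarrow>
     D \<in> extensional {..2} \<and>
     (\<forall>n\<le>2. extensional_functor (multi_cubes T m n) (D n) \<and>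
        is_functor (multi_cubes T m n) (pcubes P n) (D n)) \<and>
     \<comment> \<open>faces\<close>
     (\<forall>n\<in>{1, 2}. \<forall>\<alpha>\<in>{-1, 0, 1}. \<forall>k<m.
        (\<forall>Q\<in>Ob (multi_cubes T m n). \<forall>j<tdim (Q k).
           pface n \<alpha> (offset Q k + j) (on_ob (D n) Q) =
           on_ob (D (n - 1)) (Q(k := tface \<alpha> j (T k) (Q k)))) \<and>
        (\<forall>F\<in>Ar (multi_cubes T m n). \<forall>j<tdim (csrc (F k)).
           pface_mor n \<alpha> (offset (\<lambda>l. csrc (F l)) k + j) (on_ar (D n) F) =
           on_ar (D (n - 1)) (F(k := tface_mor \<alpha> j (T k) (F k))))) \<and>
     \<comment> \<open>degeneracies\<close>
     (\<forall>n\<in>{0, 1}. \<forall>\<alpha>\<in>{-1, 1}. \<forall>k<m.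
        (\<forall>Q\<in>Ob (multi_cubes T m n). \<forall>j\<le>tdim (Q k).
           deg_iso T m P D n \<alpha> k j Q \<in> Ar (pcubes P (n + 1))) \<and>
        (\<forall>F\<in>Ar (multi_cubes T m n). \<forall>j\<le>tdim (csrc (F k)).
           deg_iso T m P D n \<alpha> k j (Cod (multi_cubes T m n) F) \<cdot>\<^bsub>pcubes P (n + 1)\<^esub>
             on_ar (D (n + 1)) (F(k := tdeg_mor \<alpha> j (T k) (F k))) =
           pdeg_mor P n \<alpha> (offset (\<lambda>l. csrc (F l)) k + j) (on_ar (D n) F) \<cdot>\<^bsub>pcubes P (n + 1)\<^esub>
             deg_iso T m P D n \<alpha> k j (Dom (multi_cubes T m n) F)))"

end

theory Submission
  imports "HOL-Algebra.Free_Abelian_Groups" Defs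
begin

text \<open>From dimension two on, the vertices and edges of a cube in \<open>P\<close> are fixed by
  its faces. Hence the only candidate for a cubical functor extending d is \<open>cub\<close>, which
  places d at the vertices and additivity data at the edges, and conversely every cubical functor is
  \<open>cub\<close> of its levels 0 and 1 (\<open>multi.cub_level01\<close>). What has to be
  compared are the equations.

  From d to cubes: a 2-cube made of triangles in two different variables gives exactly Two
  Triangles. A square in a single variable is the hard case (\<open>det.square\<close>). Its first
  two Verdier octahedra share x' -> y -> A, and so express the two sides of the square equation
  through the data of x'' -> A -> z and z' -> A -> y''. These are linked by the third octahedron, in
  which the rotated triangles A -> y'' -> \<Sigma>z' and z -> z'' -> \<Sigma>z' occur. The link is
  closed by \<open>det.rotation\<close>: the datum of a rotated triangle composed with the datum of
  the triangle is, up to associativity and symmetry, a contraction of D(\<Sigma>w) + D(w) to the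
  unit that depends only on the first vertex w. Both triangles that are rotated start at z', so the
  two contractions cancel. To prove \<open>det.rotation\<close>, the zero morphism w -> z is
  factored through the triangle and through 0; the fourth triangles of the two octahedra are the two
  split triangles of one biproduct (\<open>tri.rotation_octahedra\<close>).

  Trivial octahedra force the data of x = x -> 0 and 0 -> x = x to be unit isomorphisms composed
  with one isomorphism from D(0) to the unit (\<open>det.ad_deg\<close>). Triangle-Function makes
  this isomorphism natural in the other variables, and Two Triangles makes it additive, which gives
  the degeneracies. Triangle-Function, used for one variable after the other, also gives naturality
  for simultaneous morphisms in all variables (\<open>multi_det.add_nat\<close>).

  From cubes to d: functoriality on morphisms of 1-cubes contains naturality and Triangle-Function
  at once. An octahedron or a pair of split triangles is completed by degenerate triangles to a
  square (\<open>tri.octahedron_square\<close>, \<open>tri.split_square\<close>). The degeneracy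
  comparison turns the degenerate edges into unit isomorphisms, after which the square equation is
  the desired axiom (\<open>picard.octahedron_equation\<close>,
  \<open>picard.split_equation\<close>).

  All equations in \<open>P\<close> are reduced to linear algebra. As x + - is an equivalence,
  Aut(x) is identified with the abelian group Aut(0). After trivialising every isomorphism class,
  each morphism has a value, and parallel morphisms with equal values are equal. Composition adds
  values, and sums add them up to a correction that depends only on the source and target objects.
  The coherence axioms become linear relations, and every required equation is an integer
  combination of those available.\<close>

section \<open>Categories and groupoids\<close>

locale catg =
  fixes C :: "('o, 'a, 'z) cat_scheme" (structure)
  assumes category: "category C"
begin

lemma in_HomI: "f \<in> Ar C \<Longrightarrow> Dom C f = x \<Longrightarrow> Cod C f = y \<Longrightarrow> f \<in> Hom C x y"
  by (simp add: Hom_def)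

lemma HomD:
  assumes "f \<in> Hom C x y"
  shows "f \<in> Ar C" "Dom C f = x" "Cod C f = y" "x \<in> Ob C" "y \<in> Ob C"
  using assms category by (auto simp: Hom_def category_def)

lemma Ar_Hom: "f \<in> Ar C \<Longrightarrow> f \<in> Hom C (Dom C f) (Cod C f)"
  by (simp add: Hom_def)

lemma Ar_Ob [simp]: "f \<in> Ar C \<Longrightarrow> Dom C f \<in> Ob C" "f \<in> Ar C \<Longrightarrow> Cod C f \<in> Ob C"
  using category by (auto simp: category_def)

lemma comp_Hom: "f \<in> Hom C x y \<Longrightarrow> g \<in> Hom C y z \<Longrightarrow> g \<cdot> f \<in> Hom C x z"
  using category unfolding category_def by blast

lemma id_Hom: "x \<in> Ob C \<Longrightarrow> Idt C x \<in> Hom C x x"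
  using category unfolding category_def by blast

lemma comp_Ar [simp]:
  assumes "f \<in> Ar C" "g \<in> Ar C" "Cod C f = Dom C g"
  shows "g \<cdot> f \<in> Ar C" "Dom C (g \<cdot> f) = Dom C f" "Cod C (g \<cdot> f) = Cod C g"
  using HomD[OF comp_Hom[of f "Dom C f" "Cod C f" g "Cod C g"]] assms by (auto simp: Hom_def)

lemma id_Ar [simp]:
  assumes "x \<in> Ob C"
  shows "Idt C x \<in> Ar C" "Dom C (Idt C x) = x" "Cod C (Idt C x) = x"
  using HomD[OF id_Hom[OF assms]] by auto

lemma comp_assoc:
  "f \<in> Hom C w x \<Longrightarrow> g \<in> Hom C x y \<Longrightarrow> h \<in> Hom C y z \<Longrightarrow> (h \<cdot> g) \<cdot> f = h \<cdot> (g \<cdot> f)"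
  using category unfolding category_def by blast

lemma comp_assoc_Ar [simp]:
  "f \<in> Ar C \<Longrightarrow> g \<in> Ar C \<Longrightarrow> h \<in> Ar C \<Longrightarrow> Cod C f = Dom C g \<Longrightarrow> Cod C g = Dom C h \<Longrightarrow>
   (h \<cdot> g) \<cdot> f = h \<cdot> (g \<cdot> f)"
  using comp_assoc[of f "Dom C f" "Cod C f" g "Cod C g" h "Cod C h"] by (simp add: Hom_def)

lemma id_right: "f \<in> Hom C x y \<Longrightarrow> f \<cdot> Idt C x = f"
  using category unfolding category_def by blast

lemma id_left: "f \<in> Hom C x y \<Longrightarrow> Idt C y \<cdot> f = f"
  using category unfolding category_def by blast

lemma id_comp_Ar [simp]:
  "f \<in> Ar C \<Longrightarrow> Dom C f = x \<Longrightarrow> f \<cdot> Idt C x = f"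
  "f \<in> Ar C \<Longrightarrow> Cod C f = y \<Longrightarrow> Idt C y \<cdot> f = f"
  using id_right[of f x "Cod C f"] id_left[of f "Dom C f" y] by (auto simp: Hom_def)

definition vinv :: "'a \<Rightarrow> 'a" where
  "vinv f = (SOME g. g \<in> Hom C (Cod C f) (Dom C f) \<and>
     g \<cdot> f = Idt C (Dom C f) \<and> f \<cdot> g = Idt C (Cod C f))"

lemma vinv:
  assumes "f \<in> isos C" "f \<in> Hom C x y"
  shows "vinv f \<in> Hom C y x" "vinv f \<cdot> f = Idt C x" "f \<cdot> vinv f = Idt C y"
proof -
  have "\<exists>g. g \<in> Hom C (Cod C f) (Dom C f) \<and>
     g \<cdot> f = Idt C (Dom C f) \<and> f \<cdot> g = Idt C (Cod C f)"
    using assms by (auto simp: isos_def)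
  from someI_ex[OF this, folded vinv_def] show
    "vinv f \<in> Hom C y x" "vinv f \<cdot> f = Idt C x" "f \<cdot> vinv f = Idt C y"
    using HomD[OF assms(2)] by auto
qed

lemma isosI:
  "f \<in> Hom C x y \<Longrightarrow> g \<in> Hom C y x \<Longrightarrow> g \<cdot> f = Idt C x \<Longrightarrow> f \<cdot> g = Idt C y \<Longrightarrow> f \<in> isos C"
  by (auto simp: isos_def Hom_def)

lemma vinv_isos: "f \<in> isos C \<Longrightarrow> f \<in> Hom C x y \<Longrightarrow> vinv f \<in> isos C"
  by (rule isosI[of _ y x f]) (auto dest: vinv)

lemma isos_comp:
  assumes "f \<in> isos C" "g \<in> isos C" "f \<in> Hom C x y" "g \<in> Hom C y z"
  shows "g \<cdot> f \<in> isos C"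
proof (rule isosI[of _ x z "vinv f \<cdot> vinv g"])
  note f = vinv[OF assms(1,3)] and g = vinv[OF assms(2,4)]
  show "g \<cdot> f \<in> Hom C x z" "vinv f \<cdot> vinv g \<in> Hom C z x"
    by (rule comp_Hom assms f g)+
  have "(vinv f \<cdot> vinv g) \<cdot> (g \<cdot> f) = vinv f \<cdot> ((vinv g \<cdot> g) \<cdot> f)"
    using comp_assoc[OF comp_Hom[OF assms(3,4)] g(1) f(1)] comp_assoc[OF assms(3,4) g(1)] by argo
  then show "(vinv f \<cdot> vinv g) \<cdot> (g \<cdot> f) = Idt C x"
    using f g id_left[OF assms(3)] by simp
  have "(g \<cdot> f) \<cdot> (vinv f \<cdot> vinv g) = g \<cdot> ((f \<cdot> vinv f) \<cdot> vinv g)"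
    using comp_assoc[OF comp_Hom[OF g(1) f(1)] assms(3,4)] comp_assoc[OF g(1) f(1) assms(3)] by argo
  then show "(g \<cdot> f) \<cdot> (vinv f \<cdot> vinv g) = Idt C z"
    using f g id_left[OF g(1)] by simp
qed

lemma isos_id: "x \<in> Ob C \<Longrightarrow> Idt C x \<in> isos C"
  by (rule isosI[of _ x x "Idt C x"]) (auto intro: in_HomI)

lemma isos_Ar: "f \<in> isos C \<Longrightarrow> f \<in> Ar C"
  by (simp add: isos_def)

lemma mono_iso:
  assumes f: "f \<in> isos C" "f \<in> Hom C y z" and g: "g \<in> Hom C x y" and h: "h \<in> Hom C x y"
    and eq: "f \<cdot> g = f \<cdot> h"
  shows "g = h"
proof -
  note v = vinv[OF f]
  have "(vinv f \<cdot> f) \<cdot> g = (vinv f \<cdot> f) \<cdot> h"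
    using comp_assoc[OF g f(2) v(1)] comp_assoc[OF h f(2) v(1)] eq by argo
  then show ?thesis using v(2) id_left[OF g] id_left[OF h] by argo
qed

lemma epi_iso:
  assumes f: "f \<in> isos C" "f \<in> Hom C x y" and g: "g \<in> Hom C y z" and h: "h \<in> Hom C y z"
    and eq: "g \<cdot> f = h \<cdot> f"
  shows "g = h"
proof -
  note v = vinv[OF f]
  have "g \<cdot> (f \<cdot> vinv f) = h \<cdot> (f \<cdot> vinv f)"
    using comp_assoc[OF v(1) f(2) g] comp_assoc[OF v(1) f(2) h] eq by argo
  then show ?thesis using v(3) id_right[OF g] id_right[OF h] by argo
qed

end

section \<open>Structural isomorphisms of a Picard groupoid and the right unit of a sum\<close>

section \<open>Valuations of Picard groupoids\<close>

locale picard =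
  fixes P :: "('p, 'q) symcat" (structure)
  assumes picard: "picard_groupoid P"

sublocale picard \<subseteq> catg P
  using picard by unfold_locales (simp add: picard_groupoid_def symmetric_monoidal_def)

context picard
begin

lemma monoidal: "symmetric_monoidal P"
  using picard by (simp add: picard_groupoid_def)

lemma iso: "f \<in> Hom P x y \<Longrightarrow> f \<in> isos P"
  using picard by (auto simp: picard_groupoid_def groupoid_def Hom_def)

lemma iso_Ar: "f \<in> Ar P \<Longrightarrow> f \<in> isos P"
  using picard by (auto simp: picard_groupoid_def groupoid_def Hom_def)

lemmas monoidal_rest0 = monoidal[unfolded symmetric_monoidal_def, THEN conjunct2]
lemmas plus_Ob0 = monoidal_rest0[THEN conjunct1]
lemmas monoidal_rest1 = monoidal_rest0[THEN conjunct2]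
lemmas unit_Ob0 = monoidal_rest1[THEN conjunct1]
lemmas monoidal_rest2 = monoidal_rest1[THEN conjunct2]
lemmas plus_Hom0 = monoidal_rest2[THEN conjunct1]
lemmas monoidal_rest3 = monoidal_rest2[THEN conjunct2]
lemmas plus_id0 = monoidal_rest3[THEN conjunct1]
lemmas monoidal_rest4 = monoidal_rest3[THEN conjunct2]
lemmas interchange0 = monoidal_rest4[THEN conjunct1]
lemmas monoidal_rest5 = monoidal_rest4[THEN conjunct2]
lemmas assoc0 = monoidal_rest5[THEN conjunct1]
lemmas monoidal_rest6 = monoidal_rest5[THEN conjunct2]
lemmas lunit0 = monoidal_rest6[THEN conjunct1]
lemmas monoidal_rest7 = monoidal_rest6[THEN conjunct2]
lemmas runit0 = monoidal_rest7[THEN conjunct1]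
lemmas monoidal_rest8 = monoidal_rest7[THEN conjunct2]
lemmas symm0 = monoidal_rest8[THEN conjunct1]
lemmas monoidal_rest9 = monoidal_rest8[THEN conjunct2]
lemmas assoc_nat0 = monoidal_rest9[THEN conjunct1]
lemmas monoidal_rest10 = monoidal_rest9[THEN conjunct2]
lemmas lunit_nat0 = monoidal_rest10[THEN conjunct1]
lemmas monoidal_rest11 = monoidal_rest10[THEN conjunct2]
lemmas runit_nat0 = monoidal_rest11[THEN conjunct1]
lemmas monoidal_rest12 = monoidal_rest11[THEN conjunct2]
lemmas symm_nat0 = monoidal_rest12[THEN conjunct1]
lemmas monoidal_rest13 = monoidal_rest12[THEN conjunct2]
lemmas pentagon0 = monoidal_rest13[THEN conjunct1]
lemmas monoidal_rest14 = monoidal_rest13[THEN conjunct2]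
lemmas triangle0 = monoidal_rest14[THEN conjunct1]
lemmas monoidal_rest15 = monoidal_rest14[THEN conjunct2]
lemmas hexagon0 = monoidal_rest15[THEN conjunct1]
lemmas monoidal_rest16 = monoidal_rest15[THEN conjunct2]
lemmas symm_symm0 = monoidal_rest16

lemma plus_Ob [simp]: "x \<in> Ob P \<Longrightarrow> y \<in> Ob P \<Longrightarrow> x \<boxplus> y \<in> Ob P"
  and unit_Ob [simp]: "punit P \<in> Ob P"
  using plus_Ob0 unit_Ob0 by auto

lemma plus_Hom: "f \<in> Hom P x x' \<Longrightarrow> g \<in> Hom P y y' \<Longrightarrow> f \<oplus> g \<in> Hom P (x \<boxplus> y) (x' \<boxplus> y')"
  using plus_Hom0 by (auto simp: Hom_def)

lemma plus_Ar [simp]: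
  assumes "f \<in> Ar P" "g \<in> Ar P"
  shows "f \<oplus> g \<in> Ar P" "Dom P (f \<oplus> g) = Dom P f \<boxplus> Dom P g" "Cod P (f \<oplus> g) = Cod P f \<boxplus> Cod P g"
  using plus_Hom[OF Ar_Hom[OF assms(1)] Ar_Hom[OF assms(2)]] by (auto dest: HomD)

lemma plus_id: "x \<in> Ob P \<Longrightarrow> y \<in> Ob P \<Longrightarrow> Idt P x \<oplus> Idt P y = Idt P (x \<boxplus> y)"
  using plus_id0 by blast

lemma interchange:
  "f \<in> Ar P \<Longrightarrow> f' \<in> Ar P \<Longrightarrow> g \<in> Ar P \<Longrightarrow> g' \<in> Ar P \<Longrightarrow> Cod P f = Dom P f' \<Longrightarrow> Cod P g = Dom P g' \<Longrightarrow>
   (f' \<oplus> g') \<cdot> (f \<oplus> g) = (f' \<cdot> f) \<oplus> (g' \<cdot> g)"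
  using interchange0 by metis

lemma assoc_Hom: "a \<in> Ob P \<Longrightarrow> b \<in> Ob P \<Longrightarrow> c \<in> Ob P \<Longrightarrow>
    assoc P a b c \<in> Hom P ((a \<boxplus> b) \<boxplus> c) (a \<boxplus> (b \<boxplus> c))"
  and lunit_Hom: "a \<in> Ob P \<Longrightarrow> lunit P a \<in> Hom P (punit P \<boxplus> a) a"
  and runit_Hom: "a \<in> Ob P \<Longrightarrow> runit P a \<in> Hom P (a \<boxplus> punit P) a"
  and symm_Hom: "a \<in> Ob P \<Longrightarrow> b \<in> Ob P \<Longrightarrow> symm P a b \<in> Hom P (a \<boxplus> b) (b \<boxplus> a)"
  using assoc0 lunit0 runit0 symm0 by auto

lemmas assoc_Ar [simp] = assoc_Hom[THEN HomD(1)] assoc_Hom[THEN HomD(2)] assoc_Hom[THEN HomD(3)]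
lemmas runit_Ar [simp] = runit_Hom[THEN HomD(1)] runit_Hom[THEN HomD(2)] runit_Hom[THEN HomD(3)]
lemmas lunit_Ar [simp] = lunit_Hom[THEN HomD(1)] lunit_Hom[THEN HomD(2)] lunit_Hom[THEN HomD(3)]
lemmas symm_Ar [simp] = symm_Hom[THEN HomD(1)] symm_Hom[THEN HomD(2)] symm_Hom[THEN HomD(3)]

lemma assoc_nat: "f \<in> Hom P a a' \<Longrightarrow> g \<in> Hom P b b' \<Longrightarrow> h \<in> Hom P c c' \<Longrightarrow>
    assoc P a' b' c' \<cdot> ((f \<oplus> g) \<oplus> h) = (f \<oplus> (g \<oplus> h)) \<cdot> assoc P a b c"
  unfolding Hom_def using assoc_nat0 by blast

lemma lunit_nat: "f \<in> Hom P a a' \<Longrightarrow> lunit P a' \<cdot> (Idt P (punit P) \<oplus> f) = f \<cdot> lunit P a"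
  unfolding Hom_def using lunit_nat0 by blast

lemma runit_nat: "f \<in> Hom P a a' \<Longrightarrow> runit P a' \<cdot> (f \<oplus> Idt P (punit P)) = f \<cdot> runit P a"
  unfolding Hom_def using runit_nat0 by blast

lemma symm_nat: "f \<in> Hom P a a' \<Longrightarrow> g \<in> Hom P b b' \<Longrightarrow>
    symm P a' b' \<cdot> (f \<oplus> g) = (g \<oplus> f) \<cdot> symm P a b"
  unfolding Hom_def using symm_nat0 by blast

lemma pentagon: "a \<in> Ob P \<Longrightarrow> b \<in> Ob P \<Longrightarrow> c \<in> Ob P \<Longrightarrow> d \<in> Ob P \<Longrightarrow>
    assoc P a b (c \<boxplus> d) \<cdot> assoc P (a \<boxplus> b) c d =
    (Idt P a \<oplus> assoc P b c d) \<cdot> assoc P a (b \<boxplus> c) d \<cdot> (assoc P a b c \<oplus> Idt P d)"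
  using pentagon0 by blast

lemma triangle: "a \<in> Ob P \<Longrightarrow> b \<in> Ob P \<Longrightarrow>
    (Idt P a \<oplus> lunit P b) \<cdot> assoc P a (punit P) b = runit P a \<oplus> Idt P b"
  using triangle0 by blast

lemma hexagon: "a \<in> Ob P \<Longrightarrow> b \<in> Ob P \<Longrightarrow> c \<in> Ob P \<Longrightarrow>
    assoc P b c a \<cdot> symm P a (b \<boxplus> c) \<cdot> assoc P a b c =
    (Idt P b \<oplus> symm P a c) \<cdot> assoc P b a c \<cdot> (symm P a b \<oplus> Idt P c)"
  using hexagon0 by blast

lemma symm_symm: "a \<in> Ob P \<Longrightarrow> b \<in> Ob P \<Longrightarrow> symm P b a \<cdot> symm P a b = Idt P (a \<boxplus> b)"
  using symm_symm0 by blast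

abbreviation unt where "unt \<equiv> punit P"

text \<open>\<open>runit\<close> is a natural isomorphism from adding the unit to the identity
  functor, so adding the unit is faithful.\<close>

lemma plus_unit_inj:
  assumes "f \<in> Hom P x y" "g \<in> Hom P x y" "f \<oplus> Idt P unt = g \<oplus> Idt P unt"
  shows "f = g"
proof (rule epi_iso)
  show "runit P x \<in> isos P" "runit P x \<in> Hom P (x \<boxplus> unt) x"
    using assms runit_Hom[of x] by (auto dest: HomD intro: iso)
  show "f \<cdot> runit P x = g \<cdot> runit P x"
    using runit_nat[OF assms(1)] runit_nat[OF assms(2)] assms(3) by simp
qed (use assms in auto)

text \<open>Kelly's coherence for the right unit. After adding the unit on the right, which is
  faithful, both sides are compared behind the associator, where the pentagon and the triangle at
  the unit give the equation.\<close>

lemma runit_plus: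
  assumes [simp]: "x \<in> Ob P" "y \<in> Ob P"
  shows "runit P (x \<boxplus> y) = (Idt P x \<oplus> runit P y) \<cdot> assoc P x y unt"
proof (rule plus_unit_inj)
  let ?l = "lunit P unt" and ?I = "Idt P"
  show "runit P (x \<boxplus> y) \<in> Hom P ((x \<boxplus> y) \<boxplus> unt) (x \<boxplus> y)" by (rule runit_Hom) simp
  show "(?I x \<oplus> runit P y) \<cdot> assoc P x y unt \<in> Hom P ((x \<boxplus> y) \<boxplus> unt) (x \<boxplus> y)"
    by (rule in_HomI) simp_all
  have "assoc P x y unt \<cdot> (runit P (x \<boxplus> y) \<oplus> ?I unt) =
      assoc P x y unt \<cdot> ((?I (x \<boxplus> y) \<oplus> ?l) \<cdot> assoc P (x \<boxplus> y) unt unt)"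
    by (simp add: triangle)
  also have "\<dots> = (assoc P x y unt \<cdot> ((?I x \<oplus> ?I y) \<oplus> ?l)) \<cdot> assoc P (x \<boxplus> y) unt unt"
    by (simp add: plus_id)
  also have "\<dots> = ((?I x \<oplus> (?I y \<oplus> ?l)) \<cdot> assoc P x y (unt \<boxplus> unt)) \<cdot> assoc P (x \<boxplus> y) unt unt"
    by (subst assoc_nat) (auto intro: in_HomI)
  also have "\<dots> = (?I x \<oplus> (?I y \<oplus> ?l)) \<cdot> (assoc P x y (unt \<boxplus> unt) \<cdot> assoc P (x \<boxplus> y) unt unt)"
    by simp
  also have "\<dots> = ((?I x \<oplus> (?I y \<oplus> ?l)) \<cdot> (?I x \<oplus> assoc P y unt unt)) \<cdot>
      assoc P x (y \<boxplus> unt) unt \<cdot> (assoc P x y unt \<oplus> ?I unt)"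
    by (simp add: pentagon)
  also have "\<dots> = (?I x \<oplus> (runit P y \<oplus> ?I unt)) \<cdot>
      assoc P x (y \<boxplus> unt) unt \<cdot> (assoc P x y unt \<oplus> ?I unt)"
    by (simp add: interchange triangle)
  also have "\<dots> = ((?I x \<oplus> (runit P y \<oplus> ?I unt)) \<cdot>
      assoc P x (y \<boxplus> unt) unt) \<cdot> (assoc P x y unt \<oplus> ?I unt)"
    by simp
  also have "\<dots> = (assoc P x y unt \<cdot> ((?I x \<oplus> runit P y) \<oplus> ?I unt)) \<cdot> (assoc P x y unt \<oplus> ?I unt)"
    by (subst assoc_nat) (auto intro: in_HomI)
  also have "\<dots> = assoc P x y unt \<cdot> (((?I x \<oplus> runit P y) \<cdot> assoc P x y unt) \<oplus> ?I unt)"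
    by (simp add: interchange)
  finally have eq: "assoc P x y unt \<cdot> (runit P (x \<boxplus> y) \<oplus> ?I unt) = \<dots>" .
  note a = assoc_Hom[OF assms(1,2) unit_Ob]
  show "runit P (x \<boxplus> y) \<oplus> ?I unt = ((?I x \<oplus> runit P y) \<cdot> assoc P x y unt) \<oplus> ?I unt"
    by (rule mono_iso[OF iso[OF a] a _ _ eq]; rule in_HomI; simp)
qed

end

section \<open>The action of the automorphisms of the unit on all objects\<close>

context picard
begin

lemma plus_full_faithful:
  assumes x: "x \<in> Ob P"
  shows plus_faithful: "f \<in> Hom P y z \<Longrightarrow> g \<in> Hom P y z \<Longrightarrow> Idt P x \<oplus> f = Idt P x \<oplus> g \<Longrightarrow> f = g"
    and plus_full: "\<phi> \<in> Hom P (x \<boxplus> y) (x \<boxplus> z) \<Longrightarrow> y \<in> Ob P \<Longrightarrow> z \<in> Ob P \<Longrightarrow>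
      \<exists>f\<in>Hom P y z. \<phi> = Idt P x \<oplus> f"
proof -
  let ?F = "\<lparr>on_ob = (\<lambda>y. x \<boxplus> y), on_ar = (\<lambda>f. Idt P x \<oplus> f)\<rparr>"
  have "equivalence P P ?F" using picard x by (auto simp: picard_groupoid_def)
  then obtain G \<eta> \<epsilon> where G: "is_functor P P G"
    and \<eta>: "natural_iso P P id_func (comp_func G ?F) \<eta>"
    and \<epsilon>: "natural_iso P P (comp_func ?F G) id_func \<epsilon>"
    unfolding equivalence_def by blast
  have GHom: "on_ar G f \<in> Hom P (on_ob G y) (on_ob G z)" if "f \<in> Hom P y z" for f y z
    using G that unfolding is_functor_def Hom_def by auto
  have eta: "\<eta> y \<in> Hom P y (on_ob G (x \<boxplus> y))" if "y \<in> Ob P" for y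
    using \<eta> that unfolding natural_iso_def by (auto simp: id_func_def comp_func_def)
  have etan: "\<eta> z \<cdot> f = on_ar G (Idt P x \<oplus> f) \<cdot> \<eta> y" if "f \<in> Hom P y z" for f y z
    using \<eta> that unfolding natural_iso_def Hom_def by (auto simp: id_func_def comp_func_def)
  have eps: "\<epsilon> y \<in> Hom P (x \<boxplus> on_ob G y) y" if "y \<in> Ob P" for y
    using \<epsilon> that unfolding natural_iso_def by (auto simp: id_func_def comp_func_def)
  have epsn: "\<epsilon> z \<cdot> (Idt P x \<oplus> on_ar G f) = f \<cdot> \<epsilon> y" if "f \<in> Hom P y z" for f y z
    using \<epsilon> that unfolding natural_iso_def Hom_def by (auto simp: id_func_def comp_func_def)
  show faithful: "f = g" if f: "f \<in> Hom P y z" and g: "g \<in> Hom P y z"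
    and eq: "Idt P x \<oplus> f = Idt P x \<oplus> g" for f g y z
  proof -
    have z: "\<eta> z \<in> Hom P z (on_ob G (x \<boxplus> z))" using eta HomD[OF f] by blast
    show ?thesis using etan[OF f] etan[OF g] eq by (intro mono_iso[OF iso[OF z] z f g]) argo
  qed
  show "\<exists>f\<in>Hom P y z. \<phi> = Idt P x \<oplus> f"
    if phi: "\<phi> \<in> Hom P (x \<boxplus> y) (x \<boxplus> z)" and y: "y \<in> Ob P" and z: "z \<in> Ob P"
  proof -
    note ey = eta[OF y] and ez = eta[OF z]
    note v = vinv[OF iso[OF ez] ez]
    note gphi = GHom[OF phi]
    \<comment> \<open>By naturality of \<eta>, a preimage of \<phi> has to be
      \<open>on_ar G \<phi>\<close> conjugated by \<eta>. That it is one is first checked under G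
      and then transported by \<epsilon>.\<close>
    define f where "f = vinv (\<eta> z) \<cdot> (on_ar G \<phi> \<cdot> \<eta> y)"
    have f: "f \<in> Hom P y z"
      unfolding f_def by (rule comp_Hom[OF comp_Hom[OF ey gphi] v(1)])
    note xf = plus_Hom[OF id_Hom[OF x] f]
    have "\<eta> z \<cdot> f = (\<eta> z \<cdot> vinv (\<eta> z)) \<cdot> (on_ar G \<phi> \<cdot> \<eta> y)"
      unfolding f_def using comp_assoc[OF comp_Hom[OF ey gphi] v(1) ez] by argo
    also have "\<dots> = on_ar G \<phi> \<cdot> \<eta> y" using v(3) id_left[OF comp_Hom[OF ey gphi]] by argo
    finally have "on_ar G (Idt P x \<oplus> f) = on_ar G \<phi>"
      using etan[OF f] by (intro epi_iso[OF iso[OF ey] ey GHom[OF xf] gphi]) argo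
    then have "(Idt P x \<oplus> f) \<cdot> \<epsilon> (x \<boxplus> y) = \<phi> \<cdot> \<epsilon> (x \<boxplus> y)"
      using epsn[OF xf] epsn[OF phi] by argo
    moreover note e = eps[OF plus_Ob[OF x y]]
    ultimately have "Idt P x \<oplus> f = \<phi>" by (intro epi_iso[OF iso[OF e] e xf phi])
    with f show ?thesis by blast
  qed
qed

text \<open>The automorphism of \<open>x\<close> induced by an automorphism of the unit.\<close>

definition act :: "'q \<Rightarrow> 'p \<Rightarrow> 'q" where
  "act a x = (runit P x \<cdot> (Idt P x \<oplus> a)) \<cdot> vinv (runit P x)"

lemma act_Hom:
  assumes "a \<in> Hom P unt unt" "x \<in> Ob P"
  shows "act a x \<in> Hom P x x"
proof -
  note r = runit_Hom[OF assms(2)]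
  show ?thesis unfolding act_def
    by (rule comp_Hom[OF vinv(1)[OF iso[OF r] r] comp_Hom[OF plus_Hom[OF id_Hom[OF assms(2)] assms(1)] r]])
qed

lemma act_runit:
  assumes "a \<in> Hom P unt unt" "x \<in> Ob P"
  shows "act a x \<cdot> runit P x = runit P x \<cdot> (Idt P x \<oplus> a)"
proof -
  note r = runit_Hom[OF assms(2)]
  note v = vinv[OF iso[OF r] r]
  note k = comp_Hom[OF plus_Hom[OF id_Hom[OF assms(2)] assms(1)] r]
  show ?thesis unfolding act_def using comp_assoc[OF r v(1) k] v(2) id_right[OF k] by argo
qed

lemma act_eqI:
  assumes "a \<in> Hom P unt unt" "\<phi> \<in> Hom P x x" "\<phi> \<cdot> runit P x = runit P x \<cdot> (Idt P x \<oplus> a)"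
  shows "\<phi> = act a x"
proof -
  have x: "x \<in> Ob P" using HomD[OF assms(2)] by blast
  note r = runit_Hom[OF x]
  show ?thesis using assms act_runit[OF assms(1) x]
    by (intro epi_iso[OF iso[OF r] r assms(2) act_Hom[OF assms(1) x]]) argo
qed

text \<open>Both sides agree after \<open>runit\<close>: it is natural in f, and adding f on the
  left commutes with adding a on the right by interchange. So the action of Aut(0) is
  central.\<close>

lemma act_nat:
  assumes a: "a \<in> Hom P unt unt" and f: "f \<in> Hom P x y"
  shows "f \<cdot> act a x = act a y \<cdot> f"
proof -
  note x = HomD(4)[OF f] and y = HomD(5)[OF f]
  note [simp] = HomD[OF a] HomD[OF f] HomD(1-3)[OF act_Hom[OF a x]] HomD(1-3)[OF act_Hom[OF a y]]
  note r = runit_Hom[OF x]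
  have "(f \<cdot> act a x) \<cdot> runit P x = f \<cdot> (act a x \<cdot> runit P x)" by simp
  also have "\<dots> = (f \<cdot> runit P x) \<cdot> (Idt P x \<oplus> a)" by (simp add: act_runit[OF a x])
  also have "\<dots> = (runit P y \<cdot> (f \<oplus> Idt P unt)) \<cdot> (Idt P x \<oplus> a)" by (simp only: runit_nat[OF f])
  also have "\<dots> = (runit P y \<cdot> (Idt P y \<oplus> a)) \<cdot> (f \<oplus> Idt P unt)" by (simp add: interchange)
  also have "\<dots> = act a y \<cdot> (runit P y \<cdot> (f \<oplus> Idt P unt))" by (simp flip: act_runit[OF a y])
  also have "\<dots> = (act a y \<cdot> f) \<cdot> runit P x" by (simp add: runit_nat[OF f])
  finally show ?thesis
    by (rule epi_iso[OF iso[OF r] r comp_Hom[OF act_Hom[OF a x] f] comp_Hom[OF f act_Hom[OF a y]]])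
qed

lemma act_comp:
  assumes a: "a \<in> Hom P unt unt" and b: "b \<in> Hom P unt unt" and x: "x \<in> Ob P"
  shows "act (b \<cdot> a) x = act b x \<cdot> act a x"
proof -
  note [simp] = HomD[OF a] HomD[OF b] HomD(1-3)[OF act_Hom[OF a x]] HomD(1-3)[OF act_Hom[OF b x]] x
  have "(act b x \<cdot> act a x) \<cdot> runit P x = act b x \<cdot> (runit P x \<cdot> (Idt P x \<oplus> a))"
    by (simp add: act_runit[OF a x])
  also have "\<dots> = (act b x \<cdot> runit P x) \<cdot> (Idt P x \<oplus> a)" by simp
  also have "\<dots> = runit P x \<cdot> ((Idt P x \<oplus> b) \<cdot> (Idt P x \<oplus> a))" by (simp add: act_runit[OF b x])
  also have "\<dots> = runit P x \<cdot> (Idt P x \<oplus> (b \<cdot> a))" by (simp add: interchange)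
  finally show ?thesis
    using act_eqI[OF comp_Hom[OF a b] comp_Hom[OF act_Hom[OF a x] act_Hom[OF b x]]] by metis
qed

lemma act_inj:
  assumes a: "a \<in> Hom P unt unt" and b: "b \<in> Hom P unt unt" and x: "x \<in> Ob P"
    and eq: "act a x = act b x"
  shows "a = b"
proof (rule plus_faithful[OF x a b])
  note r = runit_Hom[OF x]
  show "Idt P x \<oplus> a = Idt P x \<oplus> b"
    using act_runit[OF a x] act_runit[OF b x] eq
    by (intro mono_iso[OF iso[OF r] r plus_Hom[OF id_Hom[OF x] a] plus_Hom[OF id_Hom[OF x] b]]) argo
qed

text \<open>An automorphism of x, conjugated by \<open>runit\<close>, is one of x + 0 and comes from
  the unit because x + - is full. With \<open>act_inj\<close> this identifies Aut(x) with
  Aut(0).\<close>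

lemma act_surj:
  assumes "\<phi> \<in> Hom P x x"
  shows "\<exists>a\<in>Hom P unt unt. \<phi> = act a x"
proof -
  have x: "x \<in> Ob P" using HomD[OF assms] by blast
  note r = runit_Hom[OF x]
  note v = vinv[OF iso[OF r] r]
  have k: "vinv (runit P x) \<cdot> (\<phi> \<cdot> runit P x) \<in> Hom P (x \<boxplus> unt) (x \<boxplus> unt)"
    by (rule comp_Hom[OF comp_Hom[OF r assms] v(1)])
  obtain a where a: "a \<in> Hom P unt unt" "vinv (runit P x) \<cdot> (\<phi> \<cdot> runit P x) = Idt P x \<oplus> a"
    using plus_full[OF x k] by auto
  have "runit P x \<cdot> (Idt P x \<oplus> a) = (runit P x \<cdot> vinv (runit P x)) \<cdot> (\<phi> \<cdot> runit P x)"
    using comp_assoc[OF comp_Hom[OF r assms] v(1) r] a(2) by argo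
  also have "\<dots> = \<phi> \<cdot> runit P x" using v(3) id_left[OF comp_Hom[OF r assms]] by argo
  finally show ?thesis using act_eqI[OF a(1) assms] a(1) by metis
qed

text \<open>By \<open>runit_plus\<close> the right unit of x + y is that of y up to an associator,
  and naturality of the associator carries a through. It follows that an automorphism of a summand
  may be read as one of the whole sum.\<close>

lemma act_plus_right:
  assumes a: "a \<in> Hom P unt unt" and x: "x \<in> Ob P" and y: "y \<in> Ob P"
  shows "Idt P x \<oplus> act a y = act a (x \<boxplus> y)"
proof (rule act_eqI[OF a plus_Hom[OF id_Hom[OF x] act_Hom[OF a y]]])
  note [simp] = HomD[OF a] HomD(1-3)[OF act_Hom[OF a y]] x y
  have "(Idt P x \<oplus> act a y) \<cdot> runit P (x \<boxplus> y) =
      (Idt P x \<oplus> (act a y \<cdot> runit P y)) \<cdot> assoc P x y unt"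
    by (simp add: runit_plus interchange flip: comp_assoc_Ar)
  also have "\<dots> = (Idt P x \<oplus> runit P y) \<cdot> ((Idt P x \<oplus> (Idt P y \<oplus> a)) \<cdot> assoc P x y unt)"
    by (simp add: act_runit[OF a y] interchange flip: comp_assoc_Ar)
  also have "\<dots> = (Idt P x \<oplus> runit P y) \<cdot> (assoc P x y unt \<cdot> (Idt P (x \<boxplus> y) \<oplus> a))"
    using assoc_nat[OF id_Hom[OF x] id_Hom[OF y] a] by (simp add: plus_id)
  also have "\<dots> = runit P (x \<boxplus> y) \<cdot> (Idt P (x \<boxplus> y) \<oplus> a)"
    by (simp add: runit_plus)
  finally show "(Idt P x \<oplus> act a y) \<cdot> runit P (x \<boxplus> y) = \<dots>" .
qed

lemma act_plus_left:
  assumes a: "a \<in> Hom P unt unt" and x: "x \<in> Ob P" and y: "y \<in> Ob P"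
  shows "act a x \<oplus> Idt P y = act a (x \<boxplus> y)"
proof -
  note s = symm_Hom[OF x y]
  have "symm P x y \<cdot> (act a x \<oplus> Idt P y) = act a (y \<boxplus> x) \<cdot> symm P x y"
    using symm_nat[OF act_Hom[OF a x] id_Hom[OF y]] act_plus_right[OF a y x] by argo
  also have "\<dots> = symm P x y \<cdot> act a (x \<boxplus> y)"
    using act_nat[OF a s] by argo
  finally show ?thesis
    by (rule mono_iso[OF iso[OF s] s plus_Hom[OF act_Hom[OF a x] id_Hom[OF y]] act_Hom[OF a plus_Ob[OF x y]]])
qed

end

section \<open>Values of morphisms and linear relations between them\<close>

context picard
begin

definition aut :: "'q monoid" where
  "aut = \<lparr>carrier = Hom P unt unt, monoid.mult = Cmp P, one = Idt P unt\<rparr>"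

text \<open>Every automorphism of the unit is itself of the form \<open>act c unt\<close>, and the
  action commutes with all morphisms.\<close>

lemma aut_commute:
  assumes a: "a \<in> Hom P unt unt" and b: "b \<in> Hom P unt unt"
  shows "a \<cdot> b = b \<cdot> a"
  using act_surj[OF b] act_nat[OF _ a] by auto

lemma comm_group_aut: "comm_group aut"
proof (rule comm_groupI)
  fix x assume "x \<in> carrier aut"
  then have x: "x \<in> Hom P unt unt" by (simp add: aut_def)
  show "\<exists>y\<in>carrier aut. y \<otimes>\<^bsub>aut\<^esub> x = \<one>\<^bsub>aut\<^esub>"
    using vinv[OF iso[OF x] x] by (auto simp: aut_def)
qed (auto simp: aut_def id_Hom id_left comp_assoc intro: comp_Hom aut_commute)

text \<open>The chosen object of the isomorphism class of x. Isomorphic objects satisfy the same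
  predicate under the choice operator, so they get literally the same representative
  (\<open>repr_eq\<close>).\<close>

definition repr :: "'p \<Rightarrow> 'p" where
  "repr x = (SOME y. Hom P x y \<noteq> {})"

definition chart :: "'p \<Rightarrow> 'q" where
  "chart x = (SOME f. f \<in> Hom P x (repr x))"

lemma chart: "x \<in> Ob P \<Longrightarrow> chart x \<in> Hom P x (repr x)"
proof -
  assume "x \<in> Ob P"
  then have "Hom P x x \<noteq> {}" using id_Hom by blast
  then have "Hom P x (repr x) \<noteq> {}" unfolding repr_def by (rule someI[of "\<lambda>y. Hom P x y \<noteq> {}"])
  then show ?thesis unfolding chart_def by (metis ex_in_conv someI)
qed

lemma repr_eq:
  assumes "f \<in> Hom P x y"
  shows "repr x = repr y"
proof -
  have "Hom P x z \<noteq> {} \<longleftrightarrow> Hom P y z \<noteq> {}" for z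
    using comp_Hom[OF assms, of _ z] comp_Hom[OF vinv(1)[OF iso[OF assms] assms], of _ z] by blast
  then show ?thesis unfolding repr_def by simp
qed

text \<open>The charts trivialise each connected component; \<open>val f\<close> is the automorphism
  of the unit by which f differs from this trivialisation.\<close>

definition val :: "'q \<Rightarrow> 'q" where
  "val f = (THE a. a \<in> Hom P unt unt \<and>
     chart (Cod P f) \<cdot> f = act a (repr (Dom P f)) \<cdot> chart (Dom P f))"

lemma val_unique:
  assumes f: "f \<in> Hom P x y"
  shows "\<exists>!a. a \<in> Hom P unt unt \<and> chart y \<cdot> f = act a (repr x) \<cdot> chart x"
proof -
  note x = HomD(4)[OF f] and y = HomD(5)[OF f]
  note c = chart[OF x] and d = chart[OF y, folded repr_eq[OF f]]
  note v = vinv[OF iso[OF c] c]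
  have k: "(chart y \<cdot> f) \<cdot> vinv (chart x) \<in> Hom P (repr x) (repr x)"
    by (rule comp_Hom[OF v(1) comp_Hom[OF f d]])
  obtain a where a: "a \<in> Hom P unt unt" "(chart y \<cdot> f) \<cdot> vinv (chart x) = act a (repr x)"
    using act_surj[OF k] by blast
  have "chart y \<cdot> f = act a (repr x) \<cdot> chart x"
    using comp_assoc[OF c v(1) comp_Hom[OF f d]] a(2) v(2) id_right[OF comp_Hom[OF f d]] by argo
  moreover have "b = a" if "b \<in> Hom P unt unt" "act b (repr x) \<cdot> chart x = act a (repr x) \<cdot> chart x" for b
    using epi_iso[OF iso[OF c] c act_Hom act_Hom that(2)] act_inj that a(1) HomD[OF c] by blast
  ultimately show ?thesis using a(1) by metis
qed

lemma val:
  assumes "f \<in> Hom P x y"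
  shows "val f \<in> Hom P unt unt" "chart y \<cdot> f = act (val f) (repr x) \<cdot> chart x"
  using theI'[OF val_unique[OF assms]] HomD[OF assms] unfolding val_def by auto

lemma val_eqI:
  assumes "f \<in> Hom P x y" "a \<in> Hom P unt unt" "chart y \<cdot> f = act a (repr x) \<cdot> chart x"
  shows "val f = a"
  using val_unique[OF assms(1)] val[OF assms(1)] assms by blast

lemma val_comp:
  assumes f: "f \<in> Hom P x y" and g: "g \<in> Hom P y z"
  shows "val (g \<cdot> f) = val g \<cdot> val f"
proof (rule val_eqI[OF comp_Hom[OF f g] comp_Hom[OF val(1)[OF f] val(1)[OF g]]])
  have r: "repr x \<in> Ob P" using chart HomD[OF f] by (blast dest: HomD)
  note [simp] = HomD[OF f] HomD[OF g] HomD(1-3)[OF chart[OF HomD(4)[OF f]]]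
    HomD(1-3)[OF chart[OF HomD(5)[OF f]]] HomD(1-3)[OF chart[OF HomD(5)[OF g]]]
    HomD(1-3)[OF act_Hom[OF val(1)[OF f] r]] HomD(1-3)[OF act_Hom[OF val(1)[OF g] r]]
    repr_eq[OF f, symmetric]
  have "chart z \<cdot> (g \<cdot> f) = (chart z \<cdot> g) \<cdot> f" by simp
  also have "\<dots> = act (val g) (repr x) \<cdot> (chart y \<cdot> f)" unfolding val(2)[OF g] by simp
  also have "\<dots> = act (val g \<cdot> val f) (repr x) \<cdot> chart x"
    unfolding val(2)[OF f] using act_comp[OF val(1)[OF f] val(1)[OF g] r] by simp
  finally show "chart z \<cdot> (g \<cdot> f) = act (val g \<cdot> val f) (repr x) \<cdot> chart x" .
qed

lemma val_inj:
  assumes f: "f \<in> Hom P x y" and g: "g \<in> Hom P x y" and "val f = val g"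
  shows "f = g"
proof -
  have y: "y \<in> Ob P" using HomD[OF f] by blast
  show ?thesis using val(2)[OF f] val(2)[OF g] assms(3)
    by (intro mono_iso[OF iso[OF chart[OF y]] chart[OF y] f g]) argo
qed

lemma val_act:
  assumes a: "a \<in> Hom P unt unt" and x: "x \<in> Ob P"
  shows "val (act a x) = a"
  using val_eqI[OF act_Hom[OF a x] a] act_nat[OF a chart[OF x]] by blast

text \<open>The charts are chosen without regard to sums, so \<open>val\<close> respects sums only
  up to the coboundary of \<open>val (chart x \<oplus> chart y)\<close>. The sum of two
  automorphisms splits as one in each summand, and both act on the whole sum.\<close>

lemma val_plus:
  assumes f: "f \<in> Hom P x x'" and g: "g \<in> Hom P y y'"
  shows "val (chart x' \<oplus> chart y') \<cdot> val (f \<oplus> g) = (val f \<cdot> val g) \<cdot> val (chart x \<oplus> chart y)"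
proof -
  note o = HomD(4,5)[OF f] HomD(4,5)[OF g]
  let ?r = "repr x" and ?s = "repr y"
  note c = chart[OF o(1)] and c' = chart[OF o(2), folded repr_eq[OF f]]
    and d = chart[OF o(3)] and d' = chart[OF o(4), folded repr_eq[OF g]]
  note r = HomD(5)[OF c] and s = HomD(5)[OF d]
  note a = act_Hom[OF val(1)[OF f] r] and b = act_Hom[OF val(1)[OF g] s]
  note [simp] = HomD[OF f] HomD[OF g] HomD[OF c] HomD[OF c'] HomD[OF d] HomD[OF d'] HomD(1-3)[OF a] HomD(1-3)[OF b]
  have "(chart x' \<oplus> chart y') \<cdot> (f \<oplus> g) = (act (val f) ?r \<oplus> act (val g) ?s) \<cdot> (chart x \<oplus> chart y)"
    by (simp add: interchange val(2)[OF f] val(2)[OF g])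
  also have "act (val f) ?r \<oplus> act (val g) ?s =
      (act (val f) ?r \<oplus> Idt P ?s) \<cdot> (Idt P ?r \<oplus> act (val g) ?s)"
    by (simp add: interchange)
  also have "\<dots> = act (val f \<cdot> val g) (?r \<boxplus> ?s)"
    using act_comp[OF val(1)[OF g] val(1)[OF f] plus_Ob[OF r s]]
    by (simp add: act_plus_left[OF val(1)[OF f] r s] act_plus_right[OF val(1)[OF g] r s])
  finally have "val ((chart x' \<oplus> chart y') \<cdot> (f \<oplus> g)) =
      val (act (val f \<cdot> val g) (?r \<boxplus> ?s) \<cdot> (chart x \<oplus> chart y))" by simp
  then show ?thesis
    using val_comp[OF plus_Hom[OF f g] plus_Hom[OF c' d']]
      val_comp[OF plus_Hom[OF c d] act_Hom[OF comp_Hom[OF val(1)[OF g] val(1)[OF f]] plus_Ob[OF r s]]]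
      val_act[OF comp_Hom[OF val(1)[OF g] val(1)[OF f]] plus_Ob[OF r s]] by argo
qed

text \<open>A subgroup of formal sums that count as zero. The generators \<open>Inl f\<close> stand
  for values of morphisms, and \<open>Inr (x, y)\<close> absorbs the defect of values on sums.
  Calculating modulo a subgroup of a free abelian group, instead of in \<open>aut\<close>, puts all
  computations in one additive type where \<open>algebra_simps\<close> applies.\<close>

definition valuation :: "('q + 'p \<times> 'p \<Rightarrow>\<^sub>0 int) set \<Rightarrow> bool" where
  "valuation N \<longleftrightarrow> 0 \<in> N \<and> (\<forall>v\<in>N. \<forall>w\<in>N. v - w \<in> N) \<and>
     (\<forall>x y z. \<forall>f\<in>Hom P x y. \<forall>g\<in>Hom P y z.
        frag_of (Inl (g \<cdot> f)) - (frag_of (Inl g) + frag_of (Inl f)) \<in> N) \<and>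
     (\<forall>x x' y y'. \<forall>f\<in>Hom P x x'. \<forall>g\<in>Hom P y y'.
        frag_of (Inl (f \<oplus> g)) - (frag_of (Inl f) + frag_of (Inl g) +
          (frag_of (Inr (x', y')) - frag_of (Inr (x, y)))) \<in> N) \<and>
     (\<forall>x y. \<forall>f\<in>Hom P x y. \<forall>g\<in>Hom P x y. frag_of (Inl f) - frag_of (Inl g) \<in> N \<longrightarrow> f = g)"

text \<open>The kernel of the homomorphism to the abelian group \<open>aut\<close> that sends a
  morphism to its value and a pair (x, y) to the inverse of
  \<open>val (chart x \<oplus> chart y)\<close>. The last clause of \<open>valuation\<close> is
  injectivity of \<open>val\<close> on parallel morphisms.\<close>

lemma ex_valuation: "\<exists>N. valuation N"
proof -
  interpret A: comm_group aut by (rule comm_group_aut)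
  have carrier: "carrier aut = Hom P unt unt" and mult: "x \<otimes>\<^bsub>aut\<^esub> y = x \<cdot> y" for x y
    by (simp_all add: aut_def)
  define k where "k x y = val (chart x \<oplus> chart y)" for x y
  \<comment> \<open>The free group is taken on a whole type, so elements outside the arrows and
    objects of \<open>P\<close> are sent to one.\<close>
  define e where "e = (\<lambda>s. case s of Inl f \<Rightarrow> if f \<in> Ar P then val f else \<one>\<^bsub>aut\<^esub>
    | Inr (x, y) \<Rightarrow> if x \<in> Ob P \<and> y \<in> Ob P then inv\<^bsub>aut\<^esub> k x y else \<one>\<^bsub>aut\<^esub>)"
  have kc: "k x y \<in> carrier aut" if "x \<in> Ob P" "y \<in> Ob P" for x y
    unfolding k_def carrier by (rule val(1)[OF plus_Hom[OF chart[OF that(1)] chart[OF that(2)]]])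
  have vc: "val f \<in> carrier aut" if "f \<in> Hom P x y" for f x y
    unfolding carrier by (rule val(1)[OF that])
  have ec: "e s \<in> carrier aut" for s
    using kc vc[OF Ar_Hom] by (auto simp: e_def split: sum.splits)
  obtain h where h: "h \<in> hom (free_Abelian_group UNIV) aut" and he: "\<And>s. h (frag_of s) = e s"
    using A.free_Abelian_group_universal[of e UNIV] ec by auto
  have hc: "h v \<in> carrier aut" for v using h by (auto simp: hom_def free_Abelian_group_def)
  have hadd: "h (v + w) = h v \<otimes>\<^bsub>aut\<^esub> h w" for v w
    using h by (auto simp: hom_def free_Abelian_group_def)
  have h0: "h 0 = \<one>\<^bsub>aut\<^esub>" using hadd[of 0 0] hc[of 0] by (simp add: A.l_cancel_one)
  have hdiff: "h (v - w) = \<one>\<^bsub>aut\<^esub> \<longleftrightarrow> h v = h w" for v w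
    using hadd[of "v - w" w] hc[of w] hc[of "v - w"] by (simp add: A.r_cancel_one)
  have hf: "h (frag_of (Inl f)) = val f" if "f \<in> Hom P x y" for f x y
    using HomD[OF that] by (simp add: he e_def)
  have "valuation {v. h v = \<one>\<^bsub>aut\<^esub>}"
    unfolding valuation_def
  proof (intro conjI ballI allI impI CollectI)
    show "h 0 = \<one>\<^bsub>aut\<^esub>" by (rule h0)
    show "h (v - w) = \<one>\<^bsub>aut\<^esub>" if "v \<in> {v. h v = \<one>\<^bsub>aut\<^esub>}" "w \<in> {v. h v = \<one>\<^bsub>aut\<^esub>}" for v w
      using that hdiff by simp
    fix x y z f g assume f: "f \<in> Hom P x y" and g: "g \<in> Hom P y z"
    show "h (frag_of (Inl (g \<cdot> f)) - (frag_of (Inl g) + frag_of (Inl f))) = \<one>\<^bsub>aut\<^esub>"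
      by (simp add: hdiff hadd hf[OF f] hf[OF g] hf[OF comp_Hom[OF f g]] val_comp[OF f g] mult)
  next
    fix x x' y y' f g assume f: "f \<in> Hom P x x'" and g: "g \<in> Hom P y y'"
    note o = HomD(4,5)[OF f] HomD(4,5)[OF g]
    have hi: "h (frag_of (Inr (a, b))) = inv\<^bsub>aut\<^esub> k a b" if "a \<in> Ob P" "b \<in> Ob P" for a b
      using that by (simp add: he e_def)
    have "h (frag_of (Inl (f \<oplus> g)) + frag_of (Inr (x, y))) =
        h (frag_of (Inl f) + frag_of (Inl g) + frag_of (Inr (x', y')))"
    proof -
      note c = kc[OF o(2,4)] kc[OF o(1,3)] vc[OF f] vc[OF g] vc[OF plus_Hom[OF f g]]
      have "k x' y' \<otimes>\<^bsub>aut\<^esub> val (f \<oplus> g) = (val f \<otimes>\<^bsub>aut\<^esub> val g) \<otimes>\<^bsub>aut\<^esub> k x y"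
        using val_plus[OF f g] by (simp add: mult k_def)
      then have "val (f \<oplus> g) = inv\<^bsub>aut\<^esub> k x' y' \<otimes>\<^bsub>aut\<^esub> ((val f \<otimes>\<^bsub>aut\<^esub> val g) \<otimes>\<^bsub>aut\<^esub> k x y)"
        using c by (metis A.inv_solve_left A.m_closed)
      moreover have "k x y \<otimes>\<^bsub>aut\<^esub> (inv\<^bsub>aut\<^esub> k x' y' \<otimes>\<^bsub>aut\<^esub> inv\<^bsub>aut\<^esub> k x y) = inv\<^bsub>aut\<^esub> k x' y'"
        using c A.m_lcomm[of "k x y" "inv\<^bsub>aut\<^esub> k x' y'" "inv\<^bsub>aut\<^esub> k x y"] by simp
      ultimately have "val (f \<oplus> g) \<otimes>\<^bsub>aut\<^esub> inv\<^bsub>aut\<^esub> k x y = val f \<otimes>\<^bsub>aut\<^esub> val g \<otimes>\<^bsub>aut\<^esub> inv\<^bsub>aut\<^esub> k x' y'"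
        using c by (simp add: A.m_ac)
      then show ?thesis
        by (simp add: hadd hi o hf[OF f] hf[OF g] hf[OF plus_Hom[OF f g]])
    qed
    then have "h ((frag_of (Inl (f \<oplus> g)) + frag_of (Inr (x, y))) -
        (frag_of (Inl f) + frag_of (Inl g) + frag_of (Inr (x', y')))) = \<one>\<^bsub>aut\<^esub>"
      by (simp only: hdiff)
    then show "h (frag_of (Inl (f \<oplus> g)) - (frag_of (Inl f) + frag_of (Inl g) +
          (frag_of (Inr (x', y')) - frag_of (Inr (x, y))))) = \<one>\<^bsub>aut\<^esub>"
      by (simp add: algebra_simps)
  next
    fix x y f g assume f: "f \<in> Hom P x y" and g: "g \<in> Hom P x y"
      and "frag_of (Inl f) - frag_of (Inl g) \<in> {v. h v = \<one>\<^bsub>aut\<^esub>}"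
    then show "f = g" using hf[OF f] hf[OF g] val_inj[OF f g] by (simp add: hdiff)
  qed
  then show ?thesis by blast
qed

definition nul :: "('q + 'p \<times> 'p \<Rightarrow>\<^sub>0 int) set" where
  "nul = (SOME N. valuation N)"

lemma valuation_nul: "valuation nul"
  unfolding nul_def by (rule someI_ex[OF ex_valuation])

lemma nul_zero: "0 \<in> nul"
  using valuation_nul by (simp add: valuation_def)

lemma nul_diff: "v \<in> nul \<Longrightarrow> w \<in> nul \<Longrightarrow> v - w \<in> nul"
  using valuation_nul by (simp add: valuation_def)

lemma nul_minus: "v \<in> nul \<Longrightarrow> - v \<in> nul"
  using nul_diff[OF nul_zero] by fastforce

lemma nul_add: "v \<in> nul \<Longrightarrow> w \<in> nul \<Longrightarrow> v + w \<in> nul"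
  using nul_diff[OF _ nul_minus, of v w] by simp

text \<open>\<open>judge f x y v\<close>: the morphism \<open>f : x \<rightarrow> y\<close> has value \<open>v\<close>. Since \<open>Aut(0)\<close> is abelian, equations
  between parallel morphisms become linear equations between values.\<close>

definition judge :: "'q \<Rightarrow> 'p \<Rightarrow> 'p \<Rightarrow> ('q + 'p \<times> 'p \<Rightarrow>\<^sub>0 int) \<Rightarrow> bool" where
  "judge f x y v \<longleftrightarrow> f \<in> Hom P x y \<and> frag_of (Inl f) - v \<in> nul"

abbreviation kap :: "'p \<Rightarrow> 'p \<Rightarrow> ('q + 'p \<times> 'p \<Rightarrow>\<^sub>0 int)" where
  "kap x y \<equiv> frag_of (Inr (x, y))"

abbreviation ev :: "'q \<Rightarrow> ('q + 'p \<times> 'p \<Rightarrow>\<^sub>0 int)" where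
  "ev f \<equiv> frag_of (Inl f)"

lemma judge_base: "f \<in> Hom P x y \<Longrightarrow> judge f x y (ev f)"
  by (simp add: judge_def nul_zero)

lemma judge_Hom: "judge f x y v \<Longrightarrow> f \<in> Hom P x y"
  by (simp add: judge_def)

lemma judge_comp:
  assumes "judge f x y v" "judge g y z w"
  shows "judge (g \<cdot> f) x z (w + v)"
proof -
  note f = judge_Hom[OF assms(1)] and g = judge_Hom[OF assms(2)]
  have "ev (g \<cdot> f) - (ev g + ev f) \<in> nul"
    using valuation_nul f g unfolding valuation_def by blast
  from nul_add[OF nul_add[OF this assms(1)[unfolded judge_def, THEN conjunct2]]
      assms(2)[unfolded judge_def, THEN conjunct2]]
  have "ev (g \<cdot> f) - (w + v) \<in> nul" by (simp add: algebra_simps)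
  then show ?thesis using comp_Hom[OF f g] by (simp add: judge_def)
qed

lemma judge_plus:
  assumes "judge f x x' v" "judge g y y' w"
  shows "judge (f \<oplus> g) (x \<boxplus> y) (x' \<boxplus> y') (v + w + (kap x' y' - kap x y))"
proof -
  note f = judge_Hom[OF assms(1)] and g = judge_Hom[OF assms(2)]
  have "ev (f \<oplus> g) - (ev f + ev g + (kap x' y' - kap x y)) \<in> nul"
    using valuation_nul f g unfolding valuation_def by blast
  from nul_add[OF nul_add[OF this assms(1)[unfolded judge_def, THEN conjunct2]]
      assms(2)[unfolded judge_def, THEN conjunct2]]
  have "ev (f \<oplus> g) - (v + w + (kap x' y' - kap x y)) \<in> nul" by (simp add: algebra_simps)
  then show ?thesis using plus_Hom[OF f g] by (simp add: judge_def)
qed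

lemma judge_unique:
  assumes "judge f x y v" "judge f x y w"
  shows "v - w \<in> nul"
  using nul_diff[OF assms(2)[unfolded judge_def, THEN conjunct2] assms(1)[unfolded judge_def, THEN conjunct2]]
  by simp

lemma judge_value: "judge f x y v \<Longrightarrow> v - w \<in> nul \<Longrightarrow> judge f x y w"
  using nul_add[of "ev f - v" "v - w"] by (simp add: judge_def)

text \<open>An identity is idempotent, hence twice its value equals its value.\<close>

lemma judge_id: "x \<in> Ob P \<Longrightarrow> judge (Idt P x) x x 0"
proof -
  assume x: "x \<in> Ob P"
  note j = judge_base[OF id_Hom[OF x]]
  have "ev (Idt P x) - (ev (Idt P x) + ev (Idt P x)) \<in> nul"
    by (rule judge_unique[OF j]) (use judge_comp[OF j j] x in simp)
  from nul_minus[OF this] show ?thesis using j judge_value by fastforce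
qed

lemma judge_eq:
  assumes "judge f x y v" "judge g x y w" "v - w \<in> nul"
  shows "f = g"
proof -
  from judge_value[OF assms(1,3)] assms(2) have "ev f - w \<in> nul" "ev g - w \<in> nul"
    by (auto simp: judge_def)
  from nul_diff[OF this] have "ev f - ev g \<in> nul" by simp
  then show ?thesis using valuation_nul judge_Hom[OF assms(1)] judge_Hom[OF assms(2)]
    unfolding valuation_def by blast
qed

lemma judge_eqD:
  assumes "f = g" "judge f x y v" "judge g x y w"
  shows "v - w \<in> nul"
  using judge_unique assms by blast

end

section \<open>Monoidal coherence in linear form\<close>

context picard
begin

text \<open>Values of the structure isomorphisms, corrected by terms in \<open>kap\<close> so that they are invariant
  under isomorphisms of the objects involved.\<close>

definition asc where
  "asc a b c = ev (assoc P a b c) + kap a b + kap (a \<boxplus> b) c - (kap b c + kap a (b \<boxplus> c))"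
definition lu where "lu a = ev (lunit P a) + kap unt a"
definition ru where "ru a = ev (runit P a) + kap a unt"
definition sy where "sy a b = ev (symm P a b) + kap a b - kap b a"

lemma judge_assoc: "a \<in> Ob P \<Longrightarrow> b \<in> Ob P \<Longrightarrow> c \<in> Ob P \<Longrightarrow>
    judge (assoc P a b c) ((a \<boxplus> b) \<boxplus> c) (a \<boxplus> (b \<boxplus> c))
      (asc a b c + (kap b c + kap a (b \<boxplus> c)) - (kap a b + kap (a \<boxplus> b) c))"
  and judge_lunit: "a \<in> Ob P \<Longrightarrow> judge (lunit P a) (unt \<boxplus> a) a (lu a - kap unt a)"
  and judge_runit: "a \<in> Ob P \<Longrightarrow> judge (runit P a) (a \<boxplus> unt) a (ru a - kap a unt)"
  and judge_symm: "a \<in> Ob P \<Longrightarrow> b \<in> Ob P \<Longrightarrow>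
    judge (symm P a b) (a \<boxplus> b) (b \<boxplus> a) (sy a b + kap b a - kap a b)"
  using judge_base[OF assoc_Hom[of a b c]] judge_base[OF lunit_Hom[of a]]
    judge_base[OF runit_Hom[of a]] judge_base[OF symm_Hom[of a b]]
  by (simp_all add: asc_def lu_def ru_def sy_def)

lemma inv_assoc:
  assumes "a \<in> Ob P" "b \<in> Ob P" "c \<in> Ob P"
  shows "inv_assoc P a b c \<in> Hom P (a \<boxplus> (b \<boxplus> c)) ((a \<boxplus> b) \<boxplus> c)"
    and "inv_assoc P a b c \<cdot> assoc P a b c = Idt P ((a \<boxplus> b) \<boxplus> c)"
proof -
  note a = assoc_Hom[OF assms]
  note v = vinv[OF iso[OF a] a]
  have "f = vinv (assoc P a b c)" if "f \<in> Hom P (a \<boxplus> (b \<boxplus> c)) ((a \<boxplus> b) \<boxplus> c)"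
    "f \<cdot> assoc P a b c = Idt P ((a \<boxplus> b) \<boxplus> c)" for f
    using epi_iso[OF iso[OF a] a that(1) v(1)] that(2) v(2) by argo
  then have "\<exists>!f. f \<in> Hom P (a \<boxplus> (b \<boxplus> c)) ((a \<boxplus> b) \<boxplus> c) \<and>
      f \<cdot> assoc P a b c = Idt P ((a \<boxplus> b) \<boxplus> c)" using v by blast
  from theI'[OF this] show "inv_assoc P a b c \<in> Hom P (a \<boxplus> (b \<boxplus> c)) ((a \<boxplus> b) \<boxplus> c)"
    "inv_assoc P a b c \<cdot> assoc P a b c = Idt P ((a \<boxplus> b) \<boxplus> c)" unfolding inv_assoc_def by auto
qed

lemma nul_subI: "w \<in> nul \<Longrightarrow> v - w \<in> nul \<Longrightarrow> v \<in> nul"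
  using nul_add[of "v - w" w] by simp

lemma nul_addI: "w \<in> nul \<Longrightarrow> v + w \<in> nul \<Longrightarrow> v \<in> nul"
  using nul_diff[of "v + w" w] by simp

lemma nul_eqI: "v = w \<Longrightarrow> v - w \<in> nul"
  by (simp add: nul_zero)

lemma judge_inverse:
  assumes "judge f x y v" "g \<in> Hom P y x" "g \<cdot> f = Idt P x"
  shows "judge g y x (- v)"
proof -
  have x: "x \<in> Ob P" using HomD[OF assms(2)] by blast
  note j = judge_base[OF assms(2)]
  have "ev g + v - 0 \<in> nul" by (rule judge_eqD[OF assms(3) judge_comp[OF assms(1) j] judge_id[OF x]])
  then show ?thesis using j judge_value[OF j, of "- v"] by simp
qed

lemma judge_inv_assoc: "a \<in> Ob P \<Longrightarrow> b \<in> Ob P \<Longrightarrow> c \<in> Ob P \<Longrightarrow>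
    judge (inv_assoc P a b c) (a \<boxplus> (b \<boxplus> c)) ((a \<boxplus> b) \<boxplus> c)
      (- (asc a b c + (kap b c + kap a (b \<boxplus> c)) - (kap a b + kap (a \<boxplus> b) c)))"
  by (rule judge_inverse[OF judge_assoc inv_assoc])

text \<open>These rules follow the syntax of a morphism, so that applying them repeatedly computes
  its source, target and value.\<close>

lemmas judge_rules = judge_comp judge_plus judge_id judge_assoc judge_inv_assoc judge_lunit
  judge_runit judge_symm plus_Ob unit_Ob

text \<open>The premise on the difference of values leaves room for cancelling the
  \<open>kap\<close> terms, which occur on both sides of any equation between parallel morphisms,
  before the relation is recorded.\<close>

lemma judge_eqD':
  assumes "f = g" "judge f x y v" "judge g x y w" "v - w = u"
  shows "u \<in> nul"
  using judge_eqD[OF assms(1-3)] assms(4) by simp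

lemma judge_eqI':
  assumes "judge f x y v" "judge g x y w" "v - w = u" "u \<in> nul"
  shows "f = g"
  using judge_eq[OF assms(1,2)] assms(3,4) by simp

lemma lin_pentagon:
  assumes ob: "a \<in> Ob P" "b \<in> Ob P" "c \<in> Ob P" "d \<in> Ob P"
  shows "asc a b (c \<boxplus> d) + asc (a \<boxplus> b) c d - (asc b c d + asc a (b \<boxplus> c) d + asc a b c) \<in> nul"
  by (rule judge_eqD'[OF pentagon[OF ob]], (rule judge_rules ob)+, simp add: algebra_simps)

lemma lin_triangle:
  assumes ob: "a \<in> Ob P" "b \<in> Ob P"
  shows "lu b + asc a unt b - ru a \<in> nul"
  by (rule judge_eqD'[OF triangle[OF ob]], (rule judge_rules ob)+, simp add: algebra_simps)

lemma lin_hexagon: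
  assumes ob: "a \<in> Ob P" "b \<in> Ob P" "c \<in> Ob P"
  shows "asc b c a + sy a (b \<boxplus> c) + asc a b c - (sy a c + asc b a c + sy a b) \<in> nul"
  by (rule judge_eqD'[OF hexagon[OF ob]], (rule judge_rules ob)+, simp add: algebra_simps)

lemma lin_symm:
  assumes ob: "a \<in> Ob P" "b \<in> Ob P"
  shows "sy a b + sy b a \<in> nul"
  by (rule judge_eqD'[OF symm_symm[OF ob(2,1)]], (rule judge_rules ob)+, simp add: algebra_simps)

lemma lin_assoc_nat:
  assumes f: "f \<in> Hom P a a'" and g: "g \<in> Hom P b b'" and h: "h \<in> Hom P c c'"
  shows "asc a' b' c' - asc a b c \<in> nul"
  by (rule judge_eqD'[OF assoc_nat[OF f g h]],
      (rule judge_rules judge_base f g h HomD(4,5)[OF f] HomD(4,5)[OF g] HomD(4,5)[OF h])+,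
      simp add: algebra_simps)

lemma lin_lunit_nat:
  assumes f: "f \<in> Hom P a a'"
  shows "lu a' - lu a \<in> nul"
  by (rule judge_eqD'[OF lunit_nat[OF f]],
      (rule judge_rules judge_base f HomD(4,5)[OF f])+, simp add: algebra_simps)

lemma lin_runit_nat:
  assumes f: "f \<in> Hom P a a'"
  shows "ru a' - ru a \<in> nul"
  by (rule judge_eqD'[OF runit_nat[OF f]],
      (rule judge_rules judge_base f HomD(4,5)[OF f])+, simp add: algebra_simps)

lemma lin_symm_nat:
  assumes f: "f \<in> Hom P a a'" and g: "g \<in> Hom P b b'"
  shows "sy a' b' - sy a b \<in> nul"
  by (rule judge_eqD'[OF symm_nat[OF f g]],
      (rule judge_rules judge_base f g HomD(4,5)[OF f] HomD(4,5)[OF g])+, simp add: algebra_simps)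

text \<open>A known relation may enter a combination with either sign, and both signs are offered.
  Where these rules are followed by \<open>fail\<close>, a choice of signs that leaves a goal open
  is rejected and the search goes on to the next choice.\<close>

lemmas nul_I = nul_subI nul_addI

text \<open>Kelly's argument: the pentagon at two units, with the triangle axiom twice, gives the
  left unit of a sum up to naturality of the associator.\<close>

lemma lin_lunit_plus:
  assumes ob: "a \<in> Ob P" "b \<in> Ob P"
  shows "lu (a \<boxplus> b) + asc unt a b - lu a \<in> nul"
  by (rule nul_addI[OF lin_pentagon[OF unit_Ob unit_Ob ob]],
      rule nul_subI[OF lin_triangle[OF unit_Ob plus_Ob[OF ob]]],
      rule nul_addI[OF lin_triangle[OF unit_Ob ob(1)]],
      rule nul_subI[OF lin_assoc_nat[OF lunit_Hom[OF unit_Ob] id_Hom[OF ob(1)] id_Hom[OF ob(2)]]] nul_addI[OF lin_assoc_nat[OF lunit_Hom[OF unit_Ob] id_Hom[OF ob(1)] id_Hom[OF ob(2)]]],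
      rule nul_subI[OF lin_assoc_nat[OF id_Hom[OF unit_Ob] lunit_Hom[OF ob(1)] id_Hom[OF ob(2)]]] nul_addI[OF lin_assoc_nat[OF id_Hom[OF unit_Ob] lunit_Hom[OF ob(1)] id_Hom[OF ob(2)]]],
      simp add: algebra_simps nul_zero; fail)

end

context picard
begin

lemma lin_runit_plus:
  assumes ob: "a \<in> Ob P" "b \<in> Ob P"
  shows "ru (a \<boxplus> b) - (ru b + asc a b unt) \<in> nul"
  by (rule judge_eqD'[OF runit_plus[OF ob]], (rule judge_rules ob)+, simp add: algebra_simps)

lemma lin_unit: "lu unt - ru unt \<in> nul"
  by (rule nul_I[OF lin_lunit_plus[OF unit_Ob unit_Ob]],
      rule nul_I[OF lin_lunit_nat[OF lunit_Hom[OF unit_Ob]]],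
      rule nul_I[OF lin_triangle[OF unit_Ob unit_Ob]],
      simp add: algebra_simps nul_zero; fail)

text \<open>In the hexagon for a and two units the symmetry of a with 0 + 0 agrees with that of a
  with 0, so one of the symmetries cancels; the unit laws for sums do the rest.\<close>

lemma lin_symm_unit:
  assumes ob: "a \<in> Ob P"
  shows "lu a - (ru a + sy unt a) \<in> nul"
  by (rule nul_I[OF lin_hexagon[OF ob unit_Ob unit_Ob]],
      rule nul_I[OF lin_symm_nat[OF id_Hom[OF ob] lunit_Hom[OF unit_Ob]]],
      rule nul_I[OF lin_lunit_plus[OF unit_Ob ob]],
      rule nul_I[OF lin_lunit_plus[OF ob unit_Ob]],
      rule nul_I[OF lin_lunit_nat[OF symm_Hom[OF ob unit_Ob]]],
      rule nul_I[OF lin_triangle[OF ob unit_Ob]],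
      rule nul_I[OF lin_symm[OF ob unit_Ob]],
      simp add: algebra_simps nul_zero; fail)

text \<open>The value of the canonical isomorphism \<open>(a + b) + c \<rightarrow> (a + c) + b\<close>.\<close>

definition sh where "sh a b c = asc a b c + sy b c - asc a c b"

lemma lin_sh_nat:
  assumes f: "f \<in> Hom P a a'" and g: "g \<in> Hom P b b'" and h: "h \<in> Hom P c c'"
  shows "sh a' b' c' - sh a b c \<in> nul"
  unfolding sh_def
  by (rule nul_subI[OF lin_assoc_nat[OF f g h]], rule nul_addI[OF lin_assoc_nat[OF f h g]],
      rule nul_subI[OF lin_symm_nat[OF g h]], simp add: algebra_simps nul_zero)

text \<open>A unit summand may be dropped at once, or first shuffled behind b and then
  dropped.\<close>

lemma lin_runit_sh:
  assumes ob: "a \<in> Ob P" "b \<in> Ob P"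
  shows "ru (a \<boxplus> b) + sh a unt b - ru a \<in> nul"
  unfolding sh_def
  by (rule nul_I[OF lin_runit_plus[OF ob]], rule nul_I[OF lin_symm_unit[OF ob(2)]],
      rule nul_I[OF lin_triangle[OF ob]], simp add: algebra_simps nul_zero; fail)

text \<open>Two routes from ((s + t) + w) + x to s + ((t + x) + w): the exchange of w and x may take
  place inside or outside the bracket with s.\<close>

lemma lin_sh_assoc_left:
  assumes ob: "s \<in> Ob P" "t \<in> Ob P" "w \<in> Ob P" "x \<in> Ob P"
  shows "asc s (t \<boxplus> w) x + asc s t w + sh t w x - (asc s (t \<boxplus> x) w + asc s t x + sh (s \<boxplus> t) w x) \<in> nul"
  unfolding sh_def
  by (rule nul_I[OF lin_pentagon[OF ob]], rule nul_I[OF lin_pentagon[OF ob(1,2,4,3)]],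
      rule nul_I[OF lin_assoc_nat[OF id_Hom[OF ob(1)] id_Hom[OF ob(2)] symm_Hom[OF ob(3,4)]]],
      simp add: algebra_simps nul_zero; fail)

lemma lin_symm_plus_right:
  assumes ob: "s \<in> Ob P" "t \<in> Ob P" "x \<in> Ob P"
  shows "sy s (t \<boxplus> x) + asc s t x - (sh t s x + sy s t) \<in> nul"
  unfolding sh_def
  by (rule nul_I[OF lin_hexagon[OF ob]], simp add: algebra_simps nul_zero; fail)

lemma lin_symm_plus_left:
  assumes ob: "s \<in> Ob P" "w \<in> Ob P" "x \<in> Ob P"
  shows "asc x s w + sy s x + sy w x + asc s w x - (asc s x w + sy (s \<boxplus> w) x) \<in> nul"
  by (rule nul_I[OF lin_hexagon[OF ob(3,1,2)]], rule nul_I[OF lin_symm[OF ob(1,3)]],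
      rule nul_I[OF lin_symm[OF ob(2,3)]], rule nul_I[OF lin_symm[OF plus_Ob[OF ob(1,2)] ob(3)]],
      simp add: algebra_simps nul_zero; fail)

text \<open>Two routes from ((t + s) + w) + x to (t + x) + (s + w): x passes w and s one after the
  other, or passes s + w as a whole.\<close>

lemma lin_sh_assoc_right:
  assumes ob: "s \<in> Ob P" "t \<in> Ob P" "w \<in> Ob P" "x \<in> Ob P"
  shows "asc (t \<boxplus> x) s w + sh t s x + sh (t \<boxplus> s) w x - (sh t (s \<boxplus> w) x + asc t s w) \<in> nul"
  unfolding sh_def
  by (rule nul_I[OF lin_symm_plus_left[OF ob(1,3,4)]],
      rule nul_I[OF lin_pentagon[OF ob(2,4,1,3)]], rule nul_I[OF lin_pentagon[OF ob(2,1,4,3)]],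
      rule nul_I[OF lin_pentagon[OF ob(2,1,3,4)]],
      rule nul_I[OF lin_assoc_nat[OF id_Hom[OF ob(2)] symm_Hom[OF ob(4,1)] id_Hom[OF ob(3)]]],
      rule nul_I[OF lin_assoc_nat[OF id_Hom[OF ob(2)] id_Hom[OF ob(1)] symm_Hom[OF ob(3,4)]]],
      simp add: algebra_simps nul_zero; fail)

text \<open>The isomorphism l makes s + w a unit, so by naturality of the shuffle x passes s + w as
  it would pass a unit (\<open>lin_runit_sh\<close>). This, with \<open>lin_co\<close>, is the
  coherence left over in \<open>square_equation\<close> once all data have cancelled.\<close>

lemma lin_rotation:
  assumes ob: "s \<in> Ob P" "t \<in> Ob P" "w \<in> Ob P" "x \<in> Ob P" and l: "l \<in> Hom P (s \<boxplus> w) unt"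
  shows "sh t w x + asc s (t \<boxplus> w) x + asc s t w + ru (t \<boxplus> x) + asc (t \<boxplus> x) s w + sy s (t \<boxplus> x) -
    (ru t + asc t s w + sy s t + asc s (t \<boxplus> x) w) \<in> nul"
  by (rule nul_I[OF lin_sh_assoc_left[OF ob]], rule nul_I[OF lin_symm_plus_right[OF ob(1,2,4)]],
      rule nul_I[OF lin_sh_assoc_right[OF ob]],
      rule nul_I[OF lin_sh_nat[OF symm_Hom[OF ob(1,2)] id_Hom[OF ob(3)] id_Hom[OF ob(4)]]],
      rule nul_I[OF lin_sh_nat[OF id_Hom[OF ob(2)] l id_Hom[OF ob(4)]]],
      rule nul_I[OF lin_runit_sh[OF ob(2,4)]],
      simp add: algebra_simps nul_zero; fail)

text \<open>The value of \<open>coas\<close> corrected by \<open>kap\<close> terms, with one summand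
  for each nontrivial factor in the definition of \<open>coas\<close>.\<close>

definition co where
  "co a b c d = asc a b (c \<boxplus> d) - asc b c d + sy b c + asc c b d - asc a c (b \<boxplus> d)"

lemma judge_coas:
  assumes ob: "a \<in> Ob P" "b \<in> Ob P" "c \<in> Ob P" "d \<in> Ob P"
  shows "judge (coas P a b c d) ((a \<boxplus> b) \<boxplus> (c \<boxplus> d)) ((a \<boxplus> c) \<boxplus> (b \<boxplus> d))
    (co a b c d + (kap a c + kap b d + kap (a \<boxplus> c) (b \<boxplus> d)) - (kap a b + kap c d + kap (a \<boxplus> b) (c \<boxplus> d)))"
  unfolding coas_def co_def
  by (rule judge_value, (rule judge_rules ob)+, simp add: algebra_simps nul_zero)

text \<open>Two routes from ((a + b) + c) + d to (a + c) + (b + d): the exchange of b and c after or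
  before reassociating with d.\<close>

lemma lin_co:
  assumes ob: "a \<in> Ob P" "b \<in> Ob P" "c \<in> Ob P" "d \<in> Ob P"
  shows "co a b c d + asc (a \<boxplus> b) c d - (asc (a \<boxplus> c) b d + sh a b c) \<in> nul"
  unfolding co_def sh_def
  by (rule nul_I[OF lin_pentagon[OF ob]], rule nul_I[OF lin_pentagon[OF ob(1,3,2,4)]],
      rule nul_I[OF lin_assoc_nat[OF id_Hom[OF ob(1)] symm_Hom[OF ob(2,3)] id_Hom[OF ob(4)]]],
      simp add: algebra_simps nul_zero; fail)

lemma lin_co_nat:
  assumes f: "f \<in> Hom P a a'" and g: "g \<in> Hom P b b'" and h: "h \<in> Hom P c c'" and k: "k \<in> Hom P d d'"
  shows "co a' b' c' d' - co a b c d \<in> nul"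
  unfolding co_def
  by (rule nul_subI[OF lin_assoc_nat[OF f g plus_Hom[OF h k]]], rule nul_addI[OF lin_assoc_nat[OF g h k]],
      rule nul_subI[OF lin_symm_nat[OF g h]], rule nul_subI[OF lin_assoc_nat[OF h g k]],
      rule nul_addI[OF lin_assoc_nat[OF f h plus_Hom[OF g k]]],
      simp add: algebra_simps nul_zero)

lemma lin_co_involutive:
  assumes ob: "a \<in> Ob P" "b \<in> Ob P" "c \<in> Ob P" "d \<in> Ob P"
  shows "co a b c d + co a c b d \<in> nul"
  unfolding co_def
  by (rule nul_I[OF lin_symm[OF ob(2,3)]], simp add: algebra_simps nul_zero; fail)

text \<open>With units at both ends, the exchange (0 + a) + (b + 0) to (0 + b) + (a + 0) is the
  symmetry once the units are dropped.\<close>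

lemma lin_co_unit:
  assumes ob: "a \<in> Ob P" "b \<in> Ob P"
  shows "lu b + ru a + co unt a b unt - (lu a + ru b + sy a b) \<in> nul"
  by (rule nul_I[OF lin_co[OF unit_Ob ob unit_Ob]],
      rule nul_I[OF lin_runit_plus[OF plus_Ob[OF unit_Ob ob(1)] ob(2)]],
      rule nul_I[OF lin_runit_plus[OF plus_Ob[OF unit_Ob ob(2)] ob(1)]],
      rule nul_I[OF lin_lunit_plus[OF ob]], rule nul_I[OF lin_lunit_plus[OF ob(2,1)]],
      rule nul_I[OF lin_lunit_nat[OF symm_Hom[OF ob]]],
      rule nul_I[OF lin_runit_nat[OF comp_Hom[OF plus_Hom[OF lunit_Hom[OF ob(1)] id_Hom[OF ob(2)]] symm_Hom[OF ob]]]],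
      rule nul_I[OF lin_runit_nat[OF plus_Hom[OF lunit_Hom[OF ob(2)] id_Hom[OF ob(1)]]]],
      simp add: sh_def algebra_simps nul_zero; fail)


text \<open>The algebra behind \<open>det.square\<close>, where s, t, w, x, v are the values at
  \<Sigma>z', z'', z', x'', x'. \<open>oct1\<close> and \<open>oct2\<close> express the pairs row2,
  col1 and col2, row1 through aa; \<open>oct3\<close> trades e for row3 and rotated data;
  \<open>rot1\<close> and \<open>rot2\<close> trade these for col3 and b. The contraction l enters
  both rotations and cancels.\<close>

lemma square_equation:
  assumes ob: "s \<in> Ob P" "t \<in> Ob P" "w \<in> Ob P" "x \<in> Ob P" "v \<in> Ob P"
    and l: "l \<in> Hom P (s \<boxplus> w) unt"
    and col3: "col3 \<in> Hom P (t \<boxplus> w) z" and row3: "row3 \<in> Hom P (t \<boxplus> x) y"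
    and e: "e \<in> Hom P (z \<boxplus> x) A" and b: "b \<in> Hom P (y \<boxplus> w) A"
    and r: "r \<in> Hom P (s \<boxplus> z) t" and q: "q \<in> Hom P (s \<boxplus> A) y"
    and aa: "aa \<in> Hom P (A \<boxplus> v) B" and row2: "row2 \<in> Hom P (z \<boxplus> k) B" and col1: "col1 \<in> Hom P (x \<boxplus> v) k"
    and col2: "col2 \<in> Hom P (y \<boxplus> h) B" and row1: "row1 \<in> Hom P (w \<boxplus> v) h"
    and oct1: "aa \<cdot> (e \<oplus> Idt P v) = row2 \<cdot> (Idt P z \<oplus> col1) \<cdot> assoc P z x v"
    and oct2: "aa \<cdot> (b \<oplus> Idt P v) = col2 \<cdot> (Idt P y \<oplus> row1) \<cdot> assoc P y w v"
    and oct3: "row3 \<cdot> (r \<oplus> Idt P x) = q \<cdot> (Idt P s \<oplus> e) \<cdot> assoc P s z x"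
    and rot1: "r \<cdot> (Idt P s \<oplus> col3) \<cdot> assoc P s t w =
      runit P t \<cdot> (Idt P t \<oplus> l) \<cdot> assoc P t s w \<cdot> (symm P s t \<oplus> Idt P w)"
    and rot2: "q \<cdot> (Idt P s \<oplus> b) \<cdot> assoc P s y w =
      runit P y \<cdot> (Idt P y \<oplus> l) \<cdot> assoc P y s w \<cdot> (symm P s y \<oplus> Idt P w)"
  shows "row2 \<cdot> (col3 \<oplus> col1) = col2 \<cdot> (row3 \<oplus> row1) \<cdot> coas P t w x v"
proof -
  note o = ob HomD(5)[OF col3] HomD(5)[OF row3] HomD(5)[OF e] HomD(5)[OF col1] HomD(5)[OF row1]
  note j = judge_rules o judge_base[OF l] judge_base[OF col3] judge_base[OF row3] judge_base[OF e]
    judge_base[OF b] judge_base[OF r] judge_base[OF q] judge_base[OF aa] judge_base[OF row2]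
    judge_base[OF col1] judge_base[OF col2] judge_base[OF row1] judge_coas
  have 1: "ev aa + ev e + kap A v + kap z x - (ev row2 + ev col1 + kap z k + kap x v + asc z x v) \<in> nul"
    by (rule judge_eqD'[OF oct1], (rule j)+, simp add: algebra_simps)
  have 2: "ev aa + ev b + kap A v + kap y w - (ev col2 + ev row1 + kap y h + kap w v + asc y w v) \<in> nul"
    by (rule judge_eqD'[OF oct2], (rule j)+, simp add: algebra_simps)
  have 3: "ev row3 + ev r + kap t x + kap s z - (ev q + ev e + kap s A + kap z x + asc s z x) \<in> nul"
    by (rule judge_eqD'[OF oct3], (rule j)+, simp add: algebra_simps)
  have 4: "ev r + ev col3 + kap s z + kap t w + asc s t w - (ru t + ev l + kap s w + asc t s w + sy s t) \<in> nul"
    by (rule judge_eqD'[OF rot1], (rule j)+, simp add: algebra_simps)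
  have 5: "ev q + ev b + kap s A + kap y w + asc s y w - (ru y + ev l + kap s w + asc y s w + sy s y) \<in> nul"
    by (rule judge_eqD'[OF rot2], (rule j)+, simp add: algebra_simps)
  show ?thesis
  proof (rule judge_eqI', (rule j)+, rule refl)
    note I = id_Hom[OF ob(1)] id_Hom[OF ob(2)] id_Hom[OF ob(3)] id_Hom[OF ob(4)] id_Hom[OF ob(5)]
    \<comment> \<open>\<open>col3\<close> and \<open>row3\<close> identify z with t + w and y with t
      + x, so all structural values can be moved to the five basic objects.\<close>
    have "asc z x v - asc (t \<boxplus> w) x v \<in> nul" "asc s z x - asc s (t \<boxplus> w) x \<in> nul"
      "asc y w v - asc (t \<boxplus> x) w v \<in> nul" "asc s y w - asc s (t \<boxplus> x) w \<in> nul"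
      "ru y - ru (t \<boxplus> x) \<in> nul" "asc y s w - asc (t \<boxplus> x) s w \<in> nul" "sy s y - sy s (t \<boxplus> x) \<in> nul"
      using lin_assoc_nat lin_runit_nat lin_symm_nat I col3 row3 by blast+
    note n = this
    \<comment> \<open>Relations 1 to 5 eliminate aa, e, b, r, q and l; the structural remainder is
      \<open>lin_rotation\<close> together with \<open>lin_co\<close>.\<close>
    show "ev row2 + (ev col3 + ev col1 + (kap z k - kap (t \<boxplus> w) (x \<boxplus> v))) -
      (ev col2 + (ev row3 + ev row1 + (kap y h - kap (t \<boxplus> x) (w \<boxplus> v)) +
        (co t w x v + (kap t x + kap w v + kap (t \<boxplus> x) (w \<boxplus> v)) -
         (kap t w + kap x v + kap (t \<boxplus> w) (x \<boxplus> v))))) \<in> nul"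
      by (rule nul_addI[OF 1], rule nul_subI[OF 2], rule nul_addI[OF 3], rule nul_subI[OF 4], rule nul_addI[OF 5],
        rule nul_addI[OF lin_rotation[OF ob(1-4) l]], rule nul_addI[OF lin_co[OF ob(2-5)]],
        rule nul_addI[OF n(1)], rule nul_addI[OF n(2)], rule nul_subI[OF n(3)], rule nul_subI[OF n(4)],
        rule nul_addI[OF n(5)], rule nul_addI[OF n(6)], rule nul_addI[OF n(7)],
        simp add: algebra_simps nul_zero)
  qed
qed


text \<open>u occurs once on the left and twice on the right, so the equation determines its value
  by that of M.\<close>

lemma unit_map_value:
  assumes M: "M \<in> Hom P (E \<boxplus> E) E" and u: "u \<in> Hom P E unt"
  shows "u \<cdot> M = lunit P unt \<cdot> (u \<oplus> u) \<longleftrightarrow> ev M + kap E E - (lu unt + ev u) \<in> nul"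
proof
  note j = judge_rules HomD(5)[OF M] judge_base[OF u] judge_base[OF M]
  show "ev M + kap E E - (lu unt + ev u) \<in> nul" if "u \<cdot> M = lunit P unt \<cdot> (u \<oplus> u)"
    by (rule judge_eqD'[OF that], (rule j)+, simp add: algebra_simps)
  show "u \<cdot> M = lunit P unt \<cdot> (u \<oplus> u)" if "ev M + kap E E - (lu unt + ev u) \<in> nul"
    by (rule judge_eqI', (rule j)+, rule refl, rule nul_subI[OF that], simp add: algebra_simps nul_zero)
qed

text \<open>An isomorphism from E + E to E makes E a unit in exactly one way: fullness of E + -
  writes M as \<open>runit\<close> after adding some u, and uniqueness is read off from the
  value.\<close>

lemma ex1_unit_map:
  assumes M: "M \<in> Hom P (E \<boxplus> E) E"
  shows "\<exists>!u. u \<in> Hom P E unt \<and> u \<cdot> M = lunit P unt \<cdot> (u \<oplus> u)"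
proof (rule ex_ex1I)
  have E: "E \<in> Ob P" using HomD[OF M] by blast
  note r = runit_Hom[OF E]
  note v = vinv[OF iso[OF r] r]
  obtain u where u: "u \<in> Hom P E unt" "vinv (runit P E) \<cdot> M = Idt P E \<oplus> u"
    using plus_full[OF E comp_Hom[OF M v(1)] E unit_Ob] by blast
  have eq: "runit P E \<cdot> (Idt P E \<oplus> u) = M"
    using comp_assoc[OF M v(1) r] v(3) u(2) id_left[OF M] by argo
  have 1: "ru E + ev u - (ev M + kap E E) \<in> nul"
    by (rule judge_eqD'[OF eq], (rule judge_rules E judge_base[OF u(1)] judge_base[OF M])+, simp add: algebra_simps)
  have "ev M + kap E E - (lu unt + ev u) \<in> nul"
    by (rule nul_addI[OF 1], rule nul_I[OF lin_runit_nat[OF u(1)]], rule nul_I[OF lin_unit], simp add: algebra_simps nul_zero; fail)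
  then show "\<exists>u. u \<in> Hom P E unt \<and> u \<cdot> M = lunit P unt \<cdot> (u \<oplus> u)"
    using u(1) unit_map_value[OF M] by blast
next
  fix u u' assume "u \<in> Hom P E unt \<and> u \<cdot> M = lunit P unt \<cdot> (u \<oplus> u)"
    "u' \<in> Hom P E unt \<and> u' \<cdot> M = lunit P unt \<cdot> (u' \<oplus> u')"
  then have u: "u \<in> Hom P E unt" "u' \<in> Hom P E unt"
    and v: "ev M + kap E E - (lu unt + ev u) \<in> nul" "ev M + kap E E - (lu unt + ev u') \<in> nul"
    using unit_map_value[OF M] by auto
  show "u = u'"
    by (rule judge_eqI'[OF judge_base[OF u(1)] judge_base[OF u(2)] refl], rule nul_subI[OF v(2)],
      rule nul_addI[OF v(1)], simp add: algebra_simps nul_zero)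
qed

text \<open>p occurs twice on the left of the associativity equation and once on the right, so its
  value is determined by that of M and thus by u.\<close>

lemma split_right:
  assumes M: "M \<in> Hom P (E \<boxplus> E) E" and u: "u \<in> Hom P E unt" "u \<cdot> M = lunit P unt \<cdot> (u \<oplus> u)"
    and p: "p \<in> Hom P (x \<boxplus> E) x" "p \<cdot> (p \<oplus> Idt P E) = p \<cdot> (Idt P x \<oplus> M) \<cdot> assoc P x E E"
  shows "p = runit P x \<cdot> (Idt P x \<oplus> u)"
proof (rule judge_eqI')
  note o = HomD(5)[OF M] HomD(5)[OF p(1)]
  note j = judge_rules o judge_base[OF u(1)] judge_base[OF M] judge_base[OF p(1)]
  show "judge p (x \<boxplus> E) x (ev p)" by (rule judge_base[OF p(1)])
  show "judge (runit P x \<cdot> (Idt P x \<oplus> u)) (x \<boxplus> E) x (ru x - kap x unt + (0 + ev u + (kap x unt - kap x E)))"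
    by (rule j)+
  have 1: "ev p + kap x E - (ev M + kap E E + asc x E E) \<in> nul"
    by (rule judge_eqD'[OF p(2)], (rule j)+, simp add: algebra_simps)
  show "ev p + kap x E - (ru x + ev u) \<in> nul"
    by (rule nul_subI[OF 1], rule nul_I[OF unit_map_value[OF M u(1), THEN iffD1, OF u(2)]],
      rule nul_I[OF lin_assoc_nat[OF id_Hom[OF o(2)] u(1) id_Hom[OF o(1)]]],
      rule nul_I[OF lin_triangle[OF o(2,1)]], rule nul_I[OF lin_lunit_nat[OF u(1)]],
      simp add: algebra_simps nul_zero; fail)
qed (simp add: algebra_simps)

lemma split_left:
  assumes M: "M \<in> Hom P (E \<boxplus> E) E" and u: "u \<in> Hom P E unt" "u \<cdot> M = lunit P unt \<cdot> (u \<oplus> u)"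
    and p: "p \<in> Hom P (E \<boxplus> x) x" "p \<cdot> (M \<oplus> Idt P x) = p \<cdot> (Idt P E \<oplus> p) \<cdot> assoc P E E x"
  shows "p = lunit P x \<cdot> (u \<oplus> Idt P x)"
proof (rule judge_eqI')
  note o = HomD(5)[OF M] HomD(5)[OF p(1)]
  note j = judge_rules o judge_base[OF u(1)] judge_base[OF M] judge_base[OF p(1)]
  show "judge p (E \<boxplus> x) x (ev p)" by (rule judge_base[OF p(1)])
  show "judge (lunit P x \<cdot> (u \<oplus> Idt P x)) (E \<boxplus> x) x (lu x - kap unt x + (ev u + 0 + (kap unt x - kap E x)))"
    by (rule j)+
  have 1: "ev M + kap E E - (ev p + kap E x + asc E E x) \<in> nul"
    by (rule judge_eqD'[OF p(2)], (rule j)+, simp add: algebra_simps)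
  show "ev p + kap E x - (lu x + ev u) \<in> nul"
    by (rule nul_addI[OF 1], rule nul_I[OF unit_map_value[OF M u(1), THEN iffD1, OF u(2)]],
      rule nul_I[OF lin_assoc_nat[OF u(1) u(1) id_Hom[OF o(2)]]],
      rule nul_I[OF lin_triangle[OF unit_Ob o(2)]], rule nul_I[OF lin_unit],
      simp add: algebra_simps nul_zero; fail)
qed (simp add: algebra_simps)

text \<open>By naturality the four objects may be taken to be the unit. There the exchange is the
  symmetry of the unit with itself, whose value vanishes since \<open>lunit\<close> and
  \<open>runit\<close> agree on the unit.\<close>

lemma lin_co_zero:
  assumes "a \<in> Hom P x unt" "b \<in> Hom P y unt" "c \<in> Hom P z unt" "d \<in> Hom P w unt"
  shows "co x y z w \<in> nul"
  by (rule nul_I[OF lin_co_nat[OF assms]], rule nul_I[OF lin_co_unit[OF unit_Ob unit_Ob]],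
    rule nul_I[OF lin_symm_unit[OF unit_Ob]], rule nul_I[OF lin_unit],
    simp add: algebra_simps nul_zero; fail)

text \<open>The exchange is invisible on objects isomorphic to the unit
  (\<open>lin_co_zero\<close>), so the hypothesis relates D linearly to the three multiplications,
  and these have the values of their unit maps. The two alternatives are Two Triangles for the two
  orders of the variables.\<close>

lemma unit_map_additive:
  assumes M: "M1 \<in> Hom P (E1 \<boxplus> E1) E1" "M2 \<in> Hom P (E2 \<boxplus> E2) E2" "M3 \<in> Hom P (E3 \<boxplus> E3) E3"
    and u: "u1 \<in> Hom P E1 unt" "u1 \<cdot> M1 = lunit P unt \<cdot> (u1 \<oplus> u1)"
      "u2 \<in> Hom P E2 unt" "u2 \<cdot> M2 = lunit P unt \<cdot> (u2 \<oplus> u2)"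
      "u3 \<in> Hom P E3 unt" "u3 \<cdot> M3 = lunit P unt \<cdot> (u3 \<oplus> u3)"
    and D: "D \<in> Hom P (E1 \<boxplus> E2) E3"
    and eq: "D \<cdot> (M1 \<oplus> M2) = M3 \<cdot> (D \<oplus> D) \<cdot> coas P E1 E1 E2 E2 \<or>
      M3 \<cdot> (D \<oplus> D) = D \<cdot> (M1 \<oplus> M2) \<cdot> coas P E1 E2 E1 E2"
  shows "u3 \<cdot> D = lunit P unt \<cdot> (u1 \<oplus> u2)"
proof (rule judge_eqI')
  note o = HomD(5)[OF M(1)] HomD(5)[OF M(2)] HomD(5)[OF M(3)]
  note j = judge_rules o judge_base[OF M(1)] judge_base[OF M(2)] judge_base[OF M(3)]
    judge_base[OF u(1)] judge_base[OF u(3)] judge_base[OF u(5)] judge_base[OF D] judge_coas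
  note v = unit_map_value[OF M(1) u(1), THEN iffD1, OF u(2)] unit_map_value[OF M(2) u(3), THEN iffD1, OF u(4)]
    unit_map_value[OF M(3) u(5), THEN iffD1, OF u(6)]
  show "judge (u3 \<cdot> D) (E1 \<boxplus> E2) unt (ev u3 + ev D)" by (rule j)+
  show "judge (lunit P unt \<cdot> (u1 \<oplus> u2)) (E1 \<boxplus> E2) unt
      (lu unt - kap unt unt + (ev u1 + ev u2 + (kap unt unt - kap E1 E2)))" by (rule j)+
  have 0: "ev D + kap E1 E2 + ev M3 + kap E3 E3 - (ev M1 + ev M2 + kap E1 E1 + kap E2 E2) \<in> nul"
    using eq
  proof
    assume d: "D \<cdot> (M1 \<oplus> M2) = M3 \<cdot> (D \<oplus> D) \<cdot> coas P E1 E1 E2 E2"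
    have 1: "ev M1 + ev M2 + kap E1 E1 + kap E2 E2 - (ev D + kap E1 E2 + ev M3 + kap E3 E3 + co E1 E1 E2 E2) \<in> nul"
      by (rule judge_eqD'[OF d], (rule j)+, simp add: algebra_simps)
    show ?thesis
      by (rule nul_addI[OF 1], rule nul_addI[OF lin_co_zero[OF u(1,1,3,3)]], simp add: algebra_simps nul_zero)
  next
    assume d: "M3 \<cdot> (D \<oplus> D) = D \<cdot> (M1 \<oplus> M2) \<cdot> coas P E1 E2 E1 E2"
    have 1: "ev D + kap E1 E2 + ev M3 + kap E3 E3 - (ev M1 + ev M2 + kap E1 E1 + kap E2 E2 + co E1 E2 E1 E2) \<in> nul"
      by (rule judge_eqD'[OF d], (rule j)+, simp add: algebra_simps)
    show ?thesis
      by (rule nul_subI[OF 1], rule nul_subI[OF lin_co_zero[OF u(1,3,1,3)]], simp add: algebra_simps nul_zero)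
  qed
  show "ev u3 + ev D + kap E1 E2 - (lu unt + ev u1 + ev u2) \<in> nul"
    by (rule nul_subI[OF 0], rule nul_subI[OF v(1)], rule nul_subI[OF v(2)], rule nul_addI[OF v(3)],
      simp add: algebra_simps nul_zero)
qed (simp add: algebra_simps)

text \<open>The hypothesis is the cube equation of \<open>octahedron_square\<close> with the
  degenerate edges already written through u. The exchange moves only E, a unit in disguise, past
  z', so it dissolves into associators and unit isomorphisms.\<close>

lemma octahedron_equation:
  assumes u: "u \<in> Hom P E unt" and ob: "x' \<in> Ob P" "z' \<in> Ob P" "x \<in> Ob P"
    and f: "f \<in> Hom P (z' \<boxplus> x) y" and g: "g \<in> Hom P (x' \<boxplus> y) z"
    and d: "d \<in> Hom P (x' \<boxplus> z') y'" and gf: "gf \<in> Hom P (y' \<boxplus> x) z"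
    and eq: "g \<cdot> ((runit P x' \<cdot> (Idt P x' \<oplus> u)) \<oplus> f) =
      gf \<cdot> (d \<oplus> (lunit P x \<cdot> (u \<oplus> Idt P x))) \<cdot> coas P x' E z' x"
  shows "gf \<cdot> (d \<oplus> Idt P x) = g \<cdot> (Idt P x' \<oplus> f) \<cdot> assoc P x' z' x"
proof -
  note o = ob HomD(4)[OF u] HomD(5)[OF f] HomD(5)[OF d]
  note j = judge_rules o judge_base[OF u] judge_base[OF f] judge_base[OF g] judge_base[OF d]
    judge_base[OF gf] judge_coas
  have 1: "ev g + ru x' + ev f + kap x' y - (ev gf + ev d + lu x + kap y' x + co x' E z' x
      + kap x' z' - kap z' x) \<in> nul"
    by (rule judge_eqD'[OF eq], (rule j)+, simp add: algebra_simps)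
  show ?thesis
  proof (rule judge_eqI')
    show "judge (gf \<cdot> (d \<oplus> Idt P x)) ((x' \<boxplus> z') \<boxplus> x) z (ev gf + (ev d + 0 + (kap y' x - kap (x' \<boxplus> z') x)))"
      by (rule j)+
    show "judge (g \<cdot> (Idt P x' \<oplus> f) \<cdot> assoc P x' z' x) ((x' \<boxplus> z') \<boxplus> x) z
      (ev g + (0 + ev f + (kap x' y - kap x' (z' \<boxplus> x)) + (asc x' z' x + (kap z' x + kap x' (z' \<boxplus> x)) - (kap x' z' + kap (x' \<boxplus> z') x))))"
      by (rule j)+
    have c: "co x' E z' x - co x' unt z' x \<in> nul"
      by (rule nul_addI[OF lin_co_nat[OF id_Hom[OF ob(1)] u id_Hom[OF ob(2)] id_Hom[OF ob(3)]]],
        simp add: algebra_simps nul_zero)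
    show "ev gf + ev d + kap y' x - (ev g + ev f + kap x' y + asc x' z' x + kap z' x - kap x' z') \<in> nul"
      by (rule nul_addI[OF 1], rule nul_I[OF c], rule nul_I[OF lin_co[OF ob(1) unit_Ob ob(2,3)]],
        rule nul_I[OF lin_runit_sh[OF ob(1,2)]], rule nul_I[OF lin_triangle[OF plus_Ob[OF ob(1,2)] ob(3)]],
        rule nul_I[OF lin_assoc_nat[OF runit_Hom[OF ob(1)] id_Hom[OF ob(2)] id_Hom[OF ob(3)]]],
        simp add: algebra_simps nul_zero; fail)
  qed (simp add: algebra_simps)
qed

text \<open>The hypothesis is the cube equation of \<open>split_square\<close>. The map u occurs
  twice on each side and cancels, and the exchange with units at both ends is the symmetry.\<close>

lemma split_equation:
  assumes u: "u \<in> Hom P E unt" and ob: "x \<in> Ob P" "y \<in> Ob P"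
    and a: "a \<in> Hom P (y \<boxplus> x) b" and c: "c \<in> Hom P (x \<boxplus> y) b"
    and eq: "a \<cdot> ((lunit P y \<cdot> (u \<oplus> Idt P y)) \<oplus> (runit P x \<cdot> (Idt P x \<oplus> u))) =
      c \<cdot> ((lunit P x \<cdot> (u \<oplus> Idt P x)) \<oplus> (runit P y \<cdot> (Idt P y \<oplus> u))) \<cdot> coas P E y x E"
  shows "c = a \<cdot> symm P x y"
proof -
  note o = ob HomD(4)[OF u]
  note j = judge_rules o judge_base[OF u] judge_base[OF a] judge_base[OF c] judge_coas
  have 1: "ev a + lu y + ru x + kap y x - (ev c + lu x + ru y + kap x y + co E y x E) \<in> nul"
    by (rule judge_eqD'[OF eq], (rule j)+, simp add: algebra_simps)
  have k: "co E y x E - co unt y x unt \<in> nul"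
    by (rule nul_addI[OF lin_co_nat[OF u id_Hom[OF ob(2)] id_Hom[OF ob(1)] u]], simp add: algebra_simps nul_zero)
  show ?thesis
  proof (rule judge_eqI')
    show "judge c (x \<boxplus> y) b (ev c)" by (rule j)
    show "judge (a \<cdot> symm P x y) (x \<boxplus> y) b (ev a + (sy x y + kap y x - kap x y))" by (rule j)+
    show "ev c - (ev a + sy x y + kap y x - kap x y) \<in> nul"
      by (rule nul_addI[OF 1], rule nul_I[OF k], rule nul_I[OF lin_co_unit[OF ob(2,1)]],
        rule nul_I[OF lin_symm[OF ob]], simp add: algebra_simps nul_zero; fail)
  qed (simp add: algebra_simps)
qed

end

section \<open>Additive structure, translation and zero objects of a triangulated category\<close>

section \<open>Triangulated categories\<close>

locale tri =
  fixes T :: "('o, 'a) tricat" (structure)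
  assumes triangulated: "triangulated T"

sublocale tri \<subseteq> catg T
  using triangulated by unfold_locales (simp add: triangulated_def additive_category_def)

context tri
begin

lemmas tri_axioms = triangulated[unfolded triangulated_def]
lemmas additive = tri_axioms[THEN conjunct1, unfolded additive_category_def]
lemmas equivalence0 = tri_axioms[THEN conjunct2, THEN conjunct1]
lemmas tri_rest2 = tri_axioms[THEN conjunct2, THEN conjunct2]
lemmas sha_madd0 = tri_rest2[THEN conjunct1]
lemmas triangle0 = tri_rest2[THEN conjunct2, THEN conjunct1]
lemmas tri_rest4 = tri_rest2[THEN conjunct2, THEN conjunct2]
lemmas dist_iso0 = tri_rest4[THEN conjunct1]
lemmas dist_id0 = tri_rest4[THEN conjunct2, THEN conjunct1]
lemmas tri_rest6 = tri_rest4[THEN conjunct2, THEN conjunct2]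
lemmas dist_ex0 = tri_rest6[THEN conjunct1]
lemmas rotate0 = tri_rest6[THEN conjunct2, THEN conjunct1]
lemmas fill0 = tri_rest6[THEN conjunct2, THEN conjunct2, THEN conjunct1]

lemma zero_object: "zero_object T (zob T)"
  using additive by (elim conjE)

lemma zob_Ob [simp]: "zob T \<in> Ob T"
  using zero_object by (simp add: zero_object_def)

lemma hom_comm_group: "x \<in> Ob T \<Longrightarrow> y \<in> Ob T \<Longrightarrow> comm_group (hom_group T x y)"
  using additive by (elim conjE) blast

lemma ex_biproduct: "x \<in> Ob T \<Longrightarrow> y \<in> Ob T \<Longrightarrow> \<exists>b i1 i2 p1 p2. biproduct T x y b i1 i2 p1 p2"
  using additive by (elim conjE) blast

lemma hom_group_simps [simp]:
  "carrier (hom_group T x y) = Hom T x y" "monoid.mult (hom_group T x y) = madd T"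
  "one (hom_group T x y) = mzero T x y"
  by (simp_all add: hom_group_def)

lemma comp_madd0:
  "f \<in> Hom T x y \<Longrightarrow> f' \<in> Hom T x y \<Longrightarrow> g \<in> Hom T y z \<Longrightarrow> g \<cdot> madd T f f' = madd T (g \<cdot> f) (g \<cdot> f')"
  "f \<in> Hom T x y \<Longrightarrow> g \<in> Hom T y z \<Longrightarrow> g' \<in> Hom T y z \<Longrightarrow> madd T g g' \<cdot> f = madd T (g \<cdot> f) (g' \<cdot> f)"
  using additive by (elim conjE, blast)+

context
  fixes x y assumes xy: "x \<in> Ob T" "y \<in> Ob T"
begin

interpretation H: comm_group "hom_group T x y" by (rule hom_comm_group[OF xy])

lemma mzero_Hom0: "mzero T x y \<in> Hom T x y"
  using H.one_closed by simp

lemma madd_Hom0: "f \<in> Hom T x y \<Longrightarrow> g \<in> Hom T x y \<Longrightarrow> madd T f g \<in> Hom T x y"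
  using H.m_closed[of f g] by simp

lemma mneg_Hom0: "f \<in> Hom T x y \<Longrightarrow> mneg T f \<in> Hom T x y"
  using H.inv_closed[of f] HomD[of f x y] by (simp add: mneg_def)

lemma madd_zero0: "f \<in> Hom T x y \<Longrightarrow> madd T f (mzero T x y) = f" "f \<in> Hom T x y \<Longrightarrow> madd T (mzero T x y) f = f"
  using H.r_one[of f] H.l_one[of f] by simp_all

lemma madd_mneg0: "f \<in> Hom T x y \<Longrightarrow> madd T f (mneg T f) = mzero T x y" "f \<in> Hom T x y \<Longrightarrow> madd T (mneg T f) f = mzero T x y"
  using H.r_inv[of f] H.l_inv[of f] HomD[of f x y] by (simp_all add: mneg_def)

lemma madd_assoc0: "f \<in> Hom T x y \<Longrightarrow> g \<in> Hom T x y \<Longrightarrow> h \<in> Hom T x y \<Longrightarrow> madd T (madd T f g) h = madd T f (madd T g h)"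
  using H.m_assoc[of f g h] by simp

lemma madd_commute0: "f \<in> Hom T x y \<Longrightarrow> g \<in> Hom T x y \<Longrightarrow> madd T f g = madd T g f"
  using H.m_comm[of f g] by simp

lemma mneg_unique0: "f \<in> Hom T x y \<Longrightarrow> g \<in> Hom T x y \<Longrightarrow> madd T f g = mzero T x y \<Longrightarrow> g = mneg T f"
  using H.inv_equality[of g f] HomD[of f x y] madd_commute0[of f g] by (simp add: mneg_def)

lemma madd_idem0: "f \<in> Hom T x y \<Longrightarrow> madd T f f = f \<Longrightarrow> f = mzero T x y"
  using H.l_cancel_one[of f f] by simp

end

lemma mzero_Hom: "x \<in> Ob T \<Longrightarrow> y \<in> Ob T \<Longrightarrow> mzero T x y \<in> Hom T x y"
  by (rule mzero_Hom0)

lemma madd_Hom: "f \<in> Hom T x y \<Longrightarrow> g \<in> Hom T x y \<Longrightarrow> madd T f g \<in> Hom T x y"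
  by (rule madd_Hom0[OF HomD(4,5)])

lemma mneg_Hom: "f \<in> Hom T x y \<Longrightarrow> mneg T f \<in> Hom T x y"
  by (rule mneg_Hom0[OF HomD(4,5)])

lemma mzero_Ar [simp]:
  assumes "x \<in> Ob T" "y \<in> Ob T"
  shows "mzero T x y \<in> Ar T" "Dom T (mzero T x y) = x" "Cod T (mzero T x y) = y"
  using HomD[OF mzero_Hom[OF assms]] by blast+

lemma madd_Ar [simp]:
  assumes "f \<in> Ar T" "g \<in> Ar T" "Dom T f = Dom T g" "Cod T f = Cod T g"
  shows "madd T f g \<in> Ar T" "Dom T (madd T f g) = Dom T g" "Cod T (madd T f g) = Cod T g"
  using HomD[OF madd_Hom[of f "Dom T g" "Cod T g" g]] assms by (auto simp: Hom_def)

lemma mneg_Ar [simp]: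
  assumes "f \<in> Ar T"
  shows "mneg T f \<in> Ar T" "Dom T (mneg T f) = Dom T f" "Cod T (mneg T f) = Cod T f"
  using HomD[OF mneg_Hom[OF Ar_Hom[OF assms]]] by auto

lemma comp_madd [simp]:
  assumes "f \<in> Ar T" "f' \<in> Ar T" "Dom T f = Dom T f'" "Cod T f = Cod T f'"
  shows "g \<in> Ar T \<Longrightarrow> Dom T g = Cod T f' \<Longrightarrow> g \<cdot> madd T f f' = madd T (g \<cdot> f) (g \<cdot> f')"
    and "g \<in> Ar T \<Longrightarrow> Cod T g = Dom T f' \<Longrightarrow> madd T f f' \<cdot> g = madd T (f \<cdot> g) (f' \<cdot> g)"
  using comp_madd0(1)[of f "Dom T f'" "Cod T f'" f' g "Cod T g"]
    comp_madd0(2)[of g "Dom T g" "Dom T f'" f "Cod T f'" f'] assms by (auto simp: Hom_def)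

lemma madd_simps [simp]:
  assumes "f \<in> Ar T" "Dom T f = x" "Cod T f = y"
  shows "madd T f (mzero T x y) = f" "madd T (mzero T x y) f = f"
    "madd T f (mneg T f) = mzero T x y" "madd T (mneg T f) f = mzero T x y"
proof -
  have f: "f \<in> Hom T x y" using assms by (simp add: Hom_def)
  show "madd T f (mzero T x y) = f" "madd T (mzero T x y) f = f"
    "madd T f (mneg T f) = mzero T x y" "madd T (mneg T f) f = mzero T x y"
    using madd_zero0[OF HomD(4,5)[OF f] f] madd_mneg0[OF HomD(4,5)[OF f] f] by auto
qed

lemma madd_assoc [simp]:
  "f \<in> Ar T \<Longrightarrow> g \<in> Ar T \<Longrightarrow> h \<in> Ar T \<Longrightarrow> Dom T f = Dom T g \<Longrightarrow> Dom T g = Dom T h \<Longrightarrow>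
   Cod T f = Cod T g \<Longrightarrow> Cod T g = Cod T h \<Longrightarrow> madd T (madd T f g) h = madd T f (madd T g h)"
  using madd_assoc0[of "Dom T h" "Cod T h" f g h] by (auto simp: Hom_def)

lemma madd_commute:
  "f \<in> Ar T \<Longrightarrow> g \<in> Ar T \<Longrightarrow> Dom T f = Dom T g \<Longrightarrow> Cod T f = Cod T g \<Longrightarrow> madd T f g = madd T g f"
  using madd_commute0[of "Dom T g" "Cod T g" f g] by (auto simp: Hom_def)

lemma mneg_eqI:
  "f \<in> Ar T \<Longrightarrow> g \<in> Ar T \<Longrightarrow> Dom T f = Dom T g \<Longrightarrow> Cod T f = Cod T g \<Longrightarrow>
   madd T f g = mzero T (Dom T g) (Cod T g) \<Longrightarrow> g = mneg T f"
  using mneg_unique0[of "Dom T g" "Cod T g" f g] by (auto simp: Hom_def)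

lemma comp_mzero [simp]:
  assumes "f \<in> Ar T"
  shows "Dom T f = y \<Longrightarrow> x \<in> Ob T \<Longrightarrow> f \<cdot> mzero T x y = mzero T x (Cod T f)"
    and "Cod T f = y \<Longrightarrow> z \<in> Ob T \<Longrightarrow> mzero T y z \<cdot> f = mzero T (Dom T f) z"
proof -
  show "f \<cdot> mzero T x y = mzero T x (Cod T f)" if "Dom T f = y" "x \<in> Ob T"
  proof -
    have y: "y \<in> Ob T" using that assms by auto
    have "madd T (f \<cdot> mzero T x y) (f \<cdot> mzero T x y) = f \<cdot> madd T (mzero T x y) (mzero T x y)"
      by (rule comp_madd(1)[symmetric]) (simp_all add: that assms y)
    also have "madd T (mzero T x y) (mzero T x y) = mzero T x y" by (simp add: that y)
    finally show ?thesis using that assms y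
      by (intro madd_idem0) (auto simp: Hom_def)
  qed
  show "mzero T y z \<cdot> f = mzero T (Dom T f) z" if "Cod T f = y" "z \<in> Ob T"
  proof -
    have y: "y \<in> Ob T" using that assms by auto
    have "madd T (mzero T y z \<cdot> f) (mzero T y z \<cdot> f) = madd T (mzero T y z) (mzero T y z) \<cdot> f"
      by (rule comp_madd(2)[symmetric]) (simp_all add: that assms y)
    also have "madd T (mzero T y z) (mzero T y z) = mzero T y z" by (simp add: that y)
    finally show ?thesis using that assms y
      by (intro madd_idem0) (auto simp: Hom_def)
  qed
qed

lemma comp_mneg [simp]:
  assumes "f \<in> Ar T" "g \<in> Ar T" "Cod T f = Dom T g"
  shows "g \<cdot> mneg T f = mneg T (g \<cdot> f)" "mneg T g \<cdot> f = mneg T (g \<cdot> f)"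
proof -
  show "g \<cdot> mneg T f = mneg T (g \<cdot> f)"
  proof (rule mneg_eqI)
    have "madd T (g \<cdot> f) (g \<cdot> mneg T f) = g \<cdot> madd T f (mneg T f)"
      by (rule comp_madd(1)[symmetric]) (simp_all add: assms)
    then show "madd T (g \<cdot> f) (g \<cdot> mneg T f) = mzero T (Dom T (g \<cdot> mneg T f)) (Cod T (g \<cdot> mneg T f))"
      using assms by simp
  qed (simp_all add: assms)
  show "mneg T g \<cdot> f = mneg T (g \<cdot> f)"
  proof (rule mneg_eqI)
    have "madd T (g \<cdot> f) (mneg T g \<cdot> f) = madd T g (mneg T g) \<cdot> f"
      by (rule comp_madd(2)[symmetric]) (simp_all add: assms)
    then show "madd T (g \<cdot> f) (mneg T g \<cdot> f) = mzero T (Dom T (mneg T g \<cdot> f)) (Cod T (mneg T g \<cdot> f))"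
      using assms by simp
  qed (simp_all add: assms)
qed

lemma mneg_mneg [simp]: "f \<in> Ar T \<Longrightarrow> mneg T (mneg T f) = f"
  by (rule mneg_eqI[symmetric]) simp_all

lemma mneg_mzero [simp]: "x \<in> Ob T \<Longrightarrow> y \<in> Ob T \<Longrightarrow> mneg T (mzero T x y) = mzero T x y"
  by (rule mneg_eqI[symmetric]) simp_all

lemma is_functor_shift: "is_functor T T \<lparr>on_ob = sho T, on_ar = sha T\<rparr>"
  using equivalence0 by (simp add: equivalence_def)

lemma sho_Ob [simp]: "x \<in> Ob T \<Longrightarrow> sho T x \<in> Ob T"
  using is_functor_shift by (auto simp: is_functor_def)

lemma sha_Ar [simp]:
  assumes "f \<in> Ar T"
  shows "sha T f \<in> Ar T" "Dom T (sha T f) = sho T (Dom T f)" "Cod T (sha T f) = sho T (Cod T f)"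
  using is_functor_shift assms by (auto simp: is_functor_def Hom_def)

lemma sha_Hom: "f \<in> Hom T x y \<Longrightarrow> sha T f \<in> Hom T (sho T x) (sho T y)"
  by (auto simp: Hom_def)

lemma sha_id [simp]: "x \<in> Ob T \<Longrightarrow> sha T (Idt T x) = Idt T (sho T x)"
  using is_functor_shift by (auto simp: is_functor_def)

lemma sha_comp [simp]: "f \<in> Ar T \<Longrightarrow> g \<in> Ar T \<Longrightarrow> Cod T f = Dom T g \<Longrightarrow> sha T (g \<cdot> f) = sha T g \<cdot> sha T f"
  using is_functor_shift by (auto simp: is_functor_def)

lemma sha_madd: "f \<in> Hom T x y \<Longrightarrow> g \<in> Hom T x y \<Longrightarrow> sha T (madd T f g) = madd T (sha T f) (sha T g)"
  using sha_madd0 by blast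

lemma sha_mzero [simp]:
  assumes "x \<in> Ob T" "y \<in> Ob T"
  shows "sha T (mzero T x y) = mzero T (sho T x) (sho T y)"
proof (rule madd_idem0)
  show "madd T (sha T (mzero T x y)) (sha T (mzero T x y)) = sha T (mzero T x y)"
    using sha_madd[OF mzero_Hom[OF assms] mzero_Hom[OF assms]] assms by simp
qed (use assms in \<open>auto simp: Hom_def\<close>)

text \<open>Being zero in a form that is visibly stable under translation: \<Sigma>0 is a zero
  object, but it may differ from the chosen \<open>zob\<close>.\<close>

definition zeroable :: "'o \<Rightarrow> bool" where
  "zeroable z \<longleftrightarrow> z \<in> Ob T \<and> Idt T z = mzero T z z"

lemma zeroable_zob [simp]: "zeroable (zob T)"
  using zero_object id_Hom[OF zob_Ob] mzero_Hom[OF zob_Ob zob_Ob] unfolding zeroable_def zero_object_def by blast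

lemma zeroable_sho [simp]: "zeroable z \<Longrightarrow> zeroable (sho T z)"
  using sha_id[of z] sha_mzero[of z z] by (auto simp: zeroable_def)

lemma zeroable_unique:
  assumes "f \<in> Hom T x y" "g \<in> Hom T x y" "zeroable x \<or> zeroable y"
  shows "f = g"
proof -
  have "k = mzero T x y" if "k \<in> Hom T x y" for k
    using assms(3)
  proof
    assume "zeroable x"
    then have "k = k \<cdot> mzero T x x" using id_right[OF that] by (simp add: zeroable_def)
    then show ?thesis using HomD[OF that] by simp
  next
    assume "zeroable y"
    then have "k = mzero T y y \<cdot> k" using id_left[OF that] by (simp add: zeroable_def)
    then show ?thesis using HomD[OF that] by simp
  qed
  then show ?thesis using assms by metis
qed

end

section \<open>Distinguished triangles, split triangles and degenerate cubes\<close>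

context tri
begin

lemma distD:
  assumes "(f, g, h) \<in> distg T"
  shows "f \<in> Ar T" "g \<in> Ar T" "h \<in> Ar T" "Dom T g = Cod T f" "Dom T h = Cod T g" "Cod T h = sho T (Dom T f)"
proof -
  have "triangle T (f, g, h)" using triangle0 assms by blast
  then show "f \<in> Ar T" "g \<in> Ar T" "h \<in> Ar T" "Dom T g = Cod T f" "Dom T h = Cod T g"
    "Cod T h = sho T (Dom T f)" unfolding triangle.simps Hom_def by blast+
qed

lemma rotate: "(f, g, h) \<in> distg T \<Longrightarrow> (g, h, mneg T (sha T f)) \<in> distg T"
  using rotate0 triangle0 by blast

lemma unrotate:
  assumes "f \<in> Hom T x y" "g \<in> Hom T y z" "h \<in> Hom T z (sho T x)" "(g, h, mneg T (sha T f)) \<in> distg T"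
  shows "(f, g, h) \<in> distg T"
proof -
  have "triangle T (f, g, h)" using assms by (auto simp: Hom_def)
  then show ?thesis using rotate0 assms(4) by blast
qed

lemma fill:
  assumes "(f, g, h) \<in> distg T" "(f', g', h') \<in> distg T"
    "u \<in> Hom T (Dom T f) (Dom T f')" "v \<in> Hom T (Cod T f) (Cod T f')" "v \<cdot> f = f' \<cdot> u"
  shows "\<exists>w. tri_mor T (f, g, h) (f', g', h') u v w"
  using fill0 assms by blast

lemma dist_id: "x \<in> Ob T \<Longrightarrow> (Idt T x, mzero T x (zob T), mzero T (zob T) (sho T x)) \<in> distg T"
  using dist_id0 by blast

lemma dist_iso:
  "t \<in> distg T \<Longrightarrow> triangle T t' \<Longrightarrow> tri_mor T t t' u v w \<Longrightarrow> {u, v, w} \<subseteq> isos T \<Longrightarrow> t' \<in> distg T"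
  using dist_iso0 by blast

text \<open>TR3, applied to the triangle x = x -> 0 and the given one, factors the composite through
  0.\<close>

lemma dist_comp1:
  assumes t: "(f, g, h) \<in> distg T"
  shows "g \<cdot> f = mzero T (Dom T f) (Cod T g)"
proof -
  note [simp] = distD[OF t]
  obtain w where "tri_mor T (Idt T (Dom T f), mzero T (Dom T f) (zob T), mzero T (zob T) (sho T (Dom T f)))
      (f, g, h) (Idt T (Dom T f)) f w"
    using fill[OF dist_id[of "Dom T f"] t, where u = "Idt T (Dom T f)" and v = f] by (auto simp: Hom_def)
  then show ?thesis by (auto simp: Hom_def)
qed

lemma dist_comp2: "(f, g, h) \<in> distg T \<Longrightarrow> h \<cdot> g = mzero T (Cod T f) (sho T (Dom T f))"
  using dist_comp1[OF rotate, of f g h] distD[of f g h] by simp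

lemma dist_comp3:
  assumes t: "(f, g, h) \<in> distg T"
  shows "sha T f \<cdot> h = mzero T (Cod T g) (sho T (Cod T f))"
proof -
  note [simp] = distD[OF t]
  have "mneg T (sha T f \<cdot> h) = mzero T (Cod T g) (sho T (Cod T f))"
    using dist_comp2[OF rotate[OF t]] by simp
  then have "mneg T (mneg T (sha T f \<cdot> h)) = mzero T (Cod T g) (sho T (Cod T f))" by simp
  then show ?thesis by simp
qed

lemma isos_zeroable:
  assumes "zeroable x" "zeroable y"
  shows "mzero T x y \<in> isos T"
proof -
  note [simp] = assms[unfolded zeroable_def, THEN conjunct1] assms[unfolded zeroable_def, THEN conjunct2]
  show ?thesis by (rule isosI[of _ x y "mzero T y x"]) (simp_all add: mzero_Hom)
qed

lemma dist_id_zeroable: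
  assumes x: "x \<in> Ob T" and z: "zeroable z"
  shows "(Idt T x, mzero T x z, mzero T z (sho T x)) \<in> distg T"
proof (rule dist_iso[OF dist_id[OF x]])
  note [simp] = x z[unfolded zeroable_def, THEN conjunct1]
  show "triangle T (Idt T x, mzero T x z, mzero T z (sho T x))" by (simp add: Hom_def)
  show "tri_mor T (Idt T x, mzero T x (zob T), mzero T (zob T) (sho T x)) (Idt T x, mzero T x z, mzero T z (sho T x))
    (Idt T x) (Idt T x) (mzero T (zob T) z)" by (simp add: Hom_def)
  show "{Idt T x, Idt T x, mzero T (zob T) z} \<subseteq> isos T"
    using isos_zeroable[OF zeroable_zob z] isos_id[OF x] by simp
qed

lemma dist_deg:
  assumes x: "x \<in> Ob T"
  shows "deg_tri \<alpha> T x \<in> distg T"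
proof (cases "\<alpha> = 1")
  case True then show ?thesis using dist_id[OF x] by (simp add: deg_tri_def)
next
  case False
  have "(mzero T (zob T) x, Idt T x, mzero T x (sho T (zob T))) \<in> distg T"
    by (rule unrotate) (use x dist_id_zeroable[OF x zeroable_sho[OF zeroable_zob]] in \<open>simp_all add: Hom_def\<close>)
  then show ?thesis using False by (simp add: deg_tri_def)
qed

text \<open>A cone is a weak cokernel: TR3 with target 0 -> q = q supplies the
  factorisation.\<close>

lemma factor_through_cone:
  assumes t: "(f, g, h) \<in> distg T" and n: "n \<in> Hom T (Cod T f) q" "n \<cdot> f = mzero T (Dom T f) q"
  shows "\<exists>k\<in>Hom T (Cod T g) q. n = k \<cdot> g"
proof -
  note [simp] = distD[OF t] HomD[OF n(1)]
  obtain k where "tri_mor T (f, g, h) (deg_tri (-1) T q) (mzero T (Dom T f) (zob T)) n k"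
    using fill[OF t, of "mzero T (zob T) q" "Idt T q" "mzero T q (sho T (zob T))" "mzero T (Dom T f) (zob T)" n]
      dist_deg[of q "-1"] n(2) by (auto simp: deg_tri_def Hom_def)
  then show ?thesis by (auto simp: deg_tri_def Hom_def)
qed

lemma biproductD:
  assumes "biproduct T x y b i1 i2 p1 p2"
  shows "i1 \<in> Hom T x b" "i2 \<in> Hom T y b" "p1 \<in> Hom T b x" "p2 \<in> Hom T b y"
    "p1 \<cdot> i1 = Idt T x" "p2 \<cdot> i2 = Idt T y" "p1 \<cdot> i2 = mzero T y x" "p2 \<cdot> i1 = mzero T x y"
    "madd T (i1 \<cdot> p1) (i2 \<cdot> p2) = Idt T b" "b \<in> Ob T"
  using assms by (auto simp: biproduct_def)

text \<open>Complete i1 to a triangle. The retraction p1 of i1 forces the third morphism h to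
  vanish, and then p2 identifies the cone of i1 with y.\<close>

lemma dist_split:
  assumes b: "biproduct T x y b i1 i2 p1 p2"
  shows "(i1, p2, mzero T y (sho T x)) \<in> distg T"
proof -
  note B = biproductD[OF b]
  note [simp] = HomD[OF B(1)] HomD[OF B(2)] HomD[OF B(3)] HomD[OF B(4)] B(5-8)
  obtain c h where t: "(i1, c, h) \<in> distg T" using dist_ex0[rule_format, OF HomD(1)[OF B(1)]] by blast
  note [simp] = distD[OF t]
  let ?w = "Cod T c"
  have "(sha T p1 \<cdot> sha T i1) \<cdot> h = sha T p1 \<cdot> (sha T i1 \<cdot> h)" by simp
  also have "\<dots> = mzero T ?w (sho T x)" by (simp add: dist_comp3[OF t])
  also have "sha T p1 \<cdot> sha T i1 = Idt T (sho T x)" by (simp flip: sha_comp)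
  finally have h: "h = mzero T ?w (sho T x)" by simp
  obtain k where k: "k \<in> Hom T ?w y" "p2 = k \<cdot> c"
    using factor_through_cone[OF t, of p2 y] B(4) by auto
  note [simp] = HomD[OF k(1)]
  define j where "j = c \<cdot> i2"
  have j [simp]: "j \<in> Ar T" "Dom T j = y" "Cod T j = ?w" by (simp_all add: j_def)
  have kj: "k \<cdot> j = Idt T y"
  proof -
    have "(k \<cdot> c) \<cdot> i2 = Idt T y" by (simp only: k(2)[symmetric] B(6))
    then show ?thesis by (simp add: j_def)
  qed
  have "c = c \<cdot> madd T (i1 \<cdot> p1) (i2 \<cdot> p2)" by (simp add: B(9))
  also have "\<dots> = madd T ((c \<cdot> i1) \<cdot> p1) ((c \<cdot> i2) \<cdot> p2)" by simp
  also have "\<dots> = j \<cdot> p2" by (simp add: dist_comp1[OF t] j_def)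
  finally have c: "c = (j \<cdot> k) \<cdot> c" using k(2) by simp
  \<comment> \<open>The identity minus j k kills c, so it factors through the next morphism h of the
    triangle, which is zero.\<close>
  define n where "n = madd T (Idt T ?w) (mneg T (j \<cdot> k))"
  have "n \<cdot> c = madd T c (mneg T ((j \<cdot> k) \<cdot> c))" by (simp add: n_def)
  also have "\<dots> = mzero T b ?w" using c[symmetric] by simp
  finally obtain l where l: "l \<in> Hom T (sho T x) ?w" "n = l \<cdot> h"
    using factor_through_cone[OF rotate[OF t], of n ?w] by (auto simp: n_def Hom_def)
  then have "n = mzero T ?w ?w" using HomD[OF l(1)] by (simp add: h)
  then have "Idt T ?w = mneg T (mneg T (j \<cdot> k))"
    by (intro mneg_eqI) (simp_all add: n_def madd_commute[of "mneg T (j \<cdot> k)"])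
  then have jk: "j \<cdot> k = Idt T ?w" by simp
  have ki: "k \<in> isos T" by (rule isosI[OF k(1), of j]) (simp_all add: Hom_def jk kj)
  show ?thesis
  proof (rule dist_iso[OF t])
    show "triangle T (i1, p2, mzero T y (sho T x))" by (simp add: Hom_def)
    show "tri_mor T (i1, c, h) (i1, p2, mzero T y (sho T x)) (Idt T x) (Idt T b) k"
      by (simp add: Hom_def h k(2)[symmetric])
    show "{Idt T x, Idt T b, k} \<subseteq> isos T" using ki isos_id by simp
  qed
qed

lemma biproduct_commute:
  assumes "biproduct T x y b i1 i2 p1 p2"
  shows "biproduct T y x b i2 i1 p2 p1"
  using assms biproductD[OF assms] madd_commute[of "i1 \<cdot> p1" "i2 \<cdot> p2"]
  by (auto simp: biproduct_def Hom_def)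

lemma Idt_zob: "Idt T (zob T) = mzero T (zob T) (zob T)"
  using zeroable_zob by (simp add: zeroable_def)

lemma tcube_tdeg_Point: "x \<in> Ob T \<Longrightarrow> is_tcube T (tdeg \<alpha> j T (Point x))"
  by (simp add: dist_deg)

text \<open>All octahedra of the evident Verdier structure are made of t, degenerate triangles and
  rotations of these; the rotations come from the third octahedron, which contains -\<Sigma>\<beta>
  and -\<Sigma>r'.\<close>

lemma tcube_tdeg_Triangle:
  assumes t: "(f, g, h) \<in> distg T" and \<alpha>: "\<alpha> = 1 \<or> \<alpha> = -1"
  shows "is_tcube T (tdeg \<alpha> j T (Triangle (f, g, h)))"
proof -
  note [simp] = distD[OF t] dist_comp1[OF t] dist_comp2[OF t] dist_comp3[OF t] Idt_zob t
  have d: "(Idt T x, mzero T x (zob T), mzero T (zob T) (sho T x)) \<in> distg T"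
    "(mzero T (zob T) x, Idt T x, mzero T x (sho T (zob T))) \<in> distg T" if "x \<in> Ob T" for x
    using dist_deg[OF that, of 1] dist_deg[OF that, of "-1"] by (simp_all add: deg_tri_def)
  note [simp] = d[of "Dom T f"] d[of "Cod T f"] d[of "Cod T g"] d(1)[of "zob T", simplified]
  note [simp] = rotate[OF t] rotate[OF d(1), of "Cod T g", simplified] rotate[OF d(2), of "Cod T g", simplified]
    rotate[OF d(2), of "Cod T f", simplified] rotate[OF d(1), of "zob T", simplified] rotate[OF d(2), of "zob T", simplified]
  show ?thesis
    using \<alpha> by (cases "j = 0") (auto simp: deg_tri_def Let_def Idt_zob)
qed

end

section \<open>Octahedra and squares that encode the axioms and the rotation of triangles\<close>

context tri
begin

lemma dist_deg_right: "x \<in> Ob T \<Longrightarrow> (Idt T x, mzero T x (zob T), mzero T (zob T) (sho T x)) \<in> distg T"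
  and dist_deg_left: "x \<in> Ob T \<Longrightarrow> (mzero T (zob T) x, Idt T x, mzero T x (sho T (zob T))) \<in> distg T"
  using dist_deg[of x 1] dist_deg[of x "-1"] by (simp_all add: deg_tri_def)

lemma octahedronD:
  assumes "octahedron T (f, a, a') (gf, b, b') (g, c, c') (d, e, e')"
  shows "(f, a, a') \<in> distg T" "(gf, b, b') \<in> distg T" "(g, c, c') \<in> distg T" "(d, e, e') \<in> distg T"
    "Dom T g = Cod T f" "Dom T d = Cod T a" "Cod T d = Cod T b" "Cod T e = Cod T c"
    "gf = g \<cdot> f" "d \<cdot> a = b \<cdot> g" "b' \<cdot> d = a'" "e \<cdot> b = c" "c' \<cdot> e = sha T f \<cdot> b'" "e' = sha T a \<cdot> c'"
  using assms by auto

text \<open>A square whose equation is the octahedron axiom: its first column, second column, second row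
  and third row are the four triangles of the octahedron.\<close>

lemma octahedron_square:
  assumes o: "octahedron T (f, a, a') (gf, b, b') (g, c, c') (d, e, e')"
  shows "is_tcube T (Square (deg_tri 1 T (Dom T f), (g, c, c'), (d, e, e'))
    ((f, a, a'), (gf, b, b'), deg_tri (-1) T (Cod T c))
    ((b, b'), (d, e, e'), deg_tri (-1) T (Cod T b)))"
proof -
  note O = octahedronD[OF o]
  note [simp] = distD[OF O(1)] distD[OF O(3)] distD[OF O(4)] O(1-4) O(5-8,10)
  have gf [simp]: "Dom T gf = Dom T f" "Cod T gf = Cod T g" "Dom T b = Cod T g" "Dom T b' = Cod T b"
    "Cod T b' = sho T (Dom T f)" "b \<in> Ar T" "b' \<in> Ar T" "gf \<in> Ar T"
    using distD[OF O(2)] O(9) by simp_all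
  note c = O(9,11-14)
  have z1: "c \<cdot> gf = mzero T (Dom T f) (Cod T c)"
    using comp_assoc_Ar[of f g c] dist_comp1[OF O(3)] by (simp add: O(9))
  have z2: "sha T a' \<cdot> e' = mzero T (Cod T c) (sho T (sho T (Dom T f)))"
  proof -
    have "sha T a' \<cdot> e' = (sha T a' \<cdot> sha T a) \<cdot> c'" by (simp add: O(14))
    also have "sha T a' \<cdot> sha T a = sha T (a' \<cdot> a)" by simp
    also have "\<dots> = mzero T (sho T (Cod T f)) (sho T (sho T (Dom T f)))"
      by (simp add: dist_comp2[OF O(1)])
    finally show ?thesis by simp
  qed
  note [simp] = dist_deg_right[of "Dom T f"] dist_deg_left[of "Cod T c"] dist_deg_left[of "Cod T b"]
    rotate[OF dist_deg_left, of "Cod T b", simplified] rotate[OF dist_deg_left, of "Cod T c", simplified]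
  show ?thesis
    using o z1 z2 dist_comp1[OF O(2)] dist_comp3[OF O(4)] by (simp add: deg_tri_def O(9,11,12) O(13,14)[symmetric] Idt_zob)
qed

text \<open>The two split triangles cross in the middle of the square as its second row and second
  column, and the four outer triangles are degenerate. Its equation therefore compares the two split
  data, with A = b in the Verdier structure.\<close>

lemma split_square:
  assumes b: "biproduct T x y b i1 i2 p1 p2" and ob: "x \<in> Ob T" "y \<in> Ob T"
  shows "is_tcube T (Square (deg_tri (-1) T y, (i1, p2, mzero T y (sho T x)), deg_tri 1 T x)
    (deg_tri (-1) T x, (i2, p1, mzero T x (sho T y)), deg_tri 1 T y)
    ((Idt T b, mzero T b (sho T (zob T))), (i1, p2, mzero T y (sho T x)), (i2, p1, mzero T x (sho T y))))"
proof -
  note B = biproductD[OF b]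
  note t = dist_split[OF b] dist_split[OF biproduct_commute[OF b]]
  note [simp] = HomD[OF B(1)] HomD[OF B(2)] HomD[OF B(3)] HomD[OF B(4)] B(5-8) ob t rotate[OF t(2), simplified]
  note [simp] = dist_deg_right[OF ob(1)] dist_deg_right[OF ob(2)] dist_deg_left[OF ob(1)] dist_deg_left[OF ob(2)]
    dist_deg_left[OF B(10)] rotate[OF dist_deg_right[OF ob(2)], simplified]
  have [simp]: "sha T p2 \<cdot> sha T i2 = Idt T (sho T y)" by (simp flip: sha_comp)
  show ?thesis by (simp add: deg_tri_def Idt_zob)
qed

text \<open>A shear along h with a change of sign on s. The new inclusions compose with
  \<open>ps\<close> to h and to minus the identity, which are the third morphisms prescribed by the
  two octahedra of \<open>rotation_octahedra\<close>.\<close>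

lemma rotation_biproduct:
  assumes b: "biproduct T z s C iz is pz ps" and h: "h \<in> Hom T z s"
  shows "biproduct T z s C (madd T iz (is \<cdot> h)) (mneg T is) pz (madd T (h \<cdot> pz) (mneg T ps))"
proof -
  note B = biproductD[OF b]
  note [simp] = HomD[OF B(1)] HomD[OF B(2)] HomD[OF B(3)] HomD[OF B(4)] HomD[OF h] B(5-8)
  have [simp]: "pz \<cdot> (is \<cdot> h) = mzero T z z" "ps \<cdot> (is \<cdot> h) = h"
    using comp_assoc_Ar[of h "is" pz] comp_assoc_Ar[of h "is" ps] by simp_all
  let ?k = "is \<cdot> (h \<cdot> pz)"
  have [simp]: "madd T ?k (madd T (mneg T ?k) (is \<cdot> ps)) = is \<cdot> ps"
    using madd_assoc[of ?k "mneg T ?k" "is \<cdot> ps"] by simp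
  show ?thesis
    unfolding biproduct_def by (intro conjI) (simp_all add: Hom_def B(9,10))
qed

text \<open>The zero morphism w -> z factors as g f and also through 0. Its cone is C = z +
  \<Sigma>w, and the fourth triangles z -> C -> \<Sigma>w and \<Sigma>w -> C -> z of the two
  octahedra are split with respect to the same sheared biproduct, so that the split axiom can
  compare them.\<close>

lemma rotation_octahedra:
  assumes t: "(f, g, h) \<in> distg T"
  obtains b b' d e d' e' where
    "octahedron T (f, g, h) (mzero T (Dom T f) (Cod T g), b, b') (g, h, mneg T (sha T f)) (d, e, mzero T (Cod T h) (sho T (Cod T g)))"
    "octahedron T (mzero T (Dom T f) (zob T), mzero T (zob T) (Cod T h), mneg T (Idt T (Cod T h)))
      (mzero T (Dom T f) (Cod T g), b, b') (deg_tri (-1) T (Cod T g)) (d', e', mzero T (Cod T g) (sho T (Cod T h)))"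
    "biproduct T (Cod T g) (Cod T h) (Cod T d) d d' e' e"
proof -
  note [simp] = distD[OF t] dist_comp1[OF t] dist_comp2[OF t] dist_comp3[OF t] t rotate[OF t]
  let ?z = "Cod T g" and ?w = "Dom T f" and ?s = "sho T (Dom T f)"
  have h: "h \<in> Hom T ?z ?s" by (simp add: Hom_def)
  obtain C iz "is" pz ps where b: "biproduct T ?z ?s C iz is pz ps" using ex_biproduct[of ?z ?s] by auto
  note B = biproductD[OF b]
  note b' = rotation_biproduct[OF b h]
  note [simp] = HomD[OF B(1)] HomD[OF B(2)] HomD[OF B(3)] HomD[OF B(4)] B(5-8)
  have [simp]: "ps \<cdot> (is \<cdot> h) = h" "is \<cdot> (h \<cdot> g) = mzero T (Cod T f) C" "(is \<cdot> h) \<cdot> g = mzero T (Cod T f) C"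
    "sha T f \<cdot> (h \<cdot> pz) = mzero T C (sho T (Cod T f))"
    using comp_assoc_Ar[of h "is" ps] comp_assoc_Ar[of pz h "sha T f"] by simp_all
  have [simp]: "sha T g \<cdot> sha T f = mzero T ?s (sho T ?z)" by (simp flip: sha_comp)
  note [simp] = dist_split[OF b'] dist_split[OF biproduct_commute[OF b']] dist_deg_left[of ?z]
    rotate[OF dist_deg_right, of ?w, simplified]
  \<comment> \<open>The triangle on the zero morphism w -> z, a rotation of the split triangle on z
    and \<Sigma>w.\<close>
  have [simp]: "(mzero T ?w ?z, iz, ps) \<in> distg T"
    by (rule unrotate) (use dist_split[OF b] in \<open>simp_all add: Hom_def\<close>)
  show thesis
  proof (rule that)
    show "octahedron T (f, g, h) (mzero T ?w ?z, iz, ps) (g, h, mneg T (sha T f))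
      (madd T iz (is \<cdot> h), madd T (h \<cdot> pz) (mneg T ps), mzero T (Cod T h) (sho T ?z))" by simp
    show "octahedron T (mzero T ?w (zob T), mzero T (zob T) (Cod T h), mneg T (Idt T (Cod T h)))
      (mzero T ?w ?z, iz, ps) (deg_tri (-1) T ?z) (mneg T is, pz, mzero T ?z (sho T (Cod T h)))"
      by (simp add: deg_tri_def)
    show "biproduct T ?z (Cod T h) (Cod T (madd T iz (is \<cdot> h))) (madd T iz (is \<cdot> h)) (mneg T is) pz (madd T (h \<cdot> pz) (mneg T ps))"
      using b' by simp
  qed
qed

text \<open>Built on 0 = 0 -> x and x = x = x. They express associativity of the data of 0 -> x = x
  and x = x -> 0 over the datum of 0 = 0 -> 0.\<close>

lemma unit_octahedra:
  assumes "x \<in> Ob T"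
  shows "octahedron T (deg_tri 1 T (zob T)) (deg_tri (-1) T x) (deg_tri (-1) T x) (deg_tri (-1) T x)"
    and "octahedron T (deg_tri 1 T x) (deg_tri 1 T x) (deg_tri 1 T x) (deg_tri 1 T (zob T))"
  using assms dist_deg_right[OF assms] dist_deg_left[OF assms] dist_deg_right[OF zob_Ob]
  by (simp_all add: deg_tri_def Idt_zob)

end

context picard
begin

text \<open>B, the datum of the zero morphism, occurs in both octahedra. Eliminating it leaves D and
  D', which the split axiom relates by the symmetry.\<close>

lemma rotation_equation:
  assumes ob: "z \<in> Ob P" "s \<in> Ob P" "w \<in> Ob P"
    and F: "F \<in> Hom P (z \<boxplus> w) y" and R: "R \<in> Hom P (s \<boxplus> y) z"
    and B: "B \<in> Hom P (C \<boxplus> w) z" and D: "D \<in> Hom P (s \<boxplus> z) C" and D': "D' \<in> Hom P (z \<boxplus> s) C"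
    and u: "u \<in> Hom P E unt" and l: "l \<in> Hom P (s \<boxplus> w) E"
    and o1: "B \<cdot> (D \<oplus> Idt P w) = R \<cdot> (Idt P s \<oplus> F) \<cdot> assoc P s z w"
    and o2: "B \<cdot> (D' \<oplus> Idt P w) = (runit P z \<cdot> (Idt P z \<oplus> u)) \<cdot> (Idt P z \<oplus> l) \<cdot> assoc P z s w"
    and eq: "D' = D \<cdot> symm P z s"
  shows "R \<cdot> (Idt P s \<oplus> F) \<cdot> assoc P s z w =
    runit P z \<cdot> (Idt P z \<oplus> (u \<cdot> l)) \<cdot> assoc P z s w \<cdot> (symm P s z \<oplus> Idt P w)"
proof -
  note o = ob HomD(5)[OF F] HomD(5)[OF D] HomD(5)[OF l]
  note j = judge_rules o judge_base[OF F] judge_base[OF R] judge_base[OF B] judge_base[OF D]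
    judge_base[OF D'] judge_base[OF u] judge_base[OF l]
  have 2: "ev B + ev D' + kap C w + kap z s - (ru z + ev u + ev l + asc z s w + kap s w) \<in> nul"
    by (rule judge_eqD'[OF o2], (rule j)+, simp add: algebra_simps)
  have 3: "ev D' - (ev D + sy z s + kap s z - kap z s) \<in> nul"
    by (rule judge_eqD'[OF eq], (rule j)+, simp add: algebra_simps)
  show ?thesis
    unfolding o1[symmetric]
  proof (rule judge_eqI')
    show "judge (B \<cdot> (D \<oplus> Idt P w)) ((s \<boxplus> z) \<boxplus> w) z (ev B + (ev D + 0 + (kap C w - kap (s \<boxplus> z) w)))"
      by (rule j)+
    show "judge (runit P z \<cdot> (Idt P z \<oplus> (u \<cdot> l)) \<cdot> assoc P z s w \<cdot> (symm P s z \<oplus> Idt P w)) ((s \<boxplus> z) \<boxplus> w) z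
      (ru z - kap z unt + (0 + (ev u + ev l) + (kap z unt - kap z (s \<boxplus> w)) +
       ((asc z s w + (kap s w + kap z (s \<boxplus> w)) - (kap z s + kap (z \<boxplus> s) w)) +
        (sy s z + kap z s - kap s z + 0 + (kap (z \<boxplus> s) w - kap (s \<boxplus> z) w)))))" by (rule j)+
    show "ev B + ev D + kap C w + kap s z - (ru z + ev u + ev l + asc z s w + kap s w + sy s z) \<in> nul"
      by (rule nul_subI[OF 2], rule nul_addI[OF 3], rule nul_addI[OF lin_symm[OF ob(1,2)]],
        simp add: algebra_simps nul_zero)
  qed (simp add: algebra_simps)
qed

end

lemma deg_tri_simps:
  "deg_tri 1 T x = (Idt T x, mzero T x (zob T), mzero T (zob T) (sho T x))"
  "deg_tri (-1) T x = (mzero T (zob T) x, Idt T x, mzero T x (sho T (zob T)))"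
  by (simp_all add: deg_tri_def)

section \<open>Unit, rotation and square equations of a determinant functor\<close>

section \<open>Determinant functors\<close>

locale det = T: tri T + P: picard P
  for T :: "('o, 'a) tricat" and P :: "('p, 'q) symcat" +
  fixes F :: "('o, 'a, 'p, 'q) func" and ad :: "'a tri \<Rightarrow> 'q"
  assumes det: "determinant_functor T P F ad"
begin

abbreviation "Fo \<equiv> on_ob F"
abbreviation "Fa \<equiv> on_ar F"

lemmas det_axioms = det[unfolded determinant_functor_def]
lemmas functor_F = det_axioms[THEN conjunct1]
lemmas ad_Hom0 = det_axioms[THEN conjunct2, THEN conjunct1]
lemmas ad_rest = det_axioms[THEN conjunct2, THEN conjunct2, THEN conjunct2]
lemmas ad_split0 = ad_rest[THEN conjunct1]
lemmas ad_octahedron0 = ad_rest[THEN conjunct2]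

lemma Fo_Ob: "x \<in> Ob T \<Longrightarrow> Fo x \<in> Ob P"
  using functor_F by (auto simp: is_functor_def isom_def)

lemma ad_Hom:
  "(f, g, h) \<in> distg T \<Longrightarrow> ad (f, g, h) \<in> Hom P (Fo (Cod T g) \<boxplus>\<^bsub>P\<^esub> Fo (Dom T f)) (Fo (Cod T f))"
  using ad_Hom0 by blast

lemma ad_split:
  assumes "biproduct T x y b i1 i2 p1 p2"
  shows "ad (i2, p1, mzero T x (sho T y)) =
    ad (i1, p2, mzero T y (sho T x)) \<cdot>\<^bsub>P\<^esub> symm P (Fo x) (Fo y)"
  using ad_split0 assms T.HomD(4,5)[OF T.biproductD(3)[OF assms]] T.HomD(4,5)[OF T.biproductD(4)[OF assms]] by blast

lemma ad_octahedron:
  "octahedron T (f, a, a') (gf, b, b') (g, c, c') (d, e, e') \<Longrightarrow>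
    ad (gf, b, b') \<cdot>\<^bsub>P\<^esub> (ad (d, e, e') \<oplus>\<^bsub>P\<^esub> Idt P (Fo (Dom T f))) =
    ad (g, c, c') \<cdot>\<^bsub>P\<^esub> (Idt P (Fo (Cod T c)) \<oplus>\<^bsub>P\<^esub> ad (f, a, a')) \<cdot>\<^bsub>P\<^esub>
      assoc P (Fo (Cod T c)) (Fo (Cod T a)) (Fo (Dom T f))"
  using ad_octahedron0 by blast

abbreviation "E \<equiv> Fo (zob T)"
abbreviation "mu \<equiv> ad (deg_tri 1 T (zob T))"

lemma mu_Hom: "mu \<in> Hom P (E \<boxplus>\<^bsub>P\<^esub> E) E"
  using ad_Hom[OF T.dist_deg_right[OF T.zob_Ob]] by (simp add: deg_tri_simps)

lemma ad_deg_Hom: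
  assumes "x \<in> Ob T"
  shows "ad (deg_tri 1 T x) \<in> Hom P (E \<boxplus>\<^bsub>P\<^esub> Fo x) (Fo x)" "ad (deg_tri (-1) T x) \<in> Hom P (Fo x \<boxplus>\<^bsub>P\<^esub> E) (Fo x)"
  using ad_Hom[OF T.dist_deg_right[OF assms]] ad_Hom[OF T.dist_deg_left[OF assms]] assms by (simp_all add: deg_tri_simps)

context
  fixes u
  assumes u: "u \<in> Hom P E (punit P)" "u \<cdot>\<^bsub>P\<^esub> mu = lunit P (punit P) \<cdot>\<^bsub>P\<^esub> (u \<oplus>\<^bsub>P\<^esub> u)"
begin

text \<open>By \<open>unit_octahedra\<close> the degenerate data are associative over
  \<open>mu\<close>, and \<open>split_left\<close> and \<open>split_right\<close> leave only one
  possibility for them.\<close>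

lemma ad_deg:
  assumes x: "x \<in> Ob T"
  shows "ad (deg_tri 1 T x) = lunit P (Fo x) \<cdot>\<^bsub>P\<^esub> (u \<oplus>\<^bsub>P\<^esub> Idt P (Fo x))"
    and "ad (deg_tri (-1) T x) = runit P (Fo x) \<cdot>\<^bsub>P\<^esub> (Idt P (Fo x) \<oplus>\<^bsub>P\<^esub> u)"
proof -
  note o = T.unit_octahedra[OF x, unfolded deg_tri_simps]
  show "ad (deg_tri 1 T x) = lunit P (Fo x) \<cdot>\<^bsub>P\<^esub> (u \<oplus>\<^bsub>P\<^esub> Idt P (Fo x))"
    by (rule P.split_left[OF mu_Hom u ad_deg_Hom(1)[OF x]])
      (use ad_octahedron[OF o(2)] x in \<open>simp add: deg_tri_simps\<close>)
  show "ad (deg_tri (-1) T x) = runit P (Fo x) \<cdot>\<^bsub>P\<^esub> (Idt P (Fo x) \<oplus>\<^bsub>P\<^esub> u)"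
    by (rule P.split_right[OF mu_Hom u ad_deg_Hom(2)[OF x]])
      (use ad_octahedron[OF o(1)] x in \<open>simp add: deg_tri_simps\<close>)
qed

end

lemma ex_unit: "\<exists>u. u \<in> Hom P E (punit P) \<and> u \<cdot>\<^bsub>P\<^esub> mu = lunit P (punit P) \<cdot>\<^bsub>P\<^esub> (u \<oplus>\<^bsub>P\<^esub> u)"
  using P.ex1_unit_map[OF mu_Hom] by blast

text \<open>The data of a triangle and of its rotation compose to a contraction l. The quantifier
  order is the point: l is chosen for the first vertex w before the triangle is known.\<close>

lemma rotation:
  assumes w: "w \<in> Ob T"
  shows "\<exists>l\<in>Hom P (Fo (sho T w) \<boxplus>\<^bsub>P\<^esub> Fo w) (punit P). \<forall>f g h. (f, g, h) \<in> distg T \<and> Dom T f = w \<longrightarrow>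
    (let s = Fo (sho T w); z = Fo (Cod T g) in
     ad (g, h, mneg T (sha T f)) \<cdot>\<^bsub>P\<^esub> (Idt P s \<oplus>\<^bsub>P\<^esub> ad (f, g, h)) \<cdot>\<^bsub>P\<^esub> assoc P s z (Fo w) =
     runit P z \<cdot>\<^bsub>P\<^esub> (Idt P z \<oplus>\<^bsub>P\<^esub> l) \<cdot>\<^bsub>P\<^esub> assoc P z s (Fo w) \<cdot>\<^bsub>P\<^esub> (symm P s z \<oplus>\<^bsub>P\<^esub> Idt P (Fo w)))"
proof -
  obtain u where u: "u \<in> Hom P E (punit P)" "u \<cdot>\<^bsub>P\<^esub> mu = lunit P (punit P) \<cdot>\<^bsub>P\<^esub> (u \<oplus>\<^bsub>P\<^esub> u)"
    using ex_unit by blast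
  \<comment> \<open>The datum of the rotation of w = w -> 0; followed by u it is the
    contraction.\<close>
  let ?l = "ad (mzero T w (zob T), mzero T (zob T) (sho T w), mneg T (Idt T (sho T w)))"
  have l: "?l \<in> Hom P (Fo (sho T w) \<boxplus>\<^bsub>P\<^esub> Fo w) E"
    using ad_Hom[OF T.rotate[OF T.dist_deg_right[OF w]]] w by simp
  show ?thesis
  proof (intro bexI[of _ "u \<cdot>\<^bsub>P\<^esub> ?l"] allI impI, elim conjE)
    fix f g h assume t: "(f, g, h) \<in> distg T" and fw: "Dom T f = w"
    note D = T.distD[OF t]
    obtain b b' d e d' e' where
      o1: "octahedron T (f, g, h) (mzero T w (Cod T g), b, b') (g, h, mneg T (sha T f)) (d, e, mzero T (Cod T h) (sho T (Cod T g)))" and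
      o2: "octahedron T (mzero T w (zob T), mzero T (zob T) (Cod T h), mneg T (Idt T (Cod T h)))
        (mzero T w (Cod T g), b, b') (deg_tri (-1) T (Cod T g)) (d', e', mzero T (Cod T g) (sho T (Cod T h)))" and
      bp: "biproduct T (Cod T g) (Cod T h) (Cod T d) d d' e' e"
      using T.rotation_octahedra[OF t] unfolding fw by metis
    note O1 = T.octahedronD[OF o1] and O2 = T.octahedronD[OF o2[unfolded deg_tri_simps]]
    note B = T.HomD[OF T.biproductD(1)[OF bp]] T.HomD[OF T.biproductD(2)[OF bp]]
      T.HomD[OF T.biproductD(3)[OF bp]] T.HomD[OF T.biproductD(4)[OF bp]]
    have s: "Cod T h = sho T w" using D fw by simp
    let ?z = "Fo (Cod T g)" and ?s = "Fo (sho T w)"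
    have z: "Cod T g \<in> Ob T" using D by simp
    show "let s = Fo (sho T w); z = Fo (Cod T g) in
     ad (g, h, mneg T (sha T f)) \<cdot>\<^bsub>P\<^esub> (Idt P s \<oplus>\<^bsub>P\<^esub> ad (f, g, h)) \<cdot>\<^bsub>P\<^esub> assoc P s z (Fo w) =
     runit P z \<cdot>\<^bsub>P\<^esub> (Idt P z \<oplus>\<^bsub>P\<^esub> (u \<cdot>\<^bsub>P\<^esub> ?l)) \<cdot>\<^bsub>P\<^esub> assoc P z s (Fo w) \<cdot>\<^bsub>P\<^esub> (symm P s z \<oplus>\<^bsub>P\<^esub> Idt P (Fo w))"
      unfolding Let_def
    proof (rule P.rotation_equation)
      show "?z \<in> Ob P" "?s \<in> Ob P" "Fo w \<in> Ob P" using z w by (simp_all add: Fo_Ob)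
      show "ad (f, g, h) \<in> Hom P (?z \<boxplus>\<^bsub>P\<^esub> Fo w) (Fo (Cod T f))" using ad_Hom[OF t] fw by simp
      show "ad (g, h, mneg T (sha T f)) \<in> Hom P (?s \<boxplus>\<^bsub>P\<^esub> Fo (Cod T f)) ?z"
        using ad_Hom[OF T.rotate[OF t]] D s by simp
      show "ad (mzero T w (Cod T g), b, b') \<in> Hom P (Fo (Cod T d) \<boxplus>\<^bsub>P\<^esub> Fo w) ?z"
        using ad_Hom[OF O1(2)] w z O1(7) by simp
      show "ad (d, e, mzero T (Cod T h) (sho T (Cod T g))) \<in> Hom P (?s \<boxplus>\<^bsub>P\<^esub> ?z) (Fo (Cod T d))"
        using ad_Hom[OF O1(4)] B s by simp
      show "ad (d', e', mzero T (Cod T g) (sho T (Cod T h))) \<in> Hom P (?z \<boxplus>\<^bsub>P\<^esub> ?s) (Fo (Cod T d))"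
        using ad_Hom[OF O2(4)] B s by simp
      show "u \<in> Hom P E (punit P)" by (rule u)
      show "?l \<in> Hom P (?s \<boxplus>\<^bsub>P\<^esub> Fo w) E" by (rule l)
      show "ad (mzero T w (Cod T g), b, b') \<cdot>\<^bsub>P\<^esub> (ad (d, e, mzero T (Cod T h) (sho T (Cod T g))) \<oplus>\<^bsub>P\<^esub> Idt P (Fo w)) =
        ad (g, h, mneg T (sha T f)) \<cdot>\<^bsub>P\<^esub> (Idt P ?s \<oplus>\<^bsub>P\<^esub> ad (f, g, h)) \<cdot>\<^bsub>P\<^esub> assoc P ?s ?z (Fo w)"
        using ad_octahedron[OF o1] by (simp add: s fw)
      show "ad (mzero T w (Cod T g), b, b') \<cdot>\<^bsub>P\<^esub> (ad (d', e', mzero T (Cod T g) (sho T (Cod T h))) \<oplus>\<^bsub>P\<^esub> Idt P (Fo w)) =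
        (runit P ?z \<cdot>\<^bsub>P\<^esub> (Idt P ?z \<oplus>\<^bsub>P\<^esub> u)) \<cdot>\<^bsub>P\<^esub> (Idt P ?z \<oplus>\<^bsub>P\<^esub> ?l) \<cdot>\<^bsub>P\<^esub> assoc P ?z ?s (Fo w)"
        using ad_octahedron[OF o2[unfolded deg_tri_simps]] ad_deg(2)[OF u z] w z
        by (simp add: s deg_tri_simps)
      show "ad (d', e', mzero T (Cod T g) (sho T (Cod T h))) =
        ad (d, e, mzero T (Cod T h) (sho T (Cod T g))) \<cdot>\<^bsub>P\<^esub> symm P ?z ?s"
        using ad_split[OF bp] s by simp
    qed
  next
    show "u \<cdot>\<^bsub>P\<^esub> ?l \<in> Hom P (Fo (sho T w) \<boxplus>\<^bsub>P\<^esub> Fo w) (punit P)" by (rule P.comp_Hom[OF l u(1)])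
  qed
qed

text \<open>The three Verdier octahedra give the three octahedron equations of
  \<open>square_equation\<close>. The rotation equations are those of the third column and of z' ->
  A -> y''.\<close>

lemma square:
  assumes "is_tcube T (Square (r1, r2, r3) (k1, k2, k3) V)"
  shows "ad r2 \<cdot>\<^bsub>P\<^esub> (ad k3 \<oplus>\<^bsub>P\<^esub> ad k1) = ad k2 \<cdot>\<^bsub>P\<^esub> (ad r3 \<oplus>\<^bsub>P\<^esub> ad r1) \<cdot>\<^bsub>P\<^esub>
    coas P (Fo (vertex T r3 1)) (Fo (vertex T r1 1)) (Fo (vertex T r3 (-1))) (Fo (vertex T r1 (-1)))"
proof -
  obtain f' g' h' f g h f'' g'' h'' where r: "r1 = (f', g', h')" "r2 = (f, g, h)" "r3 = (f'', g'', h'')"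
    by (metis prod_cases3)
  obtain p' p p'' q' q q'' r' ra r'' where k: "k1 = (p', p, p'')" "k2 = (q', q, q'')" "k3 = (r', ra, r'')"
    by (metis prod_cases3)
  obtain \<alpha> v \<epsilon> \<eta> \<zeta> \<beta> \<gamma> \<delta> where V: "V = ((\<alpha>, v), (\<epsilon>, \<eta>, \<zeta>), (\<beta>, \<gamma>, \<delta>))"
    by (metis surj_pair)
  have d: "diagram33 T ((f', g', h'), (f, g, h), (f'', g'', h'')) ((p', p, p''), (q', q, q''), (r', ra, r''))"
    and o1: "octahedron T (p', p, p'') (f \<cdot>\<^bsub>T\<^esub> p', \<alpha>, v) (f, g, h) (\<epsilon>, \<eta>, \<zeta>)"
    and o2: "octahedron T (f', g', h') (q' \<cdot>\<^bsub>T\<^esub> f', \<alpha>, v) (q', q, q'') (\<beta>, \<gamma>, \<delta>)"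
    and o3: "octahedron T (\<epsilon>, \<eta>, \<zeta>) (f'', g'', h'') (\<gamma>, \<delta>, mneg T (sha T \<beta>)) (ra, r'', mneg T (sha T r'))"
    using assms unfolding r k V is_tcube.simps verdier_structure.simps by blast+
  have e: "q' \<cdot>\<^bsub>T\<^esub> f' = f \<cdot>\<^bsub>T\<^esub> p'" and D: "(f', g', h') \<in> distg T" "(f, g, h) \<in> distg T" "(f'', g'', h'') \<in> distg T"
    "(p', p, p'') \<in> distg T" "(q', q, q'') \<in> distg T" "(r', ra, r'') \<in> distg T"
    and c: "Dom T p' = Dom T f'" "Cod T p' = Dom T f" "Cod T p = Dom T f''"
     "Dom T q' = Cod T f'" "Cod T q' = Cod T f" "Cod T q = Cod T f''"
     "Dom T r' = Cod T g'" "Cod T r' = Cod T g" "Cod T ra = Cod T g''"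
    using d unfolding diagram33.simps by blast+
  note O1 = T.octahedronD[OF o1] and O2 = T.octahedronD[OF o2] and O3 = T.octahedronD[OF o3]
  note D1 = T.distD[OF D(1)] and D2 = T.distD[OF D(2)] and D3 = T.distD[OF D(3)] and D4 = T.distD[OF D(4)]
    and D5 = T.distD[OF D(5)] and D6 = T.distD[OF D(6)] and De = T.distD[OF O1(4)] and Db = T.distD[OF O2(4)]
  \<comment> \<open>The third column and the triangle (\<beta>, \<gamma>, \<delta>) both start at
    z', so one contraction l serves for both rotations.\<close>
  define w where "w = Cod T g'"
  have w: "w \<in> Ob T" using D1 by (simp add: w_def)
  obtain l where l: "l \<in> Hom P (Fo (sho T w) \<boxplus>\<^bsub>P\<^esub> Fo w) (punit P)"
    and rot: "(f, g, h) \<in> distg T \<Longrightarrow> Dom T f = w \<Longrightarrow>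
     ad (g, h, mneg T (sha T f)) \<cdot>\<^bsub>P\<^esub> (Idt P (Fo (sho T w)) \<oplus>\<^bsub>P\<^esub> ad (f, g, h)) \<cdot>\<^bsub>P\<^esub> assoc P (Fo (sho T w)) (Fo (Cod T g)) (Fo w) =
     runit P (Fo (Cod T g)) \<cdot>\<^bsub>P\<^esub> (Idt P (Fo (Cod T g)) \<oplus>\<^bsub>P\<^esub> l) \<cdot>\<^bsub>P\<^esub> assoc P (Fo (Cod T g)) (Fo (sho T w)) (Fo w) \<cdot>\<^bsub>P\<^esub>
       (symm P (Fo (sho T w)) (Fo (Cod T g)) \<oplus>\<^bsub>P\<^esub> Idt P (Fo w))" for f g h
    using rotation[OF w] unfolding Let_def by blast
  have b: "Dom T \<beta> = w" "Cod T \<gamma> = Cod T q" using O2(6,8) w_def by auto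
  note v = vertex.simps at.simps r
  have ob: "Fo (sho T w) \<in> Ob P" "Fo (Cod T g'') \<in> Ob P" "Fo w \<in> Ob P" "Fo (Dom T f'') \<in> Ob P" "Fo (Dom T f') \<in> Ob P"
    using D1 D3 w by (simp_all add: Fo_Ob)
  have "ad (f, g, h) \<cdot>\<^bsub>P\<^esub> (ad (r', ra, r'') \<oplus>\<^bsub>P\<^esub> ad (p', p, p'')) =
    ad (q', q, q'') \<cdot>\<^bsub>P\<^esub> (ad (f'', g'', h'') \<oplus>\<^bsub>P\<^esub> ad (f', g', h')) \<cdot>\<^bsub>P\<^esub>
      coas P (Fo (Cod T g'')) (Fo w) (Fo (Dom T f'')) (Fo (Dom T f'))"
  proof (rule P.square_equation[OF ob l])
    show "ad (r', ra, r'') \<in> Hom P (Fo (Cod T g'') \<boxplus>\<^bsub>P\<^esub> Fo w) (Fo (Cod T g))"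
      using ad_Hom[OF D(6)] c w_def by simp
    show "ad (f'', g'', h'') \<in> Hom P (Fo (Cod T g'') \<boxplus>\<^bsub>P\<^esub> Fo (Dom T f'')) (Fo (Cod T f''))"
      by (rule ad_Hom[OF D(3)])
    show "ad (\<epsilon>, \<eta>, \<zeta>) \<in> Hom P (Fo (Cod T g) \<boxplus>\<^bsub>P\<^esub> Fo (Dom T f'')) (Fo (Cod T \<alpha>))"
      using ad_Hom[OF O1(4)] O1(6-8) c by simp
    show "ad (\<beta>, \<gamma>, \<delta>) \<in> Hom P (Fo (Cod T f'') \<boxplus>\<^bsub>P\<^esub> Fo w) (Fo (Cod T \<alpha>))"
      using ad_Hom[OF O2(4)] O2(6-8) c w_def by simp
    show "ad (ra, r'', mneg T (sha T r')) \<in> Hom P (Fo (sho T w) \<boxplus>\<^bsub>P\<^esub> Fo (Cod T g)) (Fo (Cod T g''))"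
      using ad_Hom[OF O3(4)] D6 c w_def by simp
    show "ad (\<gamma>, \<delta>, mneg T (sha T \<beta>)) \<in> Hom P (Fo (sho T w) \<boxplus>\<^bsub>P\<^esub> Fo (Cod T \<alpha>)) (Fo (Cod T f''))"
      using ad_Hom[OF O3(3)] Db b c O2(7) by simp
    show "ad (f \<cdot>\<^bsub>T\<^esub> p', \<alpha>, v) \<in> Hom P (Fo (Cod T \<alpha>) \<boxplus>\<^bsub>P\<^esub> Fo (Dom T f')) (Fo (Cod T f))"
      using ad_Hom[OF O1(2)] D4 D2 c by simp
    show "ad (f, g, h) \<in> Hom P (Fo (Cod T g) \<boxplus>\<^bsub>P\<^esub> Fo (Dom T f)) (Fo (Cod T f))" by (rule ad_Hom[OF D(2)])
    show "ad (p', p, p'') \<in> Hom P (Fo (Dom T f'') \<boxplus>\<^bsub>P\<^esub> Fo (Dom T f')) (Fo (Dom T f))"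
      using ad_Hom[OF D(4)] c by simp
    show "ad (q', q, q'') \<in> Hom P (Fo (Cod T f'') \<boxplus>\<^bsub>P\<^esub> Fo (Cod T f')) (Fo (Cod T f))"
      using ad_Hom[OF D(5)] c by simp
    show "ad (f', g', h') \<in> Hom P (Fo w \<boxplus>\<^bsub>P\<^esub> Fo (Dom T f')) (Fo (Cod T f'))"
      using ad_Hom[OF D(1)] w_def by simp
    show "ad (f \<cdot>\<^bsub>T\<^esub> p', \<alpha>, v) \<cdot>\<^bsub>P\<^esub> (ad (\<epsilon>, \<eta>, \<zeta>) \<oplus>\<^bsub>P\<^esub> Idt P (Fo (Dom T f'))) =
      ad (f, g, h) \<cdot>\<^bsub>P\<^esub> (Idt P (Fo (Cod T g)) \<oplus>\<^bsub>P\<^esub> ad (p', p, p'')) \<cdot>\<^bsub>P\<^esub> assoc P (Fo (Cod T g)) (Fo (Dom T f'')) (Fo (Dom T f'))"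
      using ad_octahedron[OF o1] c by simp
    show "ad (f \<cdot>\<^bsub>T\<^esub> p', \<alpha>, v) \<cdot>\<^bsub>P\<^esub> (ad (\<beta>, \<gamma>, \<delta>) \<oplus>\<^bsub>P\<^esub> Idt P (Fo (Dom T f'))) =
      ad (q', q, q'') \<cdot>\<^bsub>P\<^esub> (Idt P (Fo (Cod T f'')) \<oplus>\<^bsub>P\<^esub> ad (f', g', h')) \<cdot>\<^bsub>P\<^esub> assoc P (Fo (Cod T f'')) (Fo w) (Fo (Dom T f'))"
      using ad_octahedron[OF o2] c e w_def by simp
    show "ad (f'', g'', h'') \<cdot>\<^bsub>P\<^esub> (ad (ra, r'', mneg T (sha T r')) \<oplus>\<^bsub>P\<^esub> Idt P (Fo (Dom T f''))) =
      ad (\<gamma>, \<delta>, mneg T (sha T \<beta>)) \<cdot>\<^bsub>P\<^esub> (Idt P (Fo (sho T w)) \<oplus>\<^bsub>P\<^esub> ad (\<epsilon>, \<eta>, \<zeta>)) \<cdot>\<^bsub>P\<^esub>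
        assoc P (Fo (sho T w)) (Fo (Cod T g)) (Fo (Dom T f''))"
      using ad_octahedron[OF o3] c O1(6,8) Db b by simp
    show "ad (ra, r'', mneg T (sha T r')) \<cdot>\<^bsub>P\<^esub> (Idt P (Fo (sho T w)) \<oplus>\<^bsub>P\<^esub> ad (r', ra, r'')) \<cdot>\<^bsub>P\<^esub> assoc P (Fo (sho T w)) (Fo (Cod T g'')) (Fo w) =
      runit P (Fo (Cod T g'')) \<cdot>\<^bsub>P\<^esub> (Idt P (Fo (Cod T g'')) \<oplus>\<^bsub>P\<^esub> l) \<cdot>\<^bsub>P\<^esub> assoc P (Fo (Cod T g'')) (Fo (sho T w)) (Fo w) \<cdot>\<^bsub>P\<^esub>
       (symm P (Fo (sho T w)) (Fo (Cod T g'')) \<oplus>\<^bsub>P\<^esub> Idt P (Fo w))"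
      using rot[OF D(6)] c w_def by simp
    show "ad (\<gamma>, \<delta>, mneg T (sha T \<beta>)) \<cdot>\<^bsub>P\<^esub> (Idt P (Fo (sho T w)) \<oplus>\<^bsub>P\<^esub> ad (\<beta>, \<gamma>, \<delta>)) \<cdot>\<^bsub>P\<^esub> assoc P (Fo (sho T w)) (Fo (Cod T f'')) (Fo w) =
      runit P (Fo (Cod T f'')) \<cdot>\<^bsub>P\<^esub> (Idt P (Fo (Cod T f'')) \<oplus>\<^bsub>P\<^esub> l) \<cdot>\<^bsub>P\<^esub> assoc P (Fo (Cod T f'')) (Fo (sho T w)) (Fo w) \<cdot>\<^bsub>P\<^esub>
       (symm P (Fo (sho T w)) (Fo (Cod T f'')) \<oplus>\<^bsub>P\<^esub> Idt P (Fo w))"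
      using rot[OF O2(4) b(1)] b(2) c by simp
  qed
  then show ?thesis by (simp add: r k w_def)
qed

end

section \<open>Shapes of families of cubes of total dimension at most two\<close>

section \<open>Coordinates and families of cubes\<close>

lemma coords_0 [simp]: "coords 0 = {[]}"
  by (auto simp: coords_def)

lemma coords_Suc: "coords (Suc n) = {\<alpha> # a | \<alpha> a. \<alpha> \<in> {-1, 0, 1} \<and> a \<in> coords n}"
proof -
  have "b \<in> coords (Suc n) \<longleftrightarrow> (\<exists>\<alpha> a. b = \<alpha> # a \<and> \<alpha> \<in> {-1, 0, 1} \<and> a \<in> coords n)" for b
    by (cases b) (auto simp: coords_def)
  then show ?thesis by blast
qed

lemma coords_1 [simp]: "coords (Suc 0) = {[-1], [0], [1]}"
  by (auto simp: coords_Suc)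

lemma coords_2: "coords 2 = {[\<alpha>, \<beta>] | \<alpha> \<beta>. \<alpha> \<in> {-1, 0, 1} \<and> \<beta> \<in> {-1, 0, 1}}"
  unfolding numeral_2_eq_2 by (subst coords_Suc) (auto simp: coords_Suc)

lemma coords_2_iff: "[\<alpha>, \<beta>] \<in> coords 2 \<longleftrightarrow> \<alpha> \<in> {-1, 0, 1} \<and> \<beta> \<in> {-1, 0, 1}"
  by (auto simp: coords_2)

lemma coords_length: "a \<in> coords n \<Longrightarrow> length a = n"
  by (simp add: coords_def)

lemma ins_simps [simp]: "ins 0 \<alpha> a = \<alpha> # a" "ins (Suc 0) \<alpha> (\<beta> # a) = \<beta> # \<alpha> # a"
  by (simp_all add: ins_def)

lemma del_simps [simp]: "del 0 (\<alpha> # a) = a" "del (Suc 0) (\<alpha> # \<beta> # a) = \<alpha> # a"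
  by (simp_all add: del_def)

lemma ins_coords: "c \<in> coords n \<Longrightarrow> \<alpha> \<in> {-1, 0, 1} \<Longrightarrow> ins i \<alpha> c \<in> coords (Suc n)"
  by (auto simp: coords_def ins_def dest: in_set_takeD in_set_dropD)

definition points :: "nat \<Rightarrow> (nat \<Rightarrow> 'o) \<Rightarrow> nat \<Rightarrow> ('o, 'a) tcube" where
  "points m x = (\<lambda>k\<in>{..<m}. Point (x k))"

text \<open>Spelled like the argument of \<open>D 1\<close> in \<open>level01\<close>, so that both
  match literally.\<close>

definition single :: "nat \<Rightarrow> nat \<Rightarrow> (nat \<Rightarrow> 'o) \<Rightarrow> ('o, 'a) tcube \<Rightarrow> nat \<Rightarrow> ('o, 'a) tcube" where
  "single m i x C = (\<lambda>k\<in>{..<m} - {i}. Point (x k))(i := C)"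

definition double ::
  "nat \<Rightarrow> nat \<Rightarrow> nat \<Rightarrow> (nat \<Rightarrow> 'o) \<Rightarrow> 'a tri \<Rightarrow> 'a tri \<Rightarrow> nat \<Rightarrow> ('o, 'a) tcube" where
  "double m i j x t t' = (\<lambda>k\<in>{..<m} - {i, j}. Point (x k))(i := Triangle t, j := Triangle t')"

lemma points_apply [simp]: "k < m \<Longrightarrow> points m x k = Point (x k)"
  by (simp add: points_def)

lemma single_apply [simp]:
  "single m i x C i = C" "k < m \<Longrightarrow> k \<noteq> i \<Longrightarrow> single m i x C k = Point (x k)"
  by (simp_all add: single_def)

lemma double_apply [simp]:
  "i \<noteq> j \<Longrightarrow> double m i j x t t' i = Triangle t" "double m i j x t t' j = Triangle t'"
  "k < m \<Longrightarrow> k \<noteq> i \<Longrightarrow> k \<noteq> j \<Longrightarrow> double m i j x t t' k = Point (x k)"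
  by (simp_all add: double_def)

lemma family_extensional:
  "points m x \<in> extensional {..<m}"
  "i < m \<Longrightarrow> single m i x C \<in> extensional {..<m}"
  "i < m \<Longrightarrow> j < m \<Longrightarrow> double m i j x t t' \<in> extensional {..<m}"
  by (auto simp: points_def single_def double_def extensional_def)

lemma offset_cong: "(\<And>l. l < k \<Longrightarrow> tdim (Q l) = tdim (R l)) \<Longrightarrow> offset Q k = offset R k"
  unfolding offset_def by (rule sum.cong) auto

lemma offset_points: "k \<le> m \<Longrightarrow> offset (points m x) k = 0"
  unfolding offset_def by (rule sum.neutral) simp

lemma offset_single:
  assumes "i < m" "k \<le> m"
  shows "offset (single m i x C) k = (if i < k then tdim C else 0)"
proof -
  have "offset (single m i x C) k = (\<Sum>l<k. if l = i then tdim C else 0)"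
    unfolding offset_def using assms by (intro sum.cong) (auto simp: single_def)
  then show ?thesis by simp
qed

lemma offset_double:
  assumes "i < j" "j < m" "k \<le> m"
  shows "offset (double m i j x t t') k = (if i < k then 1 else 0) + (if j < k then 1 else 0)"
proof -
  have "offset (double m i j x t t') k = (\<Sum>l<k. (if l = i then 1 else 0) + (if l = j then 1 else 0))"
    unfolding offset_def using assms by (intro sum.cong) (auto simp: double_def)
  then show ?thesis by (simp add: sum.distrib)
qed

lemma multi_cubes_Un:
  "Ob (multi_cubes T m n) = (\<Union>d\<in>{d \<in> {..<m} \<rightarrow>\<^sub>E {..n}. sum d {..<m} = n}. Ob (prod_cat {..<m} (\<lambda>k. tcubes (T k) (d k))))"
  "Ar (multi_cubes T m n) = (\<Union>d\<in>{d \<in> {..<m} \<rightarrow>\<^sub>E {..n}. sum d {..<m} = n}. Ar (prod_cat {..<m} (\<lambda>k. tcubes (T k) (d k))))"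
  by (simp_all add: multi_cubes_def Let_def)

text \<open>The multidegree can be read off from the dimensions of the factors, and its bound by n
  follows from the sum.\<close>

lemma multi_cubes_Ob:
  "Q \<in> Ob (multi_cubes T m n) \<longleftrightarrow>
    Q \<in> extensional {..<m} \<and> (\<forall>k<m. is_tcube (T k) (Q k)) \<and> offset Q m = n"
proof
  assume "Q \<in> Ob (multi_cubes T m n)"
  then obtain d where d: "d \<in> {..<m} \<rightarrow>\<^sub>E {..n}" "sum d {..<m} = n"
    and Q: "Q \<in> Ob (prod_cat {..<m} (\<lambda>k. tcubes (T k) (d k)))"
    unfolding multi_cubes_Un by blast
  have "offset Q m = sum d {..<m}"
    unfolding offset_def using Q by (intro sum.cong) (auto simp: prod_cat_def tcubes_def PiE_iff)
  then show "Q \<in> extensional {..<m} \<and> (\<forall>k<m. is_tcube (T k) (Q k)) \<and> offset Q m = n"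
    using Q d by (auto simp: prod_cat_def tcubes_def PiE_iff)
next
  assume Q: "Q \<in> extensional {..<m} \<and> (\<forall>k<m. is_tcube (T k) (Q k)) \<and> offset Q m = n"
  define d where "d = (\<lambda>k\<in>{..<m}. tdim (Q k))"
  have s: "sum d {..<m} = n" using Q by (auto simp: offset_def d_def)
  then have "d \<in> {..<m} \<rightarrow>\<^sub>E {..n}"
    using member_le_sum[of _ "{..<m}" d] by (auto simp: d_def)
  moreover have "Q \<in> Ob (prod_cat {..<m} (\<lambda>k. tcubes (T k) (d k)))"
    using Q by (auto simp: prod_cat_def tcubes_def PiE_iff d_def)
  ultimately show "Q \<in> Ob (multi_cubes T m n)" using s unfolding multi_cubes_Un by blast
qed

lemma multi_cubes_Ar:
  "F \<in> Ar (multi_cubes T m n) \<longleftrightarrow>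
    F \<in> extensional {..<m} \<and> (\<forall>k<m. is_tcube_mor (T k) (tdim (csrc (F k))) (F k)) \<and>
    offset (\<lambda>k. csrc (F k)) m = n"
proof
  assume "F \<in> Ar (multi_cubes T m n)"
  then obtain d where d: "d \<in> {..<m} \<rightarrow>\<^sub>E {..n}" "sum d {..<m} = n"
    and F: "F \<in> Ar (prod_cat {..<m} (\<lambda>k. tcubes (T k) (d k)))"
    unfolding multi_cubes_Un by blast
  have F': "is_tcube_mor (T k) (d k) (F k)" if "k < m" for k
    using F that by (auto simp: prod_cat_def tcubes_def PiE_iff)
  then have t: "tdim (csrc (F k)) = d k" if "k < m" for k
    using that by (simp add: is_tcube_mor_def)
  then have "offset (\<lambda>k. csrc (F k)) m = sum d {..<m}"
    unfolding offset_def by (intro sum.cong) auto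
  then show "F \<in> extensional {..<m} \<and> (\<forall>k<m. is_tcube_mor (T k) (tdim (csrc (F k))) (F k)) \<and>
    offset (\<lambda>k. csrc (F k)) m = n"
    using F F' t d by (auto simp: prod_cat_def PiE_iff)
next
  assume F: "F \<in> extensional {..<m} \<and> (\<forall>k<m. is_tcube_mor (T k) (tdim (csrc (F k))) (F k)) \<and>
    offset (\<lambda>k. csrc (F k)) m = n"
  define d where "d = (\<lambda>k\<in>{..<m}. tdim (csrc (F k)))"
  have s: "sum d {..<m} = n" using F by (auto simp: offset_def d_def)
  then have "d \<in> {..<m} \<rightarrow>\<^sub>E {..n}"
    using member_le_sum[of _ "{..<m}" d] by (auto simp: d_def)
  moreover have "F \<in> Ar (prod_cat {..<m} (\<lambda>k. tcubes (T k) (d k)))"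
    using F by (auto simp: prod_cat_def tcubes_def PiE_iff d_def)
  ultimately show "F \<in> Ar (multi_cubes T m n)" using s unfolding multi_cubes_Un by blast
qed

lemma tdim_0: "tdim C = 0 \<Longrightarrow> \<exists>x. C = Point x"
  by (cases C) auto

lemma tdim_1: "tdim C = 1 \<Longrightarrow> \<exists>t. C = Triangle t"
  by (cases C) auto

definition pt :: "('o, 'a) tcube \<Rightarrow> 'o" where
  "pt C = (case C of Point x \<Rightarrow> x)"

lemma pt_Point [simp]: "pt (Point x) = x"
  by (simp add: pt_def)

lemma points_cases:
  assumes "Q \<in> Ob (multi_cubes T m 0)"
  obtains x where "x \<in> (\<Pi>\<^sub>E k\<in>{..<m}. Ob (T k))" "Q = points m x"
proof
  note Q = assms[unfolded multi_cubes_Ob]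
  define x where "x = (\<lambda>k\<in>{..<m}. pt (Q k))"
  have q: "Q k = Point (x k)" if "k < m" for k
    using Q that tdim_0[of "Q k"] by (auto simp: offset_def x_def)
  show "x \<in> (\<Pi>\<^sub>E k\<in>{..<m}. Ob (T k))"
  proof
    fix k assume "k \<in> {..<m}"
    then have "is_tcube (T k) (Point (x k))" using Q q[of k] by auto
    then show "x k \<in> Ob (T k)" by simp
  qed (auto simp: x_def)
  show "Q = points m x"
    using Q q family_extensional(1)[of m x] by (intro extensionalityI[of Q "{..<m}"]) auto
qed

lemma single_of_family:
  assumes Q: "Q \<in> extensional {..<m}" "\<forall>k<m. is_tcube (T k) (Q k)"
    and i: "i < m" and z: "\<forall>k<m. k \<noteq> i \<longrightarrow> tdim (Q k) = 0"
  obtains x where "x \<in> others T m {i}" "Q = single m i x (Q i)"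
proof
  define x where "x = (\<lambda>k\<in>{..<m} - {i}. pt (Q k))"
  have q: "Q k = Point (x k)" if "k < m" "k \<noteq> i" for k
    using z that tdim_0[of "Q k"] by (auto simp: x_def)
  show "x \<in> others T m {i}"
    unfolding others_def
  proof
    fix k assume "k \<in> {..<m} - {i}"
    then have "is_tcube (T k) (Point (x k))" using Q q[of k] by auto
    then show "x k \<in> Ob (T k)" by simp
  qed (auto simp: x_def)
  show "Q = single m i x (Q i)"
    using Q(1) family_extensional(2)[OF i, of x "Q i"] q
    by (intro extensionalityI[of Q "{..<m}"]) (auto simp: single_def)
qed

lemma double_of_family:
  assumes Q: "Q \<in> extensional {..<m}" "\<forall>k<m. is_tcube (T k) (Q k)"
    and ij: "i < m" "j < m" "i \<noteq> j" and t: "Q i = Triangle t" "Q j = Triangle t'"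
    and z: "\<forall>k<m. k \<noteq> i \<longrightarrow> k \<noteq> j \<longrightarrow> tdim (Q k) = 0"
  obtains x where "x \<in> others T m {i, j}" "Q = double m i j x t t'"
proof
  define x where "x = (\<lambda>k\<in>{..<m} - {i, j}. pt (Q k))"
  have q: "Q k = Point (x k)" if "k < m" "k \<noteq> i" "k \<noteq> j" for k
    using z that tdim_0[of "Q k"] by (auto simp: x_def)
  show "x \<in> others T m {i, j}"
    unfolding others_def
  proof
    fix k assume "k \<in> {..<m} - {i, j}"
    then have "is_tcube (T k) (Point (x k))" using Q q[of k] by auto
    then show "x k \<in> Ob (T k)" by simp
  qed (auto simp: x_def)
  show "Q = double m i j x t t'"
    using Q(1) family_extensional(3)[OF ij(1,2), of x t t'] q t
    by (intro extensionalityI[of Q "{..<m}"]) (auto simp: double_def)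
qed

lemma single_cases:
  assumes "Q \<in> Ob (multi_cubes T m 1)"
  obtains i x t where "i < m" "x \<in> others T m {i}" "t \<in> distg (T i)" "Q = single m i x (Triangle t)"
proof -
  note Q = assms[unfolded multi_cubes_Ob]
  then have "(\<Sum>k<m. tdim (Q k)) = 1" by (simp add: offset_def)
  then obtain i where i: "i < m" "tdim (Q i) = 1" "\<forall>k<m. k \<noteq> i \<longrightarrow> tdim (Q k) = 0"
    using sum_eq_1_iff[of "{..<m}" "\<lambda>k. tdim (Q k)"] by auto
  then obtain t where t: "Q i = Triangle t" using tdim_1 by blast
  then have "t \<in> distg (T i)" using Q i(1) by (metis is_tcube.simps(2))
  moreover obtain x where "x \<in> others T m {i}" "Q = single m i x (Q i)"
    using single_of_family[of Q m T i] Q i by blast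
  ultimately show thesis using that i(1) t by metis
qed

text \<open>The dimensions of the factors add up to two: a factor of positive dimension takes the
  whole, or leaves exactly one for another factor. Symmetry allows i < j in the second case.\<close>

lemma square_cases:
  assumes "Q \<in> Ob (multi_cubes T m 2)"
  obtains
    (square) i x R K V where "i < m" "x \<in> others T m {i}" "is_tcube (T i) (Square R K V)"
      "Q = single m i x (Square R K V)"
  | (triangles) i j x t t' where "i < j" "j < m" "x \<in> others T m {i, j}" "t \<in> distg (T i)" "t' \<in> distg (T j)"
      "Q = double m i j x t t'"
proof -
  note Q = assms[unfolded multi_cubes_Ob]
  have s: "(\<Sum>k<m. tdim (Q k)) = 2" using Q by (simp add: offset_def)
  then obtain i where i: "i < m" "tdim (Q i) \<noteq> 0" by (metis lessThan_iff sum.neutral zero_neq_numeral)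
  have r: "tdim (Q i) + (\<Sum>k\<in>{..<m} - {i}. tdim (Q k)) = 2"
    using s i sum.remove[of "{..<m}" i "\<lambda>k. tdim (Q k)"] by simp
  then consider "tdim (Q i) = 2" "(\<Sum>k\<in>{..<m} - {i}. tdim (Q k)) = 0"
    | "tdim (Q i) = 1" "(\<Sum>k\<in>{..<m} - {i}. tdim (Q k)) = 1" using i(2) by linarith
  then show thesis
  proof cases
    case 1
    then obtain R K V where t: "Q i = Square R K V" by (cases "Q i") auto
    obtain x where "x \<in> others T m {i}" "Q = single m i x (Q i)"
      using single_of_family[of Q m T i] Q i(1) 1(2) by auto
    moreover have "is_tcube (T i) (Square R K V)" using Q i(1) t by metis
    ultimately show thesis using square i(1) t by metis
  next
    case 2
    then obtain j where j: "j \<in> {..<m} - {i}" "tdim (Q j) = 1"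
      "\<forall>b\<in>{..<m} - {i}. j \<noteq> b \<longrightarrow> tdim (Q b) = 0"
      using sum_eq_1_iff[of "{..<m} - {i}" "\<lambda>k. tdim (Q k)"] by blast
    then have j: "j < m" "j \<noteq> i" "tdim (Q j) = 1" "\<forall>k<m. k \<noteq> i \<longrightarrow> k \<noteq> j \<longrightarrow> tdim (Q k) = 0"
      by auto
    obtain t t' where t: "Q i = Triangle t" "Q j = Triangle t'" using tdim_1 2(1) j(3) by blast
    have d: "t \<in> distg (T i)" "t' \<in> distg (T j)" using Q i(1) j(1) t by (metis is_tcube.simps(2))+
    show thesis
    proof (cases "i < j")
      case True
      obtain x where "x \<in> others T m {i, j}" "Q = double m i j x t t'"
        using double_of_family[of Q m T i j t t'] Q i(1) j t by metis
      then show thesis using triangles True j(1) d by metis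
    next
      case False
      obtain x where "x \<in> others T m {j, i}" "Q = double m j i x t' t"
        using double_of_family[of Q m T j i t' t] Q i(1) j t by metis
      then show thesis using triangles[of j i x t' t] False j(2) i(1) d by force
    qed
  qed
qed

section \<open>The cubes built from objects and additivity data\<close>

section \<open>The cubical functor of a multi-determinant functor\<close>

definition seg :: "(nat \<Rightarrow> ('o, 'a) tcube) \<Rightarrow> nat \<Rightarrow> int list \<Rightarrow> int list" where
  "seg Q k a = take (tdim (Q k)) (drop (offset Q k) a)"

text \<open>Factors of dimension zero do not raise the offset and are skipped by the minimum, so
  this is the factor that direction i belongs to.\<close>

definition factor :: "(nat \<Rightarrow> ('o, 'a) tcube) \<Rightarrow> nat \<Rightarrow> nat" where
  "factor Q i = (LEAST k. i < offset Q (Suc k))"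

text \<open>An edge varies in one factor k only. Its position is completed by the coordinate 0, and
  the entry k is then cut out again because \<open>m_add\<close> takes the family of the remaining
  variables.\<close>

definition cub_ob ::
  "(nat \<Rightarrow> ('o, 'a) tricat) \<Rightarrow> nat \<Rightarrow> ('o, 'a, 'p, 'q) mdf \<Rightarrow> nat \<Rightarrow>
   (nat \<Rightarrow> ('o, 'a) tcube) \<Rightarrow> ('p, 'q) pcube" where
  "cub_ob T m d n Q = \<lparr>pv = (\<lambda>a\<in>coords n. on_ob d (multi_vertex T m Q a)),
     pe = (\<lambda>(i, c)\<in>{..<n} \<times> coords (n - 1). let k = factor Q i in
       m_add d (k, restrict (multi_vertex T m Q (ins i 0 c)) ({..<m} - {k}),
         tedge (Q k) (i - offset Q k) (take (tdim (Q k) - 1) (drop (offset Q k) c))))\<rparr>"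

definition cub_ar ::
  "(nat \<Rightarrow> ('o, 'a) tricat) \<Rightarrow> nat \<Rightarrow> ('o, 'a, 'p, 'q) mdf \<Rightarrow> nat \<Rightarrow>
   (nat \<Rightarrow> (('o, 'a) tcube, 'a) cmor) \<Rightarrow> (('p, 'q) pcube, 'q) cmor" where
  "cub_ar T m d n F = CMor (cub_ob T m d n (\<lambda>k\<in>{..<m}. csrc (F k)))
     (cub_ob T m d n (\<lambda>k\<in>{..<m}. ctgt (F k)))
     (\<lambda>a\<in>coords n. on_ar d (\<lambda>k\<in>{..<m}. cat_at (F k) (seg (\<lambda>l. csrc (F l)) k a)))"

definition cub ::
  "(nat \<Rightarrow> ('o, 'a) tricat) \<Rightarrow> nat \<Rightarrow> ('o, 'a, 'p, 'q) mdf \<Rightarrow> ('o, 'a, 'p, 'q) cmdf" where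
  "cub T m d = (\<lambda>n\<in>{..2}. \<lparr>on_ob = restrict (cub_ob T m d n) (Ob (multi_cubes T m n)),
     on_ar = restrict (cub_ar T m d n) (Ar (multi_cubes T m n))\<rparr>)"

lemma multi_vertex_points: "x \<in> extensional {..<m} \<Longrightarrow> multi_vertex T m (points m x) a = x"
  by (intro extensionalityI[of _ "{..<m}"]) (auto simp: multi_vertex_def)

lemma multi_vertex_single:
  assumes "i < m" "x \<in> extensional ({..<m} - {i})" "length a = tdim C"
  shows "multi_vertex T m (single m i x C) a = x(i := tv (T i) C a)"
proof (rule extensionalityI[of _ "{..<m}"])
  show "x(i := tv (T i) C a) \<in> extensional {..<m}" using assms by (auto simp: extensional_def)
  fix k assume "k \<in> {..<m}"
  then show "multi_vertex T m (single m i x C) a k = (x(i := tv (T i) C a)) k"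
    using assms by (cases "k = i") (auto simp: multi_vertex_def offset_single)
qed (simp add: multi_vertex_def)

lemma multi_vertex_double:
  assumes "i < j" "j < m" "x \<in> extensional ({..<m} - {i, j})" "length a = 2"
  shows "multi_vertex T m (double m i j x t t') a = x(i := vertex (T i) t (a ! 0), j := vertex (T j) t' (a ! 1))"
proof (rule extensionalityI[of _ "{..<m}"])
  show "x(i := vertex (T i) t (a ! 0), j := vertex (T j) t' (a ! 1)) \<in> extensional {..<m}"
    using assms by (auto simp: extensional_def)
  obtain \<alpha> \<beta> where a: "a = [\<alpha>, \<beta>]" using assms(4) by (auto simp: length_Suc_conv numeral_2_eq_2)
  fix k assume "k \<in> {..<m}"
  then consider "k = i" | "k = j" | "k < m" "k \<noteq> i" "k \<noteq> j" by auto
  then show "multi_vertex T m (double m i j x t t') a k =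
      (x(i := vertex (T i) t (a ! 0), j := vertex (T j) t' (a ! 1))) k"
    using assms by cases (auto simp: multi_vertex_def offset_double a)
qed (simp add: multi_vertex_def)

lemma factor_single:
  assumes "i < m" "l < tdim C"
  shows "factor (single m i x C) l = i"
  unfolding factor_def
proof (rule Least_equality)
  show "l < offset (single m i x C) (Suc i)" using assms by (simp add: offset_single)
  show "i \<le> k" if "l < offset (single m i x C) (Suc k)" for k
    using that offset_single[OF assms(1), of "Suc k" x C] assms by (cases "Suc k \<le> m") (auto split: if_splits)
qed

lemma factor_double:
  assumes "i < j" "j < m"
  shows "factor (double m i j x t t') 0 = i" "factor (double m i j x t t') (Suc 0) = j"
  unfolding factor_def
proof -
  show "(LEAST k. 0 < offset (double m i j x t t') (Suc k)) = i"
  proof (rule Least_equality)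
    show "0 < offset (double m i j x t t') (Suc i)" using assms by (simp add: offset_double)
    show "i \<le> k" if "0 < offset (double m i j x t t') (Suc k)" for k
      using that offset_double[OF assms, of "Suc k" x t t'] assms by (cases "Suc k \<le> m") (auto split: if_splits)
  qed
  show "(LEAST k. Suc 0 < offset (double m i j x t t') (Suc k)) = j"
  proof (rule Least_equality)
    show "Suc 0 < offset (double m i j x t t') (Suc j)" using assms by (simp add: offset_double)
    show "j \<le> k" if "Suc 0 < offset (double m i j x t t') (Suc k)" for k
      using that offset_double[OF assms, of "Suc k" x t t'] assms by (cases "Suc k \<le> m") (auto split: if_splits)
  qed
qed

lemma cub_ob_points:
  assumes "x \<in> extensional {..<m}"
  shows "cub_ob T m d 0 (points m x) = \<lparr>pv = (\<lambda>a\<in>coords 0. on_ob d x), pe = (\<lambda>_. undefined)\<rparr>"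
  using assms by (auto simp: cub_ob_def multi_vertex_points restrict_def fun_eq_iff)

lemma pcube_eqI: "v = v' \<Longrightarrow> e = e' \<Longrightarrow> \<lparr>pv = v, pe = e\<rparr> = \<lparr>pv = v', pe = e'\<rparr>"
  by simp

lemma cub_ob_single:
  assumes i: "i < m" and x: "x \<in> extensional ({..<m} - {i})" and n: "tdim C = n" "0 < n"
  shows "cub_ob T m d n (single m i x C) =
    \<lparr>pv = (\<lambda>a\<in>coords n. on_ob d (x(i := tv (T i) C a))),
     pe = (\<lambda>(l, c)\<in>{..<n} \<times> coords (n - 1). m_add d (i, x, tedge C l c))\<rparr>"
proof -
  have e: "restrict (x(i := y)) ({..<m} - {i}) = x" for y
    using x by (intro extensionalityI[of _ "{..<m} - {i}"]) auto
  have v: "multi_vertex T m (single m i x C) (ins l 0 c) = x(i := tv (T i) C (ins l 0 c))"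
    if "l < n" "c \<in> coords (n - 1)" for l c
    using that ins_coords[of c "n - 1" 0 l] i x n
    by (intro multi_vertex_single) (auto dest: coords_length)
  have w: "multi_vertex T m (single m i x C) a = x(i := tv (T i) C a)" if "a \<in> coords n" for a
    using that i x n by (intro multi_vertex_single) (auto dest: coords_length)
  have f: "factor (single m i x C) l = i" if "l < n" for l
    using that i n by (intro factor_single) auto
  have r: "restrict (multi_vertex T m (single m i x C) (ins l 0 c)) ({..<m} - {i}) = x"
    if "l < n" "c \<in> coords (n - 1)" for l c
    using v[OF that] e by simp
  show ?thesis
    unfolding cub_ob_def
  proof (rule pcube_eqI; rule restrict_ext)
    show "on_ob d (multi_vertex T m (single m i x C) a) = on_ob d (x(i := tv (T i) C a))"
      if "a \<in> coords n" for a using w[OF that] by simp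
  qed (use i n(1) in \<open>clarsimp simp: r f offset_single coords_length Let_def\<close>)
qed

lemma cub_ob_double:
  assumes ij: "i < j" "j < m" and x: "x \<in> extensional ({..<m} - {i, j})"
  shows "cub_ob T m d 2 (double m i j x t t') =
    \<lparr>pv = (\<lambda>a\<in>coords 2. on_ob d (x(i := vertex (T i) t (a ! 0), j := vertex (T j) t' (a ! 1)))),
     pe = (\<lambda>(l, c)\<in>{..<2} \<times> coords 1.
       if l = 0 then m_add d (i, x(j := vertex (T j) t' (c ! 0)), t)
       else m_add d (j, x(i := vertex (T i) t (c ! 0)), t'))\<rparr>"
proof -
  have e: "restrict (x(i := y, j := z)) ({..<m} - {i}) = x(j := z)"
    "restrict (x(i := y, j := z)) ({..<m} - {j}) = x(i := y)" for y z
    using x ij by (auto simp: extensional_def fun_eq_iff)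
  note v = multi_vertex_double[OF ij x]
  have pe: "(let k = factor (double m i j x t t') l in
       m_add d (k, restrict (multi_vertex T m (double m i j x t t') (ins l 0 c)) ({..<m} - {k}),
         tedge (double m i j x t t' k) (l - offset (double m i j x t t') k)
          (take (tdim (double m i j x t t' k) - 1) (drop (offset (double m i j x t t') k) c)))) =
      (if l = 0 then m_add d (i, x(j := vertex (T j) t' (c ! 0)), t)
       else m_add d (j, x(i := vertex (T i) t (c ! 0)), t'))" if l: "l < 2" and c: "c \<in> coords 1" for l c
  proof -
    obtain \<gamma> where c: "c = [\<gamma>]" using c by auto
    consider "l = 0" | "l = Suc 0" using l by linarith
    then show ?thesis
      using ij by cases (simp_all add: factor_double v e c Let_def)
  qed
  have w: "multi_vertex T m (double m i j x t t') a = x(i := vertex (T i) t (a ! 0), j := vertex (T j) t' (a ! 1))"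
    if "a \<in> coords 2" for a using v coords_length[OF that] by blast
  have 1: "(2 :: nat) - 1 = 1" by simp
  show ?thesis
    unfolding cub_ob_def 1
  proof (rule pcube_eqI; rule restrict_ext)
    show "on_ob d (multi_vertex T m (double m i j x t t') a) =
        on_ob d (x(i := vertex (T i) t (a ! 0), j := vertex (T j) t' (a ! 1)))"
      if "a \<in> coords 2" for a using w[OF that] by simp
  qed (use pe in \<open>clarsimp\<close>)
qed

section \<open>Joint naturality of the additivity data in all variables\<close>

section \<open>Multi-determinant functors\<close>

lemma (in picard) paste:
  assumes "a1 \<in> Hom P (z1 \<boxplus> x1) y1" "a2 \<in> Hom P (z2 \<boxplus> x2) y2" "a3 \<in> Hom P (z3 \<boxplus> x3) y3"
    "b \<in> Hom P y1 y2" "b' \<in> Hom P y2 y3" "c \<in> Hom P z1 z2" "c' \<in> Hom P z2 z3" "e \<in> Hom P x1 x2" "e' \<in> Hom P x2 x3"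
    and 1: "b \<cdot> a1 = a2 \<cdot> (c \<oplus> e)" and 2: "b' \<cdot> a2 = a3 \<cdot> (c' \<oplus> e')"
  shows "(b' \<cdot> b) \<cdot> a1 = a3 \<cdot> ((c' \<cdot> c) \<oplus> (e' \<cdot> e))"
proof -
  note [simp] = HomD(1-3)[OF assms(1)] HomD(1-3)[OF assms(2)] HomD(1-3)[OF assms(3)] HomD(1-3)[OF assms(4)]
    HomD(1-3)[OF assms(5)] HomD(1-3)[OF assms(6)] HomD(1-3)[OF assms(7)] HomD(1-3)[OF assms(8)] HomD(1-3)[OF assms(9)]
  have "(b' \<cdot> b) \<cdot> a1 = b' \<cdot> (b \<cdot> a1)" by simp
  also have "\<dots> = (b' \<cdot> a2) \<cdot> (c \<oplus> e)" unfolding 1 by simp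
  also have "\<dots> = a3 \<cdot> ((c' \<oplus> e') \<cdot> (c \<oplus> e))" unfolding 2 by simp
  finally show ?thesis by (simp add: interchange)
qed

lemma isom_prod_simps:
  "Ob (isom_prod T m) = (\<Pi>\<^sub>E k\<in>{..<m}. Ob (T k))"
  "Ar (isom_prod T m) = (\<Pi>\<^sub>E k\<in>{..<m}. isos (T k))"
  "Dom (isom_prod T m) f = (\<lambda>k\<in>{..<m}. Dom (T k) (f k))"
  "Cod (isom_prod T m) f = (\<lambda>k\<in>{..<m}. Cod (T k) (f k))"
  "Idt (isom_prod T m) x = (\<lambda>k\<in>{..<m}. Idt (T k) (x k))"
  "Cmp (isom_prod T m) g f = (\<lambda>k\<in>{..<m}. g k \<cdot>\<^bsub>T k\<^esub> f k)"
  by (simp_all add: isom_prod_def prod_cat_def isom_def)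

lemma distg_vertex:
  assumes "tri T" "t \<in> distg T" "\<alpha> \<in> {-1, 0, 1}"
  shows "vertex T t \<alpha> \<in> Ob T"
proof -
  interpret tri T by fact
  obtain f g h where t: "t = (f, g, h)" by (metis prod_cases3)
  show ?thesis using distD[OF assms(2)[unfolded t]] assms(3) by (auto simp: t)
qed

locale multi =
  fixes T :: "nat \<Rightarrow> ('o, 'a) tricat" and m :: nat and P :: "('p, 'q) symcat"
  assumes triangulated: "k < m \<Longrightarrow> triangulated (T k)" and picard_P: "picard_groupoid P"

sublocale multi \<subseteq> P: picard P
  by unfold_locales (rule picard_P)

locale multi_det = multi T m P
  for T :: "nat \<Rightarrow> ('o, 'a) tricat" and m :: nat and P :: "('p, 'q) symcat" +
  fixes d :: "('o, 'a, 'p, 'q) mdf"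
  assumes multi_det: "multi_determinant T m P d"

context multi
begin

lemma tri: "k < m \<Longrightarrow> tri (T k)"
  by unfold_locales (rule triangulated)

lemma catg: "k < m \<Longrightarrow> catg (T k)"
  using tri by (simp add: tri_def catg.intro triangulated_def additive_category_def)

lemma others_upd: "i < m \<Longrightarrow> x \<in> others T m {i} \<Longrightarrow> a \<in> Ob (T i) \<Longrightarrow> x(i := a) \<in> (\<Pi>\<^sub>E k\<in>{..<m}. Ob (T k))"
  by (auto simp: others_def PiE_iff extensional_def)

lemma others_upd2:
  "i < m \<Longrightarrow> j < m \<Longrightarrow> i \<noteq> j \<Longrightarrow> x \<in> others T m {i, j} \<Longrightarrow> a \<in> Ob (T i) \<Longrightarrow> x(i := a) \<in> others T m {j}"
  "i < m \<Longrightarrow> j < m \<Longrightarrow> i \<noteq> j \<Longrightarrow> x \<in> others T m {i, j} \<Longrightarrow> a \<in> Ob (T j) \<Longrightarrow> x(j := a) \<in> others T m {i}"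
  by (auto simp: others_def PiE_iff extensional_def)

lemma others_extensional: "x \<in> others T m J \<Longrightarrow> x \<in> extensional ({..<m} - J)"
  by (simp add: others_def PiE_iff)

end

context multi_det
begin

abbreviation "Do \<equiv> on_ob d"
abbreviation "Da \<equiv> on_ar d"
abbreviation "add i x t \<equiv> m_add d (i, x, t)"

lemmas multi_det_rest = multi_det[unfolded multi_determinant_def, THEN conjunct2, THEN conjunct2]
lemmas functor_d = multi_det_rest[THEN conjunct1]
lemmas multi_det_rest2 = multi_det_rest[THEN conjunct2]
lemmas multi_det_rest3 = multi_det_rest2[THEN conjunct2]
lemmas two_triangles0 = multi_det_rest3[THEN conjunct1]
lemmas triangle_function0 = multi_det_rest3[THEN conjunct2]

lemma Do_Ob: "x \<in> (\<Pi>\<^sub>E k\<in>{..<m}. Ob (T k)) \<Longrightarrow> Do x \<in> Ob P"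
  using functor_d unfolding is_functor_def isom_prod_simps by blast

lemma Da_Hom:
  "f \<in> (\<Pi>\<^sub>E k\<in>{..<m}. isos (T k)) \<Longrightarrow>
    Da f \<in> Hom P (Do (\<lambda>k\<in>{..<m}. Dom (T k) (f k))) (Do (\<lambda>k\<in>{..<m}. Cod (T k) (f k)))"
  using functor_d unfolding is_functor_def isom_prod_simps by blast

lemma Da_id: "x \<in> (\<Pi>\<^sub>E k\<in>{..<m}. Ob (T k)) \<Longrightarrow> Da (\<lambda>k\<in>{..<m}. Idt (T k) (x k)) = Idt P (Do x)"
  using functor_d unfolding is_functor_def isom_prod_simps by blast

lemma Da_comp:
  assumes "f \<in> (\<Pi>\<^sub>E k\<in>{..<m}. isos (T k))" "g \<in> (\<Pi>\<^sub>E k\<in>{..<m}. isos (T k))"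
    "\<And>k. k < m \<Longrightarrow> Cod (T k) (f k) = Dom (T k) (g k)"
  shows "Da (\<lambda>k\<in>{..<m}. g k \<cdot>\<^bsub>T k\<^esub> f k) = Da g \<cdot>\<^bsub>P\<^esub> Da f"
proof -
  have "(\<lambda>k\<in>{..<m}. Cod (T k) (f k)) = (\<lambda>k\<in>{..<m}. Dom (T k) (g k))" using assms(3) by fastforce
  then show ?thesis using functor_d assms(1,2) unfolding is_functor_def isom_prod_simps by blast
qed

lemma det_in_variable:
  assumes "i < m" "x \<in> others T m {i}"
  shows "det (T i) P
    \<lparr>on_ob = (\<lambda>a. Do (x(i := a))), on_ar = (\<lambda>f. Da ((others_id T m {i} x)(i := f)))\<rparr> (\<lambda>t. add i x t)"
proof -
  interpret tri "T i" by (rule tri[OF assms(1)])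
  show ?thesis
    by unfold_locales (use multi_det_rest2[THEN conjunct1] assms in blast)
qed

lemma add_Hom:
  assumes "i < m" "x \<in> others T m {i}" "t \<in> distg (T i)"
  shows "add i x t \<in> Hom P (Do (x(i := vertex (T i) t 1)) \<boxplus>\<^bsub>P\<^esub> Do (x(i := vertex (T i) t (-1))))
    (Do (x(i := vertex (T i) t 0)))"
proof -
  obtain f g h where t: "t = (f, g, h)" by (metis prod_cases3)
  interpret det "T i" P "\<lparr>on_ob = (\<lambda>a. Do (x(i := a))), on_ar = (\<lambda>f. Da ((others_id T m {i} x)(i := f)))\<rparr>"
    "\<lambda>t. add i x t" by (rule det_in_variable[OF assms(1,2)])
  show ?thesis using ad_Hom[OF assms(3)[unfolded t]] by (simp add: t)
qed

lemma two_triangles: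
  assumes "i < j" "j < m" "x \<in> others T m {i, j}" "t \<in> distg (T i)" "t' \<in> distg (T j)"
  shows "add j (x(i := vertex (T i) t 0)) t' \<cdot>\<^bsub>P\<^esub>
      (add i (x(j := vertex (T j) t' 1)) t \<oplus>\<^bsub>P\<^esub> add i (x(j := vertex (T j) t' (-1))) t) =
    add i (x(j := vertex (T j) t' 0)) t \<cdot>\<^bsub>P\<^esub>
      (add j (x(i := vertex (T i) t 1)) t' \<oplus>\<^bsub>P\<^esub> add j (x(i := vertex (T i) t (-1))) t') \<cdot>\<^bsub>P\<^esub>
      coas P (Do (x(i := vertex (T i) t 1, j := vertex (T j) t' 1))) (Do (x(i := vertex (T i) t (-1), j := vertex (T j) t' 1)))
        (Do (x(i := vertex (T i) t 1, j := vertex (T j) t' (-1)))) (Do (x(i := vertex (T i) t (-1), j := vertex (T j) t' (-1))))"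
proof -
  obtain f g h f' g' h' where t: "t = (f, g, h)" "t' = (f', g', h')" by (metis prod_cases3)
  then show ?thesis
    using two_triangles0[rule_format, of i j x f g h f' g' h'] assms by (simp add: Let_def)
qed

lemma triangle_function:
  assumes "i < m" "j < m" "i \<noteq> j" "x \<in> others T m {i, j}" "\<phi> \<in> isos (T i)" "t \<in> distg (T j)"
  shows "Da ((others_id T m {i, j} x)(i := \<phi>, j := Idt (T j) (vertex (T j) t 0))) \<cdot>\<^bsub>P\<^esub> add j (x(i := Dom (T i) \<phi>)) t =
    add j (x(i := Cod (T i) \<phi>)) t \<cdot>\<^bsub>P\<^esub>
      (Da ((others_id T m {i, j} x)(i := \<phi>, j := Idt (T j) (vertex (T j) t 1))) \<oplus>\<^bsub>P\<^esub>
       Da ((others_id T m {i, j} x)(i := \<phi>, j := Idt (T j) (vertex (T j) t (-1)))))"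
proof -
  obtain f g h where t: "t = (f, g, h)" by (metis prod_cases3)
  then show ?thesis
    using triangle_function0[rule_format, of i j x \<phi> f g h] assms by (simp add: Let_def)
qed

context
  fixes i \<phi> t
  assumes i: "i < m" and \<phi>: "\<phi> \<in> (\<Pi>\<^sub>E k\<in>{..<m} - {i}. isos (T k))" and t: "t \<in> distg (T i)"
begin

text \<open>An intermediate stage at which only the variables in S have been moved along \<phi>.
  Enlarging S by one element costs one use of Triangle-Function.\<close>

definition stage_ob :: "nat set \<Rightarrow> nat \<Rightarrow> 'o" where
  "stage_ob S = (\<lambda>k\<in>{..<m} - {i}. if k \<in> S then Cod (T k) (\<phi> k) else Dom (T k) (\<phi> k))"

definition stage_ar :: "nat set \<Rightarrow> nat \<Rightarrow> 'a" where
  "stage_ar S = (\<lambda>k\<in>{..<m} - {i}. if k \<in> S then \<phi> k else Idt (T k) (Dom (T k) (\<phi> k)))"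

lemma phi_Ob:
  assumes "k < m" "k \<noteq> i"
  shows "\<phi> k \<in> isos (T k)" "Dom (T k) (\<phi> k) \<in> Ob (T k)" "Cod (T k) (\<phi> k) \<in> Ob (T k)" "\<phi> k \<in> Ar (T k)"
proof -
  interpret catg "T k" by (rule catg[OF assms(1)])
  show "\<phi> k \<in> isos (T k)" using \<phi> assms by (auto simp: PiE_iff)
  then show "\<phi> k \<in> Ar (T k)" by (rule isos_Ar)
  then show "Dom (T k) (\<phi> k) \<in> Ob (T k)" "Cod (T k) (\<phi> k) \<in> Ob (T k)" by simp_all
qed

lemma stage_ob_others: "stage_ob S \<in> others T m {i}"
  unfolding others_def stage_ob_def using phi_Ob by (auto simp: PiE_iff)

lemma id_isos: "k < m \<Longrightarrow> x \<in> Ob (T k) \<Longrightarrow> Idt (T k) x \<in> isos (T k)"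
  by (rule catg.isos_id[OF catg])

lemma id_Dom_Cod:
  assumes "k < m" "x \<in> Ob (T k)"
  shows "Dom (T k) (Idt (T k) x) = x" "Cod (T k) (Idt (T k) x) = x"
  using catg.id_Ar[OF catg[OF assms(1)] assms(2)] by auto

lemma stage_ar_isos: "b \<in> Ob (T i) \<Longrightarrow> (stage_ar S)(i := Idt (T i) b) \<in> (\<Pi>\<^sub>E k\<in>{..<m}. isos (T k))"
  unfolding stage_ar_def using phi_Ob id_isos i by (auto simp: PiE_iff extensional_def)

lemma stage_ar_Hom:
  assumes b: "b \<in> Ob (T i)"
  shows "Da ((stage_ar S)(i := Idt (T i) b)) \<in> Hom P (Do ((stage_ob {})(i := b))) (Do ((stage_ob S)(i := b)))"
proof -
  let ?f = "(stage_ar S)(i := Idt (T i) b)"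
  have 1: "(\<lambda>k\<in>{..<m}. Dom (T k) (?f k)) = (stage_ob {})(i := b)"
    using i b phi_Ob id_Dom_Cod by (auto simp: fun_eq_iff stage_ar_def stage_ob_def)
  have 2: "(\<lambda>k\<in>{..<m}. Cod (T k) (?f k)) = (stage_ob S)(i := b)"
    using i b phi_Ob id_Dom_Cod by (auto simp: fun_eq_iff stage_ar_def stage_ob_def)
  show ?thesis using Da_Hom[OF stage_ar_isos[OF b, of S]] unfolding 1 2 .
qed

text \<open>Induction on S: each step pastes the naturality square so far with a Triangle-Function
  square for the new variable.\<close>

lemma stage_nat:
  assumes "finite S" "S \<subseteq> {..<m} - {i}"
  shows "Da ((stage_ar S)(i := Idt (T i) (vertex (T i) t 0))) \<cdot>\<^bsub>P\<^esub> add i (stage_ob {}) t =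
    add i (stage_ob S) t \<cdot>\<^bsub>P\<^esub> (Da ((stage_ar S)(i := Idt (T i) (vertex (T i) t 1))) \<oplus>\<^bsub>P\<^esub>
      Da ((stage_ar S)(i := Idt (T i) (vertex (T i) t (-1)))))"
  using assms
proof (induction S rule: finite_induct)
  case empty
  have v: "vertex (T i) t \<alpha> \<in> Ob (T i)" if "\<alpha> \<in> {-1, 0, 1}" for \<alpha>
    using distg_vertex[OF tri[OF i] t that] .
  have e: "Da ((stage_ar {})(i := Idt (T i) b)) = Idt P (Do ((stage_ob {})(i := b)))" if "b \<in> Ob (T i)" for b
  proof -
    have "(stage_ar {})(i := Idt (T i) b) = (\<lambda>k\<in>{..<m}. Idt (T k) (((stage_ob {})(i := b)) k))"
      using i by (auto simp: fun_eq_iff stage_ar_def stage_ob_def)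
    then show ?thesis using Da_id[OF others_upd[OF i stage_ob_others that]] by metis
  qed
  note a = add_Hom[OF i stage_ob_others t, of "{}"]
  note o = Do_Ob[OF others_upd[OF i stage_ob_others]]
  have v3: "vertex (T i) t 0 \<in> Ob (T i)" "vertex (T i) t 1 \<in> Ob (T i)" "vertex (T i) t (-1) \<in> Ob (T i)"
    by (rule v, simp)+
  have p: "Idt P (Do ((stage_ob {})(i := vertex (T i) t 1))) \<oplus>\<^bsub>P\<^esub> Idt P (Do ((stage_ob {})(i := vertex (T i) t (-1)))) =
    Idt P (Do ((stage_ob {})(i := vertex (T i) t 1)) \<boxplus>\<^bsub>P\<^esub> Do ((stage_ob {})(i := vertex (T i) t (-1))))"
    by (rule P.plus_id[OF o o]) (simp_all add: v)
  show ?case unfolding e[OF v3(1)] e[OF v3(2)] e[OF v3(3)] p P.id_left[OF a] P.id_right[OF a] ..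
next
  case (insert l S)
  have l: "l < m" "l \<noteq> i" "l \<notin> S" using insert by auto
  have v: "vertex (T i) t \<alpha> \<in> Ob (T i)" if "\<alpha> \<in> {-1, 0, 1}" for \<alpha>
    using distg_vertex[OF tri[OF i] t that] .
  \<comment> \<open>What the stages before and after moving l have in common: neither the variable l
    nor i is included.\<close>
  define y where "y = restrict (stage_ob S) ({..<m} - {l, i})"
  have y: "y \<in> others T m {l, i}"
    unfolding others_def y_def stage_ob_def using phi_Ob by (auto simp: PiE_iff)
  have y1: "y(l := Dom (T l) (\<phi> l)) = stage_ob S" and y2: "y(l := Cod (T l) (\<phi> l)) = stage_ob (insert l S)"
    using l by (auto simp: fun_eq_iff y_def stage_ob_def)
  define g where "g b = (others_id T m {l, i} y)(l := \<phi> l, i := Idt (T i) b)" for b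
  have g: "g b \<in> (\<Pi>\<^sub>E k\<in>{..<m}. isos (T k))" if "b \<in> Ob (T i)" for b
    unfolding g_def others_id_def using that i l phi_Ob id_isos y
    by (auto simp: PiE_iff extensional_def others_def)
  have yo: "y k \<in> Ob (T k)" if "k < m" "k \<noteq> l" "k \<noteq> i" for k
    using y that by (auto simp: others_def)
  have gd: "Dom (T k) (g b k) = ((stage_ob S)(i := b)) k" "Cod (T k) (g b k) = ((stage_ob (insert l S))(i := b)) k"
    if "b \<in> Ob (T i)" "k < m" for b k
    unfolding y1[symmetric] y2[symmetric] g_def others_id_def using that id_Dom_Cod yo i l by auto
  have e: "(\<lambda>k\<in>{..<m}. Dom (T k) (g b k)) = (stage_ob S)(i := b)" "(\<lambda>k\<in>{..<m}. Cod (T k) (g b k)) = (stage_ob (insert l S))(i := b)"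
    if b: "b \<in> Ob (T i)" for b
  proof -
    have x: "(stage_ob U)(i := b) \<in> extensional {..<m}" for U
      using others_upd[OF i stage_ob_others b] by (simp add: PiE_iff)
    show "(\<lambda>k\<in>{..<m}. Dom (T k) (g b k)) = (stage_ob S)(i := b)"
      by (rule extensionalityI[OF _ x]) (use gd(1)[OF b] in auto)
    show "(\<lambda>k\<in>{..<m}. Cod (T k) (g b k)) = (stage_ob (insert l S))(i := b)"
      by (rule extensionalityI[OF _ x]) (use gd(2)[OF b] in auto)
  qed
  have gH: "Da (g b) \<in> Hom P (Do ((stage_ob S)(i := b))) (Do ((stage_ob (insert l S))(i := b)))" if "b \<in> Ob (T i)" for b
    using Da_Hom[OF g[OF that]] unfolding e[OF that] .
  \<comment> \<open>The morphism for \<open>insert l S\<close> is the one for S followed by \<phi>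
    in the variable l alone.\<close>
  have c: "Da ((stage_ar (insert l S))(i := Idt (T i) b)) = Da (g b) \<cdot>\<^bsub>P\<^esub> Da ((stage_ar S)(i := Idt (T i) b))"
    if b: "b \<in> Ob (T i)" for b
  proof -
    have s: "Cod (T k) (((stage_ar S)(i := Idt (T i) b)) k) = ((stage_ob S)(i := b)) k" if "k < m" for k
      using that b i phi_Ob id_Dom_Cod by (auto simp: stage_ar_def stage_ob_def)
    have "(stage_ar (insert l S))(i := Idt (T i) b) =
      (\<lambda>k\<in>{..<m}. g b k \<cdot>\<^bsub>T k\<^esub> ((stage_ar S)(i := Idt (T i) b)) k)"
    proof
      fix k
      show "((stage_ar (insert l S))(i := Idt (T i) b)) k =
        (\<lambda>k\<in>{..<m}. g b k \<cdot>\<^bsub>T k\<^esub> ((stage_ar S)(i := Idt (T i) b)) k) k"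
      proof (cases "k < m")
        case True
        interpret catg "T k" by (rule catg[OF True])
        show ?thesis
          using True i l b phi_Ob catg.id_comp_Ar[OF catg[OF i] catg.id_Ar(1)[OF catg[OF i] b]]
            catg.id_comp_Ar[OF catg[OF l(1)] phi_Ob(4)[OF l(1,2)]] id_Dom_Cod[OF i b]
          by (cases "k = i"; cases "k = l") (auto simp: g_def others_id_def stage_ar_def y_def stage_ob_def)
      next
        case False
        then show ?thesis using i by (auto simp: stage_ar_def)
      qed
    qed
    then show ?thesis
      using Da_comp[OF stage_ar_isos[OF b, of S] g[OF b]] gd(1)[OF b] s by metis
  qed
  have IH: "Da ((stage_ar S)(i := Idt (T i) (vertex (T i) t 0))) \<cdot>\<^bsub>P\<^esub> add i (stage_ob {}) t =
    add i (stage_ob S) t \<cdot>\<^bsub>P\<^esub> (Da ((stage_ar S)(i := Idt (T i) (vertex (T i) t 1))) \<oplus>\<^bsub>P\<^esub>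
      Da ((stage_ar S)(i := Idt (T i) (vertex (T i) t (-1)))))"
    by (rule insert.IH) (use insert.prems in auto)
  have G: "Da (g (vertex (T i) t 0)) \<cdot>\<^bsub>P\<^esub> add i (stage_ob S) t = add i (stage_ob (insert l S)) t \<cdot>\<^bsub>P\<^esub>
      (Da (g (vertex (T i) t 1)) \<oplus>\<^bsub>P\<^esub> Da (g (vertex (T i) t (-1))))"
    using triangle_function[OF l(1) i l(2) y phi_Ob(1)[OF l(1,2)] t] unfolding y1 y2 g_def .
  have v3: "vertex (T i) t 0 \<in> Ob (T i)" "vertex (T i) t 1 \<in> Ob (T i)" "vertex (T i) t (-1) \<in> Ob (T i)"
    by (rule v, simp)+
  show ?case
    unfolding c[OF v3(1)] c[OF v3(2)] c[OF v3(3)]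
    by (rule P.paste[OF add_Hom[OF i stage_ob_others t] add_Hom[OF i stage_ob_others t] add_Hom[OF i stage_ob_others t]
      stage_ar_Hom[OF v3(1)] gH[OF v3(1)] stage_ar_Hom[OF v3(2)] gH[OF v3(2)] stage_ar_Hom[OF v3(3)] gH[OF v3(3)] IH G])
qed

end

text \<open>First all variables except i are moved with the triangle t fixed
  (\<open>stage_nat\<close>), then t is moved to t' by naturality of the determinant functor in
  variable i; the two squares are pasted.\<close>

lemma add_nat:
  assumes i: "i < m" and \<phi>: "\<phi> \<in> (\<Pi>\<^sub>E k\<in>{..<m} - {i}. isos (T k))"
    and t: "t \<in> distg (T i)" "t' \<in> distg (T i)" and uvw: "tri_mor (T i) t t' u v w" "{u, v, w} \<subseteq> isos (T i)"
    and x: "x = (\<lambda>k\<in>{..<m} - {i}. Dom (T k) (\<phi> k))" and y: "y = (\<lambda>k\<in>{..<m} - {i}. Cod (T k) (\<phi> k))"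
  shows "Da (\<phi>(i := v)) \<cdot>\<^bsub>P\<^esub> add i x t = add i y t' \<cdot>\<^bsub>P\<^esub> (Da (\<phi>(i := w)) \<oplus>\<^bsub>P\<^esub> Da (\<phi>(i := u)))"
proof -
  interpret Ti: tri "T i" by (rule tri[OF i])
  let ?S = "{..<m} - {i}"
  have xs: "stage_ob i \<phi> {} = x" and ys: "stage_ob i \<phi> ?S = y"
    by (auto simp: stage_ob_def[OF i \<phi> t(1)] x y)
  have as: "stage_ar i \<phi> ?S = \<phi>"
    using \<phi> by (auto simp: stage_ar_def[OF i \<phi> t(1)] PiE_iff extensional_def fun_eq_iff)
  note st = stage_nat[OF i \<phi> t(1), of ?S, unfolded xs ys as]
  have y': "y \<in> others T m {i}" and x': "x \<in> others T m {i}"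
    using stage_ob_others[OF i \<phi> t(1)] xs ys by metis+
  obtain f g h where tt: "t = (f, g, h)" by (metis prod_cases3)
  obtain f' g' h' where tt': "t' = (f', g', h')" by (metis prod_cases3)
  have H: "v \<in> Hom (T i) (vertex (T i) t 0) (vertex (T i) t' 0)" "w \<in> Hom (T i) (vertex (T i) t 1) (vertex (T i) t' 1)"
    "u \<in> Hom (T i) (vertex (T i) t (-1)) (vertex (T i) t' (-1))"
    using uvw(1) by (simp_all add: tt tt')
  interpret y: det "T i" P "\<lparr>on_ob = (\<lambda>a. Do (y(i := a))), on_ar = (\<lambda>f. Da ((others_id T m {i} y)(i := f)))\<rparr>"
    "\<lambda>t. add i y t" by (rule det_in_variable[OF i y'])
  have n: "Da ((others_id T m {i} y)(i := v)) \<cdot>\<^bsub>P\<^esub> add i y t = add i y t' \<cdot>\<^bsub>P\<^esub>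
      (Da ((others_id T m {i} y)(i := w)) \<oplus>\<^bsub>P\<^esub> Da ((others_id T m {i} y)(i := u)))"
    using y.det_axioms[THEN conjunct2, THEN conjunct2, THEN conjunct1] t uvw by (simp only: func.simps)
  have I: "(others_id T m {i} y)(i := f) \<in> (\<Pi>\<^sub>E k\<in>{..<m}. isos (T k))" if "f \<in> isos (T i)" for f
    using that i y' id_isos[OF i \<phi> t(1)] by (auto simp: others_id_def others_def PiE_iff extensional_def)
  have IH: "Da ((others_id T m {i} y)(i := f)) \<in> Hom P (Do (y(i := a))) (Do (y(i := b)))"
    if f: "f \<in> isos (T i)" "f \<in> Hom (T i) a b" for f a b
  proof -
    have yk: "y k \<in> Ob (T k)" if "k < m" "k \<noteq> i" for k using y' that by (auto simp: others_def)
    have e: "y(i := c) \<in> extensional {..<m}" for c using y' i by (auto simp: others_def PiE_iff extensional_def)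
    have "(\<lambda>k\<in>{..<m}. Dom (T k) (((others_id T m {i} y)(i := f)) k)) = y(i := a)"
      "(\<lambda>k\<in>{..<m}. Cod (T k) (((others_id T m {i} y)(i := f)) k)) = y(i := b)"
      by (rule extensionalityI[OF _ e]; use f Ti.HomD[OF f(2)] yk id_Dom_Cod[OF i \<phi> t(1)] in \<open>auto simp: others_id_def\<close>)+
    then show ?thesis using Da_Hom[OF I[OF f(1)]] by simp
  qed
  have SH: "Da (\<phi>(i := Idt (T i) b)) \<in> Hom P (Do (x(i := b))) (Do (y(i := b)))" if "b \<in> Ob (T i)" for b
    using stage_ar_Hom[OF i \<phi> t(1) that, of ?S] unfolding xs ys as .
  \<comment> \<open>The simultaneous morphism factors in the same order: the other variables first,
    then f in the variable i.\<close>
  have c: "Da (\<phi>(i := f)) = Da ((others_id T m {i} y)(i := f)) \<cdot>\<^bsub>P\<^esub> Da (\<phi>(i := Idt (T i) a))"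
    if f: "f \<in> isos (T i)" "f \<in> Hom (T i) a b" for f a b
  proof -
    have a: "a \<in> Ob (T i)" using Ti.HomD[OF f(2)] by blast
    have 1: "\<phi>(i := f) = (\<lambda>k\<in>{..<m}. ((others_id T m {i} y)(i := f)) k \<cdot>\<^bsub>T k\<^esub> (\<phi>(i := Idt (T i) a)) k)"
    proof
      fix k
      show "(\<phi>(i := f)) k = (\<lambda>k\<in>{..<m}. ((others_id T m {i} y)(i := f)) k \<cdot>\<^bsub>T k\<^esub> (\<phi>(i := Idt (T i) a)) k) k"
      proof (cases "k < m \<and> k \<noteq> i")
        case True
        then show ?thesis
          using catg.id_comp_Ar(2)[OF catg[of k] phi_Ob(4)[OF i \<phi> t(1), of k]] by (simp add: others_id_def y)
      next
        case False
        then show ?thesis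
          using i \<phi> Ti.id_right[OF f(2)] by (auto simp: PiE_iff extensional_def)
      qed
    qed
    have 2: "Cod (T k) ((\<phi>(i := Idt (T i) a)) k) = Dom (T k) (((others_id T m {i} y)(i := f)) k)" if "k < m" for k
      using that Ti.HomD[OF f(2)] a id_Dom_Cod[OF i \<phi> t(1)] phi_Ob[OF i \<phi> t(1)]
      by (auto simp: others_id_def y)
    have 3: "\<phi>(i := Idt (T i) a) \<in> (\<Pi>\<^sub>E k\<in>{..<m}. isos (T k))"
      using stage_ar_isos[OF i \<phi> t(1) a, of ?S] unfolding as .
    show ?thesis by (subst 1, rule Da_comp[OF 3 I[OF f(1)] 2])
  qed
  have iso: "u \<in> isos (T i)" "v \<in> isos (T i)" "w \<in> isos (T i)" using uvw(2) by auto
  have o: "vertex (T i) t 0 \<in> Ob (T i)" "vertex (T i) t 1 \<in> Ob (T i)" "vertex (T i) t (-1) \<in> Ob (T i)"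
    using H Ti.HomD by blast+
  show ?thesis
    unfolding c[OF iso(2) H(1)] c[OF iso(3) H(2)] c[OF iso(1) H(3)]
    by (rule P.paste[OF add_Hom[OF i x' t(1)] add_Hom[OF i y' t(1)] add_Hom[OF i y' t(2)]
      SH[OF o(1)] IH[OF iso(2) H(1)] SH[OF o(2)] IH[OF iso(3) H(2)] SH[OF o(3)] IH[OF iso(1) H(3)] st n]) auto
qed

end

section \<open>Vertices, edges and morphisms of cubes in one triangulated category\<close>

context tri
begin

lemma distg_vertex_Ob: "t \<in> distg T \<Longrightarrow> \<alpha> \<in> {-1, 0, 1} \<Longrightarrow> vertex T t \<alpha> \<in> Ob T"
  by (rule distg_vertex[OF tri.intro[OF triangulated]])

lemma tedge_distg:
  assumes "is_tcube T C" "j < tdim C" "c \<in> coords (tdim C - 1)"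
  shows "tedge C j c \<in> distg T"
proof (cases C)
  case (Square R K V)
  obtain r1 r2 r3 k1 k2 k3 where R: "R = (r1, r2, r3)" "K = (k1, k2, k3)" by (metis prod_cases3)
  have d: "{r1, r2, r3, k1, k2, k3} \<subseteq> distg T"
    using assms(1) unfolding Square R by (cases r1; cases r2; cases r3; cases k1; cases k2; cases k3) auto
  have "c \<in> {[-1], [0], [1]}" using assms(3) Square by simp
  then show ?thesis using d by (auto simp: Square R)
qed (use assms in auto)

text \<open>In a square \<open>tv\<close> reads vertices from the rows; the incidence conditions in
  \<open>diagram33\<close> show that the columns give the same objects.\<close>

lemma tv_ins:
  assumes "is_tcube T C" "j < tdim C" "c \<in> coords (tdim C - 1)" "\<alpha> \<in> {-1, 0, 1}"
  shows "tv T C (ins j \<alpha> c) = vertex T (tedge C j c) \<alpha>"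
proof (cases C)
  case (Square R K V)
  obtain f' g' h' f g h f'' g'' h'' where R: "R = ((f', g', h'), (f, g, h), (f'', g'', h''))"
    by (metis prod_cases3)
  obtain p' p p'' q' q q'' r' ra r'' where K: "K = ((p', p, p''), (q', q, q''), (r', ra, r''))"
    by (metis prod_cases3)
  have d: "Dom T p' = Dom T f'" "Cod T p' = Dom T f" "Cod T p = Dom T f''"
     "Dom T q' = Cod T f'" "Cod T q' = Cod T f" "Cod T q = Cod T f''"
     "Dom T r' = Cod T g'" "Cod T r' = Cod T g" "Cod T ra = Cod T g''"
    using assms(1) unfolding Square R K is_tcube.simps diagram33.simps by blast+
  have c: "c \<in> {[-1], [0], [1]}" using assms(3) Square by simp
  have "j < 2" using assms(2) by (simp add: Square)
  then consider "j = 0" | "j = Suc 0" by linarith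
  then show ?thesis
    using assms(4) c unfolding insert_iff empty_iff
    by cases (elim disjE; simp add: Square R K d)+
qed (use assms in auto)

lemma ins_nth_del: "a \<in> coords (Suc n) \<Longrightarrow> ins 0 (a ! 0) (del 0 a) = a"
  by (auto simp: coords_Suc)

lemma tv_Ob:
  assumes "is_tcube T C" "a \<in> coords (tdim C)"
  shows "tv T C a \<in> Ob T"
proof (cases "tdim C")
  case 0
  then obtain x where "C = Point x" using tdim_0 by blast
  then show ?thesis using assms(1) by simp
next
  case (Suc n)
  obtain \<alpha> c where a: "a = \<alpha> # c" "\<alpha> \<in> {-1, 0, 1}" "c \<in> coords n"
    using assms(2) by (auto simp: Suc coords_Suc)
  then have "tv T C a = vertex T (tedge C 0 c) \<alpha>"
    using tv_ins[OF assms(1), of 0 c \<alpha>] Suc by simp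
  then show ?thesis using distg_vertex_Ob[OF tedge_distg[OF assms(1), of 0 c]] a Suc by simp
qed

lemma tcube_morD:
  assumes "is_tcube_mor T n F"
  shows "is_tcube T (csrc F)" "is_tcube T (ctgt F)" "tdim (csrc F) = n" "tdim (ctgt F) = n"
    "cat_at F \<in> extensional (coords n)"
    "a \<in> coords n \<Longrightarrow> cat_at F a \<in> Hom T (tv T (csrc F) a) (tv T (ctgt F) a)"
    "a \<in> coords n \<Longrightarrow> cat_at F a \<in> isos T"
    "j < n \<Longrightarrow> c \<in> coords (n - 1) \<Longrightarrow> tri_mor T (tedge (csrc F) j c) (tedge (ctgt F) j c)
        (cat_at F (ins j (-1) c)) (cat_at F (ins j 0 c)) (cat_at F (ins j 1 c))"
  using assms unfolding is_tcube_mor_def by blast+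

lemma tri_mor_id:
  assumes "t \<in> distg T"
  shows "tri_mor T t t (Idt T (vertex T t (-1))) (Idt T (vertex T t 0)) (Idt T (vertex T t 1))"
proof -
  obtain f g h where t: "t = (f, g, h)" by (metis prod_cases3)
  note [simp] = distD[OF assms[unfolded t]]
  show ?thesis by (simp add: t Hom_def)
qed

lemma tri_mor_comp:
  assumes t: "t \<in> distg T" "t' \<in> distg T" "t'' \<in> distg T"
    and "tri_mor T t t' u v w" "tri_mor T t' t'' u' v' w'"
  shows "tri_mor T t t'' (u' \<cdot> u) (v' \<cdot> v) (w' \<cdot> w)"
proof -
  obtain f g h where t0: "t = (f, g, h)" by (metis prod_cases3)
  obtain f' g' h' where t1: "t' = (f', g', h')" by (metis prod_cases3)
  obtain f'' g'' h'' where t2: "t'' = (f'', g'', h'')" by (metis prod_cases3)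
  note m = assms(4,5)[unfolded t0 t1 t2 tri_mor.simps]
  note D = distD[OF t(1)[unfolded t0]] distD[OF t(2)[unfolded t1]] distD[OF t(3)[unfolded t2]]
  have H: "u \<in> Ar T" "v \<in> Ar T" "w \<in> Ar T" "u' \<in> Ar T" "v' \<in> Ar T" "w' \<in> Ar T"
    "Dom T u = Dom T f" "Cod T u = Dom T f'" "Dom T v = Cod T f" "Cod T v = Cod T f'" "Dom T w = Cod T g" "Cod T w = Cod T g'"
    "Dom T u' = Dom T f'" "Cod T u' = Dom T f''" "Dom T v' = Cod T f'" "Cod T v' = Cod T f''" "Dom T w' = Cod T g'" "Cod T w' = Cod T g''"
    using m by (auto simp: Hom_def)
  have 1: "v \<cdot> f = f' \<cdot> u" "w \<cdot> g = g' \<cdot> v" "sha T u \<cdot> h = h' \<cdot> w"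
    and 2: "v' \<cdot> f' = f'' \<cdot> u'" "w' \<cdot> g' = g'' \<cdot> v'" "sha T u' \<cdot> h' = h'' \<cdot> w'" using m by auto
  note [simp] = D H
  have "(v' \<cdot> v) \<cdot> f = (v' \<cdot> f') \<cdot> u" by (simp add: 1)
  then have 3: "(v' \<cdot> v) \<cdot> f = f'' \<cdot> (u' \<cdot> u)" unfolding 2 by simp
  have "(w' \<cdot> w) \<cdot> g = (w' \<cdot> g') \<cdot> v" by (simp add: 1)
  then have 4: "(w' \<cdot> w) \<cdot> g = g'' \<cdot> (v' \<cdot> v)" unfolding 2 by simp
  have "sha T (u' \<cdot> u) \<cdot> h = (sha T u' \<cdot> h') \<cdot> w" by (simp add: 1)
  then have 5: "sha T (u' \<cdot> u) \<cdot> h = h'' \<cdot> (w' \<cdot> w)" unfolding 2 by simp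
  show ?thesis unfolding t0 t2 tri_mor.simps
    using 3 4 5 by (intro conjI) (auto simp: Hom_def)
qed

lemma tcube_mor_id:
  assumes "is_tcube T C"
  shows "is_tcube_mor T (tdim C) (CMor C C (\<lambda>a\<in>coords (tdim C). Idt T (tv T C a)))"
  unfolding is_tcube_mor_def cmor.sel
proof (intro conjI ballI allI impI)
  fix a assume a: "a \<in> coords (tdim C)"
  show "(\<lambda>a\<in>coords (tdim C). Idt T (tv T C a)) a \<in> Hom T (tv T C a) (tv T C a) \<inter> isos T"
    using a id_Hom[OF tv_Ob[OF assms a]] isos_id[OF tv_Ob[OF assms a]] by simp
next
  fix j c assume j: "j < tdim C" and c: "c \<in> coords (tdim C - 1)"
  have i: "ins j \<alpha> c \<in> coords (tdim C)" if "\<alpha> \<in> {-1, 0, 1}" for \<alpha>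
    using ins_coords[OF c that, of j] j by simp
  show "tri_mor T (tedge C j c) (tedge C j c) ((\<lambda>a\<in>coords (tdim C). Idt T (tv T C a)) (ins j (-1) c))
      ((\<lambda>a\<in>coords (tdim C). Idt T (tv T C a)) (ins j 0 c)) ((\<lambda>a\<in>coords (tdim C). Idt T (tv T C a)) (ins j 1 c))"
    using tri_mor_id[OF tedge_distg[OF assms j c]] i tv_ins[OF assms j c] by simp
qed (use assms in auto)

lemma tcube_mor_comp:
  assumes F: "is_tcube_mor T n F" and G: "is_tcube_mor T n G" and eq: "ctgt F = csrc G"
  shows "is_tcube_mor T n (CMor (csrc F) (ctgt G) (\<lambda>a\<in>coords n. cat_at G a \<cdot> cat_at F a))"
proof -
  note f = tcube_morD[OF F] and g = tcube_morD[OF G]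
  show ?thesis
    unfolding is_tcube_mor_def cmor.sel
  proof (intro conjI ballI allI impI)
    fix a assume a: "a \<in> coords n"
    show "(\<lambda>a\<in>coords n. cat_at G a \<cdot> cat_at F a) a \<in> Hom T (tv T (csrc F) a) (tv T (ctgt G) a) \<inter> isos T"
      using a comp_Hom[OF f(6)[OF a]] g(6)[OF a] isos_comp[OF f(7)[OF a] g(7)[OF a] f(6)[OF a]] eq by simp
  next
    fix j c assume j: "j < n" and c: "c \<in> coords (n - 1)"
    have i: "ins j \<alpha> c \<in> coords n" if "\<alpha> \<in> {-1, 0, 1}" for \<alpha>
      using ins_coords[OF c that, of j] j by simp
    have d: "tedge (csrc F) j c \<in> distg T" "tedge (csrc G) j c \<in> distg T" "tedge (ctgt G) j c \<in> distg T"
      using tedge_distg f g j c by auto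
    show "tri_mor T (tedge (csrc F) j c) (tedge (ctgt G) j c) ((\<lambda>a\<in>coords n. cat_at G a \<cdot> cat_at F a) (ins j (-1) c))
        ((\<lambda>a\<in>coords n. cat_at G a \<cdot> cat_at F a) (ins j 0 c)) ((\<lambda>a\<in>coords n. cat_at G a \<cdot> cat_at F a) (ins j 1 c))"
      using tri_mor_comp[OF d f(8)[OF j c, unfolded eq] g(8)[OF j c]] i by simp
  qed (use f g in auto)
qed

end

section \<open>The coordinates of one factor and the category of families of cubes\<close>

lemma seg_coords:
  assumes "offset Q m = n" "k < m" "a \<in> coords n"
  shows "seg Q k a \<in> coords (tdim (Q k))"
proof -
  have "offset Q (Suc k) \<le> offset Q m"
    unfolding offset_def using assms(2) by (intro sum_mono2) auto
  then have "offset Q k + tdim (Q k) \<le> n" using assms(1) by (simp add: offset_def)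
  then show ?thesis
    using assms(3) by (auto simp: coords_def seg_def dest: in_set_takeD in_set_dropD)
qed

lemma seg_cong: "(\<And>l. l \<le> k \<Longrightarrow> tdim (Q l) = tdim (R l)) \<Longrightarrow> seg Q k a = seg R k a"
  unfolding seg_def using offset_cong[of k Q R] by simp

lemma multi_vertex_seg: "multi_vertex T m Q a = (\<lambda>k\<in>{..<m}. tv (T k) (Q k) (seg Q k a))"
  by (simp add: multi_vertex_def seg_def)

context multi
begin

lemma multi_vertex_Ob:
  assumes "Q \<in> Ob (multi_cubes T m n)" "a \<in> coords n"
  shows "multi_vertex T m Q a \<in> (\<Pi>\<^sub>E k\<in>{..<m}. Ob (T k))"
  using assms tri.tv_Ob[OF tri] seg_coords[of Q m n _ a] by (auto simp: multi_cubes_Ob multi_vertex_seg)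

lemma multi_cubes_ArD:
  assumes F: "F \<in> Ar (multi_cubes T m n)"
  shows "(\<lambda>k\<in>{..<m}. csrc (F k)) \<in> Ob (multi_cubes T m n)" "(\<lambda>k\<in>{..<m}. ctgt (F k)) \<in> Ob (multi_cubes T m n)"
    "k < m \<Longrightarrow> is_tcube_mor (T k) (tdim (csrc (F k))) (F k)" "k < m \<Longrightarrow> tdim (ctgt (F k)) = tdim (csrc (F k))"
proof -
  note A = F[unfolded multi_cubes_Ar]
  have t: "is_tcube_mor (T k) (tdim (csrc (F k))) (F k)" if "k < m" for k using A that by blast
  then show "k < m \<Longrightarrow> is_tcube_mor (T k) (tdim (csrc (F k))) (F k)" .
  have e: "tdim (ctgt (F k)) = tdim (csrc (F k))" if "k < m" for k using t[OF that] by (simp add: is_tcube_mor_def)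
  then show "k < m \<Longrightarrow> tdim (ctgt (F k)) = tdim (csrc (F k))" .
  have "offset (\<lambda>k\<in>{..<m}. csrc (F k)) m = offset (\<lambda>k. csrc (F k)) m"
    "offset (\<lambda>k\<in>{..<m}. ctgt (F k)) m = offset (\<lambda>k. csrc (F k)) m"
    by (rule offset_cong, simp add: e)+
  then show "(\<lambda>k\<in>{..<m}. csrc (F k)) \<in> Ob (multi_cubes T m n)" "(\<lambda>k\<in>{..<m}. ctgt (F k)) \<in> Ob (multi_cubes T m n)"
    using A t by (auto simp: multi_cubes_Ob is_tcube_mor_def)
qed

lemma multi_cubes_id:
  assumes Q: "Q \<in> Ob (multi_cubes T m n)"
  shows "Idt (multi_cubes T m n) Q =
      (\<lambda>k\<in>{..<m}. CMor (Q k) (Q k) (\<lambda>a\<in>coords (tdim (Q k)). Idt (T k) (tv (T k) (Q k) a)))"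
    and "Idt (multi_cubes T m n) Q \<in> Ar (multi_cubes T m n)"
proof -
  show e: "Idt (multi_cubes T m n) Q =
      (\<lambda>k\<in>{..<m}. CMor (Q k) (Q k) (\<lambda>a\<in>coords (tdim (Q k)). Idt (T k) (tv (T k) (Q k) a)))"
    by (simp add: multi_cubes_def Let_def tcubes_def)
  have "offset (\<lambda>k. csrc ((\<lambda>k\<in>{..<m}. CMor (Q k) (Q k) (\<lambda>a\<in>coords (tdim (Q k)). Idt (T k) (tv (T k) (Q k) a))) k)) m = offset Q m"
    by (rule offset_cong) simp
  then show "Idt (multi_cubes T m n) Q \<in> Ar (multi_cubes T m n)"
    using Q tri.tcube_mor_id[OF tri] unfolding e by (auto simp: multi_cubes_Ar multi_cubes_Ob)
qed

lemma multi_cubes_comp: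
  assumes F: "F \<in> Ar (multi_cubes T m n)" and G: "G \<in> Ar (multi_cubes T m n)"
    and eq: "Cod (multi_cubes T m n) F = Dom (multi_cubes T m n) G"
  shows "G \<cdot>\<^bsub>multi_cubes T m n\<^esub> F = (\<lambda>k\<in>{..<m}. CMor (csrc (F k)) (ctgt (G k))
      (\<lambda>a\<in>coords (tdim (csrc (F k))). cat_at (G k) a \<cdot>\<^bsub>T k\<^esub> cat_at (F k) a))"
    and "G \<cdot>\<^bsub>multi_cubes T m n\<^esub> F \<in> Ar (multi_cubes T m n)" "k < m \<Longrightarrow> ctgt (F k) = csrc (G k)"
proof -
  show e: "G \<cdot>\<^bsub>multi_cubes T m n\<^esub> F = (\<lambda>k\<in>{..<m}. CMor (csrc (F k)) (ctgt (G k))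
      (\<lambda>a\<in>coords (tdim (csrc (F k))). cat_at (G k) a \<cdot>\<^bsub>T k\<^esub> cat_at (F k) a))"
    by (simp add: multi_cubes_def Let_def tcubes_def)
  have c: "ctgt (F k) = csrc (G k)" if "k < m" for k
    using fun_cong[OF eq, of k] that by (simp add: multi_cubes_def Let_def)
  then show "k < m \<Longrightarrow> ctgt (F k) = csrc (G k)" .
  have t: "is_tcube_mor (T k) (tdim (csrc (F k))) (G k)" if "k < m" for k
    using multi_cubes_ArD(3)[OF G that] multi_cubes_ArD(4)[OF F that] c[OF that] by simp
  show "G \<cdot>\<^bsub>multi_cubes T m n\<^esub> F \<in> Ar (multi_cubes T m n)"
    unfolding e multi_cubes_Ar
  proof (intro conjI allI impI)
    fix k assume k: "k < m"
    show "is_tcube_mor (T k) (tdim (csrc ((\<lambda>k\<in>{..<m}. CMor (csrc (F k)) (ctgt (G k))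
      (\<lambda>a\<in>coords (tdim (csrc (F k))). cat_at (G k) a \<cdot>\<^bsub>T k\<^esub> cat_at (F k) a)) k))) ((\<lambda>k\<in>{..<m}. CMor (csrc (F k)) (ctgt (G k))
      (\<lambda>a\<in>coords (tdim (csrc (F k))). cat_at (G k) a \<cdot>\<^bsub>T k\<^esub> cat_at (F k) a)) k)"
      using tri.tcube_mor_comp[OF tri[OF k] multi_cubes_ArD(3)[OF F k] t[OF k] c[OF k]] k by simp
  next
    have "offset (\<lambda>k. csrc ((\<lambda>k\<in>{..<m}. CMor (csrc (F k)) (ctgt (G k))
      (\<lambda>a\<in>coords (tdim (csrc (F k))). cat_at (G k) a \<cdot>\<^bsub>T k\<^esub> cat_at (F k) a)) k)) m = offset (\<lambda>k. csrc (F k)) m"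
      by (rule offset_cong) simp
    then show "offset (\<lambda>k. csrc ((\<lambda>k\<in>{..<m}. CMor (csrc (F k)) (ctgt (G k))
      (\<lambda>a\<in>coords (tdim (csrc (F k))). cat_at (G k) a \<cdot>\<^bsub>T k\<^esub> cat_at (F k) a)) k)) m = n"
      using F by (simp add: multi_cubes_Ar)
  qed simp
qed

end

section \<open>The cube equations and functoriality of \<open>cub\<close>\<close>

context multi_det
begin

lemma add_square:
  assumes i: "i < m" and x: "x \<in> others T m {i}" and C: "is_tcube (T i) (Square (r1, r2, r3) (k1, k2, k3) V)"
  shows "add i x r2 \<cdot>\<^bsub>P\<^esub> (add i x k3 \<oplus>\<^bsub>P\<^esub> add i x k1) = add i x k2 \<cdot>\<^bsub>P\<^esub> (add i x r3 \<oplus>\<^bsub>P\<^esub> add i x r1) \<cdot>\<^bsub>P\<^esub>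
    coas P (Do (x(i := vertex (T i) r3 1))) (Do (x(i := vertex (T i) r1 1)))
      (Do (x(i := vertex (T i) r3 (-1)))) (Do (x(i := vertex (T i) r1 (-1))))"
proof -
  interpret det "T i" P "\<lparr>on_ob = (\<lambda>a. Do (x(i := a))), on_ar = (\<lambda>f. Da ((others_id T m {i} x)(i := f)))\<rparr>"
    "\<lambda>t. add i x t" by (rule det_in_variable[OF i x])
  show ?thesis using square[OF C] by (simp only: func.simps)
qed

text \<open>Apart from typing there is an equation only for a square, and it is
  \<open>det.square\<close> in the variable i.\<close>

lemma pcube_single:
  assumes i: "i < m" and x: "x \<in> others T m {i}" and C: "is_tcube (T i) C" "tdim C = n" "0 < n" "n \<le> 2"
  shows "is_pcube P n (cub_ob T m d n (single m i x C))"
proof -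
  interpret Ti: tri "T i" by (rule tri[OF i])
  note e = cub_ob_single[OF i others_extensional[OF x] C(2,3), of T d]
  have ic: "ins l \<alpha> c \<in> coords n" if "l < n" "c \<in> coords (n - 1)" "\<alpha> \<in> {-1, 0, 1}" for l c \<alpha>
    using ins_coords[OF that(2,3), of l] C(3) by simp
  show ?thesis
    unfolding is_pcube_def
  proof (intro conjI allI impI ballI)
    show "pv (cub_ob T m d n (single m i x C)) \<in> coords n \<rightarrow>\<^sub>E Ob P"
      unfolding e pcube.simps
      using Do_Ob[OF others_upd[OF i x]] Ti.tv_Ob[OF C(1)] C(2) by auto
    show "pe (cub_ob T m d n (single m i x C)) \<in> extensional ({..<n} \<times> coords (n - 1))"
      unfolding e by simp
    show "pe (cub_ob T m d n (single m i x C)) (l, c) \<in> Hom P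
      (pv (cub_ob T m d n (single m i x C)) (ins l 1 c) \<boxplus>\<^bsub>P\<^esub> pv (cub_ob T m d n (single m i x C)) (ins l (-1) c))
      (pv (cub_ob T m d n (single m i x C)) (ins l 0 c))" if l: "l < n" and c: "c \<in> coords (n - 1)" for l c
      using add_Hom[OF i x Ti.tedge_distg[OF C(1), of l c]] Ti.tv_ins[OF C(1), of l c] ic[OF l c] l c C(2)
      unfolding e by simp
  next
    fix l j c assume lj: "l < j \<and> j < n" and c: "c \<in> coords (n - 2)"
    then have n: "n = 2" "l = 0" "j = 1" "c = []" using C(4) by auto
    obtain R K V where S: "C = Square R K V" using C(2) n(1) by (cases C) auto
    obtain r1 r2 r3 k1 k2 k3 where "R = (r1, r2, r3)" "K = (k1, k2, k3)" by (metis prod_cases3)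
    with S have S: "C = Square (r1, r2, r3) (k1, k2, k3) V" by simp
    note sq = add_square[OF i x C(1)[unfolded S]]
    show "let s = \<lambda>\<alpha> \<beta>. pv (cub_ob T m d n (single m i x C)) (ins j \<beta> (ins l \<alpha> c));
            fi = \<lambda>\<beta>. pe (cub_ob T m d n (single m i x C)) (l, ins (j - 1) \<beta> c);
            fj = \<lambda>\<alpha>. pe (cub_ob T m d n (single m i x C)) (j, ins l \<alpha> c)
        in fj 0 \<cdot>\<^bsub>P\<^esub> (fi 1 \<oplus>\<^bsub>P\<^esub> fi (-1)) = fi 0 \<cdot>\<^bsub>P\<^esub> (fj 1 \<oplus>\<^bsub>P\<^esub> fj (-1)) \<cdot>\<^bsub>P\<^esub> coas P (s 1 1) (s (-1) 1) (s 1 (-1)) (s (-1) (-1))"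
      using sq unfolding e Let_def by (simp add: n S coords_2_iff)
  qed
qed

text \<open>The two directions belong to different variables, and the cube equation is Two
  Triangles.\<close>

lemma pcube_double:
  assumes ij: "i < j" "j < m" and x: "x \<in> others T m {i, j}" and t: "t \<in> distg (T i)" "t' \<in> distg (T j)"
  shows "is_pcube P 2 (cub_ob T m d 2 (double m i j x t t'))"
proof -
  have i: "i < m" "i \<noteq> j" using ij by auto
  note e = cub_ob_double[OF ij others_extensional[OF x], of T d t t']
  note u = others_upd2[OF i(1) ij(2) i(2) x]
  have v: "vertex (T i) t \<alpha> \<in> Ob (T i)" "vertex (T j) t' \<alpha> \<in> Ob (T j)" if "\<alpha> \<in> {-1, 0, 1}" for \<alpha>
    using distg_vertex[OF tri[OF i(1)] t(1) that] distg_vertex[OF tri[OF ij(2)] t(2) that] by auto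
  have c0: "c \<in> {[-1], [0], [1]}" if "c \<in> coords (2 - 1)" for c using that by simp
  show ?thesis
    unfolding is_pcube_def
  proof (intro conjI allI impI ballI)
    have "Do (x(i := vertex (T i) t \<alpha>, j := vertex (T j) t' \<beta>)) \<in> Ob P" if "\<alpha> \<in> {-1, 0, 1}" "\<beta> \<in> {-1, 0, 1}" for \<alpha> \<beta>
      using Do_Ob[OF others_upd[OF ij(2) u(1)[OF v(1)[OF that(1)]] v(2)[OF that(2)]]] .
    then show "pv (cub_ob T m d 2 (double m i j x t t')) \<in> coords 2 \<rightarrow>\<^sub>E Ob P"
      unfolding e by (auto simp: coords_2)
    show "pe (cub_ob T m d 2 (double m i j x t t')) \<in> extensional ({..<2} \<times> coords (2 - 1))"
      unfolding e by simp
    show "pe (cub_ob T m d 2 (double m i j x t t')) (l, c) \<in> Hom P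
      (pv (cub_ob T m d 2 (double m i j x t t')) (ins l 1 c) \<boxplus>\<^bsub>P\<^esub> pv (cub_ob T m d 2 (double m i j x t t')) (ins l (-1) c))
      (pv (cub_ob T m d 2 (double m i j x t t')) (ins l 0 c))" if l: "l < 2" and c: "c \<in> coords (2 - 1)" for l c
    proof -
      obtain \<gamma> where g: "c = [\<gamma>]" "\<gamma> \<in> {-1, 0, 1}" using c0[OF c] by blast
      consider "l = 0" | "l = Suc 0" using l by linarith
      then show ?thesis
      proof cases
        case 1
        show ?thesis using add_Hom[OF i(1) u(2)[OF v(2)[OF g(2)]] t(1)] g i(2)
          unfolding e by (simp add: 1 coords_2_iff fun_upd_twist)
      next
        case 2
        show ?thesis using add_Hom[OF ij(2) u(1)[OF v(1)[OF g(2)]] t(2)] g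
          unfolding e by (simp add: 2 coords_2_iff)
      qed
    qed
  next
    fix l k c assume lk: "l < k \<and> k < (2::nat)" and c: "c \<in> coords (2 - 2)"
    then have n: "l = 0" "k = 1" "c = []" by auto
    show "let s = \<lambda>\<alpha> \<beta>. pv (cub_ob T m d 2 (double m i j x t t')) (ins k \<beta> (ins l \<alpha> c));
            fi = \<lambda>\<beta>. pe (cub_ob T m d 2 (double m i j x t t')) (l, ins (k - 1) \<beta> c);
            fj = \<lambda>\<alpha>. pe (cub_ob T m d 2 (double m i j x t t')) (k, ins l \<alpha> c)
        in fj 0 \<cdot>\<^bsub>P\<^esub> (fi 1 \<oplus>\<^bsub>P\<^esub> fi (-1)) = fi 0 \<cdot>\<^bsub>P\<^esub> (fj 1 \<oplus>\<^bsub>P\<^esub> fj (-1)) \<cdot>\<^bsub>P\<^esub> coas P (s 1 1) (s (-1) 1) (s 1 (-1)) (s (-1) (-1))"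
      using two_triangles[OF ij x t] unfolding e Let_def by (simp add: n coords_2_iff)
  qed
qed

lemma pcube_cub_ob:
  assumes "Q \<in> Ob (multi_cubes T m n)" "n \<le> 2"
  shows "is_pcube P n (cub_ob T m d n Q)"
proof -
  consider "n = 0" | "n = 1" | "n = 2" using assms(2) by linarith
  then show ?thesis
  proof cases
    case 1
    then obtain x where x: "x \<in> (\<Pi>\<^sub>E k\<in>{..<m}. Ob (T k))" "Q = points m x"
      using points_cases assms(1) by metis
    then have "cub_ob T m d 0 Q = \<lparr>pv = (\<lambda>a\<in>coords 0. Do x), pe = (\<lambda>_. undefined)\<rparr>"
      using cub_ob_points[of x m T d] by (simp add: PiE_iff)
    then show ?thesis using Do_Ob[OF x(1)] 1 by (simp add: is_pcube_def)
  next
    case 2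
    obtain i x t where "i < m" "x \<in> others T m {i}" "t \<in> distg (T i)" "Q = single m i x (Triangle t)"
      using single_cases[OF assms(1)[unfolded 2]] by metis
    then show ?thesis using pcube_single[of i x "Triangle t" 1] 2 by simp
  next
    case 3
    show ?thesis
      using assms(1)[unfolded 3]
    proof (cases rule: square_cases)
      case (square i x R K V)
      then show ?thesis using pcube_single[of i x "Square R K V" 2] 3 by simp
    next
      case (triangles i j x t t')
      then show ?thesis using pcube_double[of i j x t t'] 3 by simp
    qed
  qed
qed

lemma cub_ar_component:
  assumes F: "F \<in> Ar (multi_cubes T m n)" and b: "\<And>k. k < m \<Longrightarrow> b k \<in> coords (tdim (csrc (F k)))"
  shows "(\<lambda>k\<in>{..<m}. cat_at (F k) (b k)) \<in> (\<Pi>\<^sub>E k\<in>{..<m}. isos (T k))"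
    and "Da (\<lambda>k\<in>{..<m}. cat_at (F k) (b k)) \<in> Hom P (Do (\<lambda>k\<in>{..<m}. tv (T k) (csrc (F k)) (b k)))
      (Do (\<lambda>k\<in>{..<m}. tv (T k) (ctgt (F k)) (b k)))"
proof -
  have t: "cat_at (F k) (b k) \<in> Hom (T k) (tv (T k) (csrc (F k)) (b k)) (tv (T k) (ctgt (F k)) (b k))"
    "cat_at (F k) (b k) \<in> isos (T k)" if "k < m" for k
    using tri.tcube_morD(6,7)[OF tri[OF that] multi_cubes_ArD(3)[OF F that] b[OF that]] by auto
  show i: "(\<lambda>k\<in>{..<m}. cat_at (F k) (b k)) \<in> (\<Pi>\<^sub>E k\<in>{..<m}. isos (T k))" using t(2) by auto
  have "(\<lambda>k\<in>{..<m}. Dom (T k) ((\<lambda>k\<in>{..<m}. cat_at (F k) (b k)) k)) = (\<lambda>k\<in>{..<m}. tv (T k) (csrc (F k)) (b k))"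
    "(\<lambda>k\<in>{..<m}. Cod (T k) ((\<lambda>k\<in>{..<m}. cat_at (F k) (b k)) k)) = (\<lambda>k\<in>{..<m}. tv (T k) (ctgt (F k)) (b k))"
    using t(1) by (auto simp: Hom_def fun_eq_iff)
  then show "Da (\<lambda>k\<in>{..<m}. cat_at (F k) (b k)) \<in> Hom P (Do (\<lambda>k\<in>{..<m}. tv (T k) (csrc (F k)) (b k)))
      (Do (\<lambda>k\<in>{..<m}. tv (T k) (ctgt (F k)) (b k)))" using Da_Hom[OF i] by simp
qed

lemma edge_nat:
  assumes F: "F \<in> Ar (multi_cubes T m n)" and i: "i < m" and l: "l < tdim (csrc (F i))" and c: "c \<in> coords (tdim (csrc (F i)) - 1)"
    and b: "\<And>k. k < m \<Longrightarrow> k \<noteq> i \<Longrightarrow> b k \<in> coords (tdim (csrc (F k)))"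
    and phi: "\<phi> = (\<lambda>k\<in>{..<m} - {i}. cat_at (F k) (b k))"
  shows "Da (\<phi>(i := cat_at (F i) (ins l 0 c))) \<cdot>\<^bsub>P\<^esub>
      add i (\<lambda>k\<in>{..<m} - {i}. tv (T k) (csrc (F k)) (b k)) (tedge (csrc (F i)) l c) =
    add i (\<lambda>k\<in>{..<m} - {i}. tv (T k) (ctgt (F k)) (b k)) (tedge (ctgt (F i)) l c) \<cdot>\<^bsub>P\<^esub>
      (Da (\<phi>(i := cat_at (F i) (ins l 1 c))) \<oplus>\<^bsub>P\<^esub> Da (\<phi>(i := cat_at (F i) (ins l (-1) c))))"
proof (rule add_nat[OF i])
  interpret Ti: tri "T i" by (rule tri[OF i])
  note M = Ti.tcube_morD[OF multi_cubes_ArD(3)[OF F i]]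
  have t: "cat_at (F k) (b k) \<in> Hom (T k) (tv (T k) (csrc (F k)) (b k)) (tv (T k) (ctgt (F k)) (b k))"
    "cat_at (F k) (b k) \<in> isos (T k)" if "k < m" "k \<noteq> i" for k
    using tri.tcube_morD(6,7)[OF tri[OF that(1)] multi_cubes_ArD(3)[OF F that(1)] b[OF that]] by auto
  show "\<phi> \<in> (\<Pi>\<^sub>E k\<in>{..<m} - {i}. isos (T k))" using t(2) by (auto simp: phi)
  show "(\<lambda>k\<in>{..<m} - {i}. tv (T k) (csrc (F k)) (b k)) = (\<lambda>k\<in>{..<m} - {i}. Dom (T k) (\<phi> k))"
    "(\<lambda>k\<in>{..<m} - {i}. tv (T k) (ctgt (F k)) (b k)) = (\<lambda>k\<in>{..<m} - {i}. Cod (T k) (\<phi> k))"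
    using t(1) by (auto simp: phi Hom_def fun_eq_iff)
  show "tedge (csrc (F i)) l c \<in> distg (T i)" by (rule Ti.tedge_distg[OF M(1) l c])
  show "tedge (ctgt (F i)) l c \<in> distg (T i)" using Ti.tedge_distg[OF M(2), of l c] M(4) l c by simp
  show "tri_mor (T i) (tedge (csrc (F i)) l c) (tedge (ctgt (F i)) l c) (cat_at (F i) (ins l (-1) c))
    (cat_at (F i) (ins l 0 c)) (cat_at (F i) (ins l 1 c))" by (rule M(8)[OF l c])
  have "ins l \<alpha> c \<in> coords (tdim (csrc (F i)))" if "\<alpha> \<in> {-1, 0, 1}" for \<alpha>
    using ins_coords[OF c that, of l] l by simp
  then show "{cat_at (F i) (ins l (-1) c), cat_at (F i) (ins l 0 c), cat_at (F i) (ins l 1 c)} \<subseteq> isos (T i)"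
    using M(7) by simp
qed

end

text \<open>Splits a direction of the whole cube into a factor and a direction of that factor, and
  shows that the other factors stay at rest along it. This is checked on the shapes of dimension one
  and two.\<close>

lemma (in multi) direction:
  assumes Q: "Q \<in> Ob (multi_cubes T m n)" "n \<le> 2" and L: "L < n" and c: "c \<in> coords (n - 1)"
  defines "i \<equiv> factor Q L"
  defines "l \<equiv> L - offset Q i" and "ci \<equiv> take (tdim (Q i) - 1) (drop (offset Q i) c)"
  shows "i < m" "l < tdim (Q i)" "ci \<in> coords (tdim (Q i) - 1)" "seg Q i (ins L \<alpha> c) = ins l \<alpha> ci"
    "k < m \<Longrightarrow> k \<noteq> i \<Longrightarrow> seg Q k (ins L \<alpha> c) = seg Q k (ins L 0 c)"
proof -
  have "i < m \<and> l < tdim (Q i) \<and> ci \<in> coords (tdim (Q i) - 1) \<and> seg Q i (ins L \<alpha> c) = ins l \<alpha> ci \<and>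
    (\<forall>k<m. k \<noteq> i \<longrightarrow> seg Q k (ins L \<alpha> c) = seg Q k (ins L 0 c))"
  proof -
    have len: "length (ins L \<alpha> c) = n" for \<alpha>
      using L coords_length[OF c] by (simp add: ins_def)
    have S: ?thesis if "j < m" "Q = single m j x C" "0 < tdim C" "tdim C = n" for j x C
    proof -
      have "i = j" using factor_single[OF that(1), of L C x] L that by (simp add: i_def)
      then show ?thesis
        using that L c coords_length[OF c] len by (auto simp: l_def ci_def seg_def offset_single)
    qed
    consider "n = 1" | "n = 2" using L Q(2) by linarith
    then show ?thesis
    proof cases
      case 1
      then obtain j x t where "j < m" "Q = single m j x (Triangle t)"
        using single_cases Q(1) by metis
      then show ?thesis using S[of j x "Triangle t"] 1 by simp
    next
      case 2
      show ?thesis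
        using Q(1)[unfolded 2]
      proof (cases rule: square_cases)
        case (square j x R K V)
        then show ?thesis using S[of j x "Square R K V"] 2 by simp
      next
        case (triangles j j' x t t')
        obtain \<gamma> where g: "c = [\<gamma>]" using c 2 by auto
        have td: "tdim (double m j j' x t t' k) = (if k = j \<or> k = j' then 1 else 0)" if "k < m" for k
          using that triangles by auto
        consider "L = 0" | "L = Suc 0" using L 2 by linarith
        then show ?thesis
          using triangles factor_double[OF triangles(1,2), of x t t']
          by cases (auto simp: i_def l_def ci_def g seg_def offset_double td)
      qed
    qed
  qed
  then show "i < m" "l < tdim (Q i)" "ci \<in> coords (tdim (Q i) - 1)" "seg Q i (ins L \<alpha> c) = ins l \<alpha> ci"
    "k < m \<Longrightarrow> k \<noteq> i \<Longrightarrow> seg Q k (ins L \<alpha> c) = seg Q k (ins L 0 c)" by auto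
qed

context multi_det
begin

text \<open>Along an edge only one factor moves, so compatibility with it is \<open>add_nat\<close>
  in that variable, with the components of the other factors as \<phi>.\<close>

lemma cub_ar_mor:
  assumes F: "F \<in> Ar (multi_cubes T m n)" and n: "n \<le> 2"
  shows "is_pcube_mor P n (cub_ar T m d n F)"
proof -
  define Q where "Q = (\<lambda>k\<in>{..<m}. csrc (F k))"
  define Q' where "Q' = (\<lambda>k\<in>{..<m}. ctgt (F k))"
  note QO = multi_cubes_ArD(1)[OF F, folded Q_def] and QO' = multi_cubes_ArD(2)[OF F, folded Q'_def]
  have td: "tdim (Q' k) = tdim (Q k)" for k
    using multi_cubes_ArD(4)[OF F] by (simp add: Q_def Q'_def)
  have off: "offset Q' k = offset Q k" for k by (rule offset_cong) (rule td)
  have sg: "seg Q' k = seg Q k" for k by (rule ext) (simp add: seg_def td off)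
  have sf: "seg (\<lambda>l. csrc (F l)) k a = seg Q k a" if "k < m" for k a
    by (rule seg_cong) (use that in \<open>simp add: Q_def\<close>)
  have fac: "factor Q' = factor Q" by (rule ext) (simp add: factor_def off)
  have at: "cat_at (cub_ar T m d n F) a = Da (\<lambda>k\<in>{..<m}. cat_at (F k) (seg Q k a))" if "a \<in> coords n" for a
    using that sf by (simp add: cub_ar_def cong: restrict_cong)
  have st: "csrc (cub_ar T m d n F) = cub_ob T m d n Q" "ctgt (cub_ar T m d n F) = cub_ob T m d n Q'"
    by (simp_all add: cub_ar_def Q_def Q'_def)
  have sc: "seg Q k a \<in> coords (tdim (csrc (F k)))" if "k < m" "a \<in> coords n" for k a
    using seg_coords[of Q m n k a] QO that by (simp add: multi_cubes_Ob Q_def)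
  have mv: "multi_vertex T m Q a = (\<lambda>k\<in>{..<m}. tv (T k) (csrc (F k)) (seg Q k a))"
    "multi_vertex T m Q' a = (\<lambda>k\<in>{..<m}. tv (T k) (ctgt (F k)) (seg Q k a))" for a
    by (auto simp: multi_vertex_seg sg fun_eq_iff) (simp_all add: Q_def Q'_def)
  show ?thesis
    unfolding is_pcube_mor_def st
  proof (intro conjI ballI allI impI)
    show "is_pcube P n (cub_ob T m d n Q)" "is_pcube P n (cub_ob T m d n Q')"
      using pcube_cub_ob n QO QO' by auto
    show "cat_at (cub_ar T m d n F) \<in> extensional (coords n)" by (simp add: cub_ar_def)
    show "cat_at (cub_ar T m d n F) a \<in> Hom P (pv (cub_ob T m d n Q) a) (pv (cub_ob T m d n Q') a)" if a: "a \<in> coords n" for a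
      using cub_ar_component(2)[OF F sc[OF _ a]] a unfolding at[OF a] by (simp add: cub_ob_def mv)
  next
    fix L c assume L: "L < n" and c: "c \<in> coords (n - 1)"
    define i l ci where "i = factor Q L" and "l = L - offset Q i" and "ci = take (tdim (Q i) - 1) (drop (offset Q i) c)"
    note D = direction[OF QO n L c, folded i_def, folded l_def ci_def]
    have Qi: "csrc (F i) = Q i" "ctgt (F i) = Q' i" using D(1) by (simp_all add: Q_def Q'_def)
    have "Suc (n - 1) = n" using L by simp
    then have ic: "ins L \<alpha> c \<in> coords n" if "\<alpha> \<in> {-1, 0, 1}" for \<alpha>
      by (rule subst[of _ _ "\<lambda>k. ins L \<alpha> c \<in> coords k"]) (rule ins_coords[OF c that])
    define \<phi> where "\<phi> = (\<lambda>k\<in>{..<m} - {i}. cat_at (F k) (seg Q k (ins L 0 c)))"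
    have comp: "cat_at (cub_ar T m d n F) (ins L \<alpha> c) = Da (\<phi>(i := cat_at (F i) (ins l \<alpha> ci)))" if "\<alpha> \<in> {-1, 0, 1}" for \<alpha>
    proof -
      have "(\<lambda>k\<in>{..<m}. cat_at (F k) (seg Q k (ins L \<alpha> c))) = \<phi>(i := cat_at (F i) (ins l \<alpha> ci))"
        using D(1,4) D(5)[where \<alpha> = \<alpha>] by (auto simp: \<phi>_def fun_eq_iff)
      then show ?thesis using at[OF ic[OF that]] by simp
    qed
    have edge: "pe (cub_ob T m d n Q) (L, c) = add i (\<lambda>k\<in>{..<m} - {i}. tv (T k) (csrc (F k)) (seg Q k (ins L 0 c))) (tedge (csrc (F i)) l ci)"
    proof -
      have "restrict (multi_vertex T m Q (ins L 0 c)) ({..<m} - {i}) =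
        (\<lambda>k\<in>{..<m} - {i}. tv (T k) (csrc (F k)) (seg Q k (ins L 0 c)))" by (auto simp: mv fun_eq_iff)
      then show ?thesis using L c unfolding Qi by (simp add: cub_ob_def Let_def i_def l_def ci_def)
    qed
    have edge': "pe (cub_ob T m d n Q') (L, c) = add i (\<lambda>k\<in>{..<m} - {i}. tv (T k) (ctgt (F k)) (seg Q k (ins L 0 c))) (tedge (ctgt (F i)) l ci)"
    proof -
      have "restrict (multi_vertex T m Q' (ins L 0 c)) ({..<m} - {i}) =
        (\<lambda>k\<in>{..<m} - {i}. tv (T k) (ctgt (F k)) (seg Q k (ins L 0 c)))" by (auto simp: mv fun_eq_iff)
      then show ?thesis using L c unfolding Qi by (simp add: cub_ob_def Let_def i_def l_def ci_def fac off td)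
    qed
    show "cat_at (cub_ar T m d n F) (ins L 0 c) \<cdot>\<^bsub>P\<^esub> pe (cub_ob T m d n Q) (L, c) =
      pe (cub_ob T m d n Q') (L, c) \<cdot>\<^bsub>P\<^esub>
        (cat_at (cub_ar T m d n F) (ins L 1 c) \<oplus>\<^bsub>P\<^esub> cat_at (cub_ar T m d n F) (ins L (-1) c))"
      using edge_nat[OF F D(1) D(2)[folded Qi] D(3)[folded Qi] sc[OF _ ic] \<phi>_def] unfolding edge edge' by (simp add: comp)
  qed
qed

lemma cub_apply:
  assumes "n \<le> 2"
  shows "Q \<in> Ob (multi_cubes T m n) \<Longrightarrow> on_ob (cub T m d n) Q = cub_ob T m d n Q"
    and "F \<in> Ar (multi_cubes T m n) \<Longrightarrow> on_ar (cub T m d n) F = cub_ar T m d n F"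
  using assms by (simp_all add: cub_def)

lemma multi_cubes_Dom_Cod:
  "Dom (multi_cubes T m n) F = (\<lambda>k\<in>{..<m}. csrc (F k))" "Cod (multi_cubes T m n) F = (\<lambda>k\<in>{..<m}. ctgt (F k))"
  by (simp_all add: multi_cubes_def Let_def)

lemma is_functor_cub:
  assumes n: "n \<le> 2"
  shows "is_functor (multi_cubes T m n) (pcubes P n) (cub T m d n)"
  unfolding is_functor_def
proof (intro conjI ballI impI funcsetI)
  fix Q assume Q: "Q \<in> Ob (multi_cubes T m n)"
  show "on_ob (cub T m d n) Q \<in> Ob (pcubes P n)"
    using pcube_cub_ob[OF Q n] cub_apply(1)[OF n Q] by (simp add: pcubes_def)
  note I = multi_cubes_id[OF Q]
  have src: "(\<lambda>k\<in>{..<m}. Q k) = Q" using Q by (simp add: multi_cubes_Ob extensional_restrict)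
  have "Da (\<lambda>k\<in>{..<m}. cat_at (Idt (multi_cubes T m n) Q k) (seg (\<lambda>l. csrc (Idt (multi_cubes T m n) Q l)) k a)) =
    Idt P (Do (multi_vertex T m Q a))" if a: "a \<in> coords n" for a
  proof -
    have sg: "seg (\<lambda>l. csrc (Idt (multi_cubes T m n) Q l)) k a = seg Q k a" if "k < m" for k
      by (rule seg_cong) (use that in \<open>simp add: I(1)\<close>)
    have "(\<lambda>k\<in>{..<m}. cat_at (Idt (multi_cubes T m n) Q k) (seg (\<lambda>l. csrc (Idt (multi_cubes T m n) Q l)) k a)) =
      (\<lambda>k\<in>{..<m}. Idt (T k) (multi_vertex T m Q a k))"
      using sg seg_coords[of Q m n _ a] a Q by (auto simp: I(1) multi_vertex_seg multi_cubes_Ob fun_eq_iff)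
    then show ?thesis using Da_id[OF multi_vertex_Ob[OF Q a]] by simp
  qed
  then show "on_ar (cub T m d n) (Idt (multi_cubes T m n) Q) = Idt (pcubes P n) (on_ob (cub T m d n) Q)"
    unfolding cub_apply(1)[OF n Q] cub_apply(2)[OF n I(2)]
    by (auto simp: cub_ar_def pcubes_def cub_ob_def I(1) src fun_eq_iff cong: restrict_cong)
next
  fix F assume F: "F \<in> Ar (multi_cubes T m n)"
  show "on_ar (cub T m d n) F \<in> Hom (pcubes P n) (on_ob (cub T m d n) (Dom (multi_cubes T m n) F))
    (on_ob (cub T m d n) (Cod (multi_cubes T m n) F))"
    unfolding multi_cubes_Dom_Cod cub_apply(2)[OF n F] cub_apply(1)[OF n multi_cubes_ArD(1)[OF F]]
      cub_apply(1)[OF n multi_cubes_ArD(2)[OF F]]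
    using cub_ar_mor[OF F n] by (simp add: Hom_def pcubes_def cub_ar_def)
next
  fix F G assume F: "F \<in> Ar (multi_cubes T m n)" and G: "G \<in> Ar (multi_cubes T m n)"
    and eq: "Cod (multi_cubes T m n) F = Dom (multi_cubes T m n) G"
  note C = multi_cubes_comp[OF F G eq]
  let ?H = "G \<cdot>\<^bsub>multi_cubes T m n\<^esub> F"
  have t: "tdim (csrc (G k)) = tdim (csrc (F k))" if "k < m" for k
    using C(3)[OF that] multi_cubes_ArD(4)[OF F that] by simp
  have "Da (\<lambda>k\<in>{..<m}. cat_at (?H k) (seg (\<lambda>l. csrc (?H l)) k a)) =
    Da (\<lambda>k\<in>{..<m}. cat_at (G k) (seg (\<lambda>l. csrc (G l)) k a)) \<cdot>\<^bsub>P\<^esub> Da (\<lambda>k\<in>{..<m}. cat_at (F k) (seg (\<lambda>l. csrc (F l)) k a))"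
    if a: "a \<in> coords n" for a
  proof -
    let ?s = "\<lambda>k. seg (\<lambda>l. csrc (F l)) k a"
    have s: "seg (\<lambda>l. csrc (G l)) k a = ?s k" "seg (\<lambda>l. csrc (?H l)) k a = ?s k" if "k < m" for k
      by (rule seg_cong, use that t C(1) in simp)+
    have sF: "?s k \<in> coords (tdim (csrc (F k)))" if "k < m" for k
      using seg_coords[OF _ that a] F by (auto simp: multi_cubes_Ar)
    have sG: "?s k \<in> coords (tdim (csrc (G k)))" if "k < m" for k using sF t that by simp
    let ?f = "\<lambda>k\<in>{..<m}. cat_at (F k) (?s k)" and ?g = "\<lambda>k\<in>{..<m}. cat_at (G k) (?s k)"
    have f: "?f \<in> (\<Pi>\<^sub>E k\<in>{..<m}. isos (T k))" by (rule cub_ar_component(1)[OF F sF])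
    have g: "?g \<in> (\<Pi>\<^sub>E k\<in>{..<m}. isos (T k))" by (rule cub_ar_component(1)[OF G sG])
    have fg: "Cod (T k) (?f k) = Dom (T k) (?g k)" if "k < m" for k
      using tri.tcube_morD(6)[OF tri[OF that] multi_cubes_ArD(3)[OF F that] sF[OF that]]
        tri.tcube_morD(6)[OF tri[OF that] multi_cubes_ArD(3)[OF G that] sG[OF that]] C(3)[OF that] that
      by (simp add: Hom_def)
    have 1: "(\<lambda>k\<in>{..<m}. cat_at (?H k) (seg (\<lambda>l. csrc (?H l)) k a)) = (\<lambda>k\<in>{..<m}. ?g k \<cdot>\<^bsub>T k\<^esub> ?f k)"
      using s(2) sF by (auto simp: C(1) fun_eq_iff)
    have 2: "(\<lambda>k\<in>{..<m}. cat_at (G k) (seg (\<lambda>l. csrc (G l)) k a)) = ?g"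
      using s(1) by (auto simp: fun_eq_iff)
    show ?thesis unfolding 1 2 by (rule Da_comp[OF f g fg])
  qed
  note K = this
  have 1: "(\<lambda>k\<in>{..<m}. csrc (?H k)) = (\<lambda>k\<in>{..<m}. csrc (F k))" "(\<lambda>k\<in>{..<m}. ctgt (?H k)) = (\<lambda>k\<in>{..<m}. ctgt (G k))"
    by (simp_all add: C(1) cong: restrict_cong)
  show "on_ar (cub T m d n) ?H = on_ar (cub T m d n) G \<cdot>\<^bsub>pcubes P n\<^esub> on_ar (cub T m d n) F"
    unfolding cub_apply(2)[OF n F] cub_apply(2)[OF n G] cub_apply(2)[OF n C(2)] cub_ar_def pcubes_def
    by (simp add: 1 K cong: restrict_cong)
qed

lemma extensional_functor_cub: "n \<le> 2 \<Longrightarrow> extensional_functor (multi_cubes T m n) (cub T m d n)"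
  by (simp add: extensional_functor_def cub_def)

end

text \<open>Q has one direction more than R, in factor k. Their offsets agree up to k and differ by
  one beyond it, so the inserted coordinate is seen by factor k alone.\<close>

lemma seg_ins:
  fixes Q R :: "nat \<Rightarrow> ('o, 'a) tcube"
  assumes R: "\<And>l. l \<noteq> k \<Longrightarrow> tdim (R l) = tdim (Q l)" "tdim (Q k) = Suc (tdim (R k))"
    and l: "k < m" "l < m" and j: "j < tdim (Q k)" and a: "length a = offset R m"
  shows "seg Q l (ins (offset Q k + j) \<alpha> a) = (if l = k then ins j \<alpha> (seg R k a) else seg R l a)"
proof -
  have le: "offset R i + tdim (R i) \<le> offset R i'" if "i < i'" for i i'
  proof -
    have "offset R (Suc i) \<le> offset R i'" unfolding offset_def using that by (intro sum_mono2) auto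
    then show ?thesis by (simp add: offset_def)
  qed
  have o1: "offset Q i = offset R i" if "i \<le> k" for i
    by (rule offset_cong) (use that R in auto)
  have o2: "offset Q i = Suc (offset R i)" if "k < i" for i
  proof -
    have s: "offset C i = tdim (C k) + (\<Sum>l\<in>{..<i} - {k}. tdim (C l))" for C :: "nat \<Rightarrow> ('o, 'a) tcube"
      unfolding offset_def using that by (intro sum.remove) auto
    have "(\<Sum>l\<in>{..<i} - {k}. tdim (Q l)) = (\<Sum>l\<in>{..<i} - {k}. tdim (R l))"
      by (rule sum.cong) (use R in auto)
    then show ?thesis unfolding s[of Q] s[of R] R(2) by simp
  qed
  have ka: "offset R k + tdim (R k) \<le> length a" using le[OF l(1)] a by simp
  consider "l < k" | "l = k" | "k < l" by linarith
  then show ?thesis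
  proof cases
    case 1
    then have "offset Q l + tdim (Q l) \<le> offset Q k + j" using le[OF 1] o1[of l] o1[of k] R(1)[of l] by simp
    then have "tdim (Q l) \<le> offset R k + j - offset R l" "offset R l \<le> offset R k + j" "offset R k + j \<le> length a"
      using o1[of l] o1[of k] 1 ka j R(2) by simp_all
    then show ?thesis
      using 1 o1[of l] o1[of k] R(1)[of l] by (simp add: seg_def ins_def drop_take min_def) linarith
  next
    case 2
    have "j \<le> tdim (R k)" using j R(2) by simp
    then show ?thesis
      using 2 o1[of k] ka R(2) by (simp add: seg_def ins_def drop_take min_def take_Cons' Suc_diff_le add.commute)
  next
    case 3
    have "offset Q k + j \<le> offset R l" using le[OF 3] o1[of k] j R(2) by simp
    moreover have "offset R l \<le> length a" using le[OF l(2)] a by simp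
    ultimately show ?thesis
      using 3 o2[OF 3] R(1)[of l] by (simp add: seg_def ins_def min_def Suc_diff_le)
  qed
qed

section \<open>Faces of cubes and of families of cubes\<close>

context tri
begin

lemma tcube_tface:
  assumes "is_tcube T C" "j < tdim C" "\<alpha> \<in> {-1, 0, 1}"
  shows "is_tcube T (tface \<alpha> j T C)" "tdim C = Suc (tdim (tface \<alpha> j T C))"
proof -
  show "is_tcube T (tface \<alpha> j T C)"
  proof (cases C)
    case (Triangle t)
    then show ?thesis using assms distg_vertex_Ob by simp
  next
    case (Square R K V)
    then show ?thesis using tedge_distg[OF assms(1), of 0 "[\<alpha>]"] tedge_distg[OF assms(1), of 1 "[\<alpha>]"] assms(3) by simp
  qed (use assms in auto)
  show "tdim C = Suc (tdim (tface \<alpha> j T C))" using assms(2) by (cases C) auto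
qed

lemma tv_tface:
  assumes "is_tcube T C" "j < tdim C" "\<alpha> \<in> {-1, 0, 1}" "a \<in> coords (tdim C - 1)"
  shows "tv T (tface \<alpha> j T C) a = tv T C (ins j \<alpha> a)"
proof (cases C)
  case (Square R K V)
  then obtain \<gamma> where a: "a = [\<gamma>]" "\<gamma> \<in> {-1, 0, 1}" using assms(4) by auto
  have "j < 2" using assms(2) by (simp add: Square)
  then consider "j = 0" | "j = Suc 0" by linarith
  then show ?thesis
    using tv_ins[OF assms(1), of 0 "[\<alpha>]" \<gamma>] assms(3) a by cases (simp_all add: Square)
qed (use assms tv_ins[OF assms(1,2,4,3)] in auto)

text \<open>A face has an edge only if the cube is a square, and this edge is an edge of the square
  in the other direction.\<close>

lemma tface_mor:
  assumes F: "is_tcube_mor T n F" and j: "j < n" and \<alpha>: "\<alpha> \<in> {-1, 0, 1}" and n: "n \<le> 2"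
  shows "is_tcube_mor T (n - 1) (tface_mor \<alpha> j T F)"
proof -
  note f = tcube_morD[OF F]
  have j': "j < tdim (csrc F)" "j < tdim (ctgt F)" using j f by auto
  note c = tcube_tface[OF f(1) j'(1) \<alpha>] and d = tcube_tface[OF f(2) j'(2) \<alpha>]
  have ic: "ins j \<alpha> a \<in> coords n" if "a \<in> coords (n - 1)" for a
    using ins_coords[OF that \<alpha>, of j] j by simp
  show ?thesis
    unfolding is_tcube_mor_def tface_mor_def cmor.sel
  proof (intro conjI ballI allI impI)
    fix a assume a: "a \<in> coords (n - 1)"
    show "(\<lambda>a\<in>coords (tdim (csrc F) - 1). cat_at F (ins j \<alpha> a)) a
      \<in> Hom T (tv T (tface \<alpha> j T (csrc F)) a) (tv T (tface \<alpha> j T (ctgt F)) a) \<inter> isos T"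
      using a f(6,7)[OF ic[OF a]] tv_tface[OF f(1) j'(1) \<alpha>, of a] tv_tface[OF f(2) j'(2) \<alpha>, of a] f(3,4) by simp
  next
    fix l b assume l: "l < n - 1" and b: "b \<in> coords (n - 1 - 1)"
    then have n2: "n = 2" "l = 0" "b = []" using n by auto
    obtain R K V where S: "csrc F = Square R K V" using f(3) n2 by (cases "csrc F") auto
    obtain R' K' V' where S': "ctgt F = Square R' K' V'" using f(4) n2 by (cases "ctgt F") auto
    have e: "tri_mor T (tedge (csrc F) i [\<alpha>]) (tedge (ctgt F) i [\<alpha>])
      (cat_at F (ins i (-1) [\<alpha>])) (cat_at F (ins i 0 [\<alpha>])) (cat_at F (ins i 1 [\<alpha>]))" if "i < 2" for i
      by (rule f(8)) (use that \<alpha> n2 in auto)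
    have "j = 0 \<or> j = Suc 0" using j n2 by linarith
    then show "tri_mor T (tedge (tface \<alpha> j T (csrc F)) l b) (tedge (tface \<alpha> j T (ctgt F)) l b)
       ((\<lambda>a\<in>coords (tdim (csrc F) - 1). cat_at F (ins j \<alpha> a)) (ins l (- 1) b))
       ((\<lambda>a\<in>coords (tdim (csrc F) - 1). cat_at F (ins j \<alpha> a)) (ins l 0 b))
       ((\<lambda>a\<in>coords (tdim (csrc F) - 1). cat_at F (ins j \<alpha> a)) (ins l 1 b))"
      using e[of 0] e[of 1] by (auto simp: S S' n2)
  qed (use c d f in auto)
qed

end

context multi
begin

lemma points_Ob: "x \<in> (\<Pi>\<^sub>E k\<in>{..<m}. Ob (T k)) \<Longrightarrow> points m x \<in> Ob (multi_cubes T m 0)"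
  using offset_points[of m m x] by (auto simp: multi_cubes_Ob family_extensional PiE_iff)

lemma single_Ob:
  assumes "i < m" "x \<in> others T m {i}" "is_tcube (T i) C" "tdim C = n"
  shows "single m i x C \<in> Ob (multi_cubes T m n)"
proof -
  have "is_tcube (T k) (single m i x C k)" if "k < m" for k
    using assms that by (cases "k = i") (auto simp: others_def)
  then show ?thesis using assms by (simp add: multi_cubes_Ob family_extensional offset_single)
qed

lemma double_Ob:
  assumes "i < j" "j < m" "x \<in> others T m {i, j}" "t \<in> distg (T i)" "t' \<in> distg (T j)"
  shows "double m i j x t t' \<in> Ob (multi_cubes T m 2)"
proof -
  have "is_tcube (T k) (double m i j x t t' k)" if "k < m" for k
  proof -
    consider "k = i" | "k = j" | "k \<noteq> i" "k \<noteq> j" by auto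
    then show ?thesis using assms that by cases (auto simp: others_def)
  qed
  then show ?thesis using assms by (simp add: multi_cubes_Ob family_extensional offset_double)
qed

lemma face_Ob:
  assumes Q: "Q \<in> Ob (multi_cubes T m (Suc n))" and k: "k < m" and j: "j < tdim (Q k)" and \<alpha>: "\<alpha> \<in> {-1, 0, 1}"
  shows "Q(k := tface \<alpha> j (T k) (Q k)) \<in> Ob (multi_cubes T m n)"
proof -
  note q = Q[unfolded multi_cubes_Ob]
  interpret Tk: tri "T k" by (rule tri[OF k])
  have c: "is_tcube (T k) (Q k)" using q k by blast
  note f = Tk.tcube_tface[OF c j \<alpha>]
  let ?R = "Q(k := tface \<alpha> j (T k) (Q k))"
  have "offset Q m = Suc (offset ?R m)"
  proof -
    have s: "offset C m = tdim (C k) + (\<Sum>l\<in>{..<m} - {k}. tdim (C l))" for C :: "nat \<Rightarrow> ('o, 'a) tcube"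
      unfolding offset_def using k by (intro sum.remove) auto
    have "(\<Sum>l\<in>{..<m} - {k}. tdim (Q l)) = (\<Sum>l\<in>{..<m} - {k}. tdim (?R l))" by (rule sum.cong) auto
    then show ?thesis using s[of Q] s[of ?R] f(2) by simp
  qed
  then show ?thesis using q f(1) k by (auto simp: multi_cubes_Ob extensional_def)
qed

lemma face_Ar:
  assumes F: "F \<in> Ar (multi_cubes T m (Suc n))" and n: "Suc n \<le> 2" and k: "k < m" and j: "j < tdim (csrc (F k))" and \<alpha>: "\<alpha> \<in> {-1, 0, 1}"
  shows "F(k := tface_mor \<alpha> j (T k) (F k)) \<in> Ar (multi_cubes T m n)"
proof -
  interpret Tk: tri "T k" by (rule tri[OF k])
  note M = multi_cubes_ArD(3)[OF F k]
  have kd: "tdim (csrc (F k)) \<le> 2"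
  proof -
    have "tdim (csrc (F k)) \<le> offset (\<lambda>l. csrc (F l)) m"
      unfolding offset_def by (rule member_le_sum) (use k in auto)
    then show ?thesis using F n by (simp add: multi_cubes_Ar)
  qed
  let ?G = "F(k := tface_mor \<alpha> j (T k) (F k))"
  have "(\<lambda>l\<in>{..<m}. csrc (F l))(k := tface \<alpha> j (T k) ((\<lambda>l\<in>{..<m}. csrc (F l)) k)) \<in> Ob (multi_cubes T m n)"
    by (rule face_Ob[OF multi_cubes_ArD(1)[OF F] k _ \<alpha>]) (use j k in simp)
  then have "offset ((\<lambda>l\<in>{..<m}. csrc (F l))(k := tface \<alpha> j (T k) (csrc (F k)))) m = n"
    using k by (simp add: multi_cubes_Ob)
  moreover have "offset (\<lambda>l. csrc (?G l)) m = offset ((\<lambda>l\<in>{..<m}. csrc (F l))(k := tface \<alpha> j (T k) (csrc (F k)))) m"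
    by (rule offset_cong) (simp add: tface_mor_def)
  ultimately have "offset (\<lambda>l. csrc (?G l)) m = n" by simp
  moreover have "is_tcube_mor (T k) (tdim (csrc (tface_mor \<alpha> j (T k) (F k)))) (tface_mor \<alpha> j (T k) (F k))"
    using Tk.tface_mor[OF M j \<alpha> kd] Tk.tcube_tface(2)[OF Tk.tcube_morD(1)[OF M] j \<alpha>] by (simp add: tface_mor_def)
  ultimately show ?thesis
    using F k by (auto simp: multi_cubes_Ar extensional_def)
qed

text \<open>The faces of the values of \<open>cub\<close> do not depend on \<open>d\<close> being a multi-determinant functor, so that
  this also determines a cubical multi-determinant functor from its levels 0 and 1.\<close>

lemma pface_cub_ob:
  assumes Q: "Q \<in> Ob (multi_cubes T m (Suc n))" "Suc n \<le> 2" and k: "k < m" and j: "j < tdim (Q k)" and \<alpha>: "\<alpha> \<in> {-1, 0, 1}"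
  shows "pface (Suc n) \<alpha> (offset Q k + j) (cub_ob T m d (Suc n) Q) = cub_ob T m d n (Q(k := tface \<alpha> j (T k) (Q k)))"
proof -
  consider "n = 0" | "n = 1" using Q(2) by linarith
  then show ?thesis
  proof cases
    case 1
    then obtain i x t where q: "i < m" "x \<in> others T m {i}" "t \<in> distg (T i)" "Q = single m i x (Triangle t)"
      using single_cases Q(1) by (metis One_nat_def)
    have ki: "k = i" "j = 0" using j k q(4) by (cases "k = i"; simp)+
    have e: "Q(k := tface \<alpha> j (T k) (Q k)) = points m (x(i := vertex (T i) t \<alpha>))"
      using q(1) by (auto simp: q(4) ki single_def points_def fun_eq_iff)
    have x: "x(i := vertex (T i) t \<alpha>) \<in> extensional {..<m}"
      using others_extensional[OF q(2)] q(1) by (auto simp: extensional_def)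
    have C: "cub_ob T m d (Suc 0) Q = \<lparr>pv = (\<lambda>a\<in>coords (Suc 0). on_ob d (x(i := vertex (T i) t (a ! 0)))),
      pe = (\<lambda>(l, c)\<in>{..<Suc 0} \<times> coords (Suc 0 - 1). m_add d (i, x, t))\<rparr>"
      using cub_ob_single[OF q(1) others_extensional[OF q(2)], of "Triangle t" "Suc 0" T d] q(4)
      by (simp cong: restrict_cong)
    have off: "offset Q k + j = 0" using q(1) by (simp add: q(4) ki offset_single)
    show ?thesis
      unfolding e 1 cub_ob_points[OF x] C pface_def off pcube.simps
      by (rule pcube_eqI) (use \<alpha> in \<open>auto simp: restrict_def fun_eq_iff\<close>)
  next
    case 2
    then have n: "Suc n = 2" by simp
    show ?thesis
      using Q(1)[unfolded n]
    proof (cases rule: square_cases)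
      case (square i x R K V)
      have ki: "k = i" using j k square(4) by (cases "k = i") auto
      have "j < 2" using j square(4) ki by simp
      then have j2: "j = 0 \<or> j = Suc 0" by linarith
      let ?t = "if j = 0 then at \<alpha> R else at \<alpha> K"
      have e: "Q(k := tface \<alpha> j (T k) (Q k)) = single m i x (Triangle ?t)"
        by (auto simp: square(4) ki single_def fun_eq_iff)
      \<comment> \<open>Rows and columns meet in common vertices. This is used for faces that are
        columns, since \<open>tv\<close> reads the rows.\<close>
      have v: "vertex (T i) (at \<gamma> R) \<alpha> = vertex (T i) (at \<alpha> K) \<gamma>" if "\<gamma> \<in> {-1, 0, 1}" for \<gamma>
        using tri.tv_ins[OF tri[OF square(1)] square(3), of 0 "[\<alpha>]" \<gamma>] \<alpha> that by simp
      have off: "offset Q k = 0" using square(1) by (simp add: square(4) ki offset_single)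
      have C: "cub_ob T m d (Suc n) Q = \<lparr>pv = (\<lambda>a\<in>coords 2. on_ob d (x(i := tv (T i) (Square R K V) a))),
       pe = (\<lambda>(l, c)\<in>{..<2} \<times> coords (2 - 1). m_add d (i, x, tedge (Square R K V) l c))\<rparr>"
        unfolding n using cub_ob_single[OF square(1) others_extensional[OF square(2)], of "Square R K V" 2 T d] square(4) by simp
      have C': "cub_ob T m d n (single m i x (Triangle ?t)) = \<lparr>pv = (\<lambda>a\<in>coords 1. on_ob d (x(i := vertex (T i) ?t (a ! 0)))),
       pe = (\<lambda>(l, c)\<in>{..<1} \<times> coords (1 - 1). m_add d (i, x, ?t))\<rparr>"
        unfolding 2 using cub_ob_single[OF square(1) others_extensional[OF square(2)], of "Triangle ?t" 1 T d]
        by (simp cong: restrict_cong)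
      note v3 = v[of 1, simplified] v[of 0, simplified] v[of "-1", simplified]
      from j2 show ?thesis
      proof
        assume j0: "j = 0"
        show ?thesis
          unfolding e off
          by (subst C, subst C', unfold n pface_def pcube.simps, rule pcube_eqI) (use \<alpha> in \<open>simp_all add: j0 fun_eq_iff coords_2_iff restrict_def\<close>)
      next
        assume j1: "j = Suc 0"
        show ?thesis
          unfolding e off
          by (subst C, subst C', unfold n pface_def pcube.simps, rule pcube_eqI) (use \<alpha> v3 in \<open>simp_all add: j1 fun_eq_iff coords_2_iff restrict_def\<close>)
      qed
    next
      case (triangles i i' x t t')
      have i: "i < m" "i \<noteq> i'" using triangles by auto
      have ki: "k = i \<or> k = i'" using j k triangles by (cases "k = i \<or> k = i'") auto
      then have j0: "j = 0" using j triangles by auto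
      have C: "cub_ob T m d (Suc n) Q = \<lparr>pv = (\<lambda>a\<in>coords 2. on_ob d (x(i := vertex (T i) t (a ! 0), i' := vertex (T i') t' (a ! 1)))),
         pe = (\<lambda>(l, c)\<in>{..<2} \<times> coords 1.
         if l = 0 then m_add d (i, x(i' := vertex (T i') t' (c ! 0)), t)
         else m_add d (i', x(i := vertex (T i) t (c ! 0)), t'))\<rparr>"
        unfolding n triangles(6) by (rule cub_ob_double[OF triangles(1,2) others_extensional[OF triangles(3)]])
      show ?thesis
      proof (cases "k = i")
        case True
        have e: "Q(k := tface \<alpha> j (T k) (Q k)) = single m i' (x(i := vertex (T i) t \<alpha>)) (Triangle t')"
          using i by (auto simp: triangles(6) True single_def double_def fun_eq_iff)
        have x: "x(i := vertex (T i) t \<alpha>) \<in> extensional ({..<m} - {i'})"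
          using others_extensional[OF triangles(3)] i by (auto simp: extensional_def)
        have C': "cub_ob T m d n (single m i' (x(i := vertex (T i) t \<alpha>)) (Triangle t')) =
          \<lparr>pv = (\<lambda>a\<in>coords 1. on_ob d (x(i := vertex (T i) t \<alpha>, i' := vertex (T i') t' (a ! 0)))),
           pe = (\<lambda>(l, c)\<in>{..<1} \<times> coords (1 - 1). m_add d (i', x(i := vertex (T i) t \<alpha>), t'))\<rparr>"
          unfolding 2 using cub_ob_single[OF triangles(2) x, of "Triangle t'" 1 T d] by (simp cong: restrict_cong)
        have off: "offset Q k + j = 0" using triangles i by (simp add: True j0 offset_double)
        show ?thesis
          unfolding e off
          by (subst C, subst C', unfold n pface_def pcube.simps, rule pcube_eqI) (use \<alpha> in \<open>auto simp: fun_eq_iff coords_2_iff restrict_def\<close>)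
      next
        case False
        then have k': "k = i'" using ki by simp
        have e: "Q(k := tface \<alpha> j (T k) (Q k)) = single m i (x(i' := vertex (T i') t' \<alpha>)) (Triangle t)"
          using i triangles(2) by (auto simp: triangles(6) k' single_def double_def fun_eq_iff)
        have x: "x(i' := vertex (T i') t' \<alpha>) \<in> extensional ({..<m} - {i})"
          using others_extensional[OF triangles(3)] i triangles(2) by (auto simp: extensional_def)
        have C': "cub_ob T m d n (single m i (x(i' := vertex (T i') t' \<alpha>)) (Triangle t)) =
          \<lparr>pv = (\<lambda>a\<in>coords 1. on_ob d (x(i := vertex (T i) t (a ! 0), i' := vertex (T i') t' \<alpha>))),
           pe = (\<lambda>(l, c)\<in>{..<1} \<times> coords (1 - 1). m_add d (i, x(i' := vertex (T i') t' \<alpha>), t))\<rparr>"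
          unfolding 2 using cub_ob_single[OF i(1) x, of "Triangle t" 1 T d] i(2) by (simp add: fun_upd_twist cong: restrict_cong)
        have off: "offset Q k + j = 1" using triangles i by (simp add: k' j0 offset_double)
        show ?thesis
          unfolding e off
          by (subst C, subst C', unfold n pface_def pcube.simps, rule pcube_eqI) (use \<alpha> in \<open>auto simp: fun_eq_iff coords_2_iff restrict_def\<close>)
      qed
    qed
  qed
qed

text \<open>The components of \<open>cub_ar\<close> depend on positions only through
  \<open>seg\<close>, and \<open>seg_ins\<close> matches the positions of a face with those of the
  cube.\<close>

lemma pface_mor_cub_ar:
  assumes F: "F \<in> Ar (multi_cubes T m (Suc n))" and n: "Suc n \<le> 2" and k: "k < m" and j: "j < tdim (csrc (F k))" and \<alpha>: "\<alpha> \<in> {-1, 0, 1}"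
  shows "pface_mor (Suc n) \<alpha> (offset (\<lambda>l. csrc (F l)) k + j) (cub_ar T m d (Suc n) F) =
    cub_ar T m d n (F(k := tface_mor \<alpha> j (T k) (F k)))"
proof -
  define Q where "Q = (\<lambda>k\<in>{..<m}. csrc (F k))"
  define Q' where "Q' = (\<lambda>k\<in>{..<m}. ctgt (F k))"
  note QO = multi_cubes_ArD(1)[OF F, folded Q_def] and QO' = multi_cubes_ArD(2)[OF F, folded Q'_def]
  have j': "j < tdim (Q k)" "j < tdim (Q' k)" using j k multi_cubes_ArD(4)[OF F k] by (simp_all add: Q_def Q'_def)
  let ?G = "F(k := tface_mor \<alpha> j (T k) (F k))"
  have G: "?G \<in> Ar (multi_cubes T m n)" by (rule face_Ar[OF F n k j \<alpha>])
  have o: "offset (\<lambda>l. csrc (F l)) k = offset Q k" "offset Q' k = offset Q k"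
    by (rule offset_cong, use k multi_cubes_ArD(4)[OF F] in \<open>simp add: Q_def Q'_def\<close>)+
  have s: "(\<lambda>l\<in>{..<m}. csrc (?G l)) = Q(k := tface \<alpha> j (T k) (Q k))" "(\<lambda>l\<in>{..<m}. ctgt (?G l)) = Q'(k := tface \<alpha> j (T k) (Q' k))"
    using k by (auto simp: Q_def Q'_def tface_mor_def fun_eq_iff)
  interpret Tk: tri "T k" by (rule tri[OF k])
  have fd: "tdim (csrc (F k)) = Suc (tdim (csrc (?G k)))"
    using Tk.tcube_tface(2)[OF Tk.tcube_morD(1)[OF multi_cubes_ArD(3)[OF F k]] j \<alpha>] by (simp add: tface_mor_def)
  have off: "offset (\<lambda>l. csrc (?G l)) m = n" using G by (simp add: multi_cubes_Ar)
  have sg: "seg (\<lambda>l. csrc (F l)) l (ins (offset Q k + j) \<alpha> a) =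
    (if l = k then ins j \<alpha> (seg (\<lambda>l. csrc (?G l)) k a) else seg (\<lambda>l. csrc (?G l)) l a)" if "l < m" "a \<in> coords n" for l a
    unfolding o(1)[symmetric]
    by (rule seg_ins[where R = "\<lambda>l. csrc (?G l)" and Q = "\<lambda>l. csrc (F l)", OF _ fd k that(1) j])
      (use coords_length[OF that(2)] off in auto)
  have sk: "seg (\<lambda>l. csrc (?G l)) k a \<in> coords (tdim (csrc (F k)) - 1)" if "a \<in> coords n" for a
    using seg_coords[OF off k that] fd by simp
  have c: "(\<lambda>l\<in>{..<m}. cat_at (F l) (seg (\<lambda>l. csrc (F l)) l (ins (offset Q k + j) \<alpha> a))) =
    (\<lambda>l\<in>{..<m}. cat_at (?G l) (seg (\<lambda>l. csrc (?G l)) l a))" if a: "a \<in> coords n" for a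
  proof (rule restrict_ext)
    fix l assume "l \<in> {..<m}"
    then show "cat_at (F l) (seg (\<lambda>l. csrc (F l)) l (ins (offset Q k + j) \<alpha> a)) = cat_at (?G l) (seg (\<lambda>l. csrc (?G l)) l a)"
      unfolding sg[OF _ a, of l, simplified] using sg[OF _ a, of l] sk[OF a] by (cases "l = k") (simp_all add: tface_mor_def)
  qed
  have ic: "ins (offset Q k + j) \<alpha> a \<in> coords (Suc n)" if "a \<in> coords n" for a by (rule ins_coords[OF that \<alpha>])
  show ?thesis
    unfolding pface_mor_def cub_ar_def cmor.sel s Q_def[symmetric] Q'_def[symmetric] o(1)
    using c ic
    by (simp add: pface_cub_ob[OF QO n k j'(1) \<alpha>] pface_cub_ob[OF QO' n k j'(2) \<alpha>, unfolded o(2)] cong: restrict_cong)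
qed

end

section \<open>A cubical functor is determined by its levels 0 and 1\<close>

lemma points_restrict: "(\<lambda>k\<in>{..<m}. Point (x k)) = points m x"
  by (simp add: points_def)

definition point_mor ::
  "(nat \<Rightarrow> ('o, 'a) tricat) \<Rightarrow> nat \<Rightarrow> (nat \<Rightarrow> 'a) \<Rightarrow> nat \<Rightarrow> (('o, 'a) tcube, 'a) cmor" where
  "point_mor T m f =
     (\<lambda>k\<in>{..<m}. CMor (Point (Dom (T k) (f k))) (Point (Cod (T k) (f k))) (\<lambda>a\<in>coords 0. f k))"

context multi
begin

lemma point_mor_Ar:
  assumes "f \<in> (\<Pi>\<^sub>E k\<in>{..<m}. isos (T k))"
  shows "point_mor T m f \<in> Ar (multi_cubes T m 0)"
proof -
  have "offset (\<lambda>k. csrc (point_mor T m f k)) m = 0"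
    unfolding offset_def by (rule sum.neutral) (simp add: point_mor_def)
  moreover have "is_tcube_mor (T k) 0 (point_mor T m f k)" if "k < m" for k
  proof -
    interpret catg "T k" by (rule catg[OF that])
    have "f k \<in> isos (T k)" using assms that by auto
    then show ?thesis using that isos_Ar[of "f k"] by (simp add: point_mor_def is_tcube_mor_def Hom_def)
  qed
  ultimately show ?thesis by (auto simp: multi_cubes_Ar point_mor_def)
qed

lemma point_mor_cases:
  assumes F: "F \<in> Ar (multi_cubes T m 0)"
  shows "(\<lambda>k\<in>{..<m}. cat_at (F k) []) \<in> (\<Pi>\<^sub>E k\<in>{..<m}. isos (T k))"
    and "F = point_mor T m (\<lambda>k\<in>{..<m}. cat_at (F k) [])"
proof -
  note A = F[unfolded multi_cubes_Ar]
  have t0: "tdim (csrc (F k)) = 0" if "k < m" for k using A that by (simp add: offset_def)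
  have M: "is_tcube_mor (T k) 0 (F k)" if "k < m" for k using A t0 that by metis
  then have i: "cat_at (F k) [] \<in> isos (T k)" "cat_at (F k) [] \<in> Hom (T k) (tv (T k) (csrc (F k)) []) (tv (T k) (ctgt (F k)) [])"
    if "k < m" for k using that by (auto simp: is_tcube_mor_def)
  show "(\<lambda>k\<in>{..<m}. cat_at (F k) []) \<in> (\<Pi>\<^sub>E k\<in>{..<m}. isos (T k))" using i by auto
  have "F k = CMor (Point (Dom (T k) (cat_at (F k) []))) (Point (Cod (T k) (cat_at (F k) []))) (\<lambda>a\<in>coords 0. cat_at (F k) [])"
    if k: "k < m" for k
  proof -
    obtain a b where ab: "csrc (F k) = Point a" "ctgt (F k) = Point b"
      using tdim_0 M[OF k] by (metis is_tcube_mor_def)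
    have "cat_at (F k) \<in> extensional (coords 0)" using M[OF k] by (simp add: is_tcube_mor_def)
    then have c: "cat_at (F k) = (\<lambda>a\<in>coords 0. cat_at (F k) [])" by (auto simp: extensional_def fun_eq_iff)
    show ?thesis using ab i(2)[OF k] c by (cases "F k") (simp add: Hom_def)
  qed
  then show "F = point_mor T m (\<lambda>k\<in>{..<m}. cat_at (F k) [])"
    using A by (intro extensionalityI[of F "{..<m}"]) (auto simp: point_mor_def)
qed

text \<open>The face axioms are stated for direction j of factor k; this makes them available for
  every direction J of the cube.\<close>

lemma direction_exists:
  assumes Q: "Q \<in> Ob (multi_cubes T m n)" "n \<le> 2" and J: "J < n"
  shows "\<exists>k<m. \<exists>j<tdim (Q k). J = offset Q k + j"
proof -
  consider "n = 1" | "n = 2" using J Q(2) by linarith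
  then show ?thesis
  proof cases
    case 1
    then obtain i x t where "i < m" "Q = single m i x (Triangle t)"
      using single_cases Q(1) by metis
    then show ?thesis using J 1 by (intro exI[of _ i]) (simp add: offset_single)
  next
    case 2
    show ?thesis
      using Q(1)[unfolded 2]
    proof (cases rule: square_cases)
      case (square i x R K V)
      then show ?thesis using J 2 by (intro exI[of _ i]) (simp add: offset_single)
    next
      case (triangles i j x t t')
      have "J = 0 \<or> J = 1" using J 2 by linarith
      then show ?thesis
      proof
        assume "J = 0"
        then show ?thesis using triangles by (intro exI[of _ i]) (simp add: offset_double)
      next
        assume "J = 1"
        then show ?thesis using triangles by (intro exI[of _ j]) (simp add: offset_double)
      qed
    qed
  qed
qed

text \<open>The faces in direction 0 alone already contain every vertex.\<close>

lemma pcube_face_ext: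
  assumes S: "pv S \<in> extensional (coords (Suc n))" "pv S' \<in> extensional (coords (Suc n))"
    and f: "\<And>\<alpha>. \<alpha> \<in> {-1, 0, 1} \<Longrightarrow> pface (Suc n) \<alpha> 0 S = pface (Suc n) \<alpha> 0 S'"
  shows "pv S = pv S'"
proof (rule extensionalityI[OF S])
  fix a assume "a \<in> coords (Suc n)"
  then obtain \<alpha> b where a: "a = \<alpha> # b" "\<alpha> \<in> {-1, 0, 1}" "b \<in> coords n" by (auto simp: coords_Suc)
  show "pv S a = pv S' a"
    using arg_cong[OF f[OF a(2)], of "\<lambda>C. pv C b"] a by (simp add: pface_def)
qed

text \<open>An edge of a square in one direction lies in a face taken in the other
  direction.\<close>

lemma square_face_ext:
  assumes S: "pe S \<in> extensional ({..<2} \<times> coords 1)" "pe S' \<in> extensional ({..<2} \<times> coords 1)"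
    and f: "\<And>\<alpha> J. \<alpha> \<in> {-1, 0, 1} \<Longrightarrow> J < 2 \<Longrightarrow> pface 2 \<alpha> J S = pface 2 \<alpha> J S'"
  shows "pe S = pe S'"
proof (rule extensionalityI[OF S])
  fix z assume "z \<in> {..<2 :: nat} \<times> coords 1"
  then obtain i \<gamma> where z: "z = (i, [\<gamma>])" "i < 2" "\<gamma> \<in> {-1, 0, 1}" by auto
  consider "i = 0" | "i = Suc 0" using z(2) by linarith
  then show "pe S z = pe S' z"
  proof cases
    case 1
    have "pe (pface 2 \<gamma> 1 S) (0, []) = pe (pface 2 \<gamma> 1 S') (0, [])" using f[OF z(3), of 1] by simp
    then show ?thesis by (simp add: pface_def z 1)
  next
    case 2
    have "pe (pface 2 \<gamma> 0 S) (0, []) = pe (pface 2 \<gamma> 0 S') (0, [])" using f[OF z(3), of 0] by simp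
    then show ?thesis by (simp add: pface_def z 2)
  qed
qed

text \<open>\<open>level01\<close> records level 0 and the edges of 1-cubes. Everything else is
  visible on faces, and both D and \<open>cub\<close> respect faces, so they agree by ascending the
  dimension. Only this comparison of formulas is made: the axioms of a multi-determinant functor for
  \<open>level01\<close> are established later with its help.\<close>

lemma cub_level01:
  assumes D: "cubical_multi_determinant T m P D"
  shows "D = cub T m (level01 T m D)"
proof -
  let ?d = "level01 T m D"
  note d = D[unfolded cubical_multi_determinant_def]
  have ext: "extensional_functor (multi_cubes T m n) (D n)" and F: "is_functor (multi_cubes T m n) (pcubes P n) (D n)"
    if "n \<le> 2" for n using d that by blast+
  have face: "pface n \<alpha> (offset Q k + j) (on_ob (D n) Q) = on_ob (D (n - 1)) (Q(k := tface \<alpha> j (T k) (Q k)))"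
    if "n \<in> {1, 2}" "\<alpha> \<in> {-1, 0, 1}" "k < m" "Q \<in> Ob (multi_cubes T m n)" "j < tdim (Q k)" for n \<alpha> k Q j
    using d that by blast
  have face_mor: "pface_mor n \<alpha> (offset (\<lambda>l. csrc (F l)) k + j) (on_ar (D n) F) = on_ar (D (n - 1)) (F(k := tface_mor \<alpha> j (T k) (F k)))"
    if "n \<in> {1, 2}" "\<alpha> \<in> {-1, 0, 1}" "k < m" "F \<in> Ar (multi_cubes T m n)" "j < tdim (csrc (F k))" for n \<alpha> k F j
    using d that by blast
  have pc: "is_pcube P n (on_ob (D n) Q)" if "n \<le> 2" "Q \<in> Ob (multi_cubes T m n)" for n Q
    using F[OF that(1)] that(2) by (auto simp: is_functor_def pcubes_def)
  have pce: "pv (on_ob (D n) Q) \<in> extensional (coords n)" "pe (on_ob (D n) Q) \<in> extensional ({..<n} \<times> coords (n - 1))"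
    if "n \<le> 2" "Q \<in> Ob (multi_cubes T m n)" for n Q
    using pc[OF that] by (auto simp: is_pcube_def PiE_iff)
  have cube: "pv (cub_ob T m ?d n Q) \<in> extensional (coords n)" "pe (cub_ob T m ?d n Q) \<in> extensional ({..<n} \<times> coords (n - 1))" for n Q
    by (simp_all add: cub_ob_def)
  \<comment> \<open>Agreement in dimension n makes all faces of the two (n + 1)-cubes agree.\<close>
  have faces: "pface (Suc n) \<alpha> J (on_ob (D (Suc n)) Q) = pface (Suc n) \<alpha> J (cub_ob T m ?d (Suc n) Q)"
    if n: "Suc n \<le> 2" and Q: "Q \<in> Ob (multi_cubes T m (Suc n))" and \<alpha>: "\<alpha> \<in> {-1, 0, 1}" and J: "J < Suc n"
      and IH: "\<And>Q. Q \<in> Ob (multi_cubes T m n) \<Longrightarrow> on_ob (D n) Q = cub_ob T m ?d n Q" for n Q \<alpha> J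
  proof -
    obtain k j where k: "k < m" "j < tdim (Q k)" "J = offset Q k + j" using direction_exists[OF Q n J] by blast
    have n12: "Suc n \<in> {1, 2}" using n by auto
    show ?thesis
      unfolding k(3) using face[OF n12 \<alpha> k(1) Q k(2)] pface_cub_ob[OF Q n k(1,2) \<alpha>, of ?d] IH[OF face_Ob[OF Q k(1,2) \<alpha>]]
      by simp
  qed
  have ob0: "on_ob (D 0) Q = cub_ob T m ?d 0 Q" if Q: "Q \<in> Ob (multi_cubes T m 0)" for Q
  proof -
    obtain x where x: "x \<in> (\<Pi>\<^sub>E k\<in>{..<m}. Ob (T k))" "Q = points m x" using points_cases[OF Q] by blast
    have xe: "x \<in> extensional {..<m}" using x by (simp add: PiE_iff)
    have 1: "on_ob ?d x = pv (on_ob (D 0) Q) []"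
      using x by (simp add: level01_def isom_prod_simps points_restrict)
    show ?thesis
      unfolding x(2) cub_ob_points[OF xe] 1[unfolded x(2)]
      using pce[of 0 Q] Q x(2) by (intro pcube.equality) (auto simp: extensional_def fun_eq_iff)
  qed
  have ob1: "on_ob (D 1) Q = cub_ob T m ?d 1 Q" if Q: "Q \<in> Ob (multi_cubes T m 1)" for Q
  proof -
    obtain i x t where q: "i < m" "x \<in> others T m {i}" "t \<in> distg (T i)" "Q = single m i x (Triangle t)"
      using single_cases[OF Q] by metis
    have v: "pv (on_ob (D 1) Q) = pv (cub_ob T m ?d 1 Q)"
      unfolding One_nat_def
      by (rule pcube_face_ext) (use faces[of 0 Q _ 0] Q pce[of 1 Q] cube[of 1 Q] ob0 in \<open>auto simp del: coords_1\<close>)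
    have "m_add ?d (i, x, t) = pe (on_ob (D 1) Q) (0, [])"
      using q by (simp add: level01_def add_dom_def single_def)
    then have "pe (on_ob (D 1) Q) (0, []) = pe (cub_ob T m ?d 1 Q) (0, [])"
      unfolding q(4) using cub_ob_single[OF q(1) others_extensional[OF q(2)], of "Triangle t" 1 T ?d] by simp
    then have "pe (on_ob (D 1) Q) = pe (cub_ob T m ?d 1 Q)"
      by (intro extensionalityI[OF pce(2)[OF _ Q] cube(2)]) auto
    then show ?thesis using v by (intro pcube.equality) auto
  qed
  have ob2: "on_ob (D 2) Q = cub_ob T m ?d 2 Q" if Q: "Q \<in> Ob (multi_cubes T m 2)" for Q
  proof -
    have s: "Suc 1 = 2" by simp
    have f: "pface 2 \<alpha> J (on_ob (D 2) Q) = pface 2 \<alpha> J (cub_ob T m ?d 2 Q)" if "\<alpha> \<in> {-1, 0, 1}" "J < 2" for \<alpha> J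
      using faces[of 1 Q \<alpha> J, unfolded s] Q that ob1 by blast
    have "pv (on_ob (D 2) Q) = pv (cub_ob T m ?d 2 Q)"
      using pcube_face_ext[where n = 1, unfolded s, OF pce(1)[OF _ Q] cube(1)] f by simp
    moreover have "pe (on_ob (D 2) Q) = pe (cub_ob T m ?d 2 Q)"
      by (rule square_face_ext) (use pce(2)[OF _ Q] cube(2)[of 2 Q] f in auto)
    ultimately show ?thesis by (intro pcube.equality) auto
  qed
  have ob: "on_ob (D n) Q = cub_ob T m ?d n Q" if "n \<le> 2" "Q \<in> Ob (multi_cubes T m n)" for n Q
  proof -
    have "n = 0 \<or> n = 1 \<or> n = 2" using that(1) by linarith
    then show ?thesis using ob0 ob1 ob2 that(2) by blast
  qed
  have mor: "csrc (on_ar (D n) G) = cub_ob T m ?d n (\<lambda>k\<in>{..<m}. csrc (G k))"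
    "ctgt (on_ar (D n) G) = cub_ob T m ?d n (\<lambda>k\<in>{..<m}. ctgt (G k))" "cat_at (on_ar (D n) G) \<in> extensional (coords n)"
    if "n \<le> 2" "G \<in> Ar (multi_cubes T m n)" for n G
  proof -
    have "on_ar (D n) G \<in> Hom (pcubes P n) (on_ob (D n) (Dom (multi_cubes T m n) G)) (on_ob (D n) (Cod (multi_cubes T m n) G))"
      using F[OF that(1)] that(2) by (simp add: is_functor_def)
    then show "csrc (on_ar (D n) G) = cub_ob T m ?d n (\<lambda>k\<in>{..<m}. csrc (G k))"
    "ctgt (on_ar (D n) G) = cub_ob T m ?d n (\<lambda>k\<in>{..<m}. ctgt (G k))" "cat_at (on_ar (D n) G) \<in> extensional (coords n)"
      using ob[OF that(1) multi_cubes_ArD(1)[OF that(2)]] ob[OF that(1) multi_cubes_ArD(2)[OF that(2)]]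
      by (simp_all add: Hom_def pcubes_def is_pcube_mor_def multi_cubes_def Let_def)
  qed
  have cmor: "on_ar (D n) G = cub_ar T m ?d n G" if "n \<le> 2" "G \<in> Ar (multi_cubes T m n)"
    "\<And>a. a \<in> coords n \<Longrightarrow> cat_at (on_ar (D n) G) a = cat_at (cub_ar T m ?d n G) a" for n G
  proof -
    have "cat_at (on_ar (D n) G) = cat_at (cub_ar T m ?d n G)"
      by (rule extensionalityI[OF mor(3)[OF that(1,2)]]) (use that(3) in \<open>simp_all add: cub_ar_def\<close>)
    moreover have "csrc (on_ar (D n) G) = csrc (cub_ar T m ?d n G)" "ctgt (on_ar (D n) G) = ctgt (cub_ar T m ?d n G)"
      using mor[OF that(1,2)] by (simp_all add: cub_ar_def)
    ultimately show ?thesis by (rule cmor.expand[OF conjI[OF _ conjI], rotated 2])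
  qed
  have ar0: "on_ar (D 0) G = cub_ar T m ?d 0 G" if G: "G \<in> Ar (multi_cubes T m 0)" for G
  proof (rule cmor[OF _ G])
    fix a assume a: "a \<in> coords 0"
    let ?f = "\<lambda>k\<in>{..<m}. cat_at (G k) []"
    note g = point_mor_cases[OF G]
    have "on_ar ?d ?f = cat_at (on_ar (D 0) (point_mor T m ?f)) []"
      using g(1) by (simp add: level01_def isom_prod_simps point_mor_def)
    moreover have "(\<lambda>k\<in>{..<m}. cat_at (G k) (seg (\<lambda>l. csrc (G l)) k a)) = ?f"
      using a by (auto simp: seg_def)
    ultimately show "cat_at (on_ar (D 0) G) a = cat_at (cub_ar T m ?d 0 G) a"
      using a g(2) by (simp add: cub_ar_def)
  qed simp
  \<comment> \<open>Each component of a morphism in positive dimension is a component of one of its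
    faces in direction 0.\<close>
  have arS: "on_ar (D (Suc n)) G = cub_ar T m ?d (Suc n) G" if n: "Suc n \<le> 2" and G: "G \<in> Ar (multi_cubes T m (Suc n))"
    and IH: "\<And>G. G \<in> Ar (multi_cubes T m n) \<Longrightarrow> on_ar (D n) G = cub_ar T m ?d n G" for n G
  proof (rule cmor[OF n G])
    fix a assume "a \<in> coords (Suc n)"
    then obtain \<alpha> b where a: "a = \<alpha> # b" "\<alpha> \<in> {-1, 0, 1}" "b \<in> coords n" by (auto simp: coords_Suc)
    obtain k j where k: "k < m" "j < tdim ((\<lambda>k\<in>{..<m}. csrc (G k)) k)" "0 = offset (\<lambda>k\<in>{..<m}. csrc (G k)) k + j"
      using direction_exists[OF multi_cubes_ArD(1)[OF G] n] by blast
    have j: "j < tdim (csrc (G k))" using k by simp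
    have o: "offset (\<lambda>l. csrc (G l)) k + j = 0"
      using offset_cong[of k "\<lambda>l. csrc (G l)" "\<lambda>k\<in>{..<m}. csrc (G k)"] k by simp
    have n12: "Suc n \<in> {1, 2}" using n by auto
    have "pface_mor (Suc n) \<alpha> 0 (on_ar (D (Suc n)) G) = pface_mor (Suc n) \<alpha> 0 (cub_ar T m ?d (Suc n) G)"
      using face_mor[OF n12 a(2) k(1) G j] pface_mor_cub_ar[OF G n k(1) j a(2), of ?d] IH[OF face_Ar[OF G n k(1) j a(2)]]
      unfolding o by simp
    from arg_cong[OF this, of "\<lambda>f. cat_at f b"]
    show "cat_at (on_ar (D (Suc n)) G) a = cat_at (cub_ar T m ?d (Suc n) G) a"
      using a by (simp add: pface_mor_def)
  qed
  have ar: "on_ar (D n) G = cub_ar T m ?d n G" if "n \<le> 2" "G \<in> Ar (multi_cubes T m n)" for n G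
    using that
  proof (induction n arbitrary: G)
    case 0 then show ?case using ar0 by blast
  next
    case (Suc n) then show ?case using arS by simp
  qed
  show ?thesis
  proof (rule extensionalityI[of D "{..2}"])
    show "D \<in> extensional {..2}" using d by blast
    fix n :: nat assume "n \<in> {..2}"
    then have n: "n \<le> 2" by simp
    have "on_ob (D n) = restrict (cub_ob T m ?d n) (Ob (multi_cubes T m n))"
      using ext[OF n] ob[OF n] by (intro extensionalityI[of _ "Ob (multi_cubes T m n)"]) (auto simp: extensional_functor_def)
    moreover have "on_ar (D n) = restrict (cub_ar T m ?d n) (Ar (multi_cubes T m n))"
      using ext[OF n] ar[OF n] by (intro extensionalityI[of _ "Ar (multi_cubes T m n)"]) (auto simp: extensional_functor_def)
    ultimately show "D n = cub T m ?d n" using n by (simp add: cub_def)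
  qed (simp add: cub_def)
qed

end

context multi_det
begin

text \<open>Together with \<open>cub_level01\<close> this makes \<open>cub\<close> and
  \<open>level01\<close> mutually inverse. Extensionality of d takes care of arguments outside the
  relevant domains.\<close>

lemma level01_cub: "level01 T m (cub T m d) = d"
proof (rule mdf.equality)
  have de: "extensional_functor (isom_prod T m) d" "m_add d \<in> extensional (add_dom T m)"
    using multi_det by (auto simp: multi_determinant_def)
  show "on_ob (level01 T m (cub T m d)) = on_ob d"
  proof (rule extensionalityI[of _ "Ob (isom_prod T m)"])
    show "on_ob d \<in> extensional (Ob (isom_prod T m))" using de by (simp add: extensional_functor_def)
    fix x assume x: "x \<in> Ob (isom_prod T m)"
    then have x': "x \<in> (\<Pi>\<^sub>E k\<in>{..<m}. Ob (T k))" by (simp add: isom_prod_simps)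
    then have "x \<in> extensional {..<m}" by (simp add: PiE_iff)
    then show "on_ob (level01 T m (cub T m d)) x = on_ob d x"
      using x cub_apply(1)[OF _ points_Ob[OF x']] by (simp add: level01_def points_restrict cub_ob_points)
  qed (simp add: level01_def)
  show "on_ar (level01 T m (cub T m d)) = on_ar d"
  proof (rule extensionalityI[of _ "Ar (isom_prod T m)"])
    show "on_ar d \<in> extensional (Ar (isom_prod T m))" using de by (simp add: extensional_functor_def)
    fix f assume f: "f \<in> Ar (isom_prod T m)"
    then have f': "f \<in> (\<Pi>\<^sub>E k\<in>{..<m}. isos (T k))" by (simp add: isom_prod_simps)
    have "(\<lambda>k\<in>{..<m}. cat_at (point_mor T m f k) (seg (\<lambda>l. csrc (point_mor T m f l)) k [])) = f"
      using f' by (intro extensionalityI[of _ "{..<m}"]) (auto simp: point_mor_def seg_def PiE_iff)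
    then have "cat_at (cub_ar T m d 0 (point_mor T m f)) [] = on_ar d f" by (simp add: cub_ar_def)
    then show "on_ar (level01 T m (cub T m d)) f = on_ar d f"
      using f cub_apply(2)[OF _ point_mor_Ar[OF f']] by (simp add: level01_def point_mor_def)
  qed (simp add: level01_def)
  show "m_add (level01 T m (cub T m d)) = m_add d"
  proof (rule extensionalityI[of _ "add_dom T m"])
    show "m_add d \<in> extensional (add_dom T m)" by (rule de)
    fix z assume z: "z \<in> add_dom T m"
    then obtain i x t where q: "z = (i, x, t)" "i < m" "x \<in> others T m {i}" "t \<in> distg (T i)" by (auto simp: add_dom_def)
    have "single m i x (Triangle t) \<in> Ob (multi_cubes T m 1)" by (rule single_Ob) (use q in auto)
    from cub_apply(1)[OF _ this] show "m_add (level01 T m (cub T m d)) z = m_add d z"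
      using z cub_ob_single[OF q(2) others_extensional[OF q(3)], of "Triangle t" 1 T d]
      by (simp add: level01_def q(1) flip: single_def)
  qed (simp add: level01_def)
qed simp

end

section \<open>Degenerate cubes in a Picard groupoid\<close>

section \<open>Degeneracies\<close>

lemma ins_del_nth:
  assumes "j \<le> length c"
  shows "ins j \<beta> c ! j = \<beta>" "del j (ins j \<beta> c) = c"
  using assms by (simp_all add: ins_def del_def nth_append)

lemma coords_ins:
  assumes "a \<in> coords (Suc n)" "j \<le> n"
  obtains \<beta> c where "a = ins j \<beta> c" "\<beta> \<in> {-1, 0, 1}" "c \<in> coords n"
proof
  have l: "length a = Suc n" using assms(1) by (simp add: coords_def)
  show "a = ins j (a ! j) (del j a)"
    using l assms(2) by (simp add: ins_def del_def id_take_nth_drop min_def)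
  have "a ! j \<in> set a" using l assms(2) by simp
  then show "a ! j \<in> {-1, 0, 1}" using assms(1) unfolding coords_def by blast
  show "del j a \<in> coords n"
    using l assms by (auto simp: coords_def del_def min_def dest: in_set_takeD in_set_dropD)
qed

context picard
begin

text \<open>The units in (0 + a) + (0 + b) may be dropped separately, or first collected in front
  and then dropped.\<close>

lemma lin_lunit_co:
  assumes ob: "a \<in> Ob P" "b \<in> Ob P"
  shows "lu (a \<boxplus> b) + lu unt + co unt a unt b - (lu a + lu b) \<in> nul"
proof -
  note I = id_Hom[OF ob(1)] id_Hom[OF ob(2)]
  have 1: "sh unt a unt + ru unt - ru a \<in> nul"
    unfolding sh_def
    by (rule nul_I[OF lin_lunit_plus[OF ob(1) unit_Ob]], rule nul_I[OF lin_lunit_nat[OF runit_Hom[OF ob(1)]]],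
      rule nul_I[OF lin_symm[OF ob(1) unit_Ob]], rule nul_I[OF lin_symm_unit[OF ob(1)]],
      rule nul_I[OF lin_triangle[OF unit_Ob ob(1)]], simp add: algebra_simps nul_zero; fail)
  show ?thesis
    by (rule nul_I[OF lin_co[OF unit_Ob ob(1) unit_Ob ob(2)]], rule nul_I[OF 1], rule nul_I[OF lin_lunit_plus[OF ob]],
      rule nul_I[OF lin_assoc_nat[OF lunit_Hom[OF unit_Ob] I]],
      rule nul_I[OF lin_assoc_nat[OF lunit_Hom[OF ob(1)] id_Hom[OF unit_Ob] I(2)]],
      rule nul_I[OF lin_triangle[OF ob]], rule nul_I[OF lin_unit], simp add: algebra_simps nul_zero; fail)
qed

lemma lin_runit_co:
  assumes ob: "a \<in> Ob P" "b \<in> Ob P"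
  shows "ru (a \<boxplus> b) + lu unt + co a unt b unt - (ru a + ru b) \<in> nul"
  by (rule nul_I[OF lin_co[OF ob(1) unit_Ob ob(2) unit_Ob]], rule nul_I[OF lin_runit_sh[OF ob]],
    rule nul_I[OF lin_runit_plus[OF ob]], rule nul_I[OF lin_triangle[OF plus_Ob[OF ob] unit_Ob]],
    rule nul_I[OF lin_assoc_nat[OF runit_Hom[OF ob(1)] id_Hom[OF ob(2)] id_Hom[OF unit_Ob]]],
    simp add: algebra_simps nul_zero; fail)

text \<open>The equations of the four degenerate squares on an edge E, for units at the end 1 or -1
  and degenerate in the first or the second direction. The last two follow from the same relations
  as the first two because the exchange is involutive.\<close>

lemma deg_square_equations:
  assumes E: "E \<in> Hom P (a \<boxplus> b) c" and ob: "a \<in> Ob P" "b \<in> Ob P"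
  shows "E \<cdot> (lunit P a \<oplus> lunit P b) = lunit P c \<cdot> (lunit P unt \<oplus> E) \<cdot> coas P unt a unt b"
    and "E \<cdot> (runit P a \<oplus> runit P b) = runit P c \<cdot> (E \<oplus> lunit P unt) \<cdot> coas P a unt b unt"
    and "lunit P c \<cdot> (lunit P unt \<oplus> E) = E \<cdot> (lunit P a \<oplus> lunit P b) \<cdot> coas P unt unt a b"
    and "runit P c \<cdot> (E \<oplus> lunit P unt) = E \<cdot> (runit P a \<oplus> runit P b) \<cdot> coas P a b unt unt"
proof -
  note j = judge_rules ob HomD(5)[OF E] judge_base[OF E] judge_coas
  note l = lin_lunit_co[OF ob] lin_lunit_nat[OF E] and r = lin_runit_co[OF ob] lin_runit_nat[OF E]
  show "E \<cdot> (lunit P a \<oplus> lunit P b) = lunit P c \<cdot> (lunit P unt \<oplus> E) \<cdot> coas P unt a unt b"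
    by (rule judge_eqI', (rule j)+, rule refl, rule nul_I[OF l(1)], rule nul_I[OF l(2)],
      simp add: algebra_simps nul_zero; fail)
  show "E \<cdot> (runit P a \<oplus> runit P b) = runit P c \<cdot> (E \<oplus> lunit P unt) \<cdot> coas P a unt b unt"
    by (rule judge_eqI', (rule j)+, rule refl, rule nul_I[OF r(1)], rule nul_I[OF r(2)],
      simp add: algebra_simps nul_zero; fail)
  show "lunit P c \<cdot> (lunit P unt \<oplus> E) = E \<cdot> (lunit P a \<oplus> lunit P b) \<cdot> coas P unt unt a b"
    by (rule judge_eqI', (rule j)+, rule refl, rule nul_I[OF l(1)], rule nul_I[OF l(2)],
      rule nul_I[OF lin_co_involutive[OF unit_Ob unit_Ob ob]], simp add: algebra_simps nul_zero; fail)
  show "runit P c \<cdot> (E \<oplus> lunit P unt) = E \<cdot> (runit P a \<oplus> runit P b) \<cdot> coas P a b unt unt"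
    by (rule judge_eqI', (rule j)+, rule refl, rule nul_I[OF r(1)], rule nul_I[OF r(2)],
      rule nul_I[OF lin_co_involutive[OF ob unit_Ob unit_Ob]], simp add: algebra_simps nul_zero; fail)
qed

lemma is_pcube_1I:
  assumes "pv S \<in> coords 1 \<rightarrow>\<^sub>E Ob P" "pe S \<in> extensional ({..<1} \<times> coords 0)"
    "pe S (0, []) \<in> Hom P (pv S [1] \<boxplus> pv S [-1]) (pv S [0])"
  shows "is_pcube P 1 S"
  using assms by (simp add: is_pcube_def)

lemma is_pcube_2I:
  assumes "pv S \<in> coords 2 \<rightarrow>\<^sub>E Ob P" "pe S \<in> extensional ({..<2} \<times> coords 1)"
    and e: "\<And>\<gamma>. \<gamma> \<in> {-1, 0, 1} \<Longrightarrow> pe S (0, [\<gamma>]) \<in> Hom P (pv S [1, \<gamma>] \<boxplus> pv S [-1, \<gamma>]) (pv S [0, \<gamma>])"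
      "\<And>\<gamma>. \<gamma> \<in> {-1, 0, 1} \<Longrightarrow> pe S (1, [\<gamma>]) \<in> Hom P (pv S [\<gamma>, 1] \<boxplus> pv S [\<gamma>, -1]) (pv S [\<gamma>, 0])"
    and q: "pe S (1, [0]) \<cdot> (pe S (0, [1]) \<oplus> pe S (0, [-1])) = pe S (0, [0]) \<cdot> (pe S (1, [1]) \<oplus> pe S (1, [-1])) \<cdot>
      coas P (pv S [1, 1]) (pv S [-1, 1]) (pv S [1, -1]) (pv S [-1, -1])"
  shows "is_pcube P 2 S"
  unfolding is_pcube_def
proof (intro conjI allI impI ballI)
  show "pv S \<in> coords 2 \<rightarrow>\<^sub>E Ob P" "pe S \<in> extensional ({..<2} \<times> coords (2 - 1))" using assms by simp_all
  fix i :: nat and c assume "i < 2" and "c \<in> coords (2 - 1)"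
  then obtain \<gamma> where c: "c = [\<gamma>]" "\<gamma> \<in> {-1, 0, 1}" by auto
  consider "i = 0" | "i = 1" using \<open>i < 2\<close> by linarith
  then show "pe S (i, c) \<in> Hom P (pv S (ins i 1 c) \<boxplus> pv S (ins i (-1) c)) (pv S (ins i 0 c))"
  proof cases
    case 1 show ?thesis using e(1)[OF c(2)] by (simp add: 1 c(1))
  next
    case 2 show ?thesis using e(2)[OF c(2)] by (simp add: 2 c(1))
  qed
next
  fix i j :: nat and c assume "i < j \<and> j < 2" and "c \<in> coords (2 - 2)"
  then have ij: "i = 0" "j = Suc 0" and c: "c = []" by auto
  show "let s = \<lambda>\<alpha> \<beta>. pv S (ins j \<beta> (ins i \<alpha> c)); fi = \<lambda>\<beta>. pe S (i, ins (j - 1) \<beta> c); fj = \<lambda>\<alpha>. pe S (j, ins i \<alpha> c)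
       in fj 0 \<cdot> (fi 1 \<oplus> fi (-1)) = fi 0 \<cdot> (fj 1 \<oplus> fj (-1)) \<cdot> coas P (s 1 1) (s (-1) 1) (s 1 (-1)) (s (-1) (-1))"
    using q by (simp add: ij c Let_def)
qed

text \<open>Degenerating an object only asks for the type of a unit isomorphism; degenerating an
  edge gives a square covered by \<open>deg_square_equations\<close>.\<close>

lemma pcube_pdeg:
  assumes S: "is_pcube P n S" and n: "n \<le> 1" and J: "J \<le> n" and \<alpha>: "\<alpha> = 1 \<or> \<alpha> = -1"
  shows "is_pcube P (n + 1) (pdeg P n \<alpha> J S)"
proof -
  let ?D = "pdeg P n \<alpha> J S"
  have pvS: "pv S a \<in> Ob P" if "a \<in> coords n" for a using S that by (auto simp: is_pcube_def)
  have ext: "pe ?D \<in> extensional ({..<n + 1} \<times> coords n)" by (simp add: pdeg_def)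
  consider "n = 0" "J = 0" | "n = 1" "J = 0" | "n = 1" "J = Suc 0" using n J by linarith
  then show ?thesis
  proof cases
    case 1
    have s: "pv S [] \<in> Ob P" using pvS[of "[]"] 1 by simp
    have v: "pv ?D = (\<lambda>a\<in>coords 1. if a ! 0 = \<alpha> then unt else pv S (del 0 a))"
      and e: "pe ?D (0, []) = (if \<alpha> = 1 then lunit P (pv S []) else runit P (pv S []))" using 1 by (simp_all add: pdeg_def)
    have "is_pcube P 1 ?D"
    proof (rule is_pcube_1I)
      show "pv ?D \<in> coords 1 \<rightarrow>\<^sub>E Ob P" unfolding v using s unit_Ob by auto
      show "pe ?D \<in> extensional ({..<1} \<times> coords 0)" using ext 1 by simp
      show "pe ?D (0, []) \<in> Hom P (pv ?D [1] \<boxplus> pv ?D [-1]) (pv ?D [0])"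
        using \<alpha> lunit_Hom[OF s] runit_Hom[OF s] unfolding e v by (elim disjE) simp_all
    qed
    then show ?thesis using 1 by simp
  next
    case 2
    have s: "pv S [1] \<in> Ob P" "pv S [0] \<in> Ob P" "pv S [-1] \<in> Ob P" using pvS 2 by auto
    have E: "pe S (0, []) \<in> Hom P (pv S [1] \<boxplus> pv S [-1]) (pv S [0])" using S 2 by (simp add: is_pcube_def)
    note q = deg_square_equations[OF E s(1,3)]
    have v: "pv ?D [\<beta>, \<gamma>] = (if \<beta> = \<alpha> then unt else pv S [\<gamma>])" if "\<beta> \<in> {-1, 0, 1}" "\<gamma> \<in> {-1, 0, 1}" for \<beta> \<gamma>
      using that 2 by (simp add: pdeg_def coords_2_iff numeral_2_eq_2[symmetric] del: coords_1)
    have e: "pe ?D (0, [\<gamma>]) = (if \<alpha> = 1 then lunit P (pv S [\<gamma>]) else runit P (pv S [\<gamma>]))"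
      "pe ?D (1, [\<gamma>]) = (if \<gamma> = \<alpha> then lunit P unt else pe S (0, []))" if "\<gamma> \<in> {-1, 0, 1}" for \<gamma>
      using that 2 by (simp_all add: pdeg_def)
    have S: "pv S [\<gamma>] \<in> Ob P" if "\<gamma> \<in> {-1, 0, 1}" for \<gamma> using s that by auto
    have "is_pcube P 2 ?D"
    proof (rule is_pcube_2I)
      have "pv ?D a \<in> Ob P" if "a \<in> coords 2" for a
      proof -
        obtain \<beta> \<gamma> where a: "a = [\<beta>, \<gamma>]" "\<beta> \<in> {-1, 0, 1}" "\<gamma> \<in> {-1, 0, 1}" using \<open>a \<in> coords 2\<close> unfolding coords_2 by blast
        show ?thesis using S[OF a(2)] S[OF a(3)] unit_Ob by (simp add: a(1) v[OF a(2,3)])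
      qed
      then show "pv ?D \<in> coords 2 \<rightarrow>\<^sub>E Ob P" using 2 by (auto simp: pdeg_def numeral_2_eq_2 PiE_iff)
      show "pe ?D \<in> extensional ({..<2} \<times> coords 1)" using ext 2 by (simp add: numeral_2_eq_2)
    next
      fix \<gamma> :: int assume g: "\<gamma> \<in> {-1, 0, 1}"
      show "pe ?D (0, [\<gamma>]) \<in> Hom P (pv ?D [1, \<gamma>] \<boxplus> pv ?D [-1, \<gamma>]) (pv ?D [0, \<gamma>])"
        using \<alpha> lunit_Hom[OF S[OF g]] runit_Hom[OF S[OF g]] e(1)[OF g] v[OF _ g, of 1] v[OF _ g, of 0] v[OF _ g, of "-1"]
        by (elim disjE) simp_all
      show "pe ?D (1, [\<gamma>]) \<in> Hom P (pv ?D [\<gamma>, 1] \<boxplus> pv ?D [\<gamma>, -1]) (pv ?D [\<gamma>, 0])"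
        using E lunit_Hom[OF unit_Ob] e(2)[OF g] by (simp add: v[OF g])
    next
      show "pe ?D (1, [0]) \<cdot> (pe ?D (0, [1]) \<oplus> pe ?D (0, [-1])) = pe ?D (0, [0]) \<cdot> (pe ?D (1, [1]) \<oplus> pe ?D (1, [-1])) \<cdot>
          coas P (pv ?D [1, 1]) (pv ?D [-1, 1]) (pv ?D [1, -1]) (pv ?D [-1, -1])"
        using \<alpha> q(1,2) e[of 1] e[of 0] e[of "-1"] v[of 1 1] v[of "-1" 1] v[of 1 "-1"] v[of "-1" "-1"]
        by (elim disjE) simp_all
    qed
    then show ?thesis using 2 by (simp add: numeral_2_eq_2)
  next
    case 3
    have s: "pv S [1] \<in> Ob P" "pv S [0] \<in> Ob P" "pv S [-1] \<in> Ob P" using pvS 3 by auto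
    have E: "pe S (0, []) \<in> Hom P (pv S [1] \<boxplus> pv S [-1]) (pv S [0])" using S 3 by (simp add: is_pcube_def)
    note q = deg_square_equations[OF E s(1,3)]
    have v: "pv ?D [\<gamma>, \<beta>] = (if \<beta> = \<alpha> then unt else pv S [\<gamma>])" if "\<beta> \<in> {-1, 0, 1}" "\<gamma> \<in> {-1, 0, 1}" for \<beta> \<gamma>
      using that 3 by (simp add: pdeg_def coords_2_iff numeral_2_eq_2[symmetric] del: coords_1)
    have e: "pe ?D (1, [\<gamma>]) = (if \<alpha> = 1 then lunit P (pv S [\<gamma>]) else runit P (pv S [\<gamma>]))"
      "pe ?D (0, [\<gamma>]) = (if \<gamma> = \<alpha> then lunit P unt else pe S (0, []))" if "\<gamma> \<in> {-1, 0, 1}" for \<gamma>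
      using that 3 by (simp_all add: pdeg_def)
    have S: "pv S [\<gamma>] \<in> Ob P" if "\<gamma> \<in> {-1, 0, 1}" for \<gamma> using s that by auto
    have "is_pcube P 2 ?D"
    proof (rule is_pcube_2I)
      have "pv ?D a \<in> Ob P" if "a \<in> coords 2" for a
      proof -
        obtain \<beta> \<gamma> where a: "a = [\<beta>, \<gamma>]" "\<beta> \<in> {-1, 0, 1}" "\<gamma> \<in> {-1, 0, 1}" using \<open>a \<in> coords 2\<close> unfolding coords_2 by blast
        show ?thesis using S[OF a(2)] S[OF a(3)] unit_Ob by (simp add: a(1) v[OF a(3,2)])
      qed
      then show "pv ?D \<in> coords 2 \<rightarrow>\<^sub>E Ob P" using 3 by (auto simp: pdeg_def numeral_2_eq_2 PiE_iff)
      show "pe ?D \<in> extensional ({..<2} \<times> coords 1)" using ext 3 by (simp add: numeral_2_eq_2)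
    next
      fix \<gamma> :: int assume g: "\<gamma> \<in> {-1, 0, 1}"
      show "pe ?D (1, [\<gamma>]) \<in> Hom P (pv ?D [\<gamma>, 1] \<boxplus> pv ?D [\<gamma>, -1]) (pv ?D [\<gamma>, 0])"
        using \<alpha> lunit_Hom[OF S[OF g]] runit_Hom[OF S[OF g]] e(1)[OF g] v[OF _ g, of 1] v[OF _ g, of 0] v[OF _ g, of "-1"]
        by (elim disjE) simp_all
      show "pe ?D (0, [\<gamma>]) \<in> Hom P (pv ?D [1, \<gamma>] \<boxplus> pv ?D [-1, \<gamma>]) (pv ?D [0, \<gamma>])"
        using E lunit_Hom[OF unit_Ob] e(2)[OF g] by (simp add: v[OF g])
    next
      show "pe ?D (1, [0]) \<cdot> (pe ?D (0, [1]) \<oplus> pe ?D (0, [-1])) = pe ?D (0, [0]) \<cdot> (pe ?D (1, [1]) \<oplus> pe ?D (1, [-1])) \<cdot>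
          coas P (pv ?D [1, 1]) (pv ?D [-1, 1]) (pv ?D [1, -1]) (pv ?D [-1, -1])"
        using \<alpha> q(3,4) e[of 1] e[of 0] e[of "-1"] v[of 1 1] v[of "-1" 1] v[of 1 "-1"] v[of "-1" "-1"]
        by (elim disjE) simp_all
    qed
    then show ?thesis using 3 by (simp add: numeral_2_eq_2)
  qed
qed

end

section \<open>Degenerate cubes and their morphisms in a triangulated category\<close>

context tri
begin

lemma vertex_deg_tri:
  "z \<in> Ob T \<Longrightarrow> \<alpha> = 1 \<or> \<alpha> = -1 \<Longrightarrow> \<beta> \<in> {-1, 0, 1} \<Longrightarrow>
   vertex T (deg_tri \<alpha> T z) \<beta> = (if \<beta> = \<alpha> then zob T else z)"
  by (auto simp: deg_tri_def)

lemma tcube_tdeg: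
  assumes "is_tcube T C" "tdim C \<le> 1" "\<alpha> = 1 \<or> \<alpha> = -1"
  shows "is_tcube T (tdeg \<alpha> j T C)" "tdim (tdeg \<alpha> j T C) = Suc (tdim C)"
proof -
  show "is_tcube T (tdeg \<alpha> j T C)"
  proof (cases C)
    case (Point x)
    then show ?thesis using assms tcube_tdeg_Point[of x \<alpha> j] by simp
  next
    case (Triangle t)
    then show ?thesis using assms tcube_tdeg_Triangle by (cases t) (simp del: tdeg.simps)
  qed (use assms in auto)
  show "tdim (tdeg \<alpha> j T C) = Suc (tdim C)"
  proof (cases C)
    case (Triangle t)
    then show ?thesis by (cases t) (simp add: Let_def)
  qed (use assms in auto)
qed

lemma tedge_tdeg:
  assumes "is_tcube T C" "tdim C \<le> 1" "\<alpha> = 1 \<or> \<alpha> = -1" "j \<le> tdim C" "c \<in> coords (tdim C)"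
  shows "tedge (tdeg \<alpha> j T C) j c = deg_tri \<alpha> T (tv T C c)"
proof (cases C)
  case (Triangle t)
  have "j = 0 \<or> j = Suc 0" using assms(4) Triangle by auto
  then show ?thesis using assms(5) by (cases t) (auto simp: Triangle Let_def)
qed (use assms in auto)

text \<open>In the direction that is not degenerate, the square repeats t, except at the zero end,
  where the null triangle appears.\<close>

lemma tedge_tdeg_other:
  assumes "t \<in> distg T" "\<alpha> = 1 \<or> \<alpha> = -1" "j \<le> 1" "\<gamma> \<in> {-1, 0, 1}"
  shows "tedge (tdeg \<alpha> j T (Triangle t)) (1 - j) [\<gamma>] = (if \<gamma> = \<alpha> then deg_tri 1 T (zob T) else t)"
proof -
  have "j = 0 \<or> j = Suc 0" using assms(3) by auto
  then show ?thesis using assms(2,4) by (cases t) (auto simp: Let_def)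
qed

lemma tv_tdeg:
  assumes "is_tcube T C" "tdim C \<le> 1" "\<alpha> = 1 \<or> \<alpha> = -1" "j \<le> tdim C" "c \<in> coords (tdim C)" "\<beta> \<in> {-1, 0, 1}"
  shows "tv T (tdeg \<alpha> j T C) (ins j \<beta> c) = (if \<beta> = \<alpha> then zob T else tv T C c)"
proof -
  note D = tcube_tdeg[OF assms(1-3), of j]
  show ?thesis
    using tv_ins[OF D(1), of j c \<beta>] D(2) assms(4-6)
      tedge_tdeg[OF assms(1-5)] vertex_deg_tri[OF tv_Ob[OF assms(1,5)] assms(3,6)] by simp
qed

lemma tri_mor_deg:
  assumes f: "f \<in> Hom T x y" and \<alpha>: "\<alpha> = 1 \<or> \<alpha> = -1"
  shows "tri_mor T (deg_tri \<alpha> T x) (deg_tri \<alpha> T y) (if -1 = \<alpha> then Idt T (zob T) else f) f (if 1 = \<alpha> then Idt T (zob T) else f)"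
proof -
  note [simp] = HomD[OF f]
  show ?thesis using \<alpha> f by (auto simp: deg_tri_simps Hom_def Idt_zob)
qed

lemma tdeg_mor:
  assumes F: "is_tcube_mor T n F" and n: "n \<le> 1" and j: "j \<le> n" and \<alpha>: "\<alpha> = 1 \<or> \<alpha> = -1"
  shows "is_tcube_mor T (Suc n) (tdeg_mor \<alpha> j T F)"
proof -
  note f = tcube_morD[OF F]
  have d: "tdim (csrc F) \<le> 1" "tdim (ctgt F) \<le> 1" "j \<le> tdim (csrc F)" "j \<le> tdim (ctgt F)" using f n j by auto
  note C = tcube_tdeg[OF f(1) d(1) \<alpha>, of j] and C' = tcube_tdeg[OF f(2) d(2) \<alpha>, of j]
  have at: "cat_at (tdeg_mor \<alpha> j T F) (ins j \<beta> c) = (if \<beta> = \<alpha> then Idt T (zob T) else cat_at F c)"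
    if "\<beta> \<in> {-1, 0, 1}" "c \<in> coords n" for \<beta> c
    using ins_coords[OF that(2,1), of j] ins_del_nth[of j c \<beta>] coords_length[OF that(2)] j f(3)
    by (simp add: tdeg_mor_def)
  have tm: "csrc (tdeg_mor \<alpha> j T F) = tdeg \<alpha> j T (csrc F)" "ctgt (tdeg_mor \<alpha> j T F) = tdeg \<alpha> j T (ctgt F)"
    by (simp_all add: tdeg_mor_def)
  show ?thesis
    unfolding is_tcube_mor_def tm
  proof (intro conjI ballI allI impI)
    show "cat_at (tdeg_mor \<alpha> j T F) \<in> extensional (coords (Suc n))" using f(3) by (simp add: tdeg_mor_def)
    fix a assume "a \<in> coords (Suc n)"
    then obtain \<beta> c where a: "a = ins j \<beta> c" "\<beta> \<in> {-1, 0, 1}" "c \<in> coords n" using coords_ins j by metis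
    have c: "c \<in> coords (tdim (csrc F))" "c \<in> coords (tdim (ctgt F))" using a(3) f by auto
    show "cat_at (tdeg_mor \<alpha> j T F) a \<in> Hom T (tv T (tdeg \<alpha> j T (csrc F)) a) (tv T (tdeg \<alpha> j T (ctgt F)) a) \<inter> isos T"
      unfolding a(1) at[OF a(2,3)] tv_tdeg[OF f(1) d(1) \<alpha> d(3) c(1) a(2)] tv_tdeg[OF f(2) d(2) \<alpha> d(4) c(2) a(2)]
      using f(6,7)[OF a(3)] id_Hom[OF zob_Ob] isos_id[OF zob_Ob] by simp
  next
    fix l c assume l: "l < Suc n" and c: "c \<in> coords (Suc n - 1)"
    then have c: "c \<in> coords n" "c \<in> coords (tdim (csrc F))" "c \<in> coords (tdim (ctgt F))" using f by auto
    show "tri_mor T (tedge (tdeg \<alpha> j T (csrc F)) l c) (tedge (tdeg \<alpha> j T (ctgt F)) l c)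
       (cat_at (tdeg_mor \<alpha> j T F) (ins l (-1) c)) (cat_at (tdeg_mor \<alpha> j T F) (ins l 0 c)) (cat_at (tdeg_mor \<alpha> j T F) (ins l 1 c))"
    proof (cases "l = j")
      case True
      show ?thesis
        unfolding True tedge_tdeg[OF f(1) d(1) \<alpha> d(3) c(2)] tedge_tdeg[OF f(2) d(2) \<alpha> d(4) c(3)]
        using tri_mor_deg[OF f(6)[OF c(1)] \<alpha>] at[OF _ c(1), of 1] at[OF _ c(1), of 0] at[OF _ c(1), of "-1"] \<alpha>
        by (elim disjE) simp_all
    next
      case False
      then have n1: "n = 1" "l = 1 - j" using l n j by auto
      obtain t where t: "csrc F = Triangle t" using tdim_1 f(3) n1 by metis
      obtain t' where t': "ctgt F = Triangle t'" using tdim_1 f(4) n1 by metis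
      have dt: "t \<in> distg T" "t' \<in> distg T" using f(1,2) t t' by auto
      obtain \<gamma> where g: "c = [\<gamma>]" "\<gamma> \<in> {-1, 0, 1}" using c(1) n1 by auto
      \<comment> \<open>A square has only the directions l and j, so the same position can be
        described by inserting along either of them.\<close>
      have sw: "ins l \<beta> [\<gamma>] = ins j \<gamma> [\<beta>]" for \<beta>
      proof -
        have "j = 0 \<or> j = Suc 0" using n1 j by linarith
        then show ?thesis using n1 by (elim disjE) simp_all
      qed
      have tm: "tri_mor T t t' (cat_at F [-1]) (cat_at F [0]) (cat_at F [1])"
        using f(8)[of 0 "[]"] n1 by (simp add: t t')
      have "cat_at (tdeg_mor \<alpha> j T F) (ins l \<beta> [\<gamma>]) = (if \<gamma> = \<alpha> then Idt T (zob T) else cat_at F [\<beta>])" if "\<beta> \<in> {-1, 0, 1}" for \<beta>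
        unfolding sw using at[of \<gamma> "[\<beta>]"] that g n1 by auto
      then show ?thesis
        using tedge_tdeg_other[OF dt(1) \<alpha> _ g(2), of j] tedge_tdeg_other[OF dt(2) \<alpha> _ g(2), of j] n1 j
          tm tri_mor_id[OF dist_deg[OF zob_Ob, of 1]] by (simp add: t t' g(1) deg_tri_simps)
    qed
  qed (use C C' f in auto)
qed

end

lemma factor_offset:
  assumes "j < tdim (Q k)"
  shows "factor Q (offset Q k + j) = k"
  unfolding factor_def
proof (rule Least_equality)
  show "offset Q k + j < offset Q (Suc k)" using assms by (simp add: offset_def)
  fix l assume l: "offset Q k + j < offset Q (Suc l)"
  show "k \<le> l"
  proof (rule ccontr)
    assume "\<not> k \<le> l"
    then have "offset Q (Suc l) \<le> offset Q k" unfolding offset_def by (intro sum_mono2) auto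
    then show False using l by simp
  qed
qed

section \<open>The canonical isomorphisms from values at zero objects to the unit\<close>

context multi_det
begin

abbreviation "zi \<equiv> zero_iso T m P d"

lemma add_null_Hom:
  assumes "k < m" "y \<in> others T m {k}"
  shows "add k y (deg_tri 1 (T k) (zob (T k))) \<in> Hom P (Do (y(k := zob (T k))) \<boxplus>\<^bsub>P\<^esub> Do (y(k := zob (T k)))) (Do (y(k := zob (T k))))"
proof -
  interpret det "T k" P "\<lparr>on_ob = (\<lambda>a. Do (y(k := a))), on_ar = (\<lambda>f. Da ((others_id T m {k} y)(k := f)))\<rparr>"
    "\<lambda>t. add k y t" by (rule det_in_variable[OF assms])
  show ?thesis using mu_Hom by (simp only: func.simps)
qed

text \<open>The description in \<open>zero_iso_def\<close> has exactly one solution by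
  \<open>ex1_unit_map\<close>, applied to the datum of the null triangle.\<close>

lemma zero_iso:
  assumes k: "k < m" and y: "y \<in> others T m {k}"
  shows "zi k (y(k := zob (T k))) \<in> Hom P (Do (y(k := zob (T k)))) (punit P)"
    and "zi k (y(k := zob (T k))) \<cdot>\<^bsub>P\<^esub> add k y (deg_tri 1 (T k) (zob (T k))) =
      lunit P (punit P) \<cdot>\<^bsub>P\<^esub> (zi k (y(k := zob (T k))) \<oplus>\<^bsub>P\<^esub> zi k (y(k := zob (T k))))"
    and "u \<in> Hom P (Do (y(k := zob (T k)))) (punit P) \<Longrightarrow>
      u \<cdot>\<^bsub>P\<^esub> add k y (deg_tri 1 (T k) (zob (T k))) = lunit P (punit P) \<cdot>\<^bsub>P\<^esub> (u \<oplus>\<^bsub>P\<^esub> u) \<Longrightarrow> u = zi k (y(k := zob (T k)))"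
proof -
  have e: "restrict (y(k := zob (T k))) ({..<m} - {k}) = y"
    using others_extensional[OF y] by (intro extensionalityI[of _ "{..<m} - {k}"]) auto
  note U = P.ex1_unit_map[OF add_null_Hom[OF k y]]
  have z: "zi k (y(k := zob (T k))) = (THE u. u \<in> Hom P (Do (y(k := zob (T k)))) (punit P) \<and>
    u \<cdot>\<^bsub>P\<^esub> add k y (deg_tri 1 (T k) (zob (T k))) = lunit P (punit P) \<cdot>\<^bsub>P\<^esub> (u \<oplus>\<^bsub>P\<^esub> u))"
    unfolding zero_iso_def e ..
  note I = theI'[OF U, folded z]
  show "zi k (y(k := zob (T k))) \<in> Hom P (Do (y(k := zob (T k)))) (punit P)" using I by (rule conjunct1)
  show "zi k (y(k := zob (T k))) \<cdot>\<^bsub>P\<^esub> add k y (deg_tri 1 (T k) (zob (T k))) =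
      lunit P (punit P) \<cdot>\<^bsub>P\<^esub> (zi k (y(k := zob (T k))) \<oplus>\<^bsub>P\<^esub> zi k (y(k := zob (T k))))" using I by (rule conjunct2)
  assume "u \<in> Hom P (Do (y(k := zob (T k)))) (punit P)"
    "u \<cdot>\<^bsub>P\<^esub> add k y (deg_tri 1 (T k) (zob (T k))) = lunit P (punit P) \<cdot>\<^bsub>P\<^esub> (u \<oplus>\<^bsub>P\<^esub> u)"
  then show "u = zi k (y(k := zob (T k)))" unfolding z by (intro the1_equality[OF U, symmetric] conjI)
qed

text \<open>\<open>det.ad_deg\<close> in the variable k, with \<open>zero_iso\<close> as the unit
  map u. This is what the degeneracy comparison needs along the degenerate direction.\<close>

lemma add_deg_tri:
  assumes k: "k < m" and y: "y \<in> others T m {k}" and a: "a \<in> Ob (T k)"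
  shows "add k y (deg_tri 1 (T k) a) = lunit P (Do (y(k := a))) \<cdot>\<^bsub>P\<^esub> (zi k (y(k := zob (T k))) \<oplus>\<^bsub>P\<^esub> Idt P (Do (y(k := a))))"
    and "add k y (deg_tri (-1) (T k) a) = runit P (Do (y(k := a))) \<cdot>\<^bsub>P\<^esub> (Idt P (Do (y(k := a))) \<oplus>\<^bsub>P\<^esub> zi k (y(k := zob (T k))))"
proof -
  interpret D: det "T k" P "\<lparr>on_ob = (\<lambda>a. Do (y(k := a))), on_ar = (\<lambda>f. Da ((others_id T m {k} y)(k := f)))\<rparr>"
    "\<lambda>t. add k y t" by (rule det_in_variable[OF k y])
  note A = D.ad_deg[unfolded func.simps, OF zero_iso(1,2)[OF k y] a]
  show "add k y (deg_tri 1 (T k) a) = lunit P (Do (y(k := a))) \<cdot>\<^bsub>P\<^esub> (zi k (y(k := zob (T k))) \<oplus>\<^bsub>P\<^esub> Idt P (Do (y(k := a))))"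
    by (rule A(1))
  show "add k y (deg_tri (-1) (T k) a) = runit P (Do (y(k := a))) \<cdot>\<^bsub>P\<^esub> (Idt P (Do (y(k := a))) \<oplus>\<^bsub>P\<^esub> zi k (y(k := zob (T k))))"
    by (rule A(2))
qed

text \<open>By \<open>add_nat\<close> for the null triangle, the composite satisfies the equation
  that characterises \<open>zero_iso\<close> at the source.\<close>

lemma zero_iso_nat:
  assumes k: "k < m" and \<phi>: "\<phi> \<in> (\<Pi>\<^sub>E l\<in>{..<m} - {k}. isos (T l))"
    and x: "x = (\<lambda>l\<in>{..<m} - {k}. Dom (T l) (\<phi> l))" and y: "y = (\<lambda>l\<in>{..<m} - {k}. Cod (T l) (\<phi> l))"
  shows "Da (\<phi>(k := Idt (T k) (zob (T k)))) \<in> Hom P (Do (x(k := zob (T k)))) (Do (y(k := zob (T k))))"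
    and "zi k (y(k := zob (T k))) \<cdot>\<^bsub>P\<^esub> Da (\<phi>(k := Idt (T k) (zob (T k)))) = zi k (x(k := zob (T k)))"
proof -
  interpret Tk: tri "T k" by (rule tri[OF k])
  let ?o = "zob (T k)" and ?n = "deg_tri 1 (T k) (zob (T k))"
  let ?f = "\<phi>(k := Idt (T k) ?o)"
  have o: "?o \<in> Ob (T k)" by (rule Tk.zob_Ob)
  have ph: "Dom (T l) (\<phi> l) \<in> Ob (T l)" "Cod (T l) (\<phi> l) \<in> Ob (T l)" if "l < m" "l \<noteq> k" for l
  proof -
    interpret catg "T l" by (rule catg[OF that(1)])
    have "\<phi> l \<in> isos (T l)" using \<phi> that by auto
    then show "Dom (T l) (\<phi> l) \<in> Ob (T l)" "Cod (T l) (\<phi> l) \<in> Ob (T l)" using isos_Ar[of "\<phi> l"] by simp_all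
  qed
  have xo: "x \<in> others T m {k}" and yo: "y \<in> others T m {k}" using ph by (auto simp: x y others_def)
  have fi: "?f \<in> (\<Pi>\<^sub>E l\<in>{..<m}. isos (T l))" using \<phi> k Tk.isos_id[OF o] by (auto simp: PiE_iff extensional_def)
  have I: "Dom (T k) (Idt (T k) ?o) = ?o" "Cod (T k) (Idt (T k) ?o) = ?o" using Tk.HomD[OF Tk.id_Hom[OF o]] by auto
  have "(\<lambda>l\<in>{..<m}. Dom (T l) (?f l)) = x(k := ?o)" "(\<lambda>l\<in>{..<m}. Cod (T l) (?f l)) = y(k := ?o)"
    using I k by (auto simp: x y fun_eq_iff)
  then show f: "Da ?f \<in> Hom P (Do (x(k := ?o))) (Do (y(k := ?o)))" using Da_Hom[OF fi] by simp
  have nd: "?n \<in> distg (T k)" by (rule Tk.dist_deg[OF o])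
  have tm: "tri_mor (T k) ?n ?n (Idt (T k) ?o) (Idt (T k) ?o) (Idt (T k) ?o)"
    using Tk.tri_mor_id[OF nd] Tk.vertex_deg_tri[OF o, of 1] by simp
  have nat: "Da ?f \<cdot>\<^bsub>P\<^esub> add k x ?n = add k y ?n \<cdot>\<^bsub>P\<^esub> (Da ?f \<oplus>\<^bsub>P\<^esub> Da ?f)"
    by (rule add_nat[OF k \<phi> nd nd tm _ x y]) (use Tk.isos_id[OF o] in simp)
  note z = zero_iso[OF k yo]
  note [simp] = P.HomD(1-3)[OF f] P.HomD(1-3)[OF z(1)] P.HomD(1-3)[OF add_null_Hom[OF k xo]] P.HomD(1-3)[OF add_null_Hom[OF k yo]]
    P.HomD(1-3)[OF P.lunit_Hom[OF P.unit_Ob]]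
  have "(zi k (y(k := ?o)) \<cdot>\<^bsub>P\<^esub> Da ?f) \<cdot>\<^bsub>P\<^esub> add k x ?n = zi k (y(k := ?o)) \<cdot>\<^bsub>P\<^esub> (Da ?f \<cdot>\<^bsub>P\<^esub> add k x ?n)" by simp
  also have "\<dots> = (zi k (y(k := ?o)) \<cdot>\<^bsub>P\<^esub> add k y ?n) \<cdot>\<^bsub>P\<^esub> (Da ?f \<oplus>\<^bsub>P\<^esub> Da ?f)" unfolding nat by simp
  also have "\<dots> = lunit P (punit P) \<cdot>\<^bsub>P\<^esub> ((zi k (y(k := ?o)) \<cdot>\<^bsub>P\<^esub> Da ?f) \<oplus>\<^bsub>P\<^esub> (zi k (y(k := ?o)) \<cdot>\<^bsub>P\<^esub> Da ?f))"
    unfolding z(2) by (simp add: P.interchange)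
  finally show "zi k (y(k := ?o)) \<cdot>\<^bsub>P\<^esub> Da ?f = zi k (x(k := ?o))"
    by (rule zero_iso(3)[OF k xo P.comp_Hom[OF f z(1)]])
qed

text \<open>Two Triangles for t in variable i and the null triangle in variable k says that the
  datum of t respects the three multiplications; \<open>unit_map_additive\<close> turns this into
  compatibility with the unit maps.\<close>

lemma zero_iso_add:
  assumes ik: "i < m" "k < m" "i \<noteq> k" and x: "x \<in> others T m {i, k}" and t: "t \<in> distg (T i)"
  shows "zi k (x(i := vertex (T i) t 0, k := zob (T k))) \<cdot>\<^bsub>P\<^esub> add i (x(k := zob (T k))) t =
    lunit P (punit P) \<cdot>\<^bsub>P\<^esub> (zi k (x(i := vertex (T i) t 1, k := zob (T k))) \<oplus>\<^bsub>P\<^esub> zi k (x(i := vertex (T i) t (-1), k := zob (T k))))"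
proof -
  interpret Tk: tri "T k" by (rule tri[OF ik(2)])
  let ?o = "zob (T k)" and ?n = "deg_tri 1 (T k) (zob (T k))"
  have o: "?o \<in> Ob (T k)" by (rule Tk.zob_Ob)
  have nd: "?n \<in> distg (T k)" by (rule Tk.dist_deg[OF o])
  have vn: "vertex (T k) ?n 1 = ?o" "vertex (T k) ?n 0 = ?o" "vertex (T k) ?n (-1) = ?o"
    using Tk.vertex_deg_tri[OF o, of 1] by simp_all
  have v: "vertex (T i) t \<alpha> \<in> Ob (T i)" if "\<alpha> \<in> {-1, 0, 1}" for \<alpha> by (rule distg_vertex[OF tri[OF ik(1)] t that])
  have xo: "x(i := vertex (T i) t \<alpha>) \<in> others T m {k}" if "\<alpha> \<in> {-1, 0, 1}" for \<alpha>
    by (rule others_upd2(1)[OF ik x v[OF that]])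
  note z1 = zero_iso[OF ik(2) xo[of 1]] and z0 = zero_iso[OF ik(2) xo[of 0]] and zm = zero_iso[OF ik(2) xo[of "-1"]]
  note M = add_null_Hom[OF ik(2) xo]
  have tw: "x(k := ?o, i := vertex (T i) t \<alpha>) = x(i := vertex (T i) t \<alpha>, k := ?o)" for \<alpha>
    using ik(3) by (rule fun_upd_twist[OF not_sym])
  have D: "add i (x(k := ?o)) t \<in> Hom P (Do (x(i := vertex (T i) t 1, k := ?o)) \<boxplus>\<^bsub>P\<^esub> Do (x(i := vertex (T i) t (-1), k := ?o)))
    (Do (x(i := vertex (T i) t 0, k := ?o)))"
    using add_Hom[OF ik(1) others_upd2(2)[OF ik x o] t] unfolding tw .
  have sw: "x \<in> others T m {k, i}" using x by (simp add: insert_commute)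
  \<comment> \<open>Two Triangles is stated for ordered variables, so either of its sides may be the
    one that carries the exchange.\<close>
  have "k < i \<or> i < k" using ik(3) by linarith
  then have eq: "add i (x(k := ?o)) t \<cdot>\<^bsub>P\<^esub> (add k (x(i := vertex (T i) t 1)) ?n \<oplus>\<^bsub>P\<^esub> add k (x(i := vertex (T i) t (-1))) ?n) =
      add k (x(i := vertex (T i) t 0)) ?n \<cdot>\<^bsub>P\<^esub> (add i (x(k := ?o)) t \<oplus>\<^bsub>P\<^esub> add i (x(k := ?o)) t) \<cdot>\<^bsub>P\<^esub>
        coas P (Do (x(i := vertex (T i) t 1, k := ?o))) (Do (x(i := vertex (T i) t 1, k := ?o)))
          (Do (x(i := vertex (T i) t (-1), k := ?o))) (Do (x(i := vertex (T i) t (-1), k := ?o))) \<or>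
      add k (x(i := vertex (T i) t 0)) ?n \<cdot>\<^bsub>P\<^esub> (add i (x(k := ?o)) t \<oplus>\<^bsub>P\<^esub> add i (x(k := ?o)) t) =
      add i (x(k := ?o)) t \<cdot>\<^bsub>P\<^esub> (add k (x(i := vertex (T i) t 1)) ?n \<oplus>\<^bsub>P\<^esub> add k (x(i := vertex (T i) t (-1))) ?n) \<cdot>\<^bsub>P\<^esub>
        coas P (Do (x(i := vertex (T i) t 1, k := ?o))) (Do (x(i := vertex (T i) t (-1), k := ?o)))
          (Do (x(i := vertex (T i) t 1, k := ?o))) (Do (x(i := vertex (T i) t (-1), k := ?o)))"
  proof
    assume "k < i"
    from two_triangles[OF this ik(1) sw nd t] show ?thesis unfolding vn tw by (rule disjI1)
  next
    assume "i < k"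
    from two_triangles[OF this ik(2) x t nd] show ?thesis unfolding vn by (rule disjI2)
  qed
  have c: "(1::int) \<in> {-1, 0, 1}" "(0::int) \<in> {-1, 0, 1}" "(-1::int) \<in> {-1, 0, 1}" by auto
  show ?thesis
    by (rule P.unit_map_additive[OF M[OF c(1)] M[OF c(3)] M[OF c(2)] z1(1,2)[OF c(1)] zm(1,2)[OF c(3)] z0(1,2)[OF c(2)] D eq])
qed

end

text \<open>Faces taken in the degenerate direction: away from the zero end the cube itself is
  recovered, at the zero end a triangle becomes the null triangle.\<close>

lemma tface_tdeg:
  assumes "tdim C \<le> 1" "\<alpha> = 1 \<or> \<alpha> = -1" "j \<le> tdim C" "\<gamma> \<in> {-1, 0, 1}"
  shows "\<gamma> \<noteq> \<alpha> \<Longrightarrow> tri T \<Longrightarrow> is_tcube T C \<Longrightarrow> tface \<gamma> j T (tdeg \<alpha> j T C) = C"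
    and "C = Triangle t \<Longrightarrow> tface \<alpha> j T (tdeg \<alpha> j T C) = Triangle (deg_tri 1 T (zob T))"
proof -
  assume g: "\<gamma> \<noteq> \<alpha>" and T: "tri T" and C: "is_tcube T C"
  interpret tri T by fact
  show "tface \<gamma> j T (tdeg \<alpha> j T C) = C"
  proof (cases C)
    case (Point x)
    then show ?thesis using vertex_deg_tri[of x \<alpha> \<gamma>] g C assms(2,4) by simp
  next
    case (Triangle t)
    then have "j = 0 \<or> j = Suc 0" using assms(3) by auto
    then show ?thesis using assms(2,4) g by (cases t) (auto simp: Triangle Let_def)
  qed (use assms(1) in auto)
next
  assume C: "C = Triangle t"
  then have "j = 0 \<or> j = Suc 0" using assms(3) by auto
  then show "tface \<alpha> j T (tdeg \<alpha> j T C) = Triangle (deg_tri 1 T (zob T))"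
    using assms(2) by (cases t) (auto simp: C Let_def)
qed

section \<open>The comparison of degeneracies as a morphism of cubes\<close>

context multi_det
begin

context
  fixes n :: nat and \<alpha> :: int and k j :: nat and Q :: "nat \<Rightarrow> ('o, 'a) tcube"
  assumes Q: "Q \<in> Ob (multi_cubes T m n)" and n: "n \<le> 1" and k: "k < m" and j: "j \<le> tdim (Q k)"
    and \<alpha>: "\<alpha> = 1 \<or> \<alpha> = -1"
begin

abbreviation "R \<equiv> Q(k := tdeg \<alpha> j (T k) (Q k))"
abbreviation "J \<equiv> offset Q k + j"

lemma deg_offset: "offset Q k + tdim (Q k) \<le> n"
proof -
  have "offset Q (Suc k) \<le> offset Q m" unfolding offset_def using k by (intro sum_mono2) auto
  then show ?thesis using Q by (simp add: offset_def multi_cubes_Ob)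
qed

lemma deg_factor: "is_tcube (T k) (Q k)" "tdim (Q k) \<le> 1" "is_tcube (T k) (R k)" "tdim (R k) = Suc (tdim (Q k))"
  "offset R k = offset Q k" "J \<le> n"
proof -
  interpret Tk: tri "T k" by (rule tri[OF k])
  show c: "is_tcube (T k) (Q k)" using Q k by (simp add: multi_cubes_Ob)
  show t: "tdim (Q k) \<le> 1" using deg_offset n by simp
  show "is_tcube (T k) (R k)" "tdim (R k) = Suc (tdim (Q k))" using Tk.tcube_tdeg[OF c t \<alpha>, of j] by simp_all
  show "offset R k = offset Q k" by (rule offset_cong) simp
  show "J \<le> n" using deg_offset j by simp
qed

lemma deg_Ob: "R \<in> Ob (multi_cubes T m (Suc n))"
proof -
  have s: "offset C m = tdim (C k) + (\<Sum>l\<in>{..<m} - {k}. tdim (C l))" for C :: "nat \<Rightarrow> ('o, 'a) tcube"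
    unfolding offset_def using k by (intro sum.remove) auto
  have "(\<Sum>l\<in>{..<m} - {k}. tdim (Q l)) = (\<Sum>l\<in>{..<m} - {k}. tdim (R l))" by (rule sum.cong) auto
  then have "offset R m = Suc (offset Q m)" using s[of Q] s[of R] deg_factor(4) by simp
  then show ?thesis using Q deg_factor(3) k by (auto simp: multi_cubes_Ob extensional_def)
qed

lemma deg_seg:
  assumes "l < m" "c \<in> coords n"
  shows "seg R l (ins J \<beta> c) = (if l = k then ins j \<beta> (seg Q k c) else seg Q l c)"
proof -
  have "length c = offset Q m" using coords_length[OF assms(2)] Q by (simp add: multi_cubes_Ob)
  moreover have "j < tdim (R k)" using deg_factor(4) j by simp
  ultimately show ?thesis
    using seg_ins[where k = k and Q = R and R = Q and m = m and l = l and j = j and a = c and \<alpha> = \<beta>,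
        unfolded deg_factor(5), OF _ deg_factor(4) k assms(1)] by simp
qed

lemma deg_vertex:
  assumes c: "c \<in> coords n" and \<beta>: "\<beta> \<in> {-1, 0, 1}"
  shows "multi_vertex T m R (ins J \<beta> c) = (if \<beta> = \<alpha> then (multi_vertex T m Q c)(k := zob (T k)) else multi_vertex T m Q c)"
proof -
  interpret Tk: tri "T k" by (rule tri[OF k])
  have sc: "seg Q k c \<in> coords (tdim (Q k))" using Q by (intro seg_coords[OF _ k c]) (simp add: multi_cubes_Ob)
  note v = Tk.tv_tdeg[OF deg_factor(1,2) \<alpha> j sc \<beta>]
  show ?thesis
    unfolding multi_vertex_seg using v k by (auto simp: deg_seg[OF _ c] fun_eq_iff)
qed

lemma deg_vertex_others:
  assumes "c \<in> coords n"
  shows "restrict (multi_vertex T m Q c) ({..<m} - {k}) \<in> others T m {k}" "multi_vertex T m Q c k \<in> Ob (T k)"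
    "(restrict (multi_vertex T m Q c) ({..<m} - {k}))(k := a) = (multi_vertex T m Q c)(k := a)"
proof -
  note v = multi_vertex_Ob[OF Q assms]
  show "restrict (multi_vertex T m Q c) ({..<m} - {k}) \<in> others T m {k}" using v by (auto simp: others_def)
  show "multi_vertex T m Q c k \<in> Ob (T k)" using v k by auto
  show "(restrict (multi_vertex T m Q c) ({..<m} - {k}))(k := a) = (multi_vertex T m Q c)(k := a)"
    by (auto simp: multi_vertex_def fun_eq_iff)
qed

lemma deg_edge:
  assumes c: "c \<in> coords n"
  shows "pe (cub_ob T m d (Suc n) R) (J, c) =
    add k (restrict (multi_vertex T m Q c) ({..<m} - {k})) (deg_tri \<alpha> (T k) (multi_vertex T m Q c k))"
proof -
  interpret Tk: tri "T k" by (rule tri[OF k])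
  have f: "factor R J = k" using factor_offset[of j R k] deg_factor(4,5) j by simp
  have sc: "seg Q k c \<in> coords (tdim (Q k))" using Q by (intro seg_coords[OF _ k c]) (simp add: multi_cubes_Ob)
  have s: "take (tdim (R k) - 1) (drop (offset R k) c) = seg Q k c"
    unfolding seg_def deg_factor(4,5) by simp
  have e: "tedge (R k) (J - offset R k) (take (tdim (R k) - 1) (drop (offset R k) c)) = deg_tri \<alpha> (T k) (multi_vertex T m Q c k)"
    unfolding s using Tk.tedge_tdeg[OF deg_factor(1,2) \<alpha> j sc] deg_factor(5) k by (simp add: multi_vertex_seg)
  have v: "multi_vertex T m R (ins J 0 c) = multi_vertex T m Q c" using deg_vertex[OF c, of 0] \<alpha> by auto
  have "pe (cub_ob T m d (Suc n) R) (J, c) = add k (restrict (multi_vertex T m R (ins J 0 c)) ({..<m} - {k}))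
      (tedge (R k) (J - offset R k) (take (tdim (R k) - 1) (drop (offset R k) c)))"
    using c deg_factor(6) by (simp add: cub_ob_def f Let_def del: fun_upd_apply)
  then show ?thesis unfolding e v .
qed

text \<open>\<open>deg_iso\<close> for the functor \<open>cub\<close>, with its values written out
  and \<open>level01\<close> evaluated to d.\<close>

definition "deg_cmp = CMor (cub_ob T m d (Suc n) R) (pdeg P n \<alpha> J (cub_ob T m d n Q))
  (\<lambda>a\<in>coords (Suc n). if a ! J = \<alpha> then zi k (multi_vertex T m R a) else Idt P (pv (cub_ob T m d n Q) (del J a)))"

lemma deg_iso_cub: "deg_iso T m P (cub T m d) n \<alpha> k j Q = deg_cmp"
proof -
  have "n \<le> 2" "Suc n \<le> 2" using n by simp_all
  then show ?thesis
    unfolding deg_iso_def deg_cmp_def Let_def level01_cub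
    by (simp only: Suc_eq_plus1[symmetric] cub_apply(1)[OF _ Q] cub_apply(1)[OF _ deg_Ob])
qed

lemma deg_cmp_at:
  assumes c: "c \<in> coords n" and \<beta>: "\<beta> \<in> {-1, 0, 1}"
  shows "cat_at deg_cmp (ins J \<beta> c) =
    (if \<beta> = \<alpha> then zi k ((multi_vertex T m Q c)(k := zob (T k))) else Idt P (Do (multi_vertex T m Q c)))"
proof -
  have "cat_at deg_cmp (ins J \<beta> c) = (if \<beta> = \<alpha> then zi k (multi_vertex T m R (ins J \<beta> c)) else Idt P (Do (multi_vertex T m Q c)))"
    using ins_coords[OF c \<beta>, of J] ins_del_nth[of J c \<beta>] deg_factor(6) coords_length[OF c] c
    by (simp add: deg_cmp_def cub_ob_def del: fun_upd_apply)
  then show ?thesis unfolding deg_vertex[OF c \<beta>] by (simp split: if_splits del: fun_upd_apply)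
qed

lemma pdeg_vertex:
  assumes c: "c \<in> coords n" and \<beta>: "\<beta> \<in> {-1, 0, 1}"
  shows "pv (pdeg P n \<alpha> J (cub_ob T m d n Q)) (ins J \<beta> c) = (if \<beta> = \<alpha> then punit P else Do (multi_vertex T m Q c))"
  using ins_coords[OF c \<beta>, of J] ins_del_nth[of J c \<beta>] deg_factor(6) coords_length[OF c] c
  by (simp add: pdeg_def cub_ob_def)

text \<open>The edges of a square in direction L are those of its faces in direction J, and these
  faces are known from \<open>pface_cub_ob\<close>.\<close>

lemma deg_edge_other:
  assumes n1: "n = 1" and L: "L < 2" "L \<noteq> J" and \<gamma>: "\<gamma> \<in> {-1, 0, 1}"
  shows "pe (cub_ob T m d 2 R) (L, [\<gamma>]) = pe (cub_ob T m d 1 (R(k := tface \<gamma> j (T k) (R k)))) (0, [])"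
proof -
  have s: "Suc 1 = 2" by simp
  have jR: "j < tdim (R k)" using deg_factor(4) j by simp
  note F = pface_cub_ob[of R 1 k j \<gamma> d, unfolded s deg_factor(5), OF deg_Ob[unfolded n1 s] order_refl k jR \<gamma>]
  have "(J = 0 \<and> L = 1) \<or> (J = 1 \<and> L = 0)" using L deg_factor(6) n1 by linarith
  then have "pe (pface 2 \<gamma> J (cub_ob T m d 2 R)) (0, []) = pe (cub_ob T m d 2 R) (L, [\<gamma>])"
    unfolding pface_def pcube.simps by (elim disjE conjE) (simp_all del: fun_upd_apply)
  then show ?thesis unfolding F by simp
qed

text \<open>Compatibility along the direction that is not degenerate. The face at \<gamma> decides
  what is to be shown: it is Q itself, a null triangle, or t with a zero object in another
  variable.\<close>

lemma deg_cmp_other: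
  assumes n1: "n = 1" and L: "L < 2" "L \<noteq> J" and \<gamma>: "\<gamma> \<in> {-1, 0, 1}"
  shows "cat_at deg_cmp (ins L 0 [\<gamma>]) \<cdot>\<^bsub>P\<^esub> pe (cub_ob T m d 2 R) (L, [\<gamma>]) =
    pe (pdeg P n \<alpha> J (cub_ob T m d n Q)) (L, [\<gamma>]) \<cdot>\<^bsub>P\<^esub> (cat_at deg_cmp (ins L 1 [\<gamma>]) \<oplus>\<^bsub>P\<^esub> cat_at deg_cmp (ins L (-1) [\<gamma>]))"
proof -
  interpret Tk: tri "T k" by (rule tri[OF k])
  obtain i x t where q: "i < m" "x \<in> others T m {i}" "t \<in> distg (T i)" "Q = single m i x (Triangle t)"
    using single_cases Q n1 by metis
  note xe = others_extensional[OF q(2)]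
  have JL: "(J = 0 \<and> L = 1) \<or> (J = 1 \<and> L = 0)" using L deg_factor(6) n1 by linarith
  have sw: "ins L \<beta> [\<gamma>] = ins J \<gamma> [\<beta>]" for \<beta> using JL by (elim disjE conjE) (simp_all only: ins_simps One_nat_def)
  have mv: "multi_vertex T m Q [\<beta>] = x(i := vertex (T i) t \<beta>)" for \<beta>
    unfolding q(4) using multi_vertex_single[OF q(1) xe, of "[\<beta>]" "Triangle t" T] by simp
  have at: "cat_at deg_cmp (ins L \<beta> [\<gamma>]) = (if \<gamma> = \<alpha> then zi k (x(i := vertex (T i) t \<beta>, k := zob (T k))) else Idt P (Do (x(i := vertex (T i) t \<beta>))))"
    if "\<beta> \<in> {-1, 0, 1}" for \<beta>
    unfolding sw using deg_cmp_at[of "[\<beta>]" \<gamma>] that n1 \<gamma> by (simp add: mv)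
  have c: "(1::int) \<in> {-1, 0, 1}" "(0::int) \<in> {-1, 0, 1}" "(-1::int) \<in> {-1, 0, 1}" by auto
  have single_edge: "pe (cub_ob T m d 1 (single m i' x' (Triangle t'))) (0, []) = add i' x' t'"
    if "i' < m" "x' \<in> extensional ({..<m} - {i'})" for i' x' t'
    using cub_ob_single[OF that, of "Triangle t'" 1 T d] by simp
  have target: "pe (pdeg P n \<alpha> J (cub_ob T m d n Q)) (L, [\<gamma>]) = (if \<gamma> = \<alpha> then lunit P (punit P) else add i x t)"
    using JL n1 \<gamma> single_edge[OF q(1) xe] by (elim disjE conjE) (simp_all add: pdeg_def q(4))
  have RR: "R(k := tface \<gamma> j (T k) (R k)) = Q(k := tface \<gamma> j (T k) (tdeg \<alpha> j (T k) (Q k)))" by simp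
  note source = deg_edge_other[OF n1 L \<gamma>, unfolded RR]
  show ?thesis
  proof (cases "\<gamma> = \<alpha>")
    \<comment> \<open>Away from the zero end the face is Q and the comparison consists of
      identities.\<close>
    case False
    have "Q(k := tface \<gamma> j (T k) (tdeg \<alpha> j (T k) (Q k))) = Q"
      using tface_tdeg(1)[OF deg_factor(2) \<alpha> j \<gamma> False tri[OF k] deg_factor(1)] by simp
    then have S: "pe (cub_ob T m d 2 R) (L, [\<gamma>]) = add i x t"
      using source single_edge[OF q(1) xe, of t] q(4) by simp
    note H = add_Hom[OF q(1,2,3)]
    have v: "Do (x(i := vertex (T i) t \<beta>)) \<in> Ob P" if "\<beta> \<in> {-1, 0, 1}" for \<beta>
      by (rule Do_Ob[OF others_upd[OF q(1,2) distg_vertex[OF tri[OF q(1)] q(3) that]]])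
    show ?thesis
      unfolding S target at[OF c(1)] at[OF c(2)] at[OF c(3)]
      using False P.id_left[OF H] P.id_right[OF H] P.plus_id[OF v[OF c(1)] v[OF c(3)]] by simp
  next
    case True
    show ?thesis
    proof (cases "i = k")
      \<comment> \<open>The triangle itself is degenerated, so the edge is the null triangle and the
        claim is the defining equation of \<open>zero_iso\<close>.\<close>
      case i: True
      have "Q k = Triangle t" using q(4) i by simp
      then have "Q(k := tface \<gamma> j (T k) (tdeg \<alpha> j (T k) (Q k))) = single m k x (Triangle (deg_tri 1 (T k) (zob (T k))))"
        using tface_tdeg(2)[OF deg_factor(2) \<alpha> j \<gamma>, of t "T k"] True i q(4) by (auto simp: single_def fun_eq_iff)
      then have S: "pe (cub_ob T m d 2 R) (L, [\<gamma>]) = add k x (deg_tri 1 (T k) (zob (T k)))"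
        using source single_edge[OF q(1) xe] i by simp
      show ?thesis
        unfolding S target at[OF c(1)] at[OF c(2)] at[OF c(3)]
        using zero_iso(2)[OF k, of x] q(2) True i by simp
    next
      \<comment> \<open>An object in another variable is degenerated; the edge is the datum of t at
        a zero object, and the claim is \<open>zero_iso_add\<close>.\<close>
      case i: False
      have Qk: "Q k = Point (x k)" using q(4) i k by simp
      then have j0: "j = 0" using j by simp
      define y where "y = restrict x ({..<m} - {i, k})"
      have y: "y \<in> others T m {i, k}" using q(2) by (auto simp: y_def others_def)
      have xy: "x(k := zob (T k)) = y(k := zob (T k))" "x(i := b, k := zob (T k)) = y(i := b, k := zob (T k))" for b
        using xe k i by (auto simp: y_def extensional_def fun_eq_iff)
      have "tface \<gamma> j (T k) (tdeg \<alpha> j (T k) (Q k)) = Point (zob (T k))"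
        using Tk.vertex_deg_tri[of "x k" \<alpha> \<gamma>] q(2) k i True \<gamma> \<alpha> by (auto simp: Qk others_def)
      then have "Q(k := tface \<gamma> j (T k) (tdeg \<alpha> j (T k) (Q k))) = single m i (x(k := zob (T k))) (Triangle t)"
        using i k by (auto simp: q(4) single_def fun_eq_iff)
      moreover have "x(k := zob (T k)) \<in> extensional ({..<m} - {i})" using xe i k by (auto simp: extensional_def)
      ultimately have S: "pe (cub_ob T m d 2 R) (L, [\<gamma>]) = add i (y(k := zob (T k))) t"
        using source single_edge[OF q(1)] xy by simp
      show ?thesis
        unfolding S target at[OF c(1)] at[OF c(2)] at[OF c(3)] xy
        using zero_iso_add[OF q(1) k i y q(3)] True by simp
    qed
  qed
qed

text \<open>Along the degenerate direction the compatibility is \<open>add_deg_tri\<close>, along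
  the other one it is \<open>deg_cmp_other\<close>.\<close>

lemma deg_cmp_mor: "is_pcube_mor P (Suc n) deg_cmp"
  unfolding is_pcube_mor_def
proof (intro conjI ballI allI impI)
  have st: "csrc deg_cmp = cub_ob T m d (Suc n) R" "ctgt deg_cmp = pdeg P n \<alpha> J (cub_ob T m d n Q)"
    by (simp_all add: deg_cmp_def)
  have sv: "pv (cub_ob T m d (Suc n) R) (ins J \<beta> c) = Do (if \<beta> = \<alpha> then (multi_vertex T m Q c)(k := zob (T k)) else multi_vertex T m Q c)"
    if "c \<in> coords n" "\<beta> \<in> {-1, 0, 1}" for c \<beta>
    using deg_vertex[OF that] ins_coords[OF that, of J] by (simp add: cub_ob_def del: fun_upd_apply)
  show "is_pcube P (Suc n) (csrc deg_cmp)" unfolding st by (rule pcube_cub_ob[OF deg_Ob]) (use n in simp)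
  show "is_pcube P (Suc n) (ctgt deg_cmp)"
    unfolding st using P.pcube_pdeg[OF pcube_cub_ob[OF Q] n deg_factor(6) \<alpha>] n by simp
  show "cat_at deg_cmp \<in> extensional (coords (Suc n))" by (simp add: deg_cmp_def)
  fix a assume "a \<in> coords (Suc n)"
  then obtain \<beta> c where a: "a = ins J \<beta> c" "\<beta> \<in> {-1, 0, 1}" "c \<in> coords n" using coords_ins deg_factor(6) by metis
  note o = deg_vertex_others[OF a(3)]
  show "cat_at deg_cmp a \<in> Hom P (pv (csrc deg_cmp) a) (pv (ctgt deg_cmp) a)"
    unfolding st a(1) deg_cmp_at[OF a(3,2)] sv[OF a(3,2)] pdeg_vertex[OF a(3,2)]
    using zero_iso(1)[OF k o(1)] P.id_Hom[OF Do_Ob[OF multi_vertex_Ob[OF Q a(3)]]] by (simp add: o(3) del: fun_upd_apply)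
next
  fix L c assume L: "L < Suc n" and c: "c \<in> coords (Suc n - 1)"
  have st: "csrc deg_cmp = cub_ob T m d (Suc n) R" "ctgt deg_cmp = pdeg P n \<alpha> J (cub_ob T m d n Q)"
    by (simp_all add: deg_cmp_def)
  have c: "c \<in> coords n" using c by simp
  show "cat_at deg_cmp (ins L 0 c) \<cdot>\<^bsub>P\<^esub> pe (csrc deg_cmp) (L, c) =
      pe (ctgt deg_cmp) (L, c) \<cdot>\<^bsub>P\<^esub> (cat_at deg_cmp (ins L 1 c) \<oplus>\<^bsub>P\<^esub> cat_at deg_cmp (ins L (-1) c))"
  proof (cases "L = J")
    case True
    note o = deg_vertex_others[OF c]
    have x: "(restrict (multi_vertex T m Q c) ({..<m} - {k}))(k := multi_vertex T m Q c k) = multi_vertex T m Q c"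
      unfolding o(3) by simp
    note A = add_deg_tri[OF k o(1,2), unfolded x o(3)]
    have v: "Do (multi_vertex T m Q c) \<in> Ob P" by (rule Do_Ob[OF multi_vertex_Ob[OF Q c]])
    have tgt: "pe (ctgt deg_cmp) (L, c) = (if \<alpha> = 1 then lunit P (Do (multi_vertex T m Q c)) else runit P (Do (multi_vertex T m Q c)))"
      unfolding st True using deg_factor(6) c by (simp add: pdeg_def cub_ob_def)
    have at: "cat_at deg_cmp (ins J 1 c) = (if 1 = \<alpha> then zi k ((multi_vertex T m Q c)(k := zob (T k))) else Idt P (Do (multi_vertex T m Q c)))"
      "cat_at deg_cmp (ins J (-1) c) = (if -1 = \<alpha> then zi k ((multi_vertex T m Q c)(k := zob (T k))) else Idt P (Do (multi_vertex T m Q c)))"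
      "cat_at deg_cmp (ins J 0 c) = Idt P (Do (multi_vertex T m Q c))"
      using deg_cmp_at[OF c, of 1] deg_cmp_at[OF c, of "-1"] deg_cmp_at[OF c, of 0] \<alpha> by auto
    have src: "pe (csrc deg_cmp) (L, c) \<in> Hom P (pv (csrc deg_cmp) (ins L 1 c) \<boxplus>\<^bsub>P\<^esub> pv (csrc deg_cmp) (ins L (-1) c)) (pv (csrc deg_cmp) (ins L 0 c))"
      using pcube_cub_ob[OF deg_Ob] n L c unfolding st is_pcube_def by (simp del: fun_upd_apply)
    have "pv (csrc deg_cmp) (ins L 0 c) = Do (multi_vertex T m Q c)"
      using deg_vertex[OF c, of 0] ins_coords[OF c, of 0 J] \<alpha> unfolding st True by (auto simp add: cub_ob_def simp del: fun_upd_apply)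
    note src = src[unfolded this]
    show ?thesis
      using \<alpha>
    proof
      assume a: "\<alpha> = 1"
      show ?thesis
        using P.id_left[OF src] deg_edge[OF c] A(1) at tgt a unfolding True st
        by (simp del: fun_upd_apply)
    next
      assume a: "\<alpha> = -1"
      show ?thesis
        using P.id_left[OF src] deg_edge[OF c] A(2) at tgt a unfolding True st
        by (simp del: fun_upd_apply)
    qed
  next
    case False
    have n1: "n = 1" using L False deg_factor(6) n by linarith
    obtain \<gamma> where g: "c = [\<gamma>]" "\<gamma> \<in> {-1, 0, 1}" using c n1 by auto
    have s: "Suc n = 2" using n1 by simp
    show ?thesis using deg_cmp_other[OF n1 _ False g(2)] L n1 unfolding st s g(1) by simp
  qed
qed

end

end

section \<open>Naturality of the comparison and the cubical functor of d\<close>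

context multi_det
begin

lemma deg_Ar:
  assumes F: "F \<in> Ar (multi_cubes T m n)" and n: "n \<le> 1" and k: "k < m" and j: "j \<le> tdim (csrc (F k))"
    and \<alpha>: "\<alpha> = 1 \<or> \<alpha> = -1"
  shows "F(k := tdeg_mor \<alpha> j (T k) (F k)) \<in> Ar (multi_cubes T m (Suc n))"
proof -
  interpret Tk: tri "T k" by (rule tri[OF k])
  let ?G = "F(k := tdeg_mor \<alpha> j (T k) (F k))"
  define Q where "Q = (\<lambda>k\<in>{..<m}. csrc (F k))"
  note QO = multi_cubes_ArD(1)[OF F, folded Q_def]
  have jQ: "j \<le> tdim (Q k)" and Qk: "Q k = csrc (F k)" using j k by (simp_all add: Q_def)
  note M = multi_cubes_ArD(3)[OF F k]
  have "tdim (csrc (F k)) \<le> 1" using deg_factor(2)[OF QO n k jQ \<alpha>] Qk by simp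
  note D = Tk.tdeg_mor[OF M this j \<alpha>]
  have "offset (\<lambda>l. csrc (?G l)) m = offset (Q(k := tdeg \<alpha> j (T k) (Q k))) m"
    by (rule offset_cong) (use k in \<open>auto simp: Q_def tdeg_mor_def\<close>)
  then have "offset (\<lambda>l. csrc (?G l)) m = Suc n" using deg_Ob[OF QO n k jQ \<alpha>] by (simp add: multi_cubes_Ob)
  moreover have "is_tcube_mor (T l) (tdim (csrc (?G l))) (?G l)" if "l < m" for l
    using D Tk.tcube_morD(3)[OF D] multi_cubes_ArD(3)[OF F that] by (cases "l = k") simp_all
  ultimately show ?thesis
    using F k by (auto simp: multi_cubes_Ar extensional_def)
qed

text \<open>Checked position by position. At the zero end it is naturality of
  \<open>zero_iso\<close> in the remaining variables; elsewhere the comparison is an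
  identity.\<close>

lemma deg_cmp_nat:
  assumes F: "F \<in> Ar (multi_cubes T m n)" and n: "n \<le> 1" and k: "k < m" and j: "j \<le> tdim (csrc (F k))"
    and \<alpha>: "\<alpha> = 1 \<or> \<alpha> = -1"
  shows "deg_cmp n \<alpha> k j (\<lambda>l\<in>{..<m}. ctgt (F l)) \<cdot>\<^bsub>pcubes P (Suc n)\<^esub> cub_ar T m d (Suc n) (F(k := tdeg_mor \<alpha> j (T k) (F k))) =
    pdeg_mor P n \<alpha> (offset (\<lambda>l. csrc (F l)) k + j) (cub_ar T m d n F) \<cdot>\<^bsub>pcubes P (Suc n)\<^esub> deg_cmp n \<alpha> k j (\<lambda>l\<in>{..<m}. csrc (F l))"
proof -
  define Q where "Q = (\<lambda>l\<in>{..<m}. csrc (F l))"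
  define Q' where "Q' = (\<lambda>l\<in>{..<m}. ctgt (F l))"
  note QO = multi_cubes_ArD(1)[OF F, folded Q_def] and QO' = multi_cubes_ArD(2)[OF F, folded Q'_def]
  let ?G = "F(k := tdeg_mor \<alpha> j (T k) (F k))"
  let ?R = "Q(k := tdeg \<alpha> j (T k) (Q k))" and ?R' = "Q'(k := tdeg \<alpha> j (T k) (Q' k))"
  interpret Tk: tri "T k" by (rule tri[OF k])
  have td: "tdim (Q' l) = tdim (Q l)" for l using multi_cubes_ArD(4)[OF F] by (cases "l < m") (auto simp: Q_def Q'_def)
  have off: "offset Q' l = offset Q l" for l by (rule offset_cong) (rule td)
  have offF: "offset (\<lambda>l. csrc (F l)) k = offset Q k" by (rule offset_cong) (use k in \<open>simp add: Q_def\<close>)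
  have sg: "seg Q' l = seg Q l" for l by (rule ext) (simp add: seg_def td off)
  have sF: "seg (\<lambda>l. csrc (F l)) l a = seg Q l a" if "l < m" for l a by (rule seg_cong) (use that in \<open>simp add: Q_def\<close>)
  have sG: "seg (\<lambda>l. csrc (?G l)) l a = seg ?R l a" if "l < m" for l a
    by (rule seg_cong) (use that k in \<open>simp add: Q_def tdeg_mor_def\<close>)
  have Ql: "Q l = csrc (F l)" "Q' l = ctgt (F l)" if "l < m" for l using that by (simp_all add: Q_def Q'_def)
  have jQ: "j \<le> tdim (Q k)" "j \<le> tdim (Q' k)" using j k td[of k] by (simp_all add: Q_def)
  note A = QO n k jQ(1) \<alpha> and A' = QO' n k jQ(2) \<alpha>
  let ?J = "offset Q k + j"
  have Jn: "?J \<le> n" by (rule deg_factor(6)[OF A])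
  have s: "(\<lambda>l\<in>{..<m}. csrc (?G l)) = ?R" "(\<lambda>l\<in>{..<m}. ctgt (?G l)) = ?R'"
    using k by (auto simp: Q_def Q'_def tdeg_mor_def fun_eq_iff)
  have comp: "cat_at (deg_cmp n \<alpha> k j Q') a \<cdot>\<^bsub>P\<^esub> cat_at (cub_ar T m d (Suc n) ?G) a =
    cat_at (pdeg_mor P n \<alpha> ?J (cub_ar T m d n F)) a \<cdot>\<^bsub>P\<^esub> cat_at (deg_cmp n \<alpha> k j Q) a" if an: "a \<in> coords (Suc n)" for a
  proof -
    obtain \<beta> c where a: "a = ins ?J \<beta> c" "\<beta> \<in> {-1, 0, 1}" "c \<in> coords n" using coords_ins[OF an Jn] by metis
    note ac = ins_coords[OF a(3,2), of ?J]
    define \<phi> where "\<phi> = (\<lambda>l\<in>{..<m} - {k}. cat_at (F l) (seg Q l c))"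
    let ?f = "\<lambda>l\<in>{..<m}. cat_at (F l) (seg Q l c)"
    have sc: "seg Q l c \<in> coords (tdim (csrc (F l)))" if "l < m" for l
      using seg_coords[OF _ that a(3), of Q] QO that by (simp add: multi_cubes_Ob Q_def)
    note FC = cub_ar_component[OF F sc]
    have mv: "multi_vertex T m Q c = (\<lambda>l\<in>{..<m}. tv (T l) (csrc (F l)) (seg Q l c))"
      "multi_vertex T m Q' c = (\<lambda>l\<in>{..<m}. tv (T l) (ctgt (F l)) (seg Q l c))"
      unfolding multi_vertex_seg sg by (rule restrict_ext, simp add: Ql)+
    have H: "cat_at (F l) (seg Q l c) \<in> Hom (T l) (tv (T l) (csrc (F l)) (seg Q l c)) (tv (T l) (ctgt (F l)) (seg Q l c))"
      if "l < m" for l using tri.tcube_morD(6)[OF tri[OF that] multi_cubes_ArD(3)[OF F that] sc[OF that]] .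
    have lk: "length (seg Q k c) = tdim (csrc (F k))" using coords_length[OF sc[OF k]] .
    have tm: "cat_at (tdeg_mor \<alpha> j (T k) (F k)) (ins j \<beta> (seg Q k c)) = (if \<beta> = \<alpha> then Idt (T k) (zob (T k)) else cat_at (F k) (seg Q k c))"
      using ins_coords[OF sc[OF k] a(2), of j] ins_del_nth[of j "seg Q k c" \<beta>] lk j by (simp add: tdeg_mor_def)
    have "(\<lambda>l\<in>{..<m}. cat_at (?G l) (seg (\<lambda>l. csrc (?G l)) l a)) = (if \<beta> = \<alpha> then \<phi>(k := Idt (T k) (zob (T k))) else ?f)"
    proof
      fix l
      show "(\<lambda>l\<in>{..<m}. cat_at (?G l) (seg (\<lambda>l. csrc (?G l)) l a)) l = (if \<beta> = \<alpha> then \<phi>(k := Idt (T k) (zob (T k))) else ?f) l"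
      proof (cases "l < m")
        case True
        have "seg (\<lambda>l. csrc (?G l)) l a = (if l = k then ins j \<beta> (seg Q k c) else seg Q l c)"
          unfolding sG[OF True] a(1) by (rule deg_seg[OF A True a(3)])
        then show ?thesis using True tm by (cases "l = k") (simp_all add: \<phi>_def)
      next
        case False
        then show ?thesis using k by (simp add: \<phi>_def)
      qed
    qed
    then have 1: "cat_at (cub_ar T m d (Suc n) ?G) a = Da (if \<beta> = \<alpha> then \<phi>(k := Idt (T k) (zob (T k))) else ?f)"
      using ac unfolding cub_ar_def cmor.sel by (simp only: a(1) restrict_apply' if_True)
    have f: "(\<lambda>l\<in>{..<m}. cat_at (F l) (seg (\<lambda>l. csrc (F l)) l c)) = ?f" using sF by auto
    have 2: "cat_at (pdeg_mor P n \<alpha> ?J (cub_ar T m d n F)) a = (if \<beta> = \<alpha> then Idt P (punit P) else Da ?f)"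
      using ac a(3) ins_del_nth[of ?J c \<beta>] coords_length[OF a(3)] Jn by (simp add: a(1) pdeg_mor_def cub_ar_def f)
    have 3: "cat_at (deg_cmp n \<alpha> k j Q) a = (if \<beta> = \<alpha> then zi k ((multi_vertex T m Q c)(k := zob (T k))) else Idt P (Do (multi_vertex T m Q c)))"
      unfolding a(1) by (rule deg_cmp_at[OF A a(3,2)])
    have 4: "cat_at (deg_cmp n \<alpha> k j Q') a = (if \<beta> = \<alpha> then zi k ((multi_vertex T m Q' c)(k := zob (T k))) else Idt P (Do (multi_vertex T m Q' c)))"
      unfolding a(1) off[of k, symmetric] by (rule deg_cmp_at[OF A' a(3,2)])
    show ?thesis
    proof (cases "\<beta> = \<alpha>")
      \<comment> \<open>On the side of the degenerated morphism the variable k carries the identity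
        of its zero object, which is the situation of \<open>zero_iso_nat\<close>.\<close>
      case True
      have ph: "\<phi> \<in> (\<Pi>\<^sub>E l\<in>{..<m} - {k}. isos (T l))" using FC(1) by (auto simp: \<phi>_def)
      have e: "(\<lambda>l\<in>{..<m} - {k}. Dom (T l) (\<phi> l))(k := b) = (multi_vertex T m Q c)(k := b)"
        "(\<lambda>l\<in>{..<m} - {k}. Cod (T l) (\<phi> l))(k := b) = (multi_vertex T m Q' c)(k := b)" for b
        using H by (auto simp: \<phi>_def mv fun_eq_iff Hom_def)
      note N = zero_iso_nat[OF k ph refl refl, unfolded e]
      note o = deg_vertex_others[OF A a(3)]
      have "zi k ((multi_vertex T m Q c)(k := zob (T k))) \<in> Hom P (Do ((multi_vertex T m Q c)(k := zob (T k)))) (punit P)"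
        using zero_iso(1)[OF k o(1)] unfolding o(3) .
      then show ?thesis unfolding 1 2 3 4 using N(2) P.id_left True by simp
    next
      case False
      show ?thesis unfolding 1 2 3 4
        using P.id_left[OF FC(2)] P.id_right[OF FC(2)] False unfolding mv by simp
    qed
  qed
  have "cmor.csrc (cub_ar T m d (Suc n) ?G) = csrc (deg_cmp n \<alpha> k j Q)"
    unfolding deg_cmp_def[OF A] cub_ar_def cmor.sel s ..
  moreover have "ctgt (deg_cmp n \<alpha> k j Q') = ctgt (pdeg_mor P n \<alpha> ?J (cub_ar T m d n F))"
    unfolding deg_cmp_def[OF A'] cub_ar_def cmor.sel pdeg_mor_def Q'_def[symmetric] off ..
  ultimately show ?thesis
    unfolding Q_def[symmetric] Q'_def[symmetric] offF pcubes_def cat.simps cmor.inject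
    by (intro conjI restrict_ext) (simp_all only: comp)
qed

lemma cubical_cub: "cubical_multi_determinant T m P (cub T m d)"
  unfolding cubical_multi_determinant_def
proof (intro conjI allI impI ballI)
  show "cub T m d \<in> extensional {..2}" by (simp add: cub_def)
  show "extensional_functor (multi_cubes T m n) (cub T m d n)" if "n \<le> 2" for n by (rule extensional_functor_cub[OF that])
  show "is_functor (multi_cubes T m n) (pcubes P n) (cub T m d n)" if "n \<le> 2" for n by (rule is_functor_cub[OF that])
next
  fix n :: nat and \<alpha> :: int and k Q j
  assume n: "n \<in> {1, 2}" and \<alpha>: "\<alpha> \<in> {-1, 0, 1}" and k: "k < m" and Q: "Q \<in> Ob (multi_cubes T m n)" and j: "j < tdim (Q k)"
  define l where "l = n - 1"
  have l: "n = Suc l" "Suc l \<le> 2" "l \<le> 2" using n by (auto simp: l_def)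
  note Q = Q[unfolded l(1)]
  show "pface n \<alpha> (offset Q k + j) (on_ob (cub T m d n) Q) = on_ob (cub T m d (n - 1)) (Q(k := tface \<alpha> j (T k) (Q k)))"
    unfolding l(1) diff_Suc_1 cub_apply(1)[OF l(2) Q] cub_apply(1)[OF l(3) face_Ob[OF Q k j \<alpha>]]
    by (rule pface_cub_ob[OF Q l(2) k j \<alpha>])
next
  fix n :: nat and \<alpha> :: int and k F j
  assume n: "n \<in> {1, 2}" and \<alpha>: "\<alpha> \<in> {-1, 0, 1}" and k: "k < m" and F: "F \<in> Ar (multi_cubes T m n)" and j: "j < tdim (csrc (F k))"
  define l where "l = n - 1"
  have l: "n = Suc l" "Suc l \<le> 2" "l \<le> 2" using n by (auto simp: l_def)
  note F = F[unfolded l(1)]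
  show "pface_mor n \<alpha> (offset (\<lambda>l. csrc (F l)) k + j) (on_ar (cub T m d n) F) = on_ar (cub T m d (n - 1)) (F(k := tface_mor \<alpha> j (T k) (F k)))"
    unfolding l(1) diff_Suc_1 cub_apply(2)[OF l(2) F] cub_apply(2)[OF l(3) face_Ar[OF F l(2) k j \<alpha>]]
    by (rule pface_mor_cub_ar[OF F l(2) k j \<alpha>])
next
  fix n :: nat and \<alpha> :: int and k Q j
  assume "n \<in> {0, 1}" "\<alpha> \<in> {-1, 1}" and k: "k < m" and Q: "Q \<in> Ob (multi_cubes T m n)" and j: "j \<le> tdim (Q k)"
  then have n: "n \<le> 1" and \<alpha>: "\<alpha> = 1 \<or> \<alpha> = -1" by auto
  show "deg_iso T m P (cub T m d) n \<alpha> k j Q \<in> Ar (pcubes P (n + 1))"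
    unfolding deg_iso_cub[OF Q n k j \<alpha>] using deg_cmp_mor[OF Q n k j \<alpha>] by (simp add: pcubes_def)
next
  fix n :: nat and \<alpha> :: int and k F j
  assume "n \<in> {0, 1}" "\<alpha> \<in> {-1, 1}" and k: "k < m" and F: "F \<in> Ar (multi_cubes T m n)" and j: "j \<le> tdim (csrc (F k))"
  then have n: "n \<le> 1" and \<alpha>: "\<alpha> = 1 \<or> \<alpha> = -1" by auto
  have n2: "n \<le> 2" "Suc n \<le> 2" using n by simp_all
  have jQ: "j \<le> tdim ((\<lambda>l\<in>{..<m}. csrc (F l)) k)" "j \<le> tdim ((\<lambda>l\<in>{..<m}. ctgt (F l)) k)"
    using j k multi_cubes_ArD(4)[OF F k] by simp_all
  show "deg_iso T m P (cub T m d) n \<alpha> k j (Cod (multi_cubes T m n) F) \<cdot>\<^bsub>pcubes P (n + 1)\<^esub>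
      on_ar (cub T m d (n + 1)) (F(k := tdeg_mor \<alpha> j (T k) (F k))) =
    pdeg_mor P n \<alpha> (offset (\<lambda>l. csrc (F l)) k + j) (on_ar (cub T m d n) F) \<cdot>\<^bsub>pcubes P (n + 1)\<^esub>
      deg_iso T m P (cub T m d) n \<alpha> k j (Dom (multi_cubes T m n) F)"
    unfolding multi_cubes_Dom_Cod deg_iso_cub[OF multi_cubes_ArD(1)[OF F] n k jQ(1) \<alpha>]
      deg_iso_cub[OF multi_cubes_ArD(2)[OF F] n k jQ(2) \<alpha>] Suc_eq_plus1[symmetric] cub_apply(2)[OF n2(1) F]
      cub_apply(2)[OF n2(2) deg_Ar[OF F n k j \<alpha>]]
    by (rule deg_cmp_nat[OF F n k j \<alpha>])
qed

end

section \<open>Recovering the axioms of a multi-determinant functor from cubes\<close>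

section \<open>The multi-determinant functor of a cubical one\<close>

locale cubical = multi T m P
  for T :: "nat \<Rightarrow> ('o, 'a) tricat" and m :: nat and P :: "('p, 'q) symcat" +
  fixes D :: "('o, 'a, 'p, 'q) cmdf"
  assumes cubical: "cubical_multi_determinant T m P D"
begin

abbreviation "d \<equiv> level01 T m D"
abbreviation "Do \<equiv> on_ob d"
abbreviation "Da \<equiv> on_ar d"
abbreviation "add i x t \<equiv> m_add d (i, x, t)"

lemma functor_D: "n \<le> 2 \<Longrightarrow> is_functor (multi_cubes T m n) (pcubes P n) (D n)"
  using cubical by (auto simp: cubical_multi_determinant_def)

text \<open>By \<open>cub_level01\<close>, D may be evaluated through the formulas of
  \<open>cub\<close> before d is known to satisfy any axiom.\<close>

lemma D_ob: "n \<le> 2 \<Longrightarrow> Q \<in> Ob (multi_cubes T m n) \<Longrightarrow> on_ob (D n) Q = cub_ob T m d n Q"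
  by (subst cub_level01[OF cubical]) (simp add: cub_def)

lemma D_ar: "n \<le> 2 \<Longrightarrow> F \<in> Ar (multi_cubes T m n) \<Longrightarrow> on_ar (D n) F = cub_ar T m d n F"
  by (subst cub_level01[OF cubical]) (simp add: cub_def)

lemma pcube_D:
  assumes "n \<le> 2" "Q \<in> Ob (multi_cubes T m n)"
  shows "is_pcube P n (cub_ob T m d n Q)"
proof -
  have "on_ob (D n) Q \<in> Ob (pcubes P n)"
    using functor_D[OF assms(1)] assms(2) by (auto simp: is_functor_def)
  then show ?thesis unfolding D_ob[OF assms] by (simp add: pcubes_def)
qed

lemma pcube_mor_D:
  assumes "n \<le> 2" "F \<in> Ar (multi_cubes T m n)"
  shows "is_pcube_mor P n (cub_ar T m d n F)"
proof -
  have "on_ar (D n) F \<in> Ar (pcubes P n)"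
    using functor_D[OF assms(1)] assms(2) by (auto simp: is_functor_def Hom_def)
  then show ?thesis unfolding D_ar[OF assms] by (simp add: pcubes_def)
qed

lemma Do_Ob:
  assumes "x \<in> (\<Pi>\<^sub>E k\<in>{..<m}. Ob (T k))"
  shows "Do x \<in> Ob P"
proof -
  have "x \<in> extensional {..<m}" using assms by (simp add: PiE_iff)
  then show ?thesis using pcube_D[OF _ points_Ob[OF assms]] by (simp add: is_pcube_def cub_ob_points PiE_iff)
qed

lemma point_mor_at: "f \<in> (\<Pi>\<^sub>E k\<in>{..<m}. isos (T k)) \<Longrightarrow> cat_at (cub_ar T m d 0 (point_mor T m f)) [] = Da f"
proof -
  assume f: "f \<in> (\<Pi>\<^sub>E k\<in>{..<m}. isos (T k))"
  have "(\<lambda>k\<in>{..<m}. cat_at (point_mor T m f k) (seg (\<lambda>l. csrc (point_mor T m f l)) k [])) = f"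
    using f by (intro extensionalityI[of _ "{..<m}"]) (auto simp: point_mor_def seg_def PiE_iff)
  then show ?thesis by (simp add: cub_ar_def)
qed

lemma Da_Hom:
  assumes "f \<in> (\<Pi>\<^sub>E k\<in>{..<m}. isos (T k))"
  shows "Da f \<in> Hom P (Do (\<lambda>k\<in>{..<m}. Dom (T k) (f k))) (Do (\<lambda>k\<in>{..<m}. Cod (T k) (f k)))"
proof -
  have s: "(\<lambda>k\<in>{..<m}. csrc (point_mor T m f k)) = points m (\<lambda>k\<in>{..<m}. Dom (T k) (f k))"
    "(\<lambda>k\<in>{..<m}. ctgt (point_mor T m f k)) = points m (\<lambda>k\<in>{..<m}. Cod (T k) (f k))"
    by (auto simp: point_mor_def points_def fun_eq_iff)
  have "cat_at (cub_ar T m d 0 (point_mor T m f)) [] \<in>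
    Hom P (pv (csrc (cub_ar T m d 0 (point_mor T m f))) []) (pv (ctgt (cub_ar T m d 0 (point_mor T m f))) [])"
    using pcube_mor_D[OF _ point_mor_Ar[OF assms]] by (simp add: is_pcube_mor_def)
  then show ?thesis unfolding point_mor_at[OF assms] by (simp add: cub_ar_def s cub_ob_points)
qed

lemma Da_id:
  assumes "x \<in> (\<Pi>\<^sub>E k\<in>{..<m}. Ob (T k))"
  shows "Da (\<lambda>k\<in>{..<m}. Idt (T k) (x k)) = Idt P (Do x)"
proof -
  let ?f = "\<lambda>k\<in>{..<m}. Idt (T k) (x k)"
  have x: "x k \<in> Ob (T k)" if "k < m" for k using assms that by auto
  have I: "Dom (T k) (Idt (T k) (x k)) = x k" "Cod (T k) (Idt (T k) (x k)) = x k" "Idt (T k) (x k) \<in> isos (T k)" if "k < m" for k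
    using catg.HomD[OF catg[OF that] catg.id_Hom[OF catg[OF that] x[OF that]]] catg.isos_id[OF catg[OF that] x[OF that]] by auto
  have f: "?f \<in> (\<Pi>\<^sub>E k\<in>{..<m}. isos (T k))" using I by auto
  have xe: "x \<in> extensional {..<m}" using assms by (simp add: PiE_iff)
  note pO = points_Ob[OF assms]
  have e: "Idt (multi_cubes T m 0) (points m x) = point_mor T m ?f"
    unfolding multi_cubes_id(1)[OF pO] point_mor_def by (rule restrict_ext) (use I in simp)
  have "on_ar (D 0) (Idt (multi_cubes T m 0) (points m x)) = Idt (pcubes P 0) (on_ob (D 0) (points m x))"
    using functor_D[of 0] pO by (simp add: is_functor_def)
  then have "cub_ar T m d 0 (point_mor T m ?f) = Idt (pcubes P 0) (cub_ob T m d 0 (points m x))"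
    unfolding e using D_ar[OF _ point_mor_Ar[OF f]] D_ob[OF _ pO] by simp
  then show ?thesis unfolding point_mor_at[OF f, symmetric] by (simp add: pcubes_def cub_ob_points[OF xe])
qed

lemma Da_comp:
  assumes f: "f \<in> (\<Pi>\<^sub>E k\<in>{..<m}. isos (T k))" and g: "g \<in> (\<Pi>\<^sub>E k\<in>{..<m}. isos (T k))"
    and fg: "\<And>k. k < m \<Longrightarrow> Cod (T k) (f k) = Dom (T k) (g k)"
  shows "Da (\<lambda>k\<in>{..<m}. g k \<cdot>\<^bsub>T k\<^esub> f k) = Da g \<cdot>\<^bsub>P\<^esub> Da f"
proof -
  let ?h = "\<lambda>k\<in>{..<m}. g k \<cdot>\<^bsub>T k\<^esub> f k"
  note F = point_mor_Ar[OF f] and G = point_mor_Ar[OF g]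
  have eq: "Cod (multi_cubes T m 0) (point_mor T m f) = Dom (multi_cubes T m 0) (point_mor T m g)"
    unfolding multi_cubes_def Let_def cat.simps by (rule restrict_ext) (use fg in \<open>simp add: point_mor_def\<close>)
  note C = multi_cubes_comp[OF F G eq]
  have h: "Dom (T k) (?h k) = Dom (T k) (f k)" "Cod (T k) (?h k) = Cod (T k) (g k)" "?h k \<in> isos (T k)" if "k < m" for k
  proof -
    interpret catg "T k" by (rule catg[OF that])
    have i: "f k \<in> isos (T k)" "g k \<in> isos (T k)" using f g that by auto
    note H = in_HomI[OF isos_Ar[OF i(1)] refl fg[OF that]] in_HomI[OF isos_Ar[OF i(2)] refl refl]
    show "Dom (T k) (?h k) = Dom (T k) (f k)" "Cod (T k) (?h k) = Cod (T k) (g k)" "?h k \<in> isos (T k)"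
      using that HomD[OF comp_Hom[OF H]] isos_comp[OF i H] by simp_all
  qed
  have hi: "?h \<in> (\<Pi>\<^sub>E k\<in>{..<m}. isos (T k))" using h(3) by auto
  have e: "point_mor T m g \<cdot>\<^bsub>multi_cubes T m 0\<^esub> point_mor T m f = point_mor T m ?h"
  proof -
    have p: "point_mor T m ?h = (\<lambda>k\<in>{..<m}. CMor (Point (Dom (T k) (?h k))) (Point (Cod (T k) (?h k))) (\<lambda>a\<in>coords 0. ?h k))"
      by (simp only: point_mor_def)
    show ?thesis unfolding C(1) p by (rule restrict_ext) (use h in \<open>simp add: point_mor_def fun_eq_iff\<close>)
  qed
  have "on_ar (D 0) (point_mor T m g \<cdot>\<^bsub>multi_cubes T m 0\<^esub> point_mor T m f) =
    on_ar (D 0) (point_mor T m g) \<cdot>\<^bsub>pcubes P 0\<^esub> on_ar (D 0) (point_mor T m f)"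
    using functor_D[of 0] F G eq by (simp add: is_functor_def)
  then have "cub_ar T m d 0 (point_mor T m ?h) = cub_ar T m d 0 (point_mor T m g) \<cdot>\<^bsub>pcubes P 0\<^esub> cub_ar T m d 0 (point_mor T m f)"
    unfolding e using D_ar[OF _ F] D_ar[OF _ G] D_ar[OF _ point_mor_Ar[OF hi]] by simp
  from arg_cong[OF this, of "\<lambda>F. cat_at F []"] show ?thesis
    unfolding point_mor_at[OF hi] by (simp add: pcubes_def point_mor_at[OF f] point_mor_at[OF g])
qed

lemma add_Hom:
  assumes "i < m" "x \<in> others T m {i}" "t \<in> distg (T i)"
  shows "add i x t \<in> Hom P (Do (x(i := vertex (T i) t 1)) \<boxplus>\<^bsub>P\<^esub> Do (x(i := vertex (T i) t (-1))))
    (Do (x(i := vertex (T i) t 0)))"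
proof -
  have "single m i x (Triangle t) \<in> Ob (multi_cubes T m 1)" by (rule single_Ob) (use assms in auto)
  from pcube_D[OF _ this] show ?thesis
    using cub_ob_single[OF assms(1) others_extensional[OF assms(2)], of "Triangle t" 1 T d] by (simp add: is_pcube_def)
qed

text \<open>The equation of the 2-cube that D assigns to a square in variable i and objects
  elsewhere.\<close>

lemma add_square:
  assumes i: "i < m" and x: "x \<in> others T m {i}" and C: "is_tcube (T i) (Square (r1, r2, r3) (k1, k2, k3) V)"
  shows "add i x r2 \<cdot>\<^bsub>P\<^esub> (add i x k3 \<oplus>\<^bsub>P\<^esub> add i x k1) = add i x k2 \<cdot>\<^bsub>P\<^esub> (add i x r3 \<oplus>\<^bsub>P\<^esub> add i x r1) \<cdot>\<^bsub>P\<^esub>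
    coas P (Do (x(i := vertex (T i) r3 1))) (Do (x(i := vertex (T i) r1 1)))
      (Do (x(i := vertex (T i) r3 (-1)))) (Do (x(i := vertex (T i) r1 (-1))))"
proof -
  let ?C = "Square (r1, r2, r3) (k1, k2, k3) V"
  have "single m i x ?C \<in> Ob (multi_cubes T m 2)" by (rule single_Ob[OF i x C]) simp
  note S = pcube_D[OF order_refl this, unfolded is_pcube_def, THEN conjunct2, THEN conjunct2, THEN conjunct2, rule_format, of 0 1 "[]"]
  have td: "tdim (?C :: ('o, 'a) tcube) = 2" by simp
  note e = cub_ob_single[OF i others_extensional[OF x] td zero_less_numeral, of T d]
  show ?thesis using S unfolding e Let_def by (simp add: coords_2_iff)
qed

lemma two_triangles:
  assumes "i < j" "j < m" "x \<in> others T m {i, j}" "t \<in> distg (T i)" "t' \<in> distg (T j)"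
  shows "add j (x(i := vertex (T i) t 0)) t' \<cdot>\<^bsub>P\<^esub>
      (add i (x(j := vertex (T j) t' 1)) t \<oplus>\<^bsub>P\<^esub> add i (x(j := vertex (T j) t' (-1))) t) =
    add i (x(j := vertex (T j) t' 0)) t \<cdot>\<^bsub>P\<^esub>
      (add j (x(i := vertex (T i) t 1)) t' \<oplus>\<^bsub>P\<^esub> add j (x(i := vertex (T i) t (-1))) t') \<cdot>\<^bsub>P\<^esub>
      coas P (Do (x(i := vertex (T i) t 1, j := vertex (T j) t' 1))) (Do (x(i := vertex (T i) t (-1), j := vertex (T j) t' 1)))
        (Do (x(i := vertex (T i) t 1, j := vertex (T j) t' (-1)))) (Do (x(i := vertex (T i) t (-1), j := vertex (T j) t' (-1))))"
proof -
  note S = pcube_D[OF order_refl double_Ob[OF assms], unfolded is_pcube_def, THEN conjunct2, THEN conjunct2, THEN conjunct2, rule_format, of 0 1 "[]"]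
  note e = cub_ob_double[OF assms(1,2) others_extensional[OF assms(3)], of T d t t']
  show ?thesis using S unfolding e Let_def by (simp add: coords_2_iff)
qed

text \<open>The comparison with the degeneracies of an object a is a morphism of 1-cubes: its
  component at the zero end types u, and its compatibility with the edge is the formula. The same u
  works for all a and both ends because \<open>zero_iso\<close> depends only on the family with
  \<open>zob\<close> in place k.\<close>

lemma unit:
  assumes k: "k < m" and y: "y \<in> others T m {k}"
  obtains u where "u \<in> Hom P (Do (y(k := zob (T k)))) (punit P)"
    "\<And>a. a \<in> Ob (T k) \<Longrightarrow> add k y (deg_tri 1 (T k) a) = lunit P (Do (y(k := a))) \<cdot>\<^bsub>P\<^esub> (u \<oplus>\<^bsub>P\<^esub> Idt P (Do (y(k := a))))"
    "\<And>a. a \<in> Ob (T k) \<Longrightarrow> add k y (deg_tri (-1) (T k) a) = runit P (Do (y(k := a))) \<cdot>\<^bsub>P\<^esub> (Idt P (Do (y(k := a))) \<oplus>\<^bsub>P\<^esub> u)"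
proof -
  interpret Tk: tri "T k" by (rule tri[OF k])
  let ?u = "zero_iso T m P d k (y(k := zob (T k)))"
  have *: "?u \<in> Hom P (Do (y(k := zob (T k)))) (punit P) \<and>
      add k y (deg_tri \<alpha> (T k) a) = (if \<alpha> = 1 then lunit P (Do (y(k := a))) else runit P (Do (y(k := a)))) \<cdot>\<^bsub>P\<^esub>
        ((if \<alpha> = 1 then ?u else Idt P (Do (y(k := a)))) \<oplus>\<^bsub>P\<^esub> (if \<alpha> = 1 then Idt P (Do (y(k := a))) else ?u))"
    if a: "a \<in> Ob (T k)" and \<alpha>: "\<alpha> = 1 \<or> \<alpha> = -1" for a \<alpha>
  proof -
    let ?Q = "points m (y(k := a))" and ?t = "deg_tri \<alpha> (T k) a"
    let ?R = "single m k y (Triangle ?t)"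
    note ya = others_upd[OF k y a]
    have ye: "y(k := a) \<in> extensional {..<m}" using ya by (simp add: PiE_iff)
    have t: "?t \<in> distg (T k)" by (rule Tk.dist_deg[OF a])
    have R: "?Q(k := tdeg \<alpha> 0 (T k) (?Q k)) = ?R" using k by (auto simp: points_def single_def fun_eq_iff)
    have RO: "?R \<in> Ob (multi_cubes T m 1)" by (rule single_Ob) (use k y t in auto)
    have D0: "on_ob (D 0) ?Q = cub_ob T m d 0 ?Q" and D1: "on_ob (D 1) ?R = cub_ob T m d 1 ?R"
      by (rule D_ob[OF _ points_Ob[OF ya]], simp, rule D_ob[OF _ RO], simp)
    have off: "offset ?Q k + 0 = 0" using k by (simp add: offset_points)
    have "deg_iso T m P D 0 \<alpha> k 0 ?Q \<in> Ar (pcubes P (0 + 1))"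
      using cubical points_Ob[OF ya] k \<alpha> unfolding cubical_multi_determinant_def by blast
    then have M: "is_pcube_mor P 1 (CMor (cub_ob T m d 1 ?R) (pdeg P 0 \<alpha> 0 (cub_ob T m d 0 ?Q))
      (\<lambda>b\<in>coords 1. if b ! 0 = \<alpha> then zero_iso T m P d k (multi_vertex T m ?R b)
        else Idt P (pv (cub_ob T m d 0 ?Q) (del 0 b))))"
      unfolding deg_iso_def Let_def off R D0 add_0 D1 by (simp add: pcubes_def)
    have mv: "multi_vertex T m ?R [\<beta>] = y(k := vertex (T k) ?t \<beta>)" for \<beta>
      using multi_vertex_single[OF k others_extensional[OF y], of "[\<beta>]" "Triangle ?t" T] by simp
    have v: "vertex (T k) ?t \<beta> = (if \<beta> = \<alpha> then zob (T k) else a)" if "\<beta> \<in> {-1, 0, 1}" for \<beta>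
      by (rule Tk.vertex_deg_tri[OF a \<alpha> that])
    have e: "pv (cub_ob T m d (Suc 0) ?R) [\<beta>] = Do (y(k := vertex (T k) ?t \<beta>))" "pe (cub_ob T m d (Suc 0) ?R) (0, []) = add k y ?t"
      if "\<beta> \<in> {-1, 0, 1}" for \<beta>
      using cub_ob_single[OF k others_extensional[OF y], of "Triangle ?t" 1 T d] that by simp_all
    note p = cub_ob_points[OF ye, of T d]
    have c: "[\<alpha>] \<in> coords 1" using \<alpha> by auto
    have 1: "?u \<in> Hom P (Do (y(k := zob (T k)))) (punit P)"
      using M[unfolded is_pcube_mor_def, THEN conjunct2, THEN conjunct2, THEN conjunct2, THEN conjunct1, rule_format, OF c] c \<alpha> v[of \<alpha>] e(1)[of \<alpha>]
      by (auto simp: mv p pdeg_def)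
    have 2: "Idt P (Do (y(k := a))) \<cdot>\<^bsub>P\<^esub> add k y ?t = (if \<alpha> = 1 then lunit P (Do (y(k := a))) else runit P (Do (y(k := a)))) \<cdot>\<^bsub>P\<^esub>
        ((if \<alpha> = 1 then ?u else Idt P (Do (y(k := a)))) \<oplus>\<^bsub>P\<^esub> (if \<alpha> = 1 then Idt P (Do (y(k := a))) else ?u))"
      using M[unfolded is_pcube_mor_def, THEN conjunct2, THEN conjunct2, THEN conjunct2, THEN conjunct2, rule_format, of 0 "[]"]
        \<alpha> v[of 1] v[of 0] v[of "-1"] e(2)[of 0] mv[of 1] mv[of "-1"] by (auto simp: p pdeg_def)
    have "add k y ?t \<in> Hom P (Do (y(k := vertex (T k) ?t 1)) \<boxplus>\<^bsub>P\<^esub> Do (y(k := vertex (T k) ?t (-1)))) (Do (y(k := a)))"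
      using add_Hom[OF k y t] v[of 0] \<alpha> by auto
    from 1 2 P.id_left[OF this] show ?thesis by simp
  qed
  show thesis
  proof (rule that[of ?u])
    show "?u \<in> Hom P (Do (y(k := zob (T k)))) (punit P)" by (rule *[OF Tk.zob_Ob disjI1[OF refl], THEN conjunct1])
    fix a assume a: "a \<in> Ob (T k)"
    show "add k y (deg_tri 1 (T k) a) = lunit P (Do (y(k := a))) \<cdot>\<^bsub>P\<^esub> (?u \<oplus>\<^bsub>P\<^esub> Idt P (Do (y(k := a))))"
      "add k y (deg_tri (-1) (T k) a) = runit P (Do (y(k := a))) \<cdot>\<^bsub>P\<^esub> (Idt P (Do (y(k := a))) \<oplus>\<^bsub>P\<^esub> ?u)"
      using *[OF a, of 1] *[OF a, of "-1"] by simp_all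
  qed
qed


text \<open>D sends a morphism of families of dimension one to a morphism of 1-cubes, and
  compatibility of the latter with the edge is joint naturality in all variables.\<close>

lemma add_nat:
  assumes i: "i < m" and \<phi>: "\<phi> \<in> (\<Pi>\<^sub>E k\<in>{..<m} - {i}. isos (T k))"
    and t: "t \<in> distg (T i)" "t' \<in> distg (T i)" and uvw: "tri_mor (T i) t t' u v w" "{u, v, w} \<subseteq> isos (T i)"
    and x: "x = (\<lambda>k\<in>{..<m} - {i}. Dom (T k) (\<phi> k))" and y: "y = (\<lambda>k\<in>{..<m} - {i}. Cod (T k) (\<phi> k))"
  shows "Da (\<phi>(i := v)) \<cdot>\<^bsub>P\<^esub> add i x t = add i y t' \<cdot>\<^bsub>P\<^esub> (Da (\<phi>(i := w)) \<oplus>\<^bsub>P\<^esub> Da (\<phi>(i := u)))"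
proof -
  \<comment> \<open>The components \<phi> and (u, v, w) assembled into one morphism of families,
    with the morphism of triangles in variable i.\<close>
  define G where "G = (\<lambda>l\<in>{..<m} - {i}. CMor (Point (Dom (T l) (\<phi> l))) (Point (Cod (T l) (\<phi> l))) (\<lambda>a\<in>coords 0. \<phi> l))
    (i := CMor (Triangle t) (Triangle t') (\<lambda>a\<in>coords 1. at (a ! 0) (u, v, w)))"
  have Gi: "G i = CMor (Triangle t) (Triangle t') (\<lambda>a\<in>coords 1. at (a ! 0) (u, v, w))" by (simp add: G_def)
  have Gl: "G l = CMor (Point (Dom (T l) (\<phi> l))) (Point (Cod (T l) (\<phi> l))) (\<lambda>a\<in>coords 0. \<phi> l)" if "l < m" "l \<noteq> i" for l
    using that by (simp add: G_def)
  have s: "(\<lambda>l\<in>{..<m}. csrc (G l)) = single m i x (Triangle t)" "(\<lambda>l\<in>{..<m}. ctgt (G l)) = single m i y (Triangle t')"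
    using i by (auto simp: G_def single_def x y fun_eq_iff)
  have Gd: "tdim (csrc (G l)) = tdim (single m i x (Triangle t) l)" if "l < m" for l
    using fun_cong[OF s(1), of l] that by simp
  have xe: "x \<in> extensional ({..<m} - {i})" and ye: "y \<in> extensional ({..<m} - {i})" by (simp_all add: x y)
  obtain f g h where tt: "t = (f, g, h)" by (metis prod_cases3)
  obtain f' g' h' where tt': "t' = (f', g', h')" by (metis prod_cases3)
  have H: "at \<beta> (u, v, w) \<in> Hom (T i) (vertex (T i) t \<beta>) (vertex (T i) t' \<beta>)" "at \<beta> (u, v, w) \<in> isos (T i)" for \<beta>
    using uvw by (simp_all add: tt tt')
  have MG: "is_tcube_mor (T l) (tdim (csrc (G l))) (G l)" if l: "l < m" for l
  proof (cases "l = i")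
    case True
    show ?thesis
      unfolding True Gi using t H uvw(1) by (simp add: is_tcube_mor_def)
  next
    case False
    interpret catg "T l" by (rule catg[OF l])
    have "\<phi> l \<in> isos (T l)" using \<phi> l False by auto
    then show ?thesis unfolding Gl[OF l False] using isos_Ar[of "\<phi> l"] by (simp add: is_tcube_mor_def Hom_def)
  qed
  have "offset (\<lambda>l. csrc (G l)) m = offset (single m i x (Triangle t)) m" by (rule offset_cong) (rule Gd)
  then have "offset (\<lambda>l. csrc (G l)) m = 1" using i by (simp add: offset_single)
  then have GA: "G \<in> Ar (multi_cubes T m 1)" using MG i by (auto simp: multi_cubes_Ar G_def extensional_def)
  have at: "cat_at (cub_ar T m d 1 G) [\<beta>] = Da (\<phi>(i := at \<beta> (u, v, w)))" if b: "\<beta> \<in> {-1, 0, 1}" for \<beta>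
  proof -
    have "(\<lambda>l\<in>{..<m}. cat_at (G l) (seg (\<lambda>l. csrc (G l)) l [\<beta>])) = \<phi>(i := at \<beta> (u, v, w))"
    proof (rule extensionalityI[of _ "{..<m}"])
      show "\<phi>(i := at \<beta> (u, v, w)) \<in> extensional {..<m}" using \<phi> i by (auto simp: PiE_iff extensional_def)
      fix l assume "l \<in> {..<m}"
      then have l: "l < m" by simp
      have sg: "seg (\<lambda>l. csrc (G l)) l [\<beta>] = seg (single m i x (Triangle t)) l [\<beta>]"
        by (rule seg_cong) (rule Gd, use l in simp)
      show "(\<lambda>l\<in>{..<m}. cat_at (G l) (seg (\<lambda>l. csrc (G l)) l [\<beta>])) l = (\<phi>(i := at \<beta> (u, v, w))) l"
      proof (cases "l = i")
        case True
        have "seg (\<lambda>l. csrc (G l)) i [\<beta>] = [\<beta>]" using sg i unfolding True by (simp add: seg_def offset_single)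
        moreover have "[\<beta>] \<in> coords 1" using b by auto
        ultimately show ?thesis using i by (simp add: True Gi del: at.simps coords_1 One_nat_def)
      next
        case False
        then show ?thesis using l unfolding sg by (simp add: Gl seg_def)
      qed
    qed simp
    then show ?thesis using b by (simp add: cub_ar_def)
  qed
  note E = pcube_mor_D[OF _ GA, unfolded is_pcube_mor_def, THEN conjunct2, THEN conjunct2, THEN conjunct2, THEN conjunct2, rule_format, of 0 "[]"]
  note e = cub_ob_single[OF i xe, of "Triangle t" 1 T d] cub_ob_single[OF i ye, of "Triangle t'" 1 T d]
  have st: "pe (csrc (cub_ar T m d 1 G)) (0, []) = add i x t" "pe (ctgt (cub_ar T m d 1 G)) (0, []) = add i y t'"
    unfolding cub_ar_def cmor.sel s using e by simp_all
  show ?thesis using E at[of 0] at[of 1] at[of "-1"] st by simp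
qed

lemma id_in:
  assumes "k < m" "x \<in> Ob (T k)"
  shows "Idt (T k) x \<in> isos (T k)" "Dom (T k) (Idt (T k) x) = x" "Cod (T k) (Idt (T k) x) = x"
  using catg.isos_id[OF catg[OF assms(1)] assms(2)] catg.HomD[OF catg[OF assms(1)] catg.id_Hom[OF catg[OF assms(1)] assms(2)]]
  by auto

lemma slice_functor:
  assumes i: "i < m" and x: "x \<in> others T m {i}"
  shows "is_functor (isom (T i)) P \<lparr>on_ob = (\<lambda>a. Do (x(i := a))), on_ar = (\<lambda>f. Da ((others_id T m {i} x)(i := f)))\<rparr>"
proof -
  interpret Ti: catg "T i" by (rule catg[OF i])
  let ?I = "others_id T m {i} x"
  have xo: "x k \<in> Ob (T k)" if "k < m" "k \<noteq> i" for k using x that by (auto simp: others_def)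
  have xe: "x(i := b) \<in> extensional {..<m}" for b using others_extensional[OF x] i by (auto simp: extensional_def)
  have I: "?I(i := f) \<in> (\<Pi>\<^sub>E k\<in>{..<m}. isos (T k))" if "f \<in> isos (T i)" for f
    using that i id_in(1) xo by (auto simp: others_id_def PiE_iff extensional_def)
  have DC: "(\<lambda>k\<in>{..<m}. Dom (T k) ((?I(i := f)) k)) = x(i := Dom (T i) f)"
    "(\<lambda>k\<in>{..<m}. Cod (T k) ((?I(i := f)) k)) = x(i := Cod (T i) f)" for f
    by (rule extensionalityI[OF _ xe]; use id_in(2,3) xo in \<open>auto simp: others_id_def\<close>)+
  have id: "?I(i := Idt (T i) a) = (\<lambda>k\<in>{..<m}. Idt (T k) ((x(i := a)) k))" for a
    using i by (auto simp: others_id_def fun_eq_iff)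
  have comp: "?I(i := g \<cdot>\<^bsub>T i\<^esub> f) = (\<lambda>k\<in>{..<m}. (?I(i := g)) k \<cdot>\<^bsub>T k\<^esub> (?I(i := f)) k)" for f g
  proof
    fix k
    show "(?I(i := g \<cdot>\<^bsub>T i\<^esub> f)) k = (\<lambda>k\<in>{..<m}. (?I(i := g)) k \<cdot>\<^bsub>T k\<^esub> (?I(i := f)) k) k"
    proof (cases "k < m \<and> k \<noteq> i")
      case True
      then show ?thesis
        using catg.id_left[OF catg[of k] catg.id_Hom[OF catg[of k] xo[of k]]] by (simp add: others_id_def)
    next
      case False
      then show ?thesis using i by (auto simp: others_id_def)
    qed
  qed
  show ?thesis
    unfolding is_functor_def func.simps
  proof (intro conjI ballI impI funcsetI)
    show "Do (x(i := a)) \<in> Ob P" if "a \<in> Ob (isom (T i))" for a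
      using Do_Ob[OF others_upd[OF i x]] that by (simp add: isom_def)
    show "Da (?I(i := f)) \<in> Hom P (Do (x(i := Dom (isom (T i)) f))) (Do (x(i := Cod (isom (T i)) f)))" if "f \<in> Ar (isom (T i))" for f
      using Da_Hom[OF I] that unfolding DC by (simp add: isom_def)
    show "Da (?I(i := Idt (isom (T i)) a)) = Idt P (Do (x(i := a)))" if "a \<in> Ob (isom (T i))" for a
      using Da_id[OF others_upd[OF i x]] that by (simp add: isom_def id)
    fix f g assume f: "f \<in> Ar (isom (T i))" and g: "g \<in> Ar (isom (T i))" and eq: "Cod (isom (T i)) f = Dom (isom (T i)) g"
    have f: "f \<in> isos (T i)" and g: "g \<in> isos (T i)" and eq: "Cod (T i) f = Dom (T i) g" using f g eq by (simp_all add: isom_def)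
    have "Cod (T k) ((?I(i := f)) k) = Dom (T k) ((?I(i := g)) k)" if "k < m" for k
      using that id_in(2,3) xo eq by (simp add: others_id_def)
    from Da_comp[OF I[OF f] I[OF g] this]
    show "Da (?I(i := g \<cdot>\<^bsub>isom (T i)\<^esub> f)) = Da (?I(i := g)) \<cdot>\<^bsub>P\<^esub> Da (?I(i := f))"
      by (simp only: isom_def cat.simps comp)
  qed
qed

text \<open>Apply \<open>add_square\<close> to the square of \<open>octahedron_square\<close>. Its
  two degenerate edges are unit isomorphisms through u (\<open>unit\<close>), and
  \<open>octahedron_equation\<close> removes them.\<close>

lemma slice_octahedron:
  assumes i: "i < m" and x: "x \<in> others T m {i}" and o: "octahedron (T i) (f, a, a') (gf, b, b') (g, c, c') (d1, e, e')"
  shows "add i x (gf, b, b') \<cdot>\<^bsub>P\<^esub> (add i x (d1, e, e') \<oplus>\<^bsub>P\<^esub> Idt P (Do (x(i := Dom (T i) f)))) =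
    add i x (g, c, c') \<cdot>\<^bsub>P\<^esub> (Idt P (Do (x(i := Cod (T i) c))) \<oplus>\<^bsub>P\<^esub> add i x (f, a, a')) \<cdot>\<^bsub>P\<^esub>
      assoc P (Do (x(i := Cod (T i) c))) (Do (x(i := Cod (T i) a))) (Do (x(i := Dom (T i) f)))"
proof -
  interpret Ti: tri "T i" by (rule tri[OF i])
  note O = Ti.octahedronD[OF o]
  have v: "Dom (T i) f \<in> Ob (T i)" "Cod (T i) a \<in> Ob (T i)" "Cod (T i) c \<in> Ob (T i)" "Dom (T i) gf = Dom (T i) f" "Cod (T i) gf = Cod (T i) g"
    using Ti.distg_vertex_Ob[OF O(1), of "-1"] Ti.distg_vertex_Ob[OF O(1), of 1] Ti.distg_vertex_Ob[OF O(3), of 1]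
      Ti.distD[OF O(1)] Ti.distD[OF O(3)] O(5,9) by simp_all
  obtain u where u: "u \<in> Hom P (Do (x(i := zob (T i)))) (punit P)"
    "\<And>a. a \<in> Ob (T i) \<Longrightarrow> add i x (deg_tri 1 (T i) a) = lunit P (Do (x(i := a))) \<cdot>\<^bsub>P\<^esub> (u \<oplus>\<^bsub>P\<^esub> Idt P (Do (x(i := a))))"
    "\<And>a. a \<in> Ob (T i) \<Longrightarrow> add i x (deg_tri (-1) (T i) a) = runit P (Do (x(i := a))) \<cdot>\<^bsub>P\<^esub> (Idt P (Do (x(i := a))) \<oplus>\<^bsub>P\<^esub> u)"
    using unit[OF i x] by blast
  note D = Do_Ob[OF others_upd[OF i x]]
  have ver: "vertex (T i) (deg_tri 1 (T i) (Dom (T i) f)) 1 = zob (T i)" "vertex (T i) (deg_tri 1 (T i) (Dom (T i) f)) (-1) = Dom (T i) f"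
    using Ti.vertex_deg_tri[OF v(1), of 1] by simp_all
  show ?thesis
  proof (rule P.octahedron_equation[OF u(1) D[OF v(3)] D[OF v(2)] D[OF v(1)]])
    show "add i x (f, a, a') \<in> Hom P (Do (x(i := Cod (T i) a)) \<boxplus>\<^bsub>P\<^esub> Do (x(i := Dom (T i) f))) (Do (x(i := Cod (T i) f)))"
      using add_Hom[OF i x O(1)] by simp
    show "add i x (g, c, c') \<in> Hom P (Do (x(i := Cod (T i) c)) \<boxplus>\<^bsub>P\<^esub> Do (x(i := Cod (T i) f))) (Do (x(i := Cod (T i) g)))"
      using add_Hom[OF i x O(3)] O(5) by simp
    show "add i x (d1, e, e') \<in> Hom P (Do (x(i := Cod (T i) c)) \<boxplus>\<^bsub>P\<^esub> Do (x(i := Cod (T i) a))) (Do (x(i := Cod (T i) b)))"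
      using add_Hom[OF i x O(4)] O(6-8) by simp
    show "add i x (gf, b, b') \<in> Hom P (Do (x(i := Cod (T i) b)) \<boxplus>\<^bsub>P\<^esub> Do (x(i := Dom (T i) f))) (Do (x(i := Cod (T i) g)))"
      using add_Hom[OF i x O(2)] v(4,5) by simp
    show "add i x (g, c, c') \<cdot>\<^bsub>P\<^esub> ((runit P (Do (x(i := Cod (T i) c))) \<cdot>\<^bsub>P\<^esub> (Idt P (Do (x(i := Cod (T i) c))) \<oplus>\<^bsub>P\<^esub> u)) \<oplus>\<^bsub>P\<^esub> add i x (f, a, a')) =
      add i x (gf, b, b') \<cdot>\<^bsub>P\<^esub> (add i x (d1, e, e') \<oplus>\<^bsub>P\<^esub> (lunit P (Do (x(i := Dom (T i) f))) \<cdot>\<^bsub>P\<^esub> (u \<oplus>\<^bsub>P\<^esub> Idt P (Do (x(i := Dom (T i) f)))))) \<cdot>\<^bsub>P\<^esub>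
        coas P (Do (x(i := Cod (T i) c))) (Do (x(i := zob (T i)))) (Do (x(i := Cod (T i) a))) (Do (x(i := Dom (T i) f)))"
      using add_square[OF i x Ti.octahedron_square[OF o]] O(6,8) unfolding u(2)[OF v(1)] u(3)[OF v(3)] ver by simp
  qed
qed

text \<open>Apply \<open>add_square\<close> to the square of \<open>split_square\<close>. Its four
  degenerate edges are unit isomorphisms through u, and \<open>split_equation\<close> leaves the
  symmetry.\<close>

lemma slice_split:
  assumes i: "i < m" and x: "x \<in> others T m {i}" and ob: "y \<in> Ob (T i)" "z \<in> Ob (T i)" and b: "biproduct (T i) y z b i1 i2 p1 p2"
  shows "add i x (i2, p1, mzero (T i) y (sho (T i) z)) =
    add i x (i1, p2, mzero (T i) z (sho (T i) y)) \<cdot>\<^bsub>P\<^esub> symm P (Do (x(i := y))) (Do (x(i := z)))"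
proof -
  interpret Ti: tri "T i" by (rule tri[OF i])
  note B = Ti.biproductD[OF b]
  have H: "Dom (T i) i1 = y" "Cod (T i) i1 = b" "Dom (T i) i2 = z" "Cod (T i) i2 = b" "Cod (T i) p1 = y" "Cod (T i) p2 = z"
    using B(1-4) Ti.HomD by blast+
  note t = Ti.dist_split[OF b] Ti.dist_split[OF Ti.biproduct_commute[OF b]]
  obtain u where u: "u \<in> Hom P (Do (x(i := zob (T i)))) (punit P)"
    "\<And>a. a \<in> Ob (T i) \<Longrightarrow> add i x (deg_tri 1 (T i) a) = lunit P (Do (x(i := a))) \<cdot>\<^bsub>P\<^esub> (u \<oplus>\<^bsub>P\<^esub> Idt P (Do (x(i := a))))"
    "\<And>a. a \<in> Ob (T i) \<Longrightarrow> add i x (deg_tri (-1) (T i) a) = runit P (Do (x(i := a))) \<cdot>\<^bsub>P\<^esub> (Idt P (Do (x(i := a))) \<oplus>\<^bsub>P\<^esub> u)"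
    using unit[OF i x] by blast
  note D = Do_Ob[OF others_upd[OF i x]]
  have ver: "vertex (T i) (deg_tri 1 (T i) y) 1 = zob (T i)" "vertex (T i) (deg_tri 1 (T i) y) (-1) = y"
    "vertex (T i) (deg_tri (-1) (T i) z) 1 = z" "vertex (T i) (deg_tri (-1) (T i) z) (-1) = zob (T i)"
    using Ti.vertex_deg_tri[OF ob(1), of 1] Ti.vertex_deg_tri[OF ob(2), of "-1"] by simp_all
  show ?thesis
  proof (rule P.split_equation[OF u(1) D[OF ob(1)] D[OF ob(2)]])
    show "add i x (i1, p2, mzero (T i) z (sho (T i) y)) \<in> Hom P (Do (x(i := z)) \<boxplus>\<^bsub>P\<^esub> Do (x(i := y))) (Do (x(i := b)))"
      using add_Hom[OF i x t(1)] H by simp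
    show "add i x (i2, p1, mzero (T i) y (sho (T i) z)) \<in> Hom P (Do (x(i := y)) \<boxplus>\<^bsub>P\<^esub> Do (x(i := z))) (Do (x(i := b)))"
      using add_Hom[OF i x t(2)] H by simp
    show "add i x (i1, p2, mzero (T i) z (sho (T i) y)) \<cdot>\<^bsub>P\<^esub> ((lunit P (Do (x(i := z))) \<cdot>\<^bsub>P\<^esub> (u \<oplus>\<^bsub>P\<^esub> Idt P (Do (x(i := z))))) \<oplus>\<^bsub>P\<^esub>
        (runit P (Do (x(i := y))) \<cdot>\<^bsub>P\<^esub> (Idt P (Do (x(i := y))) \<oplus>\<^bsub>P\<^esub> u))) =
      add i x (i2, p1, mzero (T i) y (sho (T i) z)) \<cdot>\<^bsub>P\<^esub> ((lunit P (Do (x(i := y))) \<cdot>\<^bsub>P\<^esub> (u \<oplus>\<^bsub>P\<^esub> Idt P (Do (x(i := y))))) \<oplus>\<^bsub>P\<^esub>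
        (runit P (Do (x(i := z))) \<cdot>\<^bsub>P\<^esub> (Idt P (Do (x(i := z))) \<oplus>\<^bsub>P\<^esub> u))) \<cdot>\<^bsub>P\<^esub>
        coas P (Do (x(i := zob (T i)))) (Do (x(i := z))) (Do (x(i := y))) (Do (x(i := zob (T i))))"
      using add_square[OF i x Ti.split_square[OF b ob]] unfolding u(2)[OF ob(1)] u(2)[OF ob(2)] u(3)[OF ob(1)] u(3)[OF ob(2)] ver .
  qed
qed

lemma slice_determinant:
  assumes i: "i < m" and x: "x \<in> others T m {i}"
  shows "determinant_functor (T i) P
    \<lparr>on_ob = (\<lambda>a. Do (x(i := a))), on_ar = (\<lambda>f. Da ((others_id T m {i} x)(i := f)))\<rparr> (\<lambda>t. add i x t)"
  unfolding determinant_functor_def func.simps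
proof (intro conjI allI impI ballI)
  show "is_functor (isom (T i)) P \<lparr>on_ob = (\<lambda>a. Do (x(i := a))), on_ar = (\<lambda>f. Da ((others_id T m {i} x)(i := f)))\<rparr>"
    by (rule slice_functor[OF i x])
  show "add i x (f, g, h) \<in> Hom P (Do (x(i := Cod (T i) g)) \<boxplus>\<^bsub>P\<^esub> Do (x(i := Dom (T i) f))) (Do (x(i := Cod (T i) f)))"
    if "(f, g, h) \<in> distg (T i)" for f g h using add_Hom[OF i x that] by simp
  have "x k \<in> Ob (T k)" if "k < m" "k \<noteq> i" for k using x that by (auto simp: others_def)
  note I = id_in[OF _ this]
  have "others_id T m {i} x \<in> (\<Pi>\<^sub>E k\<in>{..<m} - {i}. isos (T k))" using I by (auto simp: others_id_def)
  moreover have "x = (\<lambda>k\<in>{..<m} - {i}. Dom (T k) (others_id T m {i} x k))" "x = (\<lambda>k\<in>{..<m} - {i}. Cod (T k) (others_id T m {i} x k))"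
    using I by (intro extensionalityI[OF others_extensional[OF x]]; simp add: others_id_def)+
  ultimately show "Da ((others_id T m {i} x)(i := v)) \<cdot>\<^bsub>P\<^esub> add i x t =
      add i x t' \<cdot>\<^bsub>P\<^esub> (Da ((others_id T m {i} x)(i := w)) \<oplus>\<^bsub>P\<^esub> Da ((others_id T m {i} x)(i := u)))"
    if "t \<in> distg (T i)" "t' \<in> distg (T i)" "tri_mor (T i) t t' u v w \<and> {u, v, w} \<subseteq> isos (T i)" for t t' u v w
    using that by (intro add_nat[OF i]) blast+
  show "add i x (i2, p1, mzero (T i) y (sho (T i) z)) =
    add i x (i1, p2, mzero (T i) z (sho (T i) y)) \<cdot>\<^bsub>P\<^esub> symm P (Do (x(i := y))) (Do (x(i := z)))"
    if "y \<in> Ob (T i)" "z \<in> Ob (T i)" "biproduct (T i) y z b i1 i2 p1 p2" for y z b i1 i2 p1 p2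
    by (rule slice_split[OF i x that])
  show "add i x (gf, b, b') \<cdot>\<^bsub>P\<^esub> (add i x (d1, e, e') \<oplus>\<^bsub>P\<^esub> Idt P (Do (x(i := Dom (T i) f)))) =
    add i x (g, c, c') \<cdot>\<^bsub>P\<^esub> (Idt P (Do (x(i := Cod (T i) c))) \<oplus>\<^bsub>P\<^esub> add i x (f, a, a')) \<cdot>\<^bsub>P\<^esub>
      assoc P (Do (x(i := Cod (T i) c))) (Do (x(i := Cod (T i) a))) (Do (x(i := Dom (T i) f)))"
    if "octahedron (T i) (f, a, a') (gf, b, b') (g, c, c') (d1, e, e')" for f a a' gf b b' g c c' d1 e e'
    by (rule slice_octahedron[OF i x that])
qed

text \<open>The case of \<open>add_nat\<close> in which the triangle stays fixed and only the
  variable i is moved.\<close>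

lemma triangle_function:
  assumes ij: "i < m" "j < m" "i \<noteq> j" and x: "x \<in> others T m {i, j}" and \<phi>: "\<phi> \<in> isos (T i)" and t: "t \<in> distg (T j)"
  shows "Da ((others_id T m {i, j} x)(i := \<phi>, j := Idt (T j) (vertex (T j) t 0))) \<cdot>\<^bsub>P\<^esub> add j (x(i := Dom (T i) \<phi>)) t =
    add j (x(i := Cod (T i) \<phi>)) t \<cdot>\<^bsub>P\<^esub>
      (Da ((others_id T m {i, j} x)(i := \<phi>, j := Idt (T j) (vertex (T j) t 1))) \<oplus>\<^bsub>P\<^esub>
       Da ((others_id T m {i, j} x)(i := \<phi>, j := Idt (T j) (vertex (T j) t (-1)))))"
proof -
  interpret Tj: tri "T j" by (rule tri[OF ij(2)])
  let ?f = "(others_id T m {i, j} x)(i := \<phi>)"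
  have "x k \<in> Ob (T k)" if "k < m" "k \<noteq> i" "k \<noteq> j" for k using x that by (auto simp: others_def)
  note I = id_in[OF _ this]
  have xe: "x(i := b) \<in> extensional ({..<m} - {j})" for b using others_extensional[OF x] ij by (auto simp: extensional_def)
  have f: "?f \<in> (\<Pi>\<^sub>E k\<in>{..<m} - {j}. isos (T k))" using I \<phi> ij by (auto simp: others_id_def PiE_iff extensional_def)
  have e: "x(i := Dom (T i) \<phi>) = (\<lambda>k\<in>{..<m} - {j}. Dom (T k) (?f k))" "x(i := Cod (T i) \<phi>) = (\<lambda>k\<in>{..<m} - {j}. Cod (T k) (?f k))"
    by (rule extensionalityI[OF xe], simp, use I in \<open>auto simp: others_id_def\<close>)+
  have "{Idt (T j) (vertex (T j) t (-1)), Idt (T j) (vertex (T j) t 0), Idt (T j) (vertex (T j) t 1)} \<subseteq> isos (T j)"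
    using Tj.isos_id[OF Tj.distg_vertex_Ob[OF t]] by simp
  from add_nat[OF ij(2) f t t Tj.tri_mor_id[OF t] this e] show ?thesis .
qed

lemma multi_determinant_level01: "multi_determinant T m P d"
  unfolding multi_determinant_def
proof (intro conjI allI impI ballI)
  show "extensional_functor (isom_prod T m) d" by (simp add: extensional_functor_def level01_def)
  show "m_add d \<in> extensional (add_dom T m)" by (simp add: level01_def)
  show "is_functor (isom_prod T m) P d"
    unfolding is_functor_def isom_prod_simps
  proof (intro conjI ballI impI funcsetI)
    fix f g
    assume f: "f \<in> (\<Pi>\<^sub>E k\<in>{..<m}. isos (T k))" and g: "g \<in> (\<Pi>\<^sub>E k\<in>{..<m}. isos (T k))"
      and eq: "(\<lambda>k\<in>{..<m}. Cod (T k) (f k)) = (\<lambda>k\<in>{..<m}. Dom (T k) (g k))"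
    have "Cod (T k) (f k) = Dom (T k) (g k)" if "k < m" for k using fun_cong[OF eq, of k] that by simp
    then show "Da (\<lambda>k\<in>{..<m}. g k \<cdot>\<^bsub>T k\<^esub> f k) = Da g \<cdot>\<^bsub>P\<^esub> Da f" by (rule Da_comp[OF f g])
  qed (rule Do_Ob Da_Hom Da_id, assumption)+
  show "determinant_functor (T i) P
    \<lparr>on_ob = (\<lambda>a. Do (x(i := a))), on_ar = (\<lambda>f. Da ((others_id T m {i} x)(i := f)))\<rparr> (\<lambda>t. add i x t)"
    if "i < m" "x \<in> others T m {i}" for i x by (rule slice_determinant[OF that])
next
  fix i j x f g h f' g' h'
  assume "i < j \<and> j < m" "x \<in> others T m {i, j}" "(f, g, h) \<in> distg (T i) \<and> (f', g', h') \<in> distg (T j)"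
  then have "i < j" "j < m" "x \<in> others T m {i, j}" "(f, g, h) \<in> distg (T i)" "(f', g', h') \<in> distg (T j)" by auto
  from two_triangles[OF this]
  show "let xi = Dom (T i) f; yi = Cod (T i) f; zi = Cod (T i) g; xj = Dom (T j) f'; yj = Cod (T j) f'; zj = Cod (T j) g';
        ob = (\<lambda>a b. Do (x(i := a, j := b))); di = (\<lambda>b. add i (x(j := b)) (f, g, h)); dj = (\<lambda>a. add j (x(i := a)) (f', g', h'))
    in dj yi \<cdot>\<^bsub>P\<^esub> (di zj \<oplus>\<^bsub>P\<^esub> di xj) = di yj \<cdot>\<^bsub>P\<^esub> (dj zi \<oplus>\<^bsub>P\<^esub> dj xi) \<cdot>\<^bsub>P\<^esub> coas P (ob zi zj) (ob xi zj) (ob zi xj) (ob xi xj)"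
    by (simp add: Let_def)
next
  fix i j x f g h \<phi>
  assume "i < m" "j < m" "i \<noteq> j" "x \<in> others T m {i, j}" "\<phi> \<in> isos (T i)" "(f, g, h) \<in> distg (T j)"
  from triangle_function[OF this]
  show "let ar = (\<lambda>b. Da ((others_id T m {i, j} x)(i := \<phi>, j := Idt (T j) b))); dj = (\<lambda>a. add j (x(i := a)) (f, g, h))
    in ar (Cod (T j) f) \<cdot>\<^bsub>P\<^esub> dj (Dom (T i) \<phi>) = dj (Cod (T i) \<phi>) \<cdot>\<^bsub>P\<^esub> (ar (Cod (T j) g) \<oplus>\<^bsub>P\<^esub> ar (Dom (T j) f))"
    by (simp add: Let_def)
qed

end

theorem theorem3p26:
  fixes T :: "nat \<Rightarrow> ('o, 'a) tricat" and m :: nat and P :: "('p, 'q) symcat"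
  assumes "\<And>k. k < m \<Longrightarrow> triangulated (T k)" and "picard_groupoid P"
  shows "(\<forall>d. multi_determinant T m P d \<longrightarrow>
             (\<exists>!D. cubical_multi_determinant T m P D \<and> level01 T m D = d)) \<and>
         (\<forall>D. cubical_multi_determinant T m P D \<longrightarrow>
             multi_determinant T m P (level01 T m D))"
proof -
  interpret multi T m P by unfold_locales (use assms in auto)
  show ?thesis
  proof (intro conjI allI impI)
    fix d :: "('o, 'a, 'p, 'q) mdf" assume "multi_determinant T m P d"
    then interpret multi_det T m P d by unfold_locales
    show "\<exists>!D. cubical_multi_determinant T m P D \<and> level01 T m D = d"
    \<comment> \<open>The witness is \<open>cub T m d\<close>; any other D with the same levels 0
      and 1 equals it by \<open>cub_level01\<close>.\<close>
    proof (rule ex1I[of _ "cub T m d"])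
      show "cubical_multi_determinant T m P (cub T m d) \<and> level01 T m (cub T m d) = d"
        using cubical_cub level01_cub by (rule conjI)
      show "D = cub T m d" if "cubical_multi_determinant T m P D \<and> level01 T m D = d" for D
        using cub_level01[of D] that by simp
    qed
  next
    fix D :: "('o, 'a, 'p, 'q) cmdf" assume "cubical_multi_determinant T m P D"
    then interpret cubical T m P D by unfold_locales
    show "multi_determinant T m P (level01 T m D)" by (rule multi_determinant_level01)
  qed
qed

end
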